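(* Let $T>0$ and let $(z_t)_{t\in[0,T]}$ be an $\mathbb{R}^d$-valued Volterra-Lévy process with measurable paths such that its associated local time $L$ exists and satisfies $L\in\mathcal{C}^\gamma([0,T];H^\kappa(\mathbb{R}^d))$ for some $\kappa>0$ and $\gamma>\frac12$, $\mathbb{P}$-a.s. Then for any ($\mathbb{R}^d$-valued) $b\in H^\beta(\mathbb{R}^d)$ with $\beta>2-\kappa$ (and any $\xi\in\mathbb{R}^d$), there exists a unique pathwise solution to the equation $$x_t=\xi+\int_0^t b(x_s)\,\mathrm{d}s+z_t,\qquad t\in[0,T],$$ where the solution is interpreted in the non-linear Young sense specified in the context. Moreover, if $\beta>n+1-\kappa$ for some $n\in\mathbb{N}=\{1,2,\dots\}$, then the flow mapping $\xi\mapsto x_t(\xi)$ is $n$-times continuously differentiable.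
   Context: A Lévy process $(\mathscr{L}_t)_{t\in[0,T]}$ is a càdlàg adapted process with $\mathscr{L}_0=0$ a.s., with independent and stationary increments, continuous in probability, on a complete filtered probability space satisfying the usual assumptions. A Volterra-Lévy process is $z_t=\int_0^t k(t,s)\,\mathrm{d}\mathscr{L}_s$ where, for some $\beta_0\in(0,2]$, $k(t,\cdot)\in L^{\beta_0}([0,t])$ for every $t\in[0,T]$; the integral is defined on step functions by $\sum_j a_j(\mathscr{L}_{s_{j+1}}-\mathscr{L}_{s_j})$ and extended as the limit in $L^p(\Omega)$ (some $p\in(0,\beta_0]$) of integrals of step functions approximating $k(t,\cdot)$ in $L^{\beta_0}([0,t])$, this limit being required to exist independently of the approximating sequence. Local time: for a measurable path $z$, $\mu_t(A)=\lambda\{s\in[0,t]:z_s\in A\}$ for Borel $A\subset\mathbb{R}^d$ ($\lambda$ Lebesgue measure), and the local time is a function $L:[0,T]\times\mathbb{R}^d\to\mathbb{R}_+$ with $\mu_t(A)=\int_A L_t(x)\,\mathrm{d}x$. Write $\bar L_t(x)=L_t(-x)$ and $f_{s,t}=f_t-f_s$. Spaces: $H^s(\mathbb{R}^d)$ is the Sobolev space with $\|f\|_{H^s}^2=\int(1+|\xi|^2)^s|\mathscr{F}f(\xi)|^2\,\mathrm{d}\xi<\infty$ ($f\in\mathcal{S}'$ with $\mathscr{F}f\in L^2_{loc}$), componentwise for vector-valued distributions. $\mathcal{C}^\theta(\mathbb{R}^d)=B^\theta_{\infty,\infty}(\mathbb{R}^d)$ is the inhomogeneous Besov space. For a Banach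 space $E$ and $\gamma\in(0,1)$, $\mathcal{C}^\gamma([0,T];E)$ is the space of $\gamma$-Hölder functions $[0,T]\to E$. Non-linear Young integral: for $\Gamma\in\mathcal{C}^\gamma([0,T];\mathcal{C}^1)$, $\Gamma:[0,T]\times\mathbb{R}^d\to\mathbb{R}^d$, satisfying $|\Gamma_{s,t}(x)|\lesssim|t-s|^\gamma$ and $|\Gamma_{s,t}(x)-\Gamma_{s,t}(y)|\lesssim|x-y||t-s|^\gamma$, and $\theta:[0,T]\to\mathbb{R}^d$ which is $\eta$-Hölder with $\gamma+\eta>1$, $$\int_0^t\Gamma_{\mathrm{d}r}(\theta_r)=\lim_{|\mathcal{P}|\to0}\sum_{[u,v]\in\mathcal{P}}\Gamma_{u,v}(\theta_u),$$ the limit over partitions $\mathcal{P}$ of $[0,t]$ with mesh tending to $0$. Concept of (pathwise) solution: let $b\in\mathcal{S}'(\mathbb{R}^d)$ be such that $b\ast L\in\mathcal{C}^\gamma([0,T];\mathcal{C}^2(\mathbb{R}^d))$ for some $\gamma>\frac12$. Then $x$ is a solution to $x_t=\xi+\int_0^t b(x_s)\,\mathrm{d}s+z_t$ if and only if $x-z\in\mathcal{C}^\gamma([0,T];\mathbb{R}^d)$ and $\theta:=x-z\in\mathcal{C}^\gamma([0,T];\mathbb{R}^d)$ solves $$\theta_t=\xi+\int_0^t b\ast\bar L_{\mathrm{d}r}(\theta_r),\qquad t\in[0,T],$$ with the integral in the non-linear Young sense for $\Gamma_t=b\ast\bar L_t$. Everything is understood for $\mathbb{P}$-almost every fixed path of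 $z$. $x_t(\xi)$ denotes the solution at time $t$ started from $\xi$. *)

theory Defs
  imports "HOL-Probability.Probability"
begin

section \<open>Levy processes and Volterra-Levy processes\<close>

definition is_partition :: "real \<Rightarrow> nat \<Rightarrow> (nat \<Rightarrow> real) \<Rightarrow> bool" where
  "is_partition t N p \<longleftrightarrow> p 0 = 0 \<and> p N = t \<and> (\<forall>j<N. p j < p (Suc j))"

definition usual_filtration :: "'w measure \<Rightarrow> real \<Rightarrow> (real \<Rightarrow> 'w measure) \<Rightarrow> bool" where
  "usual_filtration M T F \<longleftrightarrow>
     prob_space M \<and> complete_measure M \<and>
     (\<forall>t\<in>{0..T}. subalgebra M (F t)) \<and>
     (\<forall>s\<in>{0..T}. \<forall>t\<in>{0..T}. s \<le> t \<longrightarrow> sets (F s) \<subseteq> sets (F t)) \<and>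
     null_sets M \<subseteq> sets (F 0) \<and>
     (\<forall>t\<in>{0..<T}. sets (F t) = (\<Inter>u\<in>{t<..T}. sets (F u)))"

definition cadlag_on :: "real \<Rightarrow> (real \<Rightarrow> 'a::topological_space) \<Rightarrow> bool" where
  "cadlag_on T f \<longleftrightarrow>
     (\<forall>t\<in>{0..<T}. (f \<longlongrightarrow> f t) (at_right t)) \<and>
     (\<forall>t\<in>{0<..T}. \<exists>l. (f \<longlongrightarrow> l) (at_left t))"

definition levy_process ::
    "'w measure \<Rightarrow> real \<Rightarrow> (real \<Rightarrow> 'w measure) \<Rightarrow> (real \<Rightarrow> 'w \<Rightarrow> 'a::euclidean_space) \<Rightarrow> bool" where
  "levy_process M T F X \<longleftrightarrow>
     usual_filtration M T F \<and>
     (\<forall>t\<in>{0..T}. X t \<in> borel_measurable (F t)) \<and>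
     (AE \<omega> in M. cadlag_on T (\<lambda>t. X t \<omega>)) \<and>
     (AE \<omega> in M. X 0 \<omega> = 0) \<and>
     (\<forall>t\<in>{0..T}. \<forall>N p. is_partition t N p \<longrightarrow>
        prob_space.indep_vars M (\<lambda>_. borel) (\<lambda>j \<omega>. X (p (Suc j)) \<omega> - X (p j) \<omega>) {..<N}) \<and>
     (\<forall>s t h. 0 \<le> s \<and> 0 \<le> t \<and> 0 \<le> h \<and> s + h \<le> T \<and> t + h \<le> T \<longrightarrow>
        distr M borel (\<lambda>\<omega>. X (s + h) \<omega> - X s \<omega>) = distr M borel (\<lambda>\<omega>. X (t + h) \<omega> - X t \<omega>)) \<and>
     (\<forall>t\<in>{0..T}. \<forall>e>0.
        ((\<lambda>s. measure M {\<omega>\<in>space M. e \<le> norm (X s \<omega> - X t \<omega>)}) \<longlongrightarrow> 0) (at t within {0..T}))"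

definition step_fun :: "nat \<Rightarrow> (nat \<Rightarrow> real) \<Rightarrow> (nat \<Rightarrow> real) \<Rightarrow> real \<Rightarrow> real" where
  "step_fun N p a s = (\<Sum>j<N. a j * indicator {p j<..p (Suc j)} s)"

definition step_integral ::
    "(real \<Rightarrow> 'w \<Rightarrow> 'a::real_vector) \<Rightarrow> nat \<Rightarrow> (nat \<Rightarrow> real) \<Rightarrow> (nat \<Rightarrow> real) \<Rightarrow> 'w \<Rightarrow> 'a" where
  "step_integral X N p a \<omega> = (\<Sum>j<N. a j *\<^sub>R (X (p (Suc j)) \<omega> - X (p j) \<omega>))"

text \<open>
  The random variable \<open>Z\<close> is the integral over \<open>[0,t]\<close> of the deterministic function \<open>f\<close> with
  respect to \<open>X\<close>: for \<^emph>\<open>every\<close> sequence of step functions converging to \<open>f\<close> in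
  \<open>L^\<beta>\<^sub>0([0,t])\<close>, the elementary integrals converge to \<open>Z\<close> in \<open>L^p(\<Omega>)\<close>.
\<close>

definition has_levy_integral ::
    "'w measure \<Rightarrow> (real \<Rightarrow> 'w \<Rightarrow> 'a::euclidean_space) \<Rightarrow> real \<Rightarrow> real \<Rightarrow> real \<Rightarrow> (real \<Rightarrow> real) \<Rightarrow> ('w \<Rightarrow> 'a) \<Rightarrow> bool"
  where
  "has_levy_integral M X \<beta>\<^sub>0 p t f Z \<longleftrightarrow>
     Z \<in> borel_measurable M \<and>
     (\<integral>\<^sup>+\<omega>. ennreal (norm (Z \<omega>) powr p) \<partial>M) < \<infinity> \<and>
     (\<forall>N q a.
        (\<forall>n. is_partition t (N n) (q n)) \<and>
        (\<lambda>n. \<integral>\<^sup>+s. ennreal (\<bar>step_fun (N n) (q n) (a n) s - f s\<bar> powr \<beta>\<^sub>0) \<partial>lebesgue_on {0..t})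
          \<longlonglongrightarrow> 0 \<longrightarrow>
        (\<lambda>n. \<integral>\<^sup>+\<omega>. ennreal (norm (step_integral X (N n) (q n) (a n) \<omega> - Z \<omega>) powr p) \<partial>M)
          \<longlonglongrightarrow> 0)"

definition volterra_levy_process ::
    "'w measure \<Rightarrow> real \<Rightarrow> (real \<Rightarrow> 'w measure) \<Rightarrow> (real \<Rightarrow> 'w \<Rightarrow> 'a::euclidean_space) \<Rightarrow> bool" where
  "volterra_levy_process M T F z \<longleftrightarrow>
     (\<exists>X k \<beta>\<^sub>0 p.
        levy_process M T F X \<and> 0 < \<beta>\<^sub>0 \<and> \<beta>\<^sub>0 \<le> 2 \<and> 0 < p \<and> p \<le> \<beta>\<^sub>0 \<and>
        (\<forall>t\<in>{0..T}.
           k t \<in> borel_measurable (lebesgue_on {0..t}) \<and>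
           (\<integral>\<^sup>+s. ennreal (\<bar>k t s\<bar> powr \<beta>\<^sub>0) \<partial>lebesgue_on {0..t}) < \<infinity> \<and>
           has_levy_integral M X \<beta>\<^sub>0 p t (k t) (z t)))"

definition is_local_time ::
    "real \<Rightarrow> (real \<Rightarrow> 'a::euclidean_space) \<Rightarrow> (real \<Rightarrow> 'a \<Rightarrow> real) \<Rightarrow> bool" where
  "is_local_time T z L \<longleftrightarrow>
     (\<forall>t\<in>{0..T}. L t \<in> borel_measurable borel \<and> (\<forall>x. 0 \<le> L t x) \<and>
        (\<forall>A\<in>sets borel. emeasure lebesgue {s\<in>{0..t}. z s \<in> A} = (\<integral>\<^sup>+x\<in>A. ennreal (L t x) \<partial>lborel)))"


section \<open>Tempered distributions\<close>

text \<open>\<open>cont_diff n f\<close>: \<open>f\<close> is \<open>n\<close> times continuously differentiable; meant for finite-dimensional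
  domains, where continuity of all directional derivatives of \<open>f\<close> up to order \<open>n\<close> is continuity of
  the Frechet derivatives in operator norm.\<close>

primrec cont_diff :: "nat \<Rightarrow> ('a::real_normed_vector \<Rightarrow> 'b::real_normed_vector) \<Rightarrow> bool" where
  "cont_diff 0 f = continuous_on UNIV f"
| "cont_diff (Suc n) f =
     (\<exists>f'. (\<forall>x. (f has_derivative f' x) (at x)) \<and> (\<forall>v. cont_diff n (\<lambda>x. f' x v)))"

primrec iter_deriv :: "'a::real_normed_vector list \<Rightarrow> ('a \<Rightarrow> 'b::real_normed_vector) \<Rightarrow> 'a \<Rightarrow> 'b" where
  "iter_deriv [] f = f"
| "iter_deriv (v # vs) f = (\<lambda>x. frechet_derivative (iter_deriv vs f) (at x) v)"

definition schwartz :: "('a::euclidean_space \<Rightarrow> complex) set" where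
  "schwartz = {\<phi>. (\<forall>n. cont_diff n \<phi>) \<and>
     (\<forall>vs k. set vs \<subseteq> Basis \<longrightarrow> bounded (range (\<lambda>x. (1 + norm x) ^ k *\<^sub>R iter_deriv vs \<phi> x)))}"

definition schwartz_seminorm :: "nat \<Rightarrow> ('a::euclidean_space \<Rightarrow> complex) \<Rightarrow> real" where
  "schwartz_seminorm N \<phi> =
     (SUP (vs, x)\<in>{vs. set vs \<subseteq> Basis \<and> length vs \<le> N} \<times> UNIV.
        (1 + norm x) ^ N * norm (iter_deriv vs \<phi> x))"

text \<open>Distributions are functionals on all functions of which only the values on \<open>schwartz\<close>
  matter.\<close>

type_synonym 'a distribution = "('a \<Rightarrow> complex) \<Rightarrow> complex"

definition tempered :: "'a::euclidean_space distribution \<Rightarrow> bool" where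
  "tempered u \<longleftrightarrow>
     (\<forall>\<phi>\<in>schwartz. \<forall>\<psi>\<in>schwartz. u (\<lambda>x. \<phi> x + \<psi> x) = u \<phi> + u \<psi>) \<and>
     (\<forall>c. \<forall>\<phi>\<in>schwartz. u (\<lambda>x. c * \<phi> x) = c * u \<phi>) \<and>
     (\<exists>C N. \<forall>\<phi>\<in>schwartz. norm (u \<phi>) \<le> C * schwartz_seminorm N \<phi>)"

definition real_valued_distribution :: "'a::euclidean_space distribution \<Rightarrow> bool" where
  "real_valued_distribution u \<longleftrightarrow> (\<forall>\<phi>\<in>schwartz. u (\<lambda>x. cnj (\<phi> x)) = cnj (u \<phi>))"

definition reg_dist :: "('a::euclidean_space \<Rightarrow> real) \<Rightarrow> 'a distribution" where
  "reg_dist f \<phi> = (LINT x|lborel. of_real (f x) * \<phi> x)"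

definition represented_by :: "'a::euclidean_space distribution \<Rightarrow> ('a \<Rightarrow> real) \<Rightarrow> bool" where
  "represented_by u f \<longleftrightarrow>
     (\<forall>\<phi>\<in>schwartz. integrable lborel (\<lambda>x. of_real (f x) * \<phi> x) \<and> u \<phi> = reg_dist f \<phi>)"

text \<open>Convolution \<open>u \<star> f\<close> of a tempered distribution with a function:
  \<open>\<langle>u \<star> f, \<phi>\<rangle> = \<integral> f(y) \<langle>u, \<phi>(\<cdot> + y)\<rangle> dy\<close>, provided these integrals exist.\<close>

definition convolvable :: "'a::euclidean_space distribution \<Rightarrow> ('a \<Rightarrow> real) \<Rightarrow> bool" where
  "convolvable u f \<longleftrightarrow>
     (\<forall>\<phi>\<in>schwartz. integrable lborel (\<lambda>y. of_real (f y) * u (\<lambda>x. \<phi> (x + y))))"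

definition conv :: "'a::euclidean_space distribution \<Rightarrow> ('a \<Rightarrow> real) \<Rightarrow> 'a distribution" where
  "conv u f \<phi> = (LINT y|lborel. of_real (f y) * u (\<lambda>x. \<phi> (x + y)))"

definition fourier :: "('a::euclidean_space \<Rightarrow> complex) \<Rightarrow> 'a \<Rightarrow> complex" where
  "fourier \<phi> \<xi> = (LINT x|lborel. exp (- \<i> * of_real (x \<bullet> \<xi>)) * \<phi> x)"

definition inv_fourier :: "('a::euclidean_space \<Rightarrow> complex) \<Rightarrow> 'a \<Rightarrow> complex" where
  "inv_fourier \<phi> x =
     (LINT \<xi>|lborel. exp (\<i> * of_real (x \<bullet> \<xi>)) * \<phi> \<xi>) / of_real ((2 * pi) ^ DIM('a))"


section \<open>Function spaces\<close>

text \<open>\<open>g\<close> is the Fourier transform of \<open>u\<close>, as a locally square integrable function.\<close>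

definition has_fourier :: "'a::euclidean_space distribution \<Rightarrow> ('a \<Rightarrow> complex) \<Rightarrow> bool" where
  "has_fourier u g \<longleftrightarrow>
     g \<in> borel_measurable borel \<and>
     (\<forall>K. compact K \<longrightarrow> set_integrable lborel K (\<lambda>\<xi>. (norm (g \<xi>))\<^sup>2)) \<and>
     (\<forall>\<phi>\<in>schwartz. integrable lborel (\<lambda>\<xi>. g \<xi> * \<phi> \<xi>) \<and>
        u (fourier \<phi>) = (LINT \<xi>|lborel. g \<xi> * \<phi> \<xi>))"

definition sobolev :: "real \<Rightarrow> 'a::euclidean_space distribution set" where
  "sobolev s = {u. tempered u \<and>
     (\<exists>g. has_fourier u g \<and>
        integrable lborel (\<lambda>\<xi>. (1 + (norm \<xi>)\<^sup>2) powr s * (norm (g \<xi>))\<^sup>2))}"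

text \<open>The Fourier transform is unique almost everywhere, so the choice below is immaterial.\<close>

definition sobolev_norm :: "real \<Rightarrow> 'a::euclidean_space distribution \<Rightarrow> real" where
  "sobolev_norm s u =
     sqrt (LINT \<xi>|lborel. (1 + (norm \<xi>)\<^sup>2) powr s * (norm ((SOME g. has_fourier u g) \<xi>))\<^sup>2)"

definition lp_symbol :: "('a::euclidean_space \<Rightarrow> real) \<Rightarrow> ('a \<Rightarrow> real) \<Rightarrow> nat \<Rightarrow> 'a \<Rightarrow> real" where
  "lp_symbol \<psi> \<rho> j = (case j of 0 \<Rightarrow> \<psi> | Suc i \<Rightarrow> (\<lambda>\<xi>. \<rho> ((1 / 2 ^ i) *\<^sub>R \<xi>)))"

definition dyadic_partition :: "('a::euclidean_space \<Rightarrow> real) \<Rightarrow> ('a \<Rightarrow> real) \<Rightarrow> bool" where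
  "dyadic_partition \<psi> \<rho> \<longleftrightarrow>
     (\<forall>n. cont_diff n \<psi>) \<and> (\<forall>n. cont_diff n \<rho>) \<and>
     (\<forall>\<xi>. 0 \<le> \<psi> \<xi> \<and> 0 \<le> \<rho> \<xi>) \<and>
     (\<forall>\<xi> \<eta>. norm \<xi> = norm \<eta> \<longrightarrow> \<psi> \<xi> = \<psi> \<eta> \<and> \<rho> \<xi> = \<rho> \<eta>) \<and>
     (\<exists>R. \<forall>\<xi>. \<psi> \<xi> \<noteq> 0 \<longrightarrow> norm \<xi> \<le> R) \<and>
     (\<exists>r>0. \<exists>R. \<forall>\<xi>. \<rho> \<xi> \<noteq> 0 \<longrightarrow> r \<le> norm \<xi> \<and> norm \<xi> \<le> R) \<and>
     (\<forall>\<xi>. (\<lambda>j. lp_symbol \<psi> \<rho> j \<xi>) sums 1) \<and>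
     (\<forall>i j. Suc i < j \<longrightarrow>
        closure {\<xi>. lp_symbol \<psi> \<rho> i \<xi> \<noteq> 0} \<inter> closure {\<xi>. lp_symbol \<psi> \<rho> j \<xi> \<noteq> 0} = {})"

text \<open>The Littlewood-Paley block \<open>\<F>\<inverse>(\<rho>\<^sub>j \<F>u)\<close> is the smooth function \<open>x \<mapsto> \<langle>u, K\<^sub>j(x - \<cdot>)\<rangle>\<close> with
  \<open>K\<^sub>j = \<F>\<inverse>\<rho>\<^sub>j\<close>. Blocks are indexed from \<open>0\<close> instead of the customary \<open>-1\<close>, whence the shift
  \<open>j - 1\<close> in the weights below.\<close>

definition lp_block ::
    "('a::euclidean_space \<Rightarrow> real) \<Rightarrow> ('a \<Rightarrow> real) \<Rightarrow> nat \<Rightarrow> 'a distribution \<Rightarrow> 'a \<Rightarrow> complex" where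
  "lp_block \<psi> \<rho> j u x = u (\<lambda>y. inv_fourier (\<lambda>\<xi>. of_real (lp_symbol \<psi> \<rho> j \<xi>)) (x - y))"

text \<open>The space \<open>B^\<theta>\<close> with both further indices infinite, and its norm, relative to the
  dyadic partition of unity \<open>\<psi>, \<rho>\<close>; another partition gives the same space with an
  equivalent norm.\<close>

definition besov :: "('a::euclidean_space \<Rightarrow> real) \<Rightarrow> ('a \<Rightarrow> real) \<Rightarrow> real \<Rightarrow> 'a distribution set" where
  "besov \<psi> \<rho> \<theta> = {u. tempered u \<and>
     bdd_above (range (\<lambda>(j, x). 2 powr ((real j - 1) * \<theta>) * norm (lp_block \<psi> \<rho> j u x)))}"

definition besov_norm ::
    "('a::euclidean_space \<Rightarrow> real) \<Rightarrow> ('a \<Rightarrow> real) \<Rightarrow> real \<Rightarrow> 'a distribution \<Rightarrow> real" where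
  "besov_norm \<psi> \<rho> \<theta> u =
     (SUP (j, x). 2 powr ((real j - 1) * \<theta>) * norm (lp_block \<psi> \<rho> j u x))"

text \<open>\<open>f\<close> belongs to \<open>C^\<gamma>([0,T]; E)\<close>, where the space \<open>E\<close> is given by its carrier and its norm.\<close>

definition holder_on :: "real \<Rightarrow> real \<Rightarrow> 'e set \<Rightarrow> ('e \<Rightarrow> real) \<Rightarrow> (real \<Rightarrow> 'e::minus) \<Rightarrow> bool" where
  "holder_on \<gamma> T E nrm f \<longleftrightarrow>
     (\<forall>t\<in>{0..T}. f t \<in> E) \<and>
     (\<exists>C. \<forall>s\<in>{0..T}. \<forall>t\<in>{0..T}. nrm (f t - f s) \<le> C * \<bar>t - s\<bar> powr \<gamma>)"


section \<open>Non-linear Young integral and pathwise solutions\<close>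

definition young_admissible ::
    "(real^'d \<Rightarrow> real) \<Rightarrow> (real^'d \<Rightarrow> real) \<Rightarrow> real \<Rightarrow> real \<Rightarrow> (real \<Rightarrow> real^'d \<Rightarrow> real^'d) \<Rightarrow> bool" where
  "young_admissible \<psi> \<rho> \<gamma> T \<Gamma> \<longleftrightarrow>
     (\<forall>i. holder_on \<gamma> T (besov \<psi> \<rho> 1) (besov_norm \<psi> \<rho> 1) (\<lambda>t. reg_dist (\<lambda>x. \<Gamma> t x $ i))) \<and>
     (\<exists>C. \<forall>s\<in>{0..T}. \<forall>t\<in>{0..T}. \<forall>x. norm (\<Gamma> t x - \<Gamma> s x) \<le> C * \<bar>t - s\<bar> powr \<gamma>) \<and>
     (\<exists>C. \<forall>s\<in>{0..T}. \<forall>t\<in>{0..T}. \<forall>x y.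
        norm ((\<Gamma> t x - \<Gamma> s x) - (\<Gamma> t y - \<Gamma> s y)) \<le> C * norm (x - y) * \<bar>t - s\<bar> powr \<gamma>)"

definition has_young_integral ::
    "(real \<Rightarrow> 'a \<Rightarrow> 'b::real_normed_vector) \<Rightarrow> (real \<Rightarrow> 'a) \<Rightarrow> real \<Rightarrow> 'b \<Rightarrow> bool" where
  "has_young_integral \<Gamma> \<theta> t I \<longleftrightarrow>
     (\<forall>\<epsilon>>0. \<exists>\<delta>>0. \<forall>N p. is_partition t N p \<and> (\<forall>j<N. p (Suc j) - p j < \<delta>) \<longrightarrow>
        norm ((\<Sum>j<N. \<Gamma> (p (Suc j)) (\<theta> (p j)) - \<Gamma> (p j) (\<theta> (p j))) - I) < \<epsilon>)"

text \<open>The spatial function \<open>\<Gamma> t\<close> below is the continuous representative of the distribution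
  \<open>b \<star> L\<^sub>t(- \<cdot>)\<close>, and the last line reads \<open>\<theta>\<^sub>t = \<xi> + \<integral>\<^sub>0\<^sup>t \<Gamma>\<^sub>d\<^sub>r(\<theta>\<^sub>r)\<close> for \<open>\<theta> = x - z\<close>.\<close>

definition pathwise_solution ::
    "(real^'d \<Rightarrow> real) \<Rightarrow> (real^'d \<Rightarrow> real) \<Rightarrow> real \<Rightarrow> real \<Rightarrow> ('d \<Rightarrow> (real^'d) distribution) \<Rightarrow>
     (real \<Rightarrow> real^'d \<Rightarrow> real) \<Rightarrow> (real \<Rightarrow> real^'d) \<Rightarrow> real^'d \<Rightarrow> (real \<Rightarrow> real^'d) \<Rightarrow> bool" where
  "pathwise_solution \<psi> \<rho> \<gamma> T b L z \<xi> x \<longleftrightarrow>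
     (\<forall>i. (\<forall>t\<in>{0..T}. convolvable (b i) (L t)) \<and>
        holder_on \<gamma> T (besov \<psi> \<rho> 2) (besov_norm \<psi> \<rho> 2) (\<lambda>t. conv (b i) (L t))) \<and>
     holder_on \<gamma> T UNIV norm (\<lambda>t. x t - z t) \<and>
     (\<exists>\<Gamma>. (\<forall>t\<in>{0..T}. continuous_on UNIV (\<Gamma> t) \<and>
             (\<forall>i. convolvable (b i) (\<lambda>y. L t (- y)) \<and>
                  represented_by (conv (b i) (\<lambda>y. L t (- y))) (\<lambda>y. \<Gamma> t y $ i))) \<and>
          young_admissible \<psi> \<rho> \<gamma> T \<Gamma> \<and>
          (\<forall>t\<in>{0..T}. has_young_integral \<Gamma> (\<lambda>r. x r - z r) t (x t - z t - \<xi>)))"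

end

(*
  The statement is pathwise. Write G for the averaged field b * Lbar; its Fourier transform is the
  product of those of b and of Lbar, and since beta + kappa > 2 the Cauchy-Schwarz inequality makes
  (1 + |xi|)^2 |G_t^ - G_s^| integrable with integral O(|t - s|^gamma). So G has gamma-Hoelder
  increments in time with values in C^2, and the distributional bookkeeping (Besov spaces,
  representatives, convolutions) only ever concerns distributions with integrable Fourier transform.

  For such fields, a non-linear Young solution is the same as a path theta with
  |theta_t - theta_s - (G_t - G_s)(theta_s)| <= C |t - s|^(2 gamma) (Davie's expansion, 2 gamma > 1).
  Discrete sewing estimates for the Euler scheme on uniform grids, with constants independent of the
  grid, make it converge to a Davie solution and show that every Davie solution is its limit: this is
  existence and uniqueness. For the flow one differentiates the Euler scheme: its derivatives of order
  up to n solve linear discrete Young equations driven by the derivatives of G, and they are bounded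
  and Hoelder continuous in the initial point uniformly in the grid. The uniform Taylor remainders then
  force the derivatives of the scheme to converge, so the limit is n times continuously differentiable.
*)
theory Submission
  imports Defs
begin

section \<open>Discrete sewing and Davie expansions\<close>

text \<open>A scheme with finitely many steps is a composition of differentiable maps, so its
  derivatives in the initial point exist at once and obey linear recursions; nothing about
  differentiability of the limit flow has to be known beforehand. This is why sewing is done on
  arbitrary monotone grids and not in the continuum, and why every constant must be uniform over
  grids. Two kinds of spatial regularity are kept apart by the exponent in
  \<open>young_field\<close>. Existence, uniqueness and stability use exponent 1, that is C^2 in
  space, which is the threshold \<beta> + \<kappa> > 2. The top derivatives of the field that enter
  an n-fold differentiated scheme are only C^(1 + \<epsilon>), and the strict inequality \<beta> +
  \<kappa> > n + 1 is what leaves some \<epsilon> > 0. A deficit \<epsilon> < 1 costs regularity in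
  the initial point only, never in time, and any uniform Hoelder modulus of the derivatives is
  enough for differentiability of the limit. On the Fourier side, the dyadic partition in the
  statement doubles as the supply of compactly supported test functions.\<close>

lemma grid_split:
  fixes t :: "nat \<Rightarrow> real"
  assumes "mono t" "j < k"
  obtains l where "j \<le> l" "l < k" "t l - t j \<le> (t k - t j) / 2" "t k - t (Suc l) \<le> (t k - t j) / 2"
proof -
  \<comment> \<open>\<open>l\<close> will be the last grid index not beyond the midpoint in time.
    The step from \<open>l\<close> to \<open>Suc l\<close> may straddle the midpoint and be long; it
    is left out of both halves, so both halves are at most half as long whatever the grid.\<close>
  define P where "P i \<longleftrightarrow> j \<le> i \<and> i < k \<and> t i - t j \<le> (t k - t j) / 2" for i
  have "t j \<le> t k" using monoD[OF assms(1), of j k] assms(2) by simp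
  then have Pj: "P j" using assms(2) by (simp add: P_def)
  have bd: "\<And>i. P i \<Longrightarrow> i \<le> k" by (simp add: P_def)
  define l where "l = (GREATEST i. P i)"
  have Pl: "P l" unfolding l_def using GreatestI_nat[of P j k] Pj bd by blast
  have "t k - t (Suc l) \<le> (t k - t j) / 2"
  proof (cases "Suc l = k")
    case True then show ?thesis using \<open>t j \<le> t k\<close> by simp
  next
    case False
    have "\<not> P (Suc l)"
    proof
      assume "P (Suc l)"
      then have "Suc l \<le> l" unfolding l_def using Greatest_le_nat[of P "Suc l" k] bd by (simp add: l_def)
      then show False by simp
    qed
    then show ?thesis using False Pl unfolding P_def by (simp add: field_simps)
  qed
  with Pl show ?thesis using that unfolding P_def by blast
qed

lemma norm_split_le:
  fixes a b c d :: "'v::real_normed_vector"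
  assumes "norm a \<le> a'" "norm b \<le> b'" "norm c \<le> c'" "norm d \<le> d'"
  shows "norm (a + b - (c + d)) \<le> a' + b' + (c' + d')"
  using assms norm_triangle_ineq4[of "a + b" "c + d"] norm_triangle_ineq[of a b] norm_triangle_ineq[of c d]
  by linarith

lemma powr_half_sum:
  fixes x y s \<theta> :: real
  assumes "0 \<le> x" "0 \<le> y" "x \<le> s / 2" "y \<le> s / 2" "\<theta> \<ge> 0"
  shows "x powr \<theta> \<le> 2 powr (-\<theta>) * s powr \<theta>" "y powr \<theta> \<le> 2 powr (-\<theta>) * s powr \<theta>"
proof -
  have s: "s \<ge> 0" using assms by linarith
  have *: "(s/2) powr \<theta> = 2 powr (-\<theta>) * s powr \<theta>"
    using s by (simp add: powr_divide powr_minus field_simps)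
  show "x powr \<theta> \<le> 2 powr (-\<theta>) * s powr \<theta>" using powr_mono2[of \<theta> x "s/2"] assms * by simp
  show "y powr \<theta> \<le> 2 powr (-\<theta>) * s powr \<theta>" using powr_mono2[of \<theta> y "s/2"] assms * by simp
qed

text \<open>Bisection at the step that straddles the midpoint: the two halves contribute 2 * 2 powr
  (-\<theta>) = 2 powr (1 - \<theta>) < 1 of the bound for the whole, the straddling step itself
  contributes no error, and reassembling the three pieces costs two defects. The constant is the
  fixed point of c = 2 powr (1 - \<theta>) * c + 2 * K, so it depends neither on the number of
  points nor on the mesh.\<close>

lemma discrete_sewing:
  fixes t :: "nat \<Rightarrow> real" and A :: "nat \<Rightarrow> nat \<Rightarrow> 'v::real_normed_vector"
  assumes t: "mono t" and \<theta>: "\<theta> > 1" and K: "K \<ge> 0"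
    and A0: "\<And>k. A k k = 0"
    and dA: "\<And>i j k. i \<le> j \<Longrightarrow> j \<le> k \<Longrightarrow> norm (A i k - A i j - A j k) \<le> K * (t k - t i) powr \<theta>"
    and jk: "j \<le> k"
  shows "norm ((\<Sum>i=j..<k. A i (Suc i)) - A j k) \<le> 2 / (1 - 2 powr (1 - \<theta>)) * K * (t k - t j) powr \<theta>"
proof -
  define lam where "lam = 1 - 2 powr (1 - \<theta>)"
  have "2 powr (1 - \<theta>) < 2 powr (0::real)" using \<theta> by (intro powr_less_mono) auto
  then have lam: "lam > 0" by (simp add: lam_def)
  define c where "c = 2 / lam * K"
  have c: "c \<ge> 0" using lam K by (simp add: c_def)
  have "\<forall>j. k = j + n \<longrightarrow> norm ((\<Sum>i=j..<k. A i (Suc i)) - A j k) \<le> c * (t k - t j) powr \<theta>" for n k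
  proof (induction n arbitrary: k rule: less_induct)
    case (less n)
    show ?case
    proof (intro allI impI)
      fix j assume kn: "k = j + n"
      show "norm ((\<Sum>i=j..<k. A i (Suc i)) - A j k) \<le> c * (t k - t j) powr \<theta>"
      proof (cases "n = 0")
        case True then show ?thesis using kn A0 c by simp
      next
        case False
        then have "j < k" using kn by simp
        from grid_split[OF t this] obtain l where l: "j \<le> l" "l < k"
          "t l - t j \<le> (t k - t j) / 2" "t k - t (Suc l) \<le> (t k - t j) / 2" by blast
        have m: "t j \<le> t l" "t l \<le> t (Suc l)" "t (Suc l) \<le> t k" using l t by (auto intro!: monoD[OF t])
        define s where "s = t k - t j"
        have p: "(t l - t j) powr \<theta> \<le> 2 powr (-\<theta>) * s powr \<theta>" "(t k - t (Suc l)) powr \<theta> \<le> 2 powr (-\<theta>) * s powr \<theta>"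
          using powr_half_sum[of "t l - t j" "t k - t (Suc l)" s \<theta>] l m \<theta> by (auto simp: s_def)
        have e1: "norm ((\<Sum>i=j..<l. A i (Suc i)) - A j l) \<le> c * (2 powr (-\<theta>) * s powr \<theta>)"
          using less[of "l - j" l] l kn order_trans[OF _ mult_left_mono[OF p(1) c]] by auto
        have e2: "norm ((\<Sum>i=Suc l..<k. A i (Suc i)) - A (Suc l) k) \<le> c * (2 powr (-\<theta>) * s powr \<theta>)"
          using less[of "k - Suc l" k] l kn order_trans[OF _ mult_left_mono[OF p(2) c]] by auto
        have d1: "norm (A j k - A j (Suc l) - A (Suc l) k) \<le> K * s powr \<theta>"
          using dA[of j "Suc l" k] l by (simp add: s_def)
        have "(t (Suc l) - t j) powr \<theta> \<le> s powr \<theta>" using m \<theta> by (intro powr_mono2) (auto simp: s_def)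
        then have d2: "norm (A j (Suc l) - A j l - A l (Suc l)) \<le> K * s powr \<theta>"
          using dA[of j l "Suc l"] l order_trans[OF _ mult_left_mono[OF _ K]] by auto
        have split: "(\<Sum>i=j..<k. A i (Suc i)) = (\<Sum>i=j..<l. A i (Suc i)) + A l (Suc l) + (\<Sum>i=Suc l..<k. A i (Suc i))"
          using l sum.atLeastLessThan_concat[of j l k "\<lambda>i. A i (Suc i)"]
            sum.atLeast_Suc_lessThan[of l k "\<lambda>i. A i (Suc i)"] by (simp add: add.assoc)
        have "(\<Sum>i=j..<k. A i (Suc i)) - A j k = ((\<Sum>i=j..<l. A i (Suc i)) - A j l)
           + ((\<Sum>i=Suc l..<k. A i (Suc i)) - A (Suc l) k)
           - ((A j k - A j (Suc l) - A (Suc l) k) + (A j (Suc l) - A j l - A l (Suc l)))"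
          unfolding split by (simp add: algebra_simps)
        also have "norm \<dots> \<le> c * (2 powr (-\<theta>) * s powr \<theta>) + c * (2 powr (-\<theta>) * s powr \<theta>) + (K * s powr \<theta> + K * s powr \<theta>)"
          by (rule norm_split_le[OF e1 e2 d1 d2])
        also have "\<dots> = (c * (2 powr (1-\<theta>)) + 2 * K) * s powr \<theta>"
          by (simp add: algebra_simps powr_diff powr_minus field_simps)
        also have "c * (2 powr (1-\<theta>)) + 2 * K = c"
        proof -
          have "c * (2 powr (1-\<theta>)) = c * (1 - lam)" by (simp add: lam_def)
          also have "\<dots> = c - 2 * K" using lam by (simp add: c_def field_simps)
          finally show ?thesis by simp
        qed
        finally show ?thesis by (simp add: s_def)
      qed
    qed
  qed
  from this[of k "k - j"] jk show ?thesis by (simp add: c_def lam_def)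
qed

text \<open>The germ depends on the unknown \<open>Y\<close>, so the sewing bound and the control of
  \<open>Y\<close> must be proved in the same induction. Over the left half the induction hypothesis
  shows that \<open>Y\<close> moves by at most e * M, over the straddling step it moves by at most 2
  * e * M, so the right half starts from a weight of at most (1 + 3 * e) * M. On intervals of length
  \<tau> the factor e is small enough for the contraction 1 - lam to absorb the excess.\<close>

lemma discrete_gronwall_local:
  fixes t :: "nat \<Rightarrow> real" and A :: "nat \<Rightarrow> nat \<Rightarrow> 'v::real_normed_vector"
  assumes t: "mono t" and \<gamma>: "\<gamma> > 1/2" and C: "C > 0" and \<rho>: "\<rho> \<ge> 0"
    and lam: "lam = 1 - 2 powr (1 - 2 * \<gamma>)" and K: "K = 2 * C * (4 * C + 2) / lam"
    and \<tau>: "\<tau> > 0" "C * \<tau> powr \<gamma> + K * \<tau> powr (2 * \<gamma>) \<le> lam / 11"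
    and step: "\<And>k. Y (Suc k) - Y k = A k (Suc k)"
    and A: "\<And>j k. j \<le> k \<Longrightarrow> norm (A j k) \<le> C * (t k - t j) powr \<gamma> * (norm (Y j) + \<rho>)"
    and dA: "\<And>i j k. i \<le> j \<Longrightarrow> j \<le> k \<Longrightarrow> norm (A i k - A i j - A j k)
           \<le> C * (t k - t j) powr \<gamma> * (norm (Y j - Y i) + (t j - t i) powr \<gamma> * (norm (Y i) + \<rho>))"
    and jk: "j \<le> k" "t k - t j \<le> \<tau>"
  shows "norm (Y k - Y j - A j k) \<le> K * (t k - t j) powr (2*\<gamma>) * (norm (Y j) + \<rho>)"
proof -
  have "2 powr (1 - 2*\<gamma>) < 2 powr (0::real)" using \<gamma> by (intro powr_less_mono) auto
  then have lam0: "lam > 0" "lam \<le> 1" by (simp_all add: lam)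
  have K0: "K > 0" using C lam0 by (simp add: K)
  have KC: "C * (4 * C + 2) = lam * K / 2" using lam0 by (simp add: K)
  have "\<forall>j. k = j + n \<longrightarrow> t k - t j \<le> \<tau> \<longrightarrow> norm (Y k - Y j - A j k) \<le> K * (t k - t j) powr (2*\<gamma>) * (norm (Y j) + \<rho>)" for n k
  proof (induction n arbitrary: k rule: less_induct)
    case (less n)
    show ?case
    proof (intro allI impI)
      fix j assume kn: "k = j + n" and le: "t k - t j \<le> \<tau>"
      show "norm (Y k - Y j - A j k) \<le> K * (t k - t j) powr (2*\<gamma>) * (norm (Y j) + \<rho>)"
      proof (cases "n = 0")
        case True then show ?thesis using kn A[of j j] by simp
      next
        case False
        then have "j < k" using kn by simp
        from grid_split[OF t this] obtain l where l: "j \<le> l" "l < k"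
          "t l - t j \<le> (t k - t j) / 2" "t k - t (Suc l) \<le> (t k - t j) / 2" by blast
        have m: "t j \<le> t l" "t l \<le> t (Suc l)" "t (Suc l) \<le> t k" using l t by (auto intro!: monoD[OF t])
        define s where "s = t k - t j"
        define x where "x = s powr \<gamma>"
        have s0: "0 \<le> s" using m by (simp add: s_def)
        have x0: "x \<ge> 0" by (simp add: x_def)
        have x2: "s powr (2*\<gamma>) = x * x" by (simp add: x_def flip: powr_add)
        define M where "M = norm (Y j) + \<rho>"
        have M0: "M \<ge> 0" using \<rho> by (simp add: M_def)
        define e where "e = C * x + K * (x * x)"
        have e0: "e \<ge> 0" using C K0 x0 by (simp add: e_def)
        have "e \<le> lam / 11"
        proof -
          have "s powr \<gamma> \<le> \<tau> powr \<gamma>" "s powr (2*\<gamma>) \<le> \<tau> powr (2*\<gamma>)"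
            using le s0 \<gamma> by (auto intro!: powr_mono2 simp: s_def)
          then have "e \<le> C * \<tau> powr \<gamma> + K * \<tau> powr (2*\<gamma>)"
            unfolding e_def x2[symmetric] using C K0 by (auto intro!: add_mono mult_left_mono simp: x_def)
          then show ?thesis using \<tau> by simp
        qed
        then have e1: "e \<le> 1" using lam0 by linarith
        have le_x: "(t b - t a) powr \<gamma> \<le> x" if "t j \<le> t a" "t a \<le> t b" "t b \<le> t k" for a b
          unfolding x_def using that \<gamma> by (intro powr_mono2) (auto simp: s_def)
        have p: "(t l - t j) powr (2*\<gamma>) \<le> 2 powr (-(2*\<gamma>)) * (x*x)" "(t k - t (Suc l)) powr (2*\<gamma>) \<le> 2 powr (-(2*\<gamma>)) * (x*x)"
          using powr_half_sum[of "t l - t j" "t k - t (Suc l)" s "2*\<gamma>"] l m \<gamma> x2 by (auto simp: s_def)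
        have p1: "2 powr (-(2*\<gamma>)) \<le> (1::real)" using powr_mono[of "-(2*\<gamma>)" 0 "2::real"] \<gamma> by simp
        have E1: "norm (Y l - Y j - A j l) \<le> K * (2 powr (-(2*\<gamma>)) * (x*x)) * M"
        proof -
          have "norm (Y l - Y j - A j l) \<le> K * (t l - t j) powr (2*\<gamma>) * M"
            using less[of "l - j" l] l kn m le by (auto simp: M_def)
          also have "\<dots> \<le> K * (2 powr (-(2*\<gamma>)) * (x*x)) * M"
            using p K0 M0 by (intro mult_right_mono mult_left_mono) auto
          finally show ?thesis .
        qed
        have Ajl: "norm (A j l) \<le> C * x * M"
          using A[OF l(1)] le_x[of j l] m C M0
          by (intro order_trans[OF A[OF l(1)]]) (auto intro!: mult_right_mono mult_left_mono simp: M_def[symmetric])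
        have Yjl: "norm (Y l - Y j) \<le> e * M"
        proof -
          have "norm (Y l - Y j) \<le> norm (Y l - Y j - A j l) + norm (A j l)"
            by (metis diff_add_cancel norm_triangle_ineq)
          also have "\<dots> \<le> K * (1 * (x*x)) * M + C * x * M"
            by (intro add_mono Ajl order_trans[OF E1] mult_right_mono mult_left_mono p1) (use K0 M0 x0 in auto)
          finally show ?thesis by (simp add: e_def algebra_simps)
        qed
        have Ml: "norm (Y l) + \<rho> \<le> 2 * M"
        proof -
          have "norm (Y l) \<le> norm (Y j) + norm (Y l - Y j)" by (metis norm_triangle_sub)
          also have "norm (Y l - Y j) \<le> 1 * M" using Yjl e1 M0 by (meson mult_right_mono order_trans)
          finally show ?thesis by (simp add: M_def)
        qed
        have Ysl: "norm (Y (Suc l) - Y l) \<le> C * x * (2 * M)"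
        proof -
          have "norm (Y (Suc l) - Y l) \<le> C * (t (Suc l) - t l) powr \<gamma> * (norm (Y l) + \<rho>)"
            using A[of l "Suc l"] step by simp
          also have "\<dots> \<le> C * x * (2 * M)"
            using Ml le_x[of l "Suc l"] m C x0 \<rho> by (intro mult_mono) auto
          finally show ?thesis .
        qed
        have Cxe: "C * x \<le> e" using K0 x0 by (simp add: e_def)
        have Yjsl: "norm (Y (Suc l) - Y j) \<le> 3 * e * M"
        proof -
          have "norm (Y (Suc l) - Y j) \<le> norm (Y (Suc l) - Y l) + norm (Y l - Y j)"
            by (metis diff_add_cancel add_diff_eq norm_triangle_ineq)
          also have "\<dots> \<le> e * (2 * M) + e * M" using Ysl Yjl mult_right_mono[OF Cxe, of "2 * M"] M0 by linarith
          finally show ?thesis by (simp add: algebra_simps)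
        qed
        have Msl: "norm (Y (Suc l)) + \<rho> \<le> (1 + 3 * e) * M"
        proof -
          have "norm (Y (Suc l)) \<le> norm (Y j) + norm (Y (Suc l) - Y j)" by (metis norm_triangle_sub)
          then show ?thesis using Yjsl by (simp add: M_def algebra_simps)
        qed
        have E2: "norm (Y k - Y (Suc l) - A (Suc l) k) \<le> K * (2 powr (-(2*\<gamma>)) * (x*x)) * ((1 + 3 * e) * M)"
        proof -
          have "norm (Y k - Y (Suc l) - A (Suc l) k) \<le> K * (t k - t (Suc l)) powr (2*\<gamma>) * (norm (Y (Suc l)) + \<rho>)"
            using less[of "k - Suc l" k] l kn m le by auto
          also have "\<dots> \<le> K * (2 powr (-(2*\<gamma>)) * (x*x)) * ((1 + 3 * e) * M)"
            using p K0 M0 Msl \<rho> by (intro mult_mono) auto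
          finally show ?thesis .
        qed
        have D1: "norm (A j k - A j (Suc l) - A (Suc l) k) \<le> C * x * (3 * e * M + x * M)"
        proof -
          have "norm (A j k - A j (Suc l) - A (Suc l) k) \<le> C * (t k - t (Suc l)) powr \<gamma> * (norm (Y (Suc l) - Y j) + (t (Suc l) - t j) powr \<gamma> * M)"
            using dA[of j "Suc l" k] l by (simp add: M_def)
          also have "\<dots> \<le> C * x * (3 * e * M + x * M)"
            using le_x m C x0 M0 Yjsl by (intro mult_mono add_mono add_nonneg_nonneg mult_nonneg_nonneg) auto
          finally show ?thesis .
        qed
        have D2: "norm (A j (Suc l) - A j l - A l (Suc l)) \<le> C * x * (e * M + x * M)"
        proof -
          have "norm (A j (Suc l) - A j l - A l (Suc l)) \<le> C * (t (Suc l) - t l) powr \<gamma> * (norm (Y l - Y j) + (t l - t j) powr \<gamma> * M)"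
            using dA[of j l "Suc l"] l by (simp add: M_def)
          also have "\<dots> \<le> C * x * (e * M + x * M)"
            using le_x m C x0 M0 Yjl by (intro mult_mono add_mono add_nonneg_nonneg mult_nonneg_nonneg) auto
          finally show ?thesis .
        qed
        have "Y k - Y j - A j k = (Y l - Y j - A j l) + (Y k - Y (Suc l) - A (Suc l) k)
           - ((A j k - A j (Suc l) - A (Suc l) k) + (A j (Suc l) - A j l - A l (Suc l)))"
          using step[of l] by (simp add: algebra_simps)
        also have "norm \<dots> \<le> K * (2 powr (-(2*\<gamma>)) * (x*x)) * M + K * (2 powr (-(2*\<gamma>)) * (x*x)) * ((1 + 3 * e) * M)
            + (C * x * (3 * e * M + x * M) + C * x * (e * M + x * M))"
          by (rule norm_split_le[OF E1 E2 D1 D2])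
        also have "\<dots> = (K * (2 * 2 powr (-(2*\<gamma>))) + K * 2 powr (-(2*\<gamma>)) * (3 * e) + C * (4 * C + 2) + 4 * K * (C * x)) * (x * x) * M"
          by (simp add: e_def algebra_simps)
        \<comment> \<open>Bisection gains lam * K. Half of it pays for C * (4 * C + 2), which is how
          \<open>K\<close> was chosen; the other half pays for the terms in e, at most (3/2 + 4) * K
          * e = 11/2 * K * e. This is the origin of lam / 11.\<close>
        also have "\<dots> \<le> K * (x * x) * M"
        proof -
          have *: "2 * 2 powr (-(2*\<gamma>)) = 1 - lam" by (simp add: lam powr_diff powr_minus field_simps)
          have "K * (2 * 2 powr (-(2*\<gamma>))) = K - lam * K" by (subst *) (simp add: algebra_simps)
          moreover have "K * 2 powr (-(2*\<gamma>)) * (3 * e) \<le> K * (3 * e) / 2"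
          proof -
            have "2 powr (-(2*\<gamma>)) \<le> (2::real) powr (-1)" using \<gamma> by (intro powr_mono) auto
            then have "2 powr (-(2*\<gamma>)) \<le> (1::real)/2" by (simp add: powr_minus)
            then have "K * 2 powr (-(2*\<gamma>)) * (3 * e) \<le> K * (1/2) * (3 * e)"
              using K0 e0 by (intro mult_right_mono mult_left_mono) auto
            then show ?thesis by simp
          qed
          moreover have "4 * K * (C * x) \<le> 4 * K * e" using Cxe K0 by simp
          moreover have "K * e \<le> K * (lam / 11)" using \<open>e \<le> lam / 11\<close> K0 by simp
          ultimately have "K * (2 * 2 powr (-(2*\<gamma>))) + K * 2 powr (-(2*\<gamma>)) * (3 * e) + C * (4 * C + 2) + 4 * K * (C * x) \<le> K"
            unfolding KC by (simp only: mult.assoc mult.commute mult.left_commute times_divide_eq_right times_divide_eq_left)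
          then show ?thesis using x0 M0 by (intro mult_right_mono) auto
        qed
        finally show ?thesis by (simp add: M_def s_def flip: x2)
      qed
    qed
  qed
  from this[of k "k - j"] jk show ?thesis by simp
qed

text \<open>Discrete linear Young equation in abstract form, where \<rho> carries the inhomogeneity.
  The defect bound allows for a move of \<open>Y\<close> itself or for a factor (t j - t i) powr
  \<gamma>; both are of order \<gamma> in time, and together with the factor in front they reach 2 *
  \<gamma> > 1. Instances are the Euler scheme, the difference of two schemes, and linearised
  systems.\<close>

definition young_germ ::
    "real \<Rightarrow> real \<Rightarrow> real \<Rightarrow> (nat \<Rightarrow> real) \<Rightarrow> (nat \<Rightarrow> 'v::real_normed_vector) \<Rightarrow> (nat \<Rightarrow> nat \<Rightarrow> 'v) \<Rightarrow> bool" where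
  "young_germ \<gamma> C \<rho> t Y A \<longleftrightarrow>
     (\<forall>k. Y (Suc k) - Y k = A k (Suc k)) \<and>
     (\<forall>j k. j \<le> k \<longrightarrow> norm (A j k) \<le> C * (t k - t j) powr \<gamma> * (norm (Y j) + \<rho>)) \<and>
     (\<forall>i j k. i \<le> j \<longrightarrow> j \<le> k \<longrightarrow> norm (A i k - A i j - A j k)
           \<le> C * (t k - t j) powr \<gamma> * (norm (Y j - Y i) + (t j - t i) powr \<gamma> * (norm (Y i) + \<rho>)))"

text \<open>Infinite and not strictly increasing: a finite partition is an eventually constant
  sequence, so no index bounds have to be carried through the inductions.\<close>

definition grid :: "real \<Rightarrow> (nat \<Rightarrow> real) \<Rightarrow> bool" where
  "grid T t \<longleftrightarrow> mono t \<and> range t \<subseteq> {0..T}"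

lemma gridD:
  assumes "grid T t"
  shows "mono t" "\<And>k. 0 \<le> t k" "\<And>k. t k \<le> T" "\<And>j k. j \<le> k \<Longrightarrow> t j \<le> t k"
  using assms by (auto simp: grid_def mono_def image_subset_iff)

text \<open>The local estimate is chained over n intervals of length \<tau>. Each interval at most
  doubles the weight norm (Y k) + \<rho>, and passing from one to the next takes one grid step of
  uncontrolled length, which costs the crude factor c; hence (2 * c) ^ n. For points more than
  \<tau> apart the increment bound follows from boundedness and 1 <= (t k - t j) powr \<gamma> /
  u.\<close>

lemma discrete_gronwall:
  assumes \<gamma>: "\<gamma> > 1/2" and C: "C > 0" and T: "T \<ge> 0"
  obtains D where "D \<ge> 0"
    "\<And>t (Y :: nat \<Rightarrow> 'v::real_normed_vector) A \<rho> k. grid T t \<Longrightarrow> \<rho> \<ge> 0 \<Longrightarrow> young_germ \<gamma> C \<rho> t Y A \<Longrightarrow>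
        norm (Y k) \<le> D * (norm (Y 0) + \<rho>)"
    "\<And>t (Y :: nat \<Rightarrow> 'v::real_normed_vector) A \<rho> j k. grid T t \<Longrightarrow> \<rho> \<ge> 0 \<Longrightarrow> young_germ \<gamma> C \<rho> t Y A \<Longrightarrow> j \<le> k \<Longrightarrow>
        norm (Y k - Y j) \<le> D * (norm (Y 0) + \<rho>) * (t k - t j) powr \<gamma>"
proof -
  define lam where "lam = 1 - 2 powr (1 - 2 * \<gamma>)"
  have "2 powr (1 - 2*\<gamma>) < 2 powr (0::real)" using \<gamma> by (intro powr_less_mono) auto
  then have lam0: "lam > 0" "lam \<le> 1" by (simp_all add: lam_def)
  define K where "K = 2 * C * (4 * C + 2) / lam"
  have K0: "K > 0" using C lam0 by (simp add: K_def)
  \<comment> \<open>\<open>u\<close> plays the role of \<tau> powr \<gamma>. Keeping it below 1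
    gives u * u <= u, so that the smallness condition of the local estimate becomes linear in
    \<open>u\<close>.\<close>
  define u where "u = min 1 (lam / (11 * (C + K)))"
  have u0: "u > 0" "u \<le> 1" using lam0 C K0 by (auto simp: u_def)
  define \<tau> where "\<tau> = u powr (1 / \<gamma>)"
  have \<tau>0: "\<tau> > 0" using u0 by (simp add: \<tau>_def)
  have \<tau>u: "\<tau> powr \<gamma> = u" using u0 \<gamma> by (simp add: \<tau>_def powr_powr)
  have \<tau>2: "\<tau> powr (2 * \<gamma>) = u * u" using \<tau>u by (metis mult_2 powr_add)
  have \<tau>: "C * \<tau> powr \<gamma> + K * \<tau> powr (2 * \<gamma>) \<le> lam / 11"
  proof -
    have "u * u \<le> u" using u0 by (simp add: mult_left_le)
    then have "C * u + K * (u * u) \<le> (C + K) * u" using K0 by (simp add: algebra_simps)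
    also have "\<dots> \<le> (C + K) * (lam / (11 * (C + K)))" using C K0 by (intro mult_left_mono) (auto simp: u_def)
    also have "\<dots> = lam / 11" using C K0 by (simp add: field_simps)
    finally show ?thesis by (simp add: \<tau>u \<tau>2)
  qed
  define c where "c = 1 + C * T powr \<gamma>"
  have c1: "c \<ge> 1" using C by (simp add: c_def)
  define n where "n = nat \<lceil>T / \<tau>\<rceil>"
  define D1 where "D1 = 2 * (2 * c) ^ n"
  have D1: "D1 > 0" using c1 by (simp add: D1_def)
  define D where "D = D1 + D1 * (C + K * u) + 2 * D1 / u"
  have D: "D \<ge> D1" "D \<ge> D1 * (C + K * u)" "D \<ge> 2 * D1 / u" using D1 C K0 u0 by (auto simp: D_def)
  have D0: "D \<ge> 0" using D(1) D1 by linarith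
  have main: "norm (Y k) \<le> D * (norm (Y 0) + \<rho>)" "j \<le> k \<Longrightarrow> norm (Y k - Y j) \<le> D * (norm (Y 0) + \<rho>) * (t k - t j) powr \<gamma>"
    if g: "grid T t" and \<rho>: "\<rho> \<ge> 0" and yg: "young_germ \<gamma> C \<rho> t Y A" 
    for t and Y :: "nat \<Rightarrow> 'v" and A \<rho> j k
  proof -
    note t = gridD(4)[OF g]
    have step: "\<And>k. Y (Suc k) - Y k = A k (Suc k)"
      and A: "\<And>j k. j \<le> k \<Longrightarrow> norm (A j k) \<le> C * (t k - t j) powr \<gamma> * (norm (Y j) + \<rho>)"
      and dA: "\<And>i j k. i \<le> j \<Longrightarrow> j \<le> k \<Longrightarrow> norm (A i k - A i j - A j k)
           \<le> C * (t k - t j) powr \<gamma> * (norm (Y j - Y i) + (t j - t i) powr \<gamma> * (norm (Y i) + \<rho>))"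
      using yg by (auto simp: young_germ_def)
    define m where "m k = norm (Y k) + \<rho>" for k
    have m0: "m k \<ge> 0" for k using \<rho> by (simp add: m_def)
    have loc: "norm (Y k - Y j) \<le> (C + K * u) * (t k - t j) powr \<gamma> * m j" if "j \<le> k" "t k - t j \<le> \<tau>" for j k
    proof -
      let ?s = "t k - t j"
      have s: "0 \<le> ?s" using t[OF that(1)] by simp
      have "norm (Y k - Y j - A j k) \<le> K * ?s powr (2*\<gamma>) * m j"
        using discrete_gronwall_local[OF gridD(1)[OF g] \<gamma> C \<rho> lam_def K_def \<tau>0 \<tau> step A dA that] by (simp add: m_def)
      also have "?s powr (2*\<gamma>) = ?s powr \<gamma> * ?s powr \<gamma>" by (simp flip: powr_add)
      also have "K * (?s powr \<gamma> * ?s powr \<gamma>) * m j \<le> K * (u * ?s powr \<gamma>) * m j"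
        using K0 m0 powr_mono2[of \<gamma> ?s \<tau>] s that \<gamma> \<tau>u by (intro mult_right_mono mult_left_mono) auto
      finally have 1: "norm (Y k - Y j - A j k) \<le> K * u * ?s powr \<gamma> * m j" by (simp add: mult.assoc)
      have "norm (Y k - Y j) \<le> norm (Y k - Y j - A j k) + norm (A j k)" by (metis diff_add_cancel norm_triangle_ineq)
      also have "\<dots> \<le> K * u * ?s powr \<gamma> * m j + C * ?s powr \<gamma> * m j" using 1 A[OF that(1)] by (simp add: m_def)
      finally show ?thesis by (simp add: algebra_simps)
    qed
    have locm: "m k \<le> 2 * m j" if "j \<le> k" "t k - t j \<le> \<tau>" for j k
    proof -
      have "(C + K * u) * (t k - t j) powr \<gamma> \<le> (C + K * u) * u"
        using t[OF that(1)] that \<gamma> C K0 u0 \<tau>u powr_mono2[of \<gamma> "t k - t j" \<tau>] by (intro mult_left_mono) auto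
      also have "\<dots> \<le> 1" using \<tau> lam0 unfolding \<tau>u \<tau>2 by (simp add: algebra_simps)
      finally have "norm (Y k - Y j) \<le> 1 * m j" using loc[OF that] m0[of j] by (meson mult_right_mono order_trans)
      then show ?thesis using norm_triangle_sub[of "Y k" "Y j"] by (simp add: m_def)
    qed
    have step_m: "m (Suc k) \<le> c * m k" for k
    proof -
      have "norm (Y (Suc k) - Y k) \<le> C * (t (Suc k) - t k) powr \<gamma> * m k" using A[of k "Suc k"] step by (simp add: m_def)
      also have "\<dots> \<le> C * T powr \<gamma> * m k"
        using t[of k "Suc k"] gridD(2)[OF g, of k] gridD(3)[OF g, of "Suc k"] \<gamma> C m0
        by (intro mult_right_mono mult_left_mono powr_mono2) auto
      finally show ?thesis using norm_triangle_sub[of "Y (Suc k)" "Y k"] by (simp add: m_def c_def algebra_simps)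
    qed
    have bound: "t k - t 0 \<le> real n * \<tau> \<Longrightarrow> m k \<le> 2 * (2 * c) ^ n * m 0" for n k
    proof (induction n arbitrary: k)
      case 0
      then show ?case using locm[of 0 k] \<tau>0 by simp
    next
      case (Suc n)
      show ?case
      proof (cases "t k - t 0 \<le> \<tau>")
        case True
        have "m k \<le> 2 * 1 * m 0" using locm[of 0 k] True by simp
        also have "\<dots> \<le> 2 * (2 * c) ^ Suc n * m 0"
          using c1 m0 by (intro mult_right_mono mult_left_mono one_le_power) auto
        finally show ?thesis .
      next
        case False
        \<comment> \<open>The first grid point within \<tau> of \<open>t k\<close>. Its predecessor
          is more than \<tau> away and hence covered by the induction hypothesis; only the single
          step between the two is left to the factor \<open>c\<close>.\<close>
        define j where "j = (LEAST j. t k - t j \<le> \<tau>)"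
        have jt: "t k - t j \<le> \<tau>" unfolding j_def by (rule LeastI[of _ k]) (use \<tau>0 in auto)
        have jk: "j \<le> k" unfolding j_def by (rule Least_le) (use \<tau>0 in auto)
        have "j \<noteq> 0" using jt False by (metis)
        then obtain i where i: "j = Suc i" using not0_implies_Suc by blast
        then have "\<not> t k - t i \<le> \<tau>" using not_less_Least[of i "\<lambda>j. t k - t j \<le> \<tau>"] by (simp add: j_def)
        then have "m i \<le> 2 * (2 * c) ^ n * m 0" using Suc.prems by (intro Suc.IH) (simp add: algebra_simps)
        then have "2 * c * m i \<le> 2 * c * (2 * (2 * c) ^ n * m 0)" using c1 by (intro mult_left_mono) auto
        moreover have "m k \<le> 2 * (c * m i)" using locm[OF jk jt] step_m[of i] i by simp
        ultimately show ?thesis by (simp add: algebra_simps)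
      qed
    qed
    have "T / \<tau> \<le> real n" unfolding n_def by linarith
    then have "T \<le> real n * \<tau>" using \<tau>0 by (simp add: field_simps)
    then have mk: "m k \<le> D1 * m 0" for k
      using bound[of k n] gridD(2)[OF g, of 0] gridD(3)[OF g, of k] by (simp add: D1_def)
    have "m k \<le> D * m 0" using mk[of k] mult_right_mono[OF D(1) m0[of 0]] by linarith
    then show "norm (Y k) \<le> D * (norm (Y 0) + \<rho>)" using \<rho> by (simp add: m_def)
    show "norm (Y k - Y j) \<le> D * (norm (Y 0) + \<rho>) * (t k - t j) powr \<gamma>" if jk: "j \<le> k"
    proof (cases "t k - t j \<le> \<tau>")
      case True
      have "norm (Y k - Y j) \<le> (C + K * u) * (t k - t j) powr \<gamma> * m j" by (rule loc[OF jk True])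
      also have "\<dots> \<le> (C + K * u) * (t k - t j) powr \<gamma> * (D1 * m 0)"
        using mk[of j] C K0 u0 by (intro mult_left_mono) auto
      also have "\<dots> = D1 * (C + K * u) * (m 0 * (t k - t j) powr \<gamma>)" by (simp add: algebra_simps)
      also have "\<dots> \<le> D * (m 0 * (t k - t j) powr \<gamma>)"
        using D(2) m0[of 0] by (intro mult_right_mono) auto
      finally show ?thesis by (simp add: m_def algebra_simps)
    next
      case False
      have "norm (Y k - Y j) \<le> norm (Y k) + norm (Y j)" by (rule norm_triangle_ineq4)
      also have "\<dots> \<le> m k + m j" using \<rho> by (simp add: m_def)
      also have "\<dots> \<le> 2 * D1 / u * (m 0 * u)" using mk[of k] mk[of j] u0 by simp
      also have "\<dots> \<le> D * (m 0 * (t k - t j) powr \<gamma>)"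
        using D0 D(3) m0[of 0] D1 u0 powr_mono2[of \<gamma> \<tau> "t k - t j"] False \<tau>0 \<gamma> \<tau>u by (intro mult_mono mult_left_mono) auto
      finally show ?thesis by (simp add: m_def algebra_simps)
    qed
  qed
  show ?thesis by (rule that[OF D0 main])
qed

section \<open>Non-linear Young fields and their Euler schemes\<close>

definition incr :: "(real \<Rightarrow> 'a \<Rightarrow> 'b::ab_group_add) \<Rightarrow> real \<Rightarrow> real \<Rightarrow> 'a \<Rightarrow> 'b" where
  "incr f s t x = f t x - f s x"

lemma incr_split: "incr f s u x = incr f s t x + incr f t u x"
  by (simp add: incr_def)

text \<open>Increments in time of order \<gamma> with values in C^(1 + \<epsilon>), in terms of
  differences only. A bounded \<epsilon>-Hoelder derivative gives the last clause: replace x' by x +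
  (y' - y), then compare the derivatives along two parallel segments. In this form it applies
  directly to differences of two trajectories.\<close>

definition young_field ::
    "real \<Rightarrow> real \<Rightarrow> real \<Rightarrow> real \<Rightarrow> (real \<Rightarrow> 'a::real_normed_vector \<Rightarrow> 'b::real_normed_vector) \<Rightarrow> bool" where
  "young_field \<gamma> \<epsilon> T C f \<longleftrightarrow> 0 \<le> C \<and> (\<forall>s\<in>{0..T}. \<forall>t\<in>{0..T}.
     (\<forall>x. norm (incr f s t x) \<le> C * \<bar>t - s\<bar> powr \<gamma>) \<and>
     (\<forall>x y. norm (incr f s t x - incr f s t y) \<le> C * \<bar>t - s\<bar> powr \<gamma> * norm (x - y)) \<and>
     (\<forall>x x' y y'. norm ((incr f s t x' - incr f s t x) - (incr f s t y' - incr f s t y))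
        \<le> C * \<bar>t - s\<bar> powr \<gamma> * (norm ((x' - x) - (y' - y)) + norm (x - y) powr \<epsilon> * norm (y' - y))))"

lemma young_fieldD:
  assumes "young_field \<gamma> \<epsilon> T C f"
  shows "0 \<le> C"
    "\<And>s t x. 0 \<le> s \<Longrightarrow> s \<le> t \<Longrightarrow> t \<le> T \<Longrightarrow> norm (incr f s t x) \<le> C * (t - s) powr \<gamma>"
    "\<And>s t x y. 0 \<le> s \<Longrightarrow> s \<le> t \<Longrightarrow> t \<le> T \<Longrightarrow> norm (incr f s t x - incr f s t y) \<le> C * (t - s) powr \<gamma> * norm (x - y)"
    "\<And>s t x x' y y'. 0 \<le> s \<Longrightarrow> s \<le> t \<Longrightarrow> t \<le> T \<Longrightarrow>
       norm ((incr f s t x' - incr f s t x) - (incr f s t y' - incr f s t y))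
        \<le> C * (t - s) powr \<gamma> * (norm ((x' - x) - (y' - y)) + norm (x - y) powr \<epsilon> * norm (y' - y))"
proof -
  show "0 \<le> C" using assms by (simp add: young_field_def)
  fix s t :: real assume st: "0 \<le> s" "s \<le> t" "t \<le> T"
  then have "s \<in> {0..T}" "t \<in> {0..T}" and a: "\<bar>t - s\<bar> = t - s" by auto
  with assms have *: "(\<forall>x. norm (incr f s t x) \<le> C * \<bar>t - s\<bar> powr \<gamma>) \<and>
     (\<forall>x y. norm (incr f s t x - incr f s t y) \<le> C * \<bar>t - s\<bar> powr \<gamma> * norm (x - y)) \<and>
     (\<forall>x x' y y'. norm ((incr f s t x' - incr f s t x) - (incr f s t y' - incr f s t y))
        \<le> C * \<bar>t - s\<bar> powr \<gamma> * (norm ((x' - x) - (y' - y)) + norm (x - y) powr \<epsilon> * norm (y' - y)))"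
    unfolding young_field_def by blast
  fix x x' y y'
  show "norm (incr f s t x) \<le> C * (t - s) powr \<gamma>"
    "norm (incr f s t x - incr f s t y) \<le> C * (t - s) powr \<gamma> * norm (x - y)"
    "norm ((incr f s t x' - incr f s t x) - (incr f s t y' - incr f s t y))
        \<le> C * (t - s) powr \<gamma> * (norm ((x' - x) - (y' - y)) + norm (x - y) powr \<epsilon> * norm (y' - y))"
    using * unfolding a by blast+
qed

lemma powr_sewing:
  fixes a b c :: real
  assumes "a \<le> b" "b \<le> c" "\<gamma> \<ge> 0"
  shows "(c - b) powr \<gamma> * (b - a) powr \<gamma> \<le> (c - a) powr (2 * \<gamma>)"
proof -
  have "(c - b) powr \<gamma> * (b - a) powr \<gamma> \<le> (c - a) powr \<gamma> * (c - a) powr \<gamma>"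
    using assms by (intro mult_mono powr_mono2) auto
  then show ?thesis by (simp flip: powr_add)
qed

primrec euler :: "(real \<Rightarrow> 'a \<Rightarrow> 'a) \<Rightarrow> (nat \<Rightarrow> real) \<Rightarrow> 'a \<Rightarrow> nat \<Rightarrow> 'a::real_normed_vector" where
  "euler f t \<xi> 0 = \<xi>"
| "euler f t \<xi> (Suc k) = euler f t \<xi> k + incr f (t k) (t (Suc k)) (euler f t \<xi> k)"

text \<open>Boundedness of the increments of \<open>f\<close> makes the scheme, shifted to start at
  0 and with \<rho> = 1, a Young germ, whence a Hoelder bound that does not depend on the initial
  point. Fed back into the defect, it gives C * D * (t k - t i) powr (2 * \<gamma>), and sewing
  turns this into Davie's expansion with exponent 2 * \<gamma>.\<close>

lemma euler_bounds:
  fixes f :: "real \<Rightarrow> 'a::real_normed_vector \<Rightarrow> 'a"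
  assumes \<gamma>: "\<gamma> > 1/2" and T: "T \<ge> 0" and f: "young_field \<gamma> \<epsilon> T C f"
  obtains D where "D \<ge> 0"
    "\<And>t \<xi> j k. grid T t \<Longrightarrow> j \<le> k \<Longrightarrow> norm (euler f t \<xi> k - euler f t \<xi> j) \<le> D * (t k - t j) powr \<gamma>"
    "\<And>t \<xi> j k. grid T t \<Longrightarrow> j \<le> k \<Longrightarrow>
       norm (euler f t \<xi> k - euler f t \<xi> j - incr f (t j) (t k) (euler f t \<xi> j)) \<le> D * (t k - t j) powr (2 * \<gamma>)"
proof -
  note fD = young_fieldD[OF f]
  have C1: "C + 1 > 0" using fD(1) by simp
  obtain D where D: "D \<ge> 0"
    "\<And>t (Y :: nat \<Rightarrow> 'a) A \<rho> j k. grid T t \<Longrightarrow> \<rho> \<ge> 0 \<Longrightarrow> young_germ \<gamma> (C + 1) \<rho> t Y A \<Longrightarrow> j \<le> k \<Longrightarrow>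
        norm (Y k - Y j) \<le> D * (norm (Y 0) + \<rho>) * (t k - t j) powr \<gamma>"
    by (rule discrete_gronwall[OF \<gamma> C1 T]) blast
  define c where "c = 2 / (1 - 2 powr (1 - 2 * \<gamma>)) * (C * D)"
  have "2 powr (1 - 2*\<gamma>) < 2 powr (0::real)" using \<gamma> by (intro powr_less_mono) auto
  then have c0: "c \<ge> 0" using D(1) fD(1) by (simp add: c_def)
  have A: "norm (euler f t \<xi> k - euler f t \<xi> j) \<le> D * (t k - t j) powr \<gamma>"
    and B: "norm (euler f t \<xi> k - euler f t \<xi> j - incr f (t j) (t k) (euler f t \<xi> j)) \<le> c * (t k - t j) powr (2 * \<gamma>)"
    if g: "grid T t" and jk: "j \<le> k" for t \<xi> j k
  proof -
    define X where "X = euler f t \<xi>"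
    define A where "A j k = incr f (t j) (t k) (X j)" for j k
    have dA: "norm (A i k - A i j - A j k) \<le> C * (t k - t j) powr \<gamma> * norm (X j - X i)" if "i \<le> j" "j \<le> k" for i j k
    proof -
      have "A i k - A i j - A j k = incr f (t j) (t k) (X i) - incr f (t j) (t k) (X j)"
        unfolding A_def by (simp add: incr_split[of f "t i" "t k" _ "t j"])
      then show ?thesis
        using fD(3)[of "t j" "t k" "X i" "X j"] gridD[OF g] that by (simp add: norm_minus_commute)
    qed
    have "young_germ \<gamma> (C + 1) 1 t (\<lambda>k. X k - X 0) A"
      unfolding young_germ_def
    proof (intro conjI allI impI)
      fix k show "X (Suc k) - X 0 - (X k - X 0) = A k (Suc k)" by (simp add: X_def A_def)
    next
      fix j k :: nat assume "j \<le> k"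
      then have "norm (A j k) \<le> C * (t k - t j) powr \<gamma>" unfolding A_def using gridD[OF g] by (intro fD) auto
      also have "\<dots> \<le> (C + 1) * (t k - t j) powr \<gamma> * (norm (X j - X 0) + 1)"
      proof -
        have "C * (t k - t j) powr \<gamma> \<le> (C + 1) * (t k - t j) powr \<gamma>" by (intro mult_right_mono) auto
        also have "\<dots> * 1 \<le> (C + 1) * (t k - t j) powr \<gamma> * (norm (X j - X 0) + 1)"
          using fD(1) by (intro mult_left_mono) auto
        finally show ?thesis by simp
      qed
      finally show "norm (A j k) \<le> (C + 1) * (t k - t j) powr \<gamma> * (norm (X j - X 0) + 1)" .
    next
      fix i j k :: nat assume ij: "i \<le> j" "j \<le> k"
      have "norm (A i k - A i j - A j k) \<le> C * (t k - t j) powr \<gamma> * norm (X j - X i)" by (rule dA[OF ij])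
      also have "\<dots> \<le> (C + 1) * (t k - t j) powr \<gamma> * (norm (X j - X i) + (t j - t i) powr \<gamma> * (norm (X i - X 0) + 1))"
        using fD(1) by (intro mult_mono) auto
      finally show "norm (A i k - A i j - A j k) \<le> (C + 1) * (t k - t j) powr \<gamma> *
        (norm (X j - X 0 - (X i - X 0)) + (t j - t i) powr \<gamma> * (norm (X i - X 0) + 1))" by simp
    qed
    from D(2)[OF g _ this] have Xh: "norm (X k - X j) \<le> D * (t k - t j) powr \<gamma>" if "j \<le> k" for j k
      using that by simp
    then show "norm (euler f t \<xi> k - euler f t \<xi> j) \<le> D * (t k - t j) powr \<gamma>" using jk by (simp add: X_def)
    have "norm ((\<Sum>i=j..<k. A i (Suc i)) - A j k) \<le> 2 / (1 - 2 powr (1 - 2 * \<gamma>)) * (C * D) * (t k - t j) powr (2 * \<gamma>)"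
    proof (rule discrete_sewing[OF gridD(1)[OF g] _ _ _ _ jk])
      show "2 * \<gamma> > 1" "C * D \<ge> 0" using \<gamma> D(1) fD(1) by auto
      show "A k k = 0" for k by (simp add: A_def incr_def)
      fix i j k :: nat assume ij: "i \<le> j" "j \<le> k"
      have "norm (A i k - A i j - A j k) \<le> C * (t k - t j) powr \<gamma> * norm (X j - X i)" by (rule dA[OF ij])
      also have "\<dots> \<le> C * (t k - t j) powr \<gamma> * (D * (t j - t i) powr \<gamma>)" using fD(1) Xh[OF ij(1)] by (intro mult_left_mono) auto
      also have "\<dots> = C * D * ((t k - t j) powr \<gamma> * (t j - t i) powr \<gamma>)" by simp
      also have "\<dots> \<le> C * D * (t k - t i) powr (2 * \<gamma>)"
        using gridD(4)[OF g] ij \<gamma> fD(1) D(1) by (intro mult_left_mono powr_sewing) auto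
      finally show "norm (A i k - A i j - A j k) \<le> C * D * (t k - t i) powr (2 * \<gamma>)" .
    qed
    also have "(\<Sum>i=j..<k. A i (Suc i)) = (\<Sum>i=j..<k. X (Suc i) - X i)" by (simp add: A_def X_def)
    also have "\<dots> = X k - X j" using sum_Suc_diff'[OF jk, of X] by simp
    finally show "norm (euler f t \<xi> k - euler f t \<xi> j - incr f (t j) (t k) (euler f t \<xi> j)) \<le> c * (t k - t j) powr (2 * \<gamma>)"
      by (simp add: X_def A_def c_def)
  qed
  show ?thesis
  proof (rule that[of "max D c"])
    show "max D c \<ge> 0" using D by simp
    show "norm (euler f t \<xi> k - euler f t \<xi> j) \<le> max D c * (t k - t j) powr \<gamma>" if "grid T t" "j \<le> k" for t \<xi> j k
      by (rule order_trans[OF A[OF that]]) (auto intro!: mult_right_mono)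
    show "norm (euler f t \<xi> k - euler f t \<xi> j - incr f (t j) (t k) (euler f t \<xi> j)) \<le> max D c * (t k - t j) powr (2 * \<gamma>)"
      if "grid T t" "j \<le> k" for t \<xi> j k
      by (rule order_trans[OF B[OF that]]) (auto intro!: mult_right_mono)
  qed
qed

text \<open>Linear dependence of the defect on the difference of the two sequences comes from the
  four-point inequality. The points are paired so that the base points are two positions of the
  exact scheme, whose Hoelder bound is known; the perturbed sequence enters through the difference
  alone. Exponent 1 is essential here: \<epsilon> < 1 would yield only (t j - t i) powr (\<gamma> *
  \<epsilon>) where the germ asks for (t j - t i) powr \<gamma>.\<close>

lemma euler_stability:
  fixes f :: "real \<Rightarrow> 'a::real_normed_vector \<Rightarrow> 'a"
  assumes \<gamma>: "\<gamma> > 1/2" and T: "T \<ge> 0" and f: "young_field \<gamma> 1 T C f"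
  obtains D where "D \<ge> 0"
    "\<And>t \<xi> X r \<rho> k. grid T t \<Longrightarrow> \<rho> \<ge> 0 \<Longrightarrow>
       (\<And>k. X (Suc k) = X k + incr f (t k) (t (Suc k)) (X k) + (r (Suc k) - r k)) \<Longrightarrow>
       (\<And>j k. j \<le> k \<Longrightarrow> norm (r k - r j) \<le> \<rho> * (t k - t j) powr \<gamma>) \<Longrightarrow>
       norm (X k - euler f t \<xi> k) \<le> D * (norm (X 0 - \<xi>) + \<rho>)"
    "\<And>t \<xi> X r \<rho> j k. grid T t \<Longrightarrow> \<rho> \<ge> 0 \<Longrightarrow>
       (\<And>k. X (Suc k) = X k + incr f (t k) (t (Suc k)) (X k) + (r (Suc k) - r k)) \<Longrightarrow>
       (\<And>j k. j \<le> k \<Longrightarrow> norm (r k - r j) \<le> \<rho> * (t k - t j) powr \<gamma>) \<Longrightarrow> j \<le> k \<Longrightarrow>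
       norm ((X k - euler f t \<xi> k) - (X j - euler f t \<xi> j)) \<le> D * (norm (X 0 - \<xi>) + \<rho>) * (t k - t j) powr \<gamma>"
proof -
  note fD = young_fieldD[OF f]
  obtain E where E: "E \<ge> 0" 
    "\<And>t \<xi> j k. grid T t \<Longrightarrow> j \<le> k \<Longrightarrow> norm (euler f t \<xi> k - euler f t \<xi> j) \<le> E * (t k - t j) powr \<gamma>"
    by (rule euler_bounds[OF \<gamma> T f]) blast
  define C' where "C' = C * (1 + E) + 1"
  have CC': "C * 1 \<le> C * (1 + E)" using fD(1) E(1) by (intro mult_left_mono) auto
  then have C': "C' > 0" "C' \<ge> 1" "C' \<ge> C" "C' \<ge> C * (1 + E)" using fD(1) by (auto simp: C'_def)
  obtain D where D: "D \<ge> 0"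
    "\<And>t (Y :: nat \<Rightarrow> 'a) A \<rho> k. grid T t \<Longrightarrow> \<rho> \<ge> 0 \<Longrightarrow> young_germ \<gamma> C' \<rho> t Y A \<Longrightarrow>
        norm (Y k) \<le> D * (norm (Y 0) + \<rho>)"
    "\<And>t (Y :: nat \<Rightarrow> 'a) A \<rho> j k. grid T t \<Longrightarrow> \<rho> \<ge> 0 \<Longrightarrow> young_germ \<gamma> C' \<rho> t Y A \<Longrightarrow> j \<le> k \<Longrightarrow>
        norm (Y k - Y j) \<le> D * (norm (Y 0) + \<rho>) * (t k - t j) powr \<gamma>"
    by (rule discrete_gronwall[OF \<gamma> C'(1) T]) blast
  have germ: "young_germ \<gamma> C' \<rho> t (\<lambda>k. X k - euler f t \<xi> k)
      (\<lambda>j k. incr f (t j) (t k) (X j) - incr f (t j) (t k) (euler f t \<xi> j) + (r k - r j))"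
    if g: "grid T t" and \<rho>: "\<rho> \<ge> 0"
      and X: "\<And>k. X (Suc k) = X k + incr f (t k) (t (Suc k)) (X k) + (r (Suc k) - r k)"
      and r: "\<And>j k. j \<le> k \<Longrightarrow> norm (r k - r j) \<le> \<rho> * (t k - t j) powr \<gamma>"
    for t \<xi> X r \<rho>
  proof -
    let ?X = "euler f t \<xi>"
    show ?thesis unfolding young_germ_def
    proof (intro conjI allI impI)
      fix k show "X (Suc k) - ?X (Suc k) - (X k - ?X k) =
         incr f (t k) (t (Suc k)) (X k) - incr f (t k) (t (Suc k)) (?X k) + (r (Suc k) - r k)" by (simp add: X)
    next
      fix j k :: nat assume jk: "j \<le> k"
      let ?s = "(t k - t j) powr \<gamma>"
      have "norm (incr f (t j) (t k) (X j) - incr f (t j) (t k) (?X j)) \<le> C * ?s * norm (X j - ?X j)"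
        using gridD[OF g] jk by (intro fD) auto
      also have "\<dots> \<le> C' * ?s * norm (X j - ?X j)" using C' by (intro mult_right_mono) auto
      finally have 1: "norm (incr f (t j) (t k) (X j) - incr f (t j) (t k) (?X j)) \<le> C' * ?s * norm (X j - ?X j)" .
      have "1 * \<rho> * ?s \<le> C' * \<rho> * ?s" using C' \<rho> by (intro mult_right_mono) auto
      then have 2: "norm (r k - r j) \<le> C' * \<rho> * ?s" using r[OF jk] by simp
      show "norm (incr f (t j) (t k) (X j) - incr f (t j) (t k) (?X j) + (r k - r j)) \<le> C' * ?s * (norm (X j - ?X j) + \<rho>)"
        by (rule order_trans[OF norm_triangle_mono[OF 1 2]]) (simp add: algebra_simps)
    next
      fix i j k :: nat assume ij: "i \<le> j" "j \<le> k"
      let ?I = "incr f (t j) (t k)" and ?s = "(t k - t j) powr \<gamma>"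
      let ?y = "\<lambda>j. X j - ?X j"
      have p: "norm (?X j - ?X i) * norm (?y i) \<le> E * (t j - t i) powr \<gamma> * (norm (?y i) + \<rho>)"
        using E ij g \<rho> by (intro mult_mono) auto
      have 1: "norm (?y j - ?y i) + norm (?X j - ?X i) * norm (?y i) \<le> (1 + E) * (norm (?y j - ?y i) + (t j - t i) powr \<gamma> * (norm (?y i) + \<rho>))"
      proof -
        have w: "0 \<le> (t j - t i) powr \<gamma> * (norm (?y i) + \<rho>)" using \<rho> by simp
        have "0 \<le> E * norm (?y j - ?y i)" using E(1) by simp
        then show ?thesis using p w
          unfolding mult.assoc[of E] distrib_right[of 1 E] mult_1_left
          by (simp only: distrib_left[of E])
      qed
      have "incr f (t i) (t k) (X i) - incr f (t i) (t k) (?X i) + (r k - r i)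
        - (incr f (t i) (t j) (X i) - incr f (t i) (t j) (?X i) + (r j - r i))
        - (incr f (t j) (t k) (X j) - incr f (t j) (t k) (?X j) + (r k - r j))
        = - ((?I (X j) - ?I (?X j)) - (?I (X i) - ?I (?X i)))"
        by (simp add: incr_split[of f "t i" "t k" _ "t j"])
      also have "norm \<dots> \<le> C * ?s * (norm (?y j - ?y i) + norm (?X j - ?X i) powr 1 * norm (?y i))"
        unfolding norm_minus_cancel using gridD[OF g] ij by (intro fD) auto
      also have "\<dots> \<le> C * ?s * ((1 + E) * (norm (?y j - ?y i) + (t j - t i) powr \<gamma> * (norm (?y i) + \<rho>)))"
        using 1 fD(1) by (intro mult_left_mono) auto
      also have "\<dots> = (C * (1 + E)) * (?s * (norm (?y j - ?y i) + (t j - t i) powr \<gamma> * (norm (?y i) + \<rho>)))" by simp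
      also have "\<dots> \<le> C' * (?s * (norm (?y j - ?y i) + (t j - t i) powr \<gamma> * (norm (?y i) + \<rho>)))"
        using C' \<rho> by (intro mult_right_mono) auto
      finally show "norm (incr f (t i) (t k) (X i) - incr f (t i) (t k) (?X i) + (r k - r i)
        - (incr f (t i) (t j) (X i) - incr f (t i) (t j) (?X i) + (r j - r i))
        - (incr f (t j) (t k) (X j) - incr f (t j) (t k) (?X j) + (r k - r j)))
        \<le> C' * ?s * (norm (?y j - ?y i) + (t j - t i) powr \<gamma> * (norm (?y i) + \<rho>))" by simp
    qed
  qed
  show ?thesis
  proof (rule that[OF D(1)])
    show "norm (X k - euler f t \<xi> k) \<le> D * (norm (X 0 - \<xi>) + \<rho>)"
      if "grid T t" "\<rho> \<ge> 0" "\<And>k. X (Suc k) = X k + incr f (t k) (t (Suc k)) (X k) + (r (Suc k) - r k)"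
      "\<And>j k. j \<le> k \<Longrightarrow> norm (r k - r j) \<le> \<rho> * (t k - t j) powr \<gamma>" for t \<xi> X r \<rho> k
      using D(2)[OF that(1,2) germ[OF that], of k \<xi>] by simp
    show "norm ((X k - euler f t \<xi> k) - (X j - euler f t \<xi> j)) \<le> D * (norm (X 0 - \<xi>) + \<rho>) * (t k - t j) powr \<gamma>"
      if "grid T t" "\<rho> \<ge> 0" "\<And>k. X (Suc k) = X k + incr f (t k) (t (Suc k)) (X k) + (r (Suc k) - r k)"
      "\<And>j k. j \<le> k \<Longrightarrow> norm (r k - r j) \<le> \<rho> * (t k - t j) powr \<gamma>" "j \<le> k" for t \<xi> X r \<rho> j k
      using D(3)[OF that(1,2) germ[OF that(1-4)] that(5), of \<xi>] by simp
  qed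
qed

section \<open>Davie solutions: stability, convergence of the Euler scheme, existence\<close>

definition davie_solution ::
    "real \<Rightarrow> real \<Rightarrow> (real \<Rightarrow> 'a::real_normed_vector \<Rightarrow> 'a) \<Rightarrow> 'a \<Rightarrow> (real \<Rightarrow> 'a) \<Rightarrow> bool" where
  "davie_solution \<gamma> T f \<xi> \<theta> \<longleftrightarrow> \<theta> 0 = \<xi> \<and>
     (\<exists>C\<ge>0. \<forall>s t. 0 \<le> s \<longrightarrow> s \<le> t \<longrightarrow> t \<le> T \<longrightarrow>
        norm (\<theta> t - \<theta> s - incr f s t (\<theta> s)) \<le> C * (t - s) powr (2 * \<gamma>))"

lemma davie_solutionE:
  assumes "davie_solution \<gamma> T f \<xi> \<theta>"
  obtains D where "D \<ge> 0" "\<And>s t. 0 \<le> s \<Longrightarrow> s \<le> t \<Longrightarrow> t \<le> T \<Longrightarrow> norm (\<theta> t - \<theta> s - incr f s t (\<theta> s)) \<le> D * (t - s) powr (2 * \<gamma>)"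
proof -
  note * = assms[unfolded davie_solution_def, THEN conjunct2]
  show ?thesis by (rule exE[OF *], elim conjE, rule that) blast+
qed

text \<open>A sequence with Davie's expansion over single steps is an Euler scheme perturbed by the
  sum \<open>r\<close> of its local errors. Of each error K * d powr (2 * \<gamma>) one power of d
  is kept for telescoping and the rest is bounded by h powr (2 * \<gamma> - 1). Writing a length s
  as s powr (1 - \<gamma>) * s powr \<gamma> makes \<open>r\<close> \<gamma>-Hoelder, as
  \<open>euler_stability\<close> requires.\<close>

lemma euler_davie_stability:
  fixes f :: "real \<Rightarrow> 'a::real_normed_vector \<Rightarrow> 'a"
  assumes \<gamma>: "\<gamma> > 1/2" "\<gamma> \<le> 1" and T: "T \<ge> 0" and f: "young_field \<gamma> 1 T C f"
  obtains D where "D \<ge> 0"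
    "\<And>t X K h k. grid T t \<Longrightarrow> K \<ge> 0 \<Longrightarrow> (\<And>k. t (Suc k) - t k \<le> h) \<Longrightarrow>
       (\<And>k. norm (X (Suc k) - X k - incr f (t k) (t (Suc k)) (X k)) \<le> K * (t (Suc k) - t k) powr (2 * \<gamma>)) \<Longrightarrow>
       norm (X k - euler f t (X 0) k) \<le> D * K * h powr (2 * \<gamma> - 1)"
proof -
  obtain D where D: "D \<ge> 0" 
    "\<And>t \<xi> X r \<rho> k. grid T t \<Longrightarrow> \<rho> \<ge> 0 \<Longrightarrow>
       (\<And>k. X (Suc k) = X k + incr f (t k) (t (Suc k)) (X k) + (r (Suc k) - r k)) \<Longrightarrow>
       (\<And>j k. j \<le> k \<Longrightarrow> norm (r k - r j) \<le> \<rho> * (t k - t j) powr \<gamma>) \<Longrightarrow>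
       norm (X k - euler f t \<xi> k) \<le> D * (norm (X 0 - \<xi>) + \<rho>)"
    by (rule euler_stability[OF \<gamma>(1) T f]) blast
  show ?thesis
  proof (rule that[of "D * T powr (1 - \<gamma>)"])
    show "D * T powr (1 - \<gamma>) \<ge> 0" using D by simp
    fix t X K h k
    assume g: "grid T t" and K: "(K::real) \<ge> 0" and h: "\<And>k. t (Suc k) - t k \<le> h"
      and X: "\<And>k. norm (X (Suc k) - X k - incr f (t k) (t (Suc k)) (X k)) \<le> K * (t (Suc k) - t k) powr (2 * \<gamma>)"
    define r where "r k = (\<Sum>i<k. X (Suc i) - X i - incr f (t i) (t (Suc i)) (X i))" for k
    define \<rho> where "\<rho> = K * h powr (2 * \<gamma> - 1) * T powr (1 - \<gamma>)"
    have \<rho>: "\<rho> \<ge> 0" using K by (simp add: \<rho>_def)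
    have one: "norm (X (Suc i) - X i - incr f (t i) (t (Suc i)) (X i)) \<le> K * h powr (2 * \<gamma> - 1) * (t (Suc i) - t i)" for i
    proof -
      let ?d = "t (Suc i) - t i"
      have d: "0 \<le> ?d" using gridD(4)[OF g, of i "Suc i"] by simp
      have "?d powr (2 * \<gamma>) = ?d powr (2 * \<gamma> - 1) * ?d"
        using d powr_add[of ?d "2 * \<gamma> - 1" 1] by (cases "?d = 0") auto
      also have "\<dots> \<le> h powr (2 * \<gamma> - 1) * ?d"
        using d h[of i] \<gamma> by (intro mult_right_mono powr_mono2) auto
      finally have "K * ?d powr (2 * \<gamma>) \<le> K * (h powr (2 * \<gamma> - 1) * ?d)" using K by (rule mult_left_mono)
      then show ?thesis using X[of i] by (simp add: mult.assoc)
    qed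
    have rb: "norm (r k - r j) \<le> \<rho> * (t k - t j) powr \<gamma>" if "j \<le> k" for j k
    proof -
      let ?s = "t k - t j"
      have s: "0 \<le> ?s" "?s \<le> T" using gridD(4)[OF g that] gridD(2)[OF g, of j] gridD(3)[OF g, of k] by auto
      have "r k - r j = (\<Sum>i=j..<k. X (Suc i) - X i - incr f (t i) (t (Suc i)) (X i))"
        unfolding r_def using sum.atLeastLessThan_concat[of 0 j k "\<lambda>i. X (Suc i) - X i - incr f (t i) (t (Suc i)) (X i)"] that
        by (simp add: atLeast0LessThan algebra_simps)
      also have "norm \<dots> \<le> (\<Sum>i=j..<k. K * h powr (2 * \<gamma> - 1) * (t (Suc i) - t i))"
        by (rule sum_norm_le) (rule one)
      also have "\<dots> = K * h powr (2 * \<gamma> - 1) * ?s"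
        using sum_Suc_diff'[OF that, of t] by (simp flip: sum_distrib_left)
      also have "?s = ?s powr (1 - \<gamma>) * ?s powr \<gamma>" using s by (cases "?s = 0") (auto simp flip: powr_add)
      also have "K * h powr (2 * \<gamma> - 1) * \<dots> \<le> K * h powr (2 * \<gamma> - 1) * (T powr (1 - \<gamma>) * ?s powr \<gamma>)"
        using K s \<gamma> by (intro mult_left_mono mult_right_mono powr_mono2) auto
      finally show ?thesis by (simp add: \<rho>_def mult.assoc)
    qed
    have "norm (X k - euler f t (X 0) k) \<le> D * (norm (X 0 - X 0) + \<rho>)"
      by (rule D(2)[OF g \<rho> _ rb]) (simp add: r_def)
    then show "norm (X k - euler f t (X 0) k) \<le> D * T powr (1 - \<gamma>) * K * h powr (2 * \<gamma> - 1)"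
      by (simp add: \<rho>_def algebra_simps)
  qed
qed

text \<open>The minimum freezes the grid after \<open>N\<close> steps, because \<open>grid\<close>
  speaks of infinite sequences.\<close>

definition ugrid :: "real \<Rightarrow> nat \<Rightarrow> nat \<Rightarrow> real" where
  "ugrid t N k = t * real (min k N) / real N"

lemma grid_ugrid:
  assumes "0 \<le> t" "t \<le> T"
  shows "grid T (ugrid t N)"
proof -
  have "0 \<le> ugrid t N k" "ugrid t N k \<le> t" for k
  proof -
    show "0 \<le> ugrid t N k" using assms by (simp add: ugrid_def)
    have "real (min k N) / real N \<le> 1" by (simp add: divide_le_eq)
    then show "ugrid t N k \<le> t" using mult_left_mono[of "real (min k N) / real N" 1 t] assms by (simp add: ugrid_def)
  qed
  moreover have "mono (ugrid t N)" unfolding ugrid_def using assms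
    by (intro monoI divide_right_mono mult_left_mono) auto
  ultimately show ?thesis using assms by (force simp: grid_def intro: order_trans)
qed

lemma ugrid_mesh:
  assumes "0 \<le> t" 
  shows "ugrid t N (Suc k) - ugrid t N k \<le> t / real N"
proof -
  have "real (min (Suc k) N) - real (min k N) \<le> 1" by simp
  then have "t * (real (min (Suc k) N) - real (min k N)) \<le> t * 1" using assms by (intro mult_left_mono) auto
  then have "t * (real (min (Suc k) N) - real (min k N)) / real N \<le> t / real N" by (intro divide_right_mono) auto
  then show ?thesis by (simp add: ugrid_def diff_divide_distrib algebra_simps)
qed

text \<open>Sampled on a uniform grid, the solution obeys the expansion over single steps, so the
  Euler scheme from the same point stays within a multiple of (t / N) powr (2 * \<gamma> - 1). The
  scheme does not involve \<theta>, and this is what uniqueness rests on.\<close>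

lemma davie_euler_limit:
  fixes f :: "real \<Rightarrow> 'a::real_normed_vector \<Rightarrow> 'a"
  assumes \<gamma>: "\<gamma> > 1/2" "\<gamma> \<le> 1" and f: "young_field \<gamma> 1 T C f"
    and sol: "davie_solution \<gamma> T f \<xi> \<theta>" and t: "0 \<le> t" "t \<le> T"
  shows "(\<lambda>N. euler f (ugrid t (Suc N)) \<xi> (Suc N)) \<longlonglongrightarrow> \<theta> t"
proof -
  have T: "T \<ge> 0" using t by simp
  obtain D where D: "D \<ge> 0"
    "\<And>t X K h k. grid T t \<Longrightarrow> K \<ge> 0 \<Longrightarrow> (\<And>k. t (Suc k) - t k \<le> h) \<Longrightarrow>
       (\<And>k. norm (X (Suc k) - X k - incr f (t k) (t (Suc k)) (X k)) \<le> K * (t (Suc k) - t k) powr (2 * \<gamma>)) \<Longrightarrow>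
       norm (X k - euler f t (X 0) k) \<le> D * K * h powr (2 * \<gamma> - 1)"
    by (rule euler_davie_stability[OF \<gamma> T f]) blast
  obtain K where K: "K \<ge> 0" "\<And>s t. 0 \<le> s \<Longrightarrow> s \<le> t \<Longrightarrow> t \<le> T \<Longrightarrow>
        norm (\<theta> t - \<theta> s - incr f s t (\<theta> s)) \<le> K * (t - s) powr (2 * \<gamma>)" and \<theta>0: "\<theta> 0 = \<xi>"
    using sol unfolding davie_solution_def by blast
  have b: "norm (euler f (ugrid t (Suc N)) \<xi> (Suc N) - \<theta> t) \<le> D * K * (t / real (Suc N)) powr (2 * \<gamma> - 1)" for N
  proof -
    let ?u = "ugrid t (Suc N)"
    have g: "grid T ?u" using t by (rule grid_ugrid)
    have "norm ((\<lambda>k. \<theta> (?u k)) (Suc N) - euler f ?u ((\<lambda>k. \<theta> (?u k)) 0) (Suc N)) \<le> D * K * (t / real (Suc N)) powr (2 * \<gamma> - 1)"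
    proof (rule D(2)[OF g K(1)])
      show "?u (Suc k) - ?u k \<le> t / real (Suc N)" for k by (rule ugrid_mesh[OF t(1)])
      show "norm (\<theta> (?u (Suc k)) - \<theta> (?u k) - incr f (?u k) (?u (Suc k)) (\<theta> (?u k))) \<le> K * (?u (Suc k) - ?u k) powr (2 * \<gamma>)" for k
        using gridD[OF g] by (intro K(2)) auto
    qed
    moreover have "?u (Suc N) = t" "?u 0 = 0" by (simp_all add: ugrid_def)
    ultimately show ?thesis by (simp add: \<theta>0 norm_minus_commute)
  qed
  have "(\<lambda>N. t / real (Suc N)) \<longlonglongrightarrow> 0" by (intro LIMSEQ_Suc lim_const_over_n)
  then have "(\<lambda>N. D * K * (t / real (Suc N)) powr (2 * \<gamma> - 1)) \<longlonglongrightarrow> D * K * 0 powr (2 * \<gamma> - 1)"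
    using \<gamma> t by (intro tendsto_intros tendsto_powr') auto
  then have "(\<lambda>N. D * K * (t / real (Suc N)) powr (2 * \<gamma> - 1)) \<longlonglongrightarrow> 0" by simp
  then have "(\<lambda>N. euler f (ugrid t (Suc N)) \<xi> (Suc N) - \<theta> t) \<longlonglongrightarrow> 0"
    by (rule Lim_null_comparison[rotated]) (use b in auto)
  then show ?thesis by (simp add: LIM_zero_iff)
qed

text \<open>Comparison of dyadic levels: the finer scheme, read only at the points of the coarser
  grid, satisfies Davie's expansion over coarse steps with the grid-independent constant
  \<open>E\<close>. Hence it lies within D * E * h m powr (2 * \<gamma> - 1) of the coarse scheme,
  and the levels form a Cauchy sequence at every time.\<close>

lemma davie_solution_exists:
  fixes f :: "real \<Rightarrow> 'a::banach \<Rightarrow> 'a"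
  assumes \<gamma>: "\<gamma> > 1/2" "\<gamma> \<le> 1" and T: "T > 0" and f: "young_field \<gamma> 1 T C f"
  shows "\<exists>\<theta>. davie_solution \<gamma> T f \<xi> \<theta>"
proof -
  note fD = young_fieldD[OF f]
  have T0: "T \<ge> 0" using T by simp
  obtain D where D: "D \<ge> 0"
    "\<And>t X K h k. grid T t \<Longrightarrow> K \<ge> 0 \<Longrightarrow> (\<And>k. t (Suc k) - t k \<le> h) \<Longrightarrow>
       (\<And>k. norm (X (Suc k) - X k - incr f (t k) (t (Suc k)) (X k)) \<le> K * (t (Suc k) - t k) powr (2 * \<gamma>)) \<Longrightarrow>
       norm (X k - euler f t (X 0) k) \<le> D * K * h powr (2 * \<gamma> - 1)"
    by (rule euler_davie_stability[OF \<gamma> T0 f]) blast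
  obtain E where E: "E \<ge> 0" 
    "\<And>t \<xi> j k. grid T t \<Longrightarrow> j \<le> k \<Longrightarrow> norm (euler f t \<xi> k - euler f t \<xi> j) \<le> E * (t k - t j) powr \<gamma>"
    "\<And>t \<xi> j k. grid T t \<Longrightarrow> j \<le> k \<Longrightarrow>
       norm (euler f t \<xi> k - euler f t \<xi> j - incr f (t j) (t k) (euler f t \<xi> j)) \<le> E * (t k - t j) powr (2 * \<gamma>)"
    by (rule euler_bounds[OF \<gamma>(1) T0 f]) blast
  define u where "u m = ugrid T (2 ^ m)" for m
  have g: "grid T (u m)" for m unfolding u_def using T by (intro grid_ugrid) auto
  define h where "h m = T / 2 ^ m" for m
  have h0: "h m > 0" for m using T by (simp add: h_def)
  have mesh: "u m (Suc k) - u m k \<le> h m" for m k using ugrid_mesh[OF T0, of "2 ^ m" k] by (simp add: u_def h_def)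
  \<comment> \<open>Index of the last point of the m-th dyadic grid not after \<open>t\<close>;
    between grid points the schemes are extended by their last value.\<close>
  define e where "e m t = nat \<lfloor>t * 2 ^ m / T\<rfloor>" for m t
  have e0: "e m 0 = 0" for m by (simp add: e_def)
  have ele: "real (e m t) \<le> t * 2 ^ m / T" "t * 2 ^ m / T < real (e m t) + 1" if "0 \<le> t" for m t
    using that T by (simp_all add: e_def)
  have e_le: "e m t \<le> 2 ^ m" if "0 \<le> t" "t \<le> T" for m t
  proof -
    have "real (e m t) \<le> t / T * 2 ^ m" using ele(1)[OF that(1), of m] by simp
    also have "\<dots> \<le> 1 * 2 ^ m" using that T by (intro mult_right_mono) auto
    finally have "real (e m t) \<le> real (2 ^ m)" by simp
    then show ?thesis by (simp only: of_nat_le_iff)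
  qed
  have e_mono: "e m s \<le> e m t" if "s \<le> t" for m s t
    using that T unfolding e_def by (intro nat_mono floor_mono divide_right_mono mult_right_mono) auto
  have ue: "u m (e m t) \<le> t" "t - h m \<le> u m (e m t)" if "0 \<le> t" "t \<le> T" for m t
  proof -
    have ueq: "u m (e m t) = T * real (e m t) / 2 ^ m" using e_le[OF that] by (simp add: u_def ugrid_def min_def)
    show "u m (e m t) \<le> t" unfolding ueq using ele(1)[OF that(1), of m] T by (simp add: field_simps)
    have "t \<le> (T * real (e m t) + T) / 2 ^ m" using ele(2)[OF that(1), of m] T by (simp add: field_simps)
    then show "t - h m \<le> u m (e m t)" unfolding ueq h_def by (simp add: add_divide_distrib)
  qed
  define X where "X m t = euler f (u m) \<xi> (e m t)" for m t
  have refine: "u (m + p) (k * 2 ^ p) = u m k" for m p k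
  proof -
    have "min (k * 2 ^ p) (2 ^ m * 2 ^ p) = min k (2 ^ m) * (2 ^ p :: nat)" by (simp add: min_def)
    then show ?thesis by (simp add: u_def ugrid_def power_add)
  qed
  have cauchy1: "norm (X (m + p) t - X m t) \<le> D * E * h m powr (2 * \<gamma> - 1) + E * h m powr \<gamma>"
    if t: "0 \<le> t" "t \<le> T" for m p t
  proof -
    let ?Z = "\<lambda>k. euler f (u (m + p)) \<xi> (k * 2 ^ p)"
    have 1: "norm (?Z k - euler f (u m) (?Z 0) k) \<le> D * E * h m powr (2 * \<gamma> - 1)" for k
    proof (rule D(2)[OF g E(1) mesh])
      show "norm (?Z (Suc k) - ?Z k - incr f (u m k) (u m (Suc k)) (?Z k)) \<le> E * (u m (Suc k) - u m k) powr (2 * \<gamma>)" for k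
        unfolding refine[symmetric, of m _ p] by (rule E(3)[OF g]) simp
    qed
    \<comment> \<open>The coarse grid point below \<open>t\<close> is also a point of the finer
      grid, so it cannot come after the fine grid point below \<open>t\<close>.\<close>
    have k: "e m t * 2 ^ p \<le> e (m + p) t"
    proof -
      have "real (e m t) * 2 ^ p \<le> t * 2 ^ m / T * 2 ^ p" using ele(1)[OF t(1)] by (intro mult_right_mono) auto
      also have "\<dots> < real (e (m + p) t) + 1" using ele(2)[OF t(1), of "m + p"] by (simp add: power_add)
      finally have "real (e m t * 2 ^ p) < real (e (m + p) t + 1)" by simp
      then show ?thesis unfolding of_nat_less_iff by simp
    qed
    have "u (m + p) (e (m + p) t) - u (m + p) (e m t * 2 ^ p) \<le> h m"
      unfolding refine using ue(1)[OF t, of "m + p"] ue(2)[OF t, of m] by linarith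
    then have "E * (u (m + p) (e (m + p) t) - u (m + p) (e m t * 2 ^ p)) powr \<gamma> \<le> E * h m powr \<gamma>"
      using gridD(4)[OF g k, of "m + p"] \<gamma> E(1) by (intro mult_left_mono powr_mono2) auto
    then have 2: "norm (X (m + p) t - ?Z (e m t)) \<le> E * h m powr \<gamma>"
      using E(2)[OF g k, of "m + p" \<xi>] by (simp add: X_def)
    have "norm (X (m + p) t - X m t) \<le> norm (X (m + p) t - ?Z (e m t)) + norm (?Z (e m t) - X m t)"
      using norm_triangle_ineq[of "X (m + p) t - ?Z (e m t)" "?Z (e m t) - X m t"] by simp
    then show ?thesis using 1[of "e m t"] 2 by (simp add: X_def)
  qed
  have h_lim: "h \<longlonglongrightarrow> 0" unfolding h_def by (rule LIMSEQ_divide_realpow_zero) simp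
  have "(\<lambda>m. D * E * h m powr (2 * \<gamma> - 1) + E * h m powr \<gamma>) \<longlonglongrightarrow> D * E * 0 powr (2 * \<gamma> - 1) + E * 0 powr \<gamma>"
    using \<gamma> h_lim h0 by (intro tendsto_intros tendsto_powr') (auto simp: less_imp_le)
  then have lim0: "(\<lambda>m. D * E * h m powr (2 * \<gamma> - 1) + E * h m powr \<gamma>) \<longlonglongrightarrow> 0" by simp
  have conv: "convergent (\<lambda>m. X m t)" if t: "0 \<le> t" "t \<le> T" for t
  proof -
    have "Cauchy (\<lambda>m. X m t)"
      unfolding Cauchy_altdef dist_norm
    proof (intro allI impI)
      fix r :: real assume "r > 0"
      then obtain M where M: "\<And>m. m \<ge> M \<Longrightarrow> \<bar>D * E * h m powr (2 * \<gamma> - 1) + E * h m powr \<gamma>\<bar> < r"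
        using LIMSEQ_D[OF lim0] by force
      have "norm (X m t - X n t) < r" if "m \<ge> M" "m < n" for m n
      proof -
        have "norm (X (m + (n - m)) t - X m t) < r" using cauchy1[OF t, of m "n - m"] M[OF that(1)] by linarith
        then show ?thesis using that by (simp add: norm_minus_commute)
      qed
      then show "\<exists>M. \<forall>m\<ge>M. \<forall>n>m. norm (X m t - X n t) < r" by blast
    qed
    then show ?thesis by (rule Cauchy_convergent)
  qed
  define \<theta> where "\<theta> t = lim (\<lambda>m. X m t)" for t
  have lim: "(\<lambda>m. X m t) \<longlonglongrightarrow> \<theta> t" if "0 \<le> t" "t \<le> T" for t
    using conv[OF that] by (simp add: \<theta>_def convergent_LIMSEQ_iff)
  have u_lim: "(\<lambda>m. u m (e m t)) \<longlonglongrightarrow> t" if "0 \<le> t" "t \<le> T" for t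
  proof (rule tendsto_sandwich[of "\<lambda>m. t - h m" _ _ "\<lambda>_. t"])
    have "(\<lambda>m. t - h m) \<longlonglongrightarrow> t - 0" by (intro tendsto_intros h_lim)
    then show "(\<lambda>m. t - h m) \<longlonglongrightarrow> t" by simp
  qed (use ue[OF that] in auto)
  show ?thesis
  proof (intro exI[of _ \<theta>], unfold davie_solution_def, intro conjI)
    have "(\<lambda>m. X m 0) \<longlonglongrightarrow> \<xi>" by (simp add: X_def e0)
    then show "\<theta> 0 = \<xi>" using lim[of 0] T0 LIMSEQ_unique by blast
    show "\<exists>C\<ge>0. \<forall>s t. 0 \<le> s \<longrightarrow> s \<le> t \<longrightarrow> t \<le> T \<longrightarrow>
        norm (\<theta> t - \<theta> s - incr f s t (\<theta> s)) \<le> C * (t - s) powr (2 * \<gamma>)"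
    proof (intro exI[of _ E] conjI allI impI)
      show "E \<ge> 0" by (rule E(1))
      fix s t assume st: "0 \<le> s" "s \<le> t" "t \<le> T"
      define v where "v m = u m (e m t)" for m
      define w where "w m = u m (e m s)" for m
      have s': "s \<le> T" and t': "0 \<le> t" using st by auto
      have wv: "0 \<le> w m" "w m \<le> v m" "v m \<le> t" "w m \<le> s" for m
        using gridD(2)[OF g] gridD(4)[OF g e_mono[OF st(2)]] ue(1)[OF t' st(3)] ue(1)[OF st(1) s']
        by (auto simp: v_def w_def)
      \<comment> \<open>The expansion is known between the grid times \<open>w m\<close> and
        \<open>v m\<close> only. Moving the increment of \<open>f\<close> to the true times costs
        the two Hoelder terms, which vanish with the mesh; the last term vanishes because
        \<open>X m s\<close> converges.\<close>
      have "norm (X m t - X m s - incr f s t (\<theta> s)) \<le> E * (v m - w m) powr (2 * \<gamma>)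
         + (C * (s - w m) powr \<gamma> + C * (t - v m) powr \<gamma> + C * (t - s) powr \<gamma> * norm (X m s - \<theta> s))" for m
      proof -
        have 1: "norm (X m t - X m s - incr f (w m) (v m) (X m s)) \<le> E * (v m - w m) powr (2 * \<gamma>)"
          using E(3)[OF g e_mono[OF st(2)]] by (simp add: X_def v_def w_def)
        have 2: "norm (incr f (w m) s (X m s)) \<le> C * (s - w m) powr \<gamma>" using wv st by (intro fD) auto
        have 3: "norm (incr f (v m) t (X m s)) \<le> C * (t - v m) powr \<gamma>" using wv st by (intro fD) (auto intro: order_trans)
        have 4: "norm (incr f s t (X m s) - incr f s t (\<theta> s)) \<le> C * (t - s) powr \<gamma> * norm (X m s - \<theta> s)"
          using st by (intro fD)
        have "X m t - X m s - incr f s t (\<theta> s) = (X m t - X m s - incr f (w m) (v m) (X m s))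
          + (incr f (w m) s (X m s) - incr f (v m) t (X m s) + (incr f s t (X m s) - incr f s t (\<theta> s)))"
          by (simp add: incr_def)
        also have "norm \<dots> \<le> norm (X m t - X m s - incr f (w m) (v m) (X m s)) + (norm (incr f (w m) s (X m s)) + norm (incr f (v m) t (X m s)) + norm (incr f s t (X m s) - incr f s t (\<theta> s)))"
          by (intro norm_triangle_mono norm_triangle_ineq4 order_refl)
        finally show ?thesis using 1 2 3 4 by linarith
      qed
      moreover have "(\<lambda>m. norm (X m t - X m s - incr f s t (\<theta> s))) \<longlonglongrightarrow> norm (\<theta> t - \<theta> s - incr f s t (\<theta> s))"
        by (intro tendsto_intros lim st s' t')
      moreover have "(\<lambda>m. E * (v m - w m) powr (2 * \<gamma>)
         + (C * (s - w m) powr \<gamma> + C * (t - v m) powr \<gamma> + C * (t - s) powr \<gamma> * norm (X m s - \<theta> s)))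
         \<longlonglongrightarrow> E * (t - s) powr (2 * \<gamma>) + (C * (s - s) powr \<gamma> + C * (t - t) powr \<gamma> + C * (t - s) powr \<gamma> * norm (\<theta> s - \<theta> s))"
        using \<gamma> wv unfolding v_def w_def
        by (intro tendsto_intros tendsto_powr' u_lim lim st s' t') auto
      ultimately show "norm (\<theta> t - \<theta> s - incr f s t (\<theta> s)) \<le> E * (t - s) powr (2 * \<gamma>)"
        using LIMSEQ_le[of _ _ _ "E * (t - s) powr (2 * \<gamma>)"] by auto
    qed
  qed
qed

section \<open>Davie solutions and non-linear Young integrals\<close>

lemma is_partition_ugrid:
  assumes "0 < t"
  shows "is_partition t (Suc N) (ugrid t (Suc N))"
  unfolding is_partition_def
proof (intro conjI allI impI)
  show "ugrid t (Suc N) 0 = 0" "ugrid t (Suc N) (Suc N) = t" by (simp_all add: ugrid_def)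
  fix j assume "j < Suc N"
  then show "ugrid t (Suc N) j < ugrid t (Suc N) (Suc j)"
    using assms unfolding ugrid_def by (intro divide_strict_right_mono mult_strict_left_mono) auto
qed

lemma fine_partition:
  assumes "0 \<le> t" "0 < \<delta>"
  obtains N p where "is_partition t N p" "\<And>j. j < N \<Longrightarrow> p (Suc j) - p j < \<delta>"
proof (cases "t = 0")
  case True
  then have "is_partition t 0 (\<lambda>_. 0)" by (simp add: is_partition_def)
  then show ?thesis using that by blast
next
  case False
  then have t: "0 < t" using assms by simp
  obtain N where N: "t / \<delta> < real (Suc N)" using reals_Archimedean2[of "t / \<delta>"] by (meson less_trans lessI of_nat_less_iff)
  then have "t / real (Suc N) < \<delta>" using assms(2) by (simp add: field_simps)
  then show ?thesis 
    using that[OF is_partition_ugrid[OF t, of N]] order.strict_trans1[OF ugrid_mesh[OF assms(1), of "Suc N"]] by blast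
qed

lemma is_partition_append:
  assumes p: "is_partition s M p" and q: "is_partition u N q"
  shows "is_partition (s + u) (M + N) (\<lambda>k. if k \<le> M then p k else s + q (k - M))"
  using p q unfolding is_partition_def
  by (auto simp: Suc_diff_le not_less_eq_eq le_Suc_eq) 

text \<open>Telescoping: the Riemann sum and \<theta> t - \<xi> differ by the sum of Davie's
  remainders over the partition, and each of these is small compared with the length of its interval
  because 2 * \<gamma> > 1.\<close>

lemma young_integral_of_davie:
  fixes f :: "real \<Rightarrow> 'a::real_normed_vector \<Rightarrow> 'a"
  assumes \<gamma>: "\<gamma> > 1/2" and sol: "davie_solution \<gamma> T f \<xi> \<theta>" and t: "0 \<le> t" "t \<le> T"
  shows "has_young_integral f \<theta> t (\<theta> t - \<xi>)"
  unfolding has_young_integral_def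
proof (intro allI impI)
  fix \<epsilon> :: real assume \<epsilon>: "\<epsilon> > 0"
  obtain C where C: "C \<ge> 0" "\<And>s t. 0 \<le> s \<Longrightarrow> s \<le> t \<Longrightarrow> t \<le> T \<Longrightarrow>
        norm (\<theta> t - \<theta> s - incr f s t (\<theta> s)) \<le> C * (t - s) powr (2 * \<gamma>)" and \<theta>0: "\<theta> 0 = \<xi>"
    using sol unfolding davie_solution_def by blast
  \<comment> \<open>Solves \<delta> powr (2 * \<gamma> - 1) * (C * t + 1) = \<epsilon>; the summand
    1 excludes division by zero and makes the final bound strict.\<close>
  define \<delta> where "\<delta> = (\<epsilon> / (C * t + 1)) powr (1 / (2 * \<gamma> - 1))"
  have Ct: "C * t + 1 > 0" using C t by (simp add: add_nonneg_pos)
  have \<delta>: "\<delta> > 0" using \<epsilon> Ct by (simp add: \<delta>_def)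
  have \<delta>p: "\<delta> powr (2 * \<gamma> - 1) = \<epsilon> / (C * t + 1)" using \<gamma> \<epsilon> Ct by (simp add: \<delta>_def powr_powr)
  show "\<exists>\<delta>>0. \<forall>N p. is_partition t N p \<and> (\<forall>j<N. p (Suc j) - p j < \<delta>) \<longrightarrow>
        norm ((\<Sum>j<N. f (p (Suc j)) (\<theta> (p j)) - f (p j) (\<theta> (p j))) - (\<theta> t - \<xi>)) < \<epsilon>"
  proof (intro exI[of _ \<delta>] conjI \<delta> allI impI, elim conjE)
    fix N p assume p: "is_partition t N p" and mesh: "\<forall>j<N. p (Suc j) - p j < \<delta>"
    have p0: "p 0 = 0" and pN: "p N = t" and ps: "\<And>j. j < N \<Longrightarrow> p j < p (Suc j)" using p by (auto simp: is_partition_def)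
    have mono: "p i \<le> p j" if "i \<le> j" "j \<le> N" for i j
      using that
    proof (induction rule: dec_induct)
      case (step n)
      then show ?case using ps[of n] by simp
    qed simp
    have one: "norm (\<theta> (p (Suc j)) - \<theta> (p j) - incr f (p j) (p (Suc j)) (\<theta> (p j))) \<le> \<epsilon> / (C * t + 1) * C * (p (Suc j) - p j)"
      if j: "j < N" for j
    proof -
      let ?d = "p (Suc j) - p j"
      have d: "0 < ?d" "?d \<le> \<delta>" using ps[OF j] mesh j by auto
      have "norm (\<theta> (p (Suc j)) - \<theta> (p j) - incr f (p j) (p (Suc j)) (\<theta> (p j))) \<le> C * ?d powr (2 * \<gamma>)"
        using ps[OF j] mono[of 0 j] mono[of "Suc j" N] j t p0 pN by (intro C) auto
      also have "?d powr (2 * \<gamma>) = ?d powr (2 * \<gamma> - 1) * ?d"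
        using d powr_add[of ?d "2 * \<gamma> - 1" 1] by auto
      also have "C * \<dots> \<le> C * (\<delta> powr (2 * \<gamma> - 1) * ?d)"
        using d \<gamma> C by (intro mult_left_mono mult_right_mono powr_mono2) auto
      finally show ?thesis unfolding \<delta>p by (simp only: mult_ac)
    qed
    have "\<theta> t - \<xi> = (\<Sum>j<N. \<theta> (p (Suc j)) - \<theta> (p j))" 
      using sum_lessThan_telescope[of "\<lambda>j. \<theta> (p j)" N] by (simp add: p0 pN \<theta>0)
    then have "norm ((\<Sum>j<N. f (p (Suc j)) (\<theta> (p j)) - f (p j) (\<theta> (p j))) - (\<theta> t - \<xi>))
      = norm (\<Sum>j<N. \<theta> (p (Suc j)) - \<theta> (p j) - incr f (p j) (p (Suc j)) (\<theta> (p j)))"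
      by (simp add: norm_minus_commute incr_def sum_subtractf)
    also have "\<dots> \<le> (\<Sum>j<N. \<epsilon> / (C * t + 1) * C * (p (Suc j) - p j))"
      by (rule sum_norm_le) (use one in auto)
    also have "\<dots> = \<epsilon> / (C * t + 1) * C * t"
      unfolding sum_distrib_left[symmetric] using sum_lessThan_telescope[of p N] by (simp add: p0 pN)
    also have "\<dots> < \<epsilon>" using \<epsilon> Ct by (simp add: field_simps)
    finally show "norm ((\<Sum>j<N. f (p (Suc j)) (\<theta> (p j)) - f (p j) (\<theta> (p j))) - (\<theta> t - \<xi>)) < \<epsilon>" .
  qed
qed

text \<open>Only integrals from 0 are given. A fine partition of [0, s] is therefore prolonged by a
  uniform one of [s, t]: both Riemann sums are close to their integrals, and their difference is a
  Riemann sum over [s, t]. Sewing compares that sum with the single increment, with a constant that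
  does not depend on the mesh, so the approximation error can be sent to 0.\<close>

lemma davie_of_young_solution:
  fixes f :: "real \<Rightarrow> 'a::real_normed_vector \<Rightarrow> 'a"
  assumes \<gamma>: "\<gamma> > 1/2" and T: "T \<ge> 0" and f: "young_field \<gamma> \<epsilon>' T C f"
    and \<theta>: "\<And>s t. 0 \<le> s \<Longrightarrow> s \<le> t \<Longrightarrow> t \<le> T \<Longrightarrow> norm (\<theta> t - \<theta> s) \<le> M * (t - s) powr \<gamma>"
    and sol: "\<And>t. 0 \<le> t \<Longrightarrow> t \<le> T \<Longrightarrow> has_young_integral f \<theta> t (\<theta> t - \<xi>)"
  shows "davie_solution \<gamma> T f \<xi> \<theta>"
proof -
  note fD = young_fieldD[OF f]
  define M' where "M' = max M 0"
  have M': "M' \<ge> 0" by (simp add: M'_def)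
  have \<theta>': "norm (\<theta> t - \<theta> s) \<le> M' * (t - s) powr \<gamma>" if "0 \<le> s" "s \<le> t" "t \<le> T" for s t
    by (rule order_trans[OF \<theta>[OF that]]) (auto simp: M'_def intro!: mult_right_mono)
  define c where "c = 2 / (1 - 2 powr (1 - 2 * \<gamma>)) * (C * M')"
  have "2 powr (1 - 2*\<gamma>) < 2 powr (0::real)" using \<gamma> by (intro powr_less_mono) auto
  then have c0: "c \<ge> 0" using M' fD(1) by (simp add: c_def)
  have main: "norm (\<theta> t - \<theta> s - incr f s t (\<theta> s)) \<le> c * (t - s) powr (2 * \<gamma>)" if st: "0 \<le> s" "s \<le> t" "t \<le> T" for s t
  proof (cases "s = t")
    case True then show ?thesis by (simp add: incr_def)
  next
    case False
    then have lt: "s < t" using st by simp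
    show ?thesis
    proof (rule field_le_epsilon)
      fix e :: real assume e: "e > 0"
      define S where "S N p = (\<Sum>j<N. f (p (Suc j)) (\<theta> (p j)) - f (p j) (\<theta> (p j)))" for N :: nat and p
      have "e / 2 > 0" using e by simp
      then obtain d1 where d1: "d1 > 0" "\<And>N p. is_partition s N p \<Longrightarrow> (\<And>j. j < N \<Longrightarrow> p (Suc j) - p j < d1) \<Longrightarrow> norm (S N p - (\<theta> s - \<xi>)) < e / 2"
        using sol[of s] order_trans[OF st(2,3)] st(1) unfolding has_young_integral_def S_def by blast
      obtain d2 where d2: "d2 > 0" "\<And>N p. is_partition t N p \<Longrightarrow> (\<And>j. j < N \<Longrightarrow> p (Suc j) - p j < d2) \<Longrightarrow> norm (S N p - (\<theta> t - \<xi>)) < e / 2"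
        using sol[of t] order_trans[OF st(1,2)] st(3) \<open>e / 2 > 0\<close> unfolding has_young_integral_def S_def by blast
      define d where "d = min d1 d2"
      have d: "d > 0" using d1 d2 by (simp add: d_def)
      obtain N1 p where p: "is_partition s N1 p" "\<And>j. j < N1 \<Longrightarrow> p (Suc j) - p j < d" by (rule fine_partition[OF st(1) d]) blast
      obtain N where "(t - s) / d < real (Suc N)" using reals_Archimedean2[of "(t - s) / d"] by (meson less_trans lessI of_nat_less_iff)
      then have N: "(t - s) / real (Suc N) < d" using d by (simp add: field_simps)
      define q where "q k = s + ugrid (t - s) (Suc N) k" for k
      have gu: "grid (t - s) (ugrid (t - s) (Suc N))" using lt by (intro grid_ugrid) auto
      have q: "mono q" "\<And>k. s \<le> q k" "\<And>k. q k \<le> t" "\<And>j k. j \<le> k \<Longrightarrow> q j \<le> q k"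
        using gridD[OF gu] by (auto simp: q_def mono_def le_diff_eq add.commute)
      have q0: "q 0 = s" "q (Suc N) = t" by (simp_all add: q_def ugrid_def)
      define pq where "pq k = (if k \<le> N1 then p k else s + ugrid (t - s) (Suc N) (k - N1))" for k
      have part: "is_partition t (N1 + Suc N) pq"
        using is_partition_append[OF p(1) is_partition_ugrid[of "t - s" N]] lt by (simp add: pq_def[abs_def])
      have pN1: "p N1 = s" using p(1) by (simp add: is_partition_def)
      have pq_q: "pq (N1 + j) = q j" for j by (cases "j = 0") (simp_all add: pq_def q_def pN1 ugrid_def)
      have pq_p: "pq j = p j" if "j \<le> N1" for j using that by (simp add: pq_def)
      have mesh: "pq (Suc j) - pq j < d" for j
      proof (cases "j < N1")
        case True then show ?thesis using p(2)[of j] pq_p by simp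
      next
        case False
        then obtain i where i: "j = N1 + i" by (metis le_Suc_ex not_less)
        have "pq (Suc j) - pq j = q (Suc i) - q i" using pq_q[of i] pq_q[of "Suc i"] i by simp
        also have "\<dots> \<le> (t - s) / real (Suc N)" using ugrid_mesh[of "t - s" "Suc N" i] lt by (simp add: q_def)
        finally show ?thesis using N by linarith
      qed
      have 1: "norm (S N1 p - (\<theta> s - \<xi>)) < e / 2" using p d by (intro d1(2)) (auto simp: d_def)
      have 2: "norm (S (N1 + Suc N) pq - (\<theta> t - \<xi>)) < e / 2" using mesh part by (intro d2(2)) (auto simp: d_def)
      define A where "A i k = incr f (q i) (q k) (\<theta> (q i))" for i k
      have Ssplit: "S (N1 + Suc N) pq = S N1 p + (\<Sum>i=0..<Suc N. A i (Suc i))"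
      proof -
        define F where "F j = f (pq (Suc j)) (\<theta> (pq j)) - f (pq j) (\<theta> (pq j))" for j
        have "S (N1 + Suc N) pq = sum F {0..<N1 + Suc N}" unfolding S_def F_def lessThan_atLeast0 ..
        also have "\<dots> = sum F {0..<N1} + sum F {N1..<N1 + Suc N}"
          by (rule sum.atLeastLessThan_concat[symmetric]) auto
        also have "sum F {0..<N1} = S N1 p" unfolding S_def lessThan_atLeast0 by (intro sum.cong) (auto simp: F_def pq_p)
        also have "sum F {N1..<N1 + Suc N} = (\<Sum>i=0..<Suc N. F (N1 + i))"
          using sum.shift_bounds_nat_ivl[of F 0 N1 "Suc N"] by (simp add: add.commute)
        also have "\<dots> = (\<Sum>i=0..<Suc N. A i (Suc i))"
        proof (intro sum.cong refl)
          fix i show "F (N1 + i) = A i (Suc i)" using pq_q[of i] pq_q[of "Suc i"] by (simp add: F_def A_def incr_def)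
        qed
        finally show ?thesis .
      qed
      have 3: "norm ((\<Sum>i=0..<Suc N. A i (Suc i)) - A 0 (Suc N)) \<le> 2 / (1 - 2 powr (1 - 2 * \<gamma>)) * (C * M') * (q (Suc N) - q 0) powr (2 * \<gamma>)"
      proof (rule discrete_sewing[OF q(1)])
        show "2 * \<gamma> > 1" "C * M' \<ge> 0" using \<gamma> M' fD(1) by auto
        show "A k k = 0" for k by (simp add: A_def incr_def)
        fix i j k :: nat assume ij: "i \<le> j" "j \<le> k"
        note qq = q(2)[of i] q(3)[of k] q(4)[OF ij(1)] q(4)[OF ij(2)]
        have "A i k - A i j - A j k = incr f (q j) (q k) (\<theta> (q i)) - incr f (q j) (q k) (\<theta> (q j))"
          unfolding A_def by (simp add: incr_split[of f "q i" "q k" _ "q j"])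
        also have "norm \<dots> \<le> C * (q k - q j) powr \<gamma> * norm (\<theta> (q i) - \<theta> (q j))"
          using qq st by (intro fD) auto
        also have "norm (\<theta> (q i) - \<theta> (q j)) = norm (\<theta> (q j) - \<theta> (q i))" by (rule norm_minus_commute)
        also have "C * (q k - q j) powr \<gamma> * \<dots> \<le> C * (q k - q j) powr \<gamma> * (M' * (q j - q i) powr \<gamma>)"
          using qq st fD(1) by (intro mult_left_mono \<theta>') auto
        also have "\<dots> = C * M' * ((q k - q j) powr \<gamma> * (q j - q i) powr \<gamma>)" by simp
        also have "\<dots> \<le> C * M' * (q k - q i) powr (2 * \<gamma>)"
          using qq \<gamma> fD(1) M' by (intro mult_left_mono powr_sewing) auto
        finally show "norm (A i k - A i j - A j k) \<le> C * M' * (q k - q i) powr (2 * \<gamma>)" .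
      qed auto
      then have 3: "norm ((\<Sum>i=0..<Suc N. A i (Suc i)) - incr f s t (\<theta> s)) \<le> c * (t - s) powr (2 * \<gamma>)"
        unfolding q0 c_def A_def .
      have "\<theta> t - \<theta> s - incr f s t (\<theta> s) = ((\<Sum>i=0..<Suc N. A i (Suc i)) - incr f s t (\<theta> s))
          + (S N1 p - (\<theta> s - \<xi>) - (S (N1 + Suc N) pq - (\<theta> t - \<xi>)))"
        unfolding Ssplit by (simp add: algebra_simps)
      also have "norm \<dots> \<le> norm ((\<Sum>i=0..<Suc N. A i (Suc i)) - incr f s t (\<theta> s)) + (norm (S N1 p - (\<theta> s - \<xi>)) + norm (S (N1 + Suc N) pq - (\<theta> t - \<xi>)))"
        by (rule norm_triangle_mono[OF order_refl norm_triangle_ineq4])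
      finally show "norm (\<theta> t - \<theta> s - incr f s t (\<theta> s)) \<le> c * (t - s) powr (2 * \<gamma>) + e" using 1 2 3 by linarith
    qed
  qed
  \<comment> \<open>Over [0, 0] the empty partition is admissible and has sum 0, so the value of the
    integral pins down the initial point.\<close>
  have "has_young_integral f \<theta> 0 (\<theta> 0 - \<xi>)" using sol[of 0] T by simp
  then have "norm (\<theta> 0 - \<xi>) < e" if "e > 0" for e
  proof -
    have "is_partition 0 0 (\<lambda>_. 0)" by (simp add: is_partition_def)
    with \<open>has_young_integral f \<theta> 0 (\<theta> 0 - \<xi>)\<close> that show ?thesis
      unfolding has_young_integral_def by (fastforce simp: norm_minus_commute)
  qed
  then have "norm (\<theta> 0 - \<xi>) = 0" by (metis norm_ge_zero less_irrefl less_eq_real_def)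
  then have "\<theta> 0 = \<xi>" by simp
  with main c0 show ?thesis unfolding davie_solution_def by blast
qed

section \<open>Discrete Young sums along Hoelder paths\<close>

definition holder_path :: "real \<Rightarrow> (nat \<Rightarrow> real) \<Rightarrow> real \<Rightarrow> (nat \<Rightarrow> 'v::real_normed_vector) \<Rightarrow> bool" where
  "holder_path \<gamma> t A p \<longleftrightarrow> (\<forall>k. norm (p k) \<le> A) \<and>
     (\<forall>j k. j \<le> k \<longrightarrow> norm (p k - p j) \<le> A * (t k - t j) powr \<gamma>)"

lemma holder_pathI:
  assumes "\<And>k. norm (p k) \<le> A" "\<And>j k. j \<le> k \<Longrightarrow> norm (p k - p j) \<le> A * (t k - t j) powr \<gamma>"
  shows "holder_path \<gamma> t A p"
  using assms by (simp add: holder_path_def)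

lemma holder_pathD:
  assumes "holder_path \<gamma> t A p"
  shows "\<And>k. norm (p k) \<le> A" "\<And>j k. j \<le> k \<Longrightarrow> norm (p k - p j) \<le> A * (t k - t j) powr \<gamma>" "A \<ge> 0"
proof -
  show "norm (p k) \<le> A" for k using assms by (simp add: holder_path_def)
  from this[of 0] show "A \<ge> 0" by (rule order_trans[OF norm_ge_zero])
qed (use assms in \<open>simp add: holder_path_def\<close>)

lemma holder_path_mono:
  assumes "holder_path \<gamma> t A p" "A \<le> B"
  shows "holder_path \<gamma> t B p"
proof (rule holder_pathI)
  show "norm (p k) \<le> B" for k using holder_pathD(1)[OF assms(1), of k] assms(2) by linarith
  show "norm (p k - p j) \<le> B * (t k - t j) powr \<gamma>" if "j \<le> k" for j k
    by (rule order_trans[OF holder_pathD(2)[OF assms(1) that] mult_right_mono[OF assms(2)]]) simp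
qed

lemma holder_path_add:
  assumes "holder_path \<gamma> t A p" "holder_path \<gamma> t B r"
  shows "holder_path \<gamma> t (A + B) (\<lambda>k. p k + r k)"
proof (rule holder_pathI)
  show "norm (p k + r k) \<le> A + B" for k by (intro norm_triangle_mono holder_pathD(1)[OF assms(1)] holder_pathD(1)[OF assms(2)])
  show "norm (p k + r k - (p j + r j)) \<le> (A + B) * (t k - t j) powr \<gamma>" if "j \<le> k" for j k
    unfolding add_diff_add distrib_right
    by (intro norm_triangle_mono holder_pathD(2)[OF assms(1)] holder_pathD(2)[OF assms(2)] that)
qed

lemma holder_path_sum:
  assumes "finite I" "\<And>i. i \<in> I \<Longrightarrow> holder_path \<gamma> t (A i) (p i)"
  shows "holder_path \<gamma> t (\<Sum>i\<in>I. A i) (\<lambda>k. \<Sum>i\<in>I. p i k)"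
  using assms
proof (induction I)
  case empty then show ?case by (simp add: holder_path_def)
next
  case (insert x F)
  then show ?case using holder_path_add by fastforce
qed

lemma holder_path_mult:
  fixes p r :: "nat \<Rightarrow> real"
  assumes p: "holder_path \<gamma> t A p" and r: "holder_path \<gamma> t B r"
  shows "holder_path \<gamma> t (2 * A * B) (\<lambda>k. p k * r k)"
proof (rule holder_pathI)
  note A = holder_pathD[OF p] and B = holder_pathD[OF r]
  have m: "norm (p k * r k') \<le> A * B" for k k' unfolding norm_mult using A B by (intro mult_mono) auto
  show "norm (p k * r k) \<le> 2 * A * B" for k using m[of k k] A(3) B(3) mult_nonneg_nonneg[of A B] by linarith
  fix j k :: nat assume jk: "j \<le> k"
  have 1: "norm (p k * (r k - r j)) \<le> A * (B * (t k - t j) powr \<gamma>)"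
    unfolding norm_mult using A B jk by (intro mult_mono) auto
  have 2: "norm ((p k - p j) * r j) \<le> A * (t k - t j) powr \<gamma> * B"
    unfolding norm_mult using A B jk by (intro mult_mono) auto
  have "p k * r k - p j * r j = p k * (r k - r j) + (p k - p j) * r j" by (simp add: algebra_simps)
  also have "norm \<dots> \<le> A * (B * (t k - t j) powr \<gamma>) + A * (t k - t j) powr \<gamma> * B"
    by (rule norm_triangle_mono[OF 1 2])
  also have "\<dots> = 2 * A * B * (t k - t j) powr \<gamma>" by simp
  finally show "norm (p k * r k - p j * r j) \<le> 2 * A * B * (t k - t j) powr \<gamma>" .
qed

text \<open>The first-order bound on the germ and sewing together control the increments of the
  sums; since the sums start at 0, a factor T powr \<gamma> turns this into a bound on their
  values.\<close>

lemma holder_path_sewing: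
  assumes \<gamma>: "\<gamma> > 1/2" and T: "T \<ge> 0"
  obtains K where "K \<ge> 0"
    "\<And>t (A :: nat \<Rightarrow> nat \<Rightarrow> 'v::real_normed_vector) B. grid T t \<Longrightarrow> B \<ge> 0 \<Longrightarrow>
      (\<And>j k. j \<le> k \<Longrightarrow> norm (A j k) \<le> B * (t k - t j) powr \<gamma>) \<Longrightarrow>
      (\<And>i j k. i \<le> j \<Longrightarrow> j \<le> k \<Longrightarrow> norm (A i k - A i j - A j k) \<le> B * ((t k - t j) powr \<gamma> * (t j - t i) powr \<gamma>)) \<Longrightarrow>
      holder_path \<gamma> t (K * B) (\<lambda>k. \<Sum>i<k. A i (Suc i))"
proof -
  define c where "c = 2 / (1 - 2 powr (1 - 2 * \<gamma>))"
  have "2 powr (1 - 2*\<gamma>) < 2 powr (0::real)" using \<gamma> by (intro powr_less_mono) auto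
  then have c0: "c \<ge> 0" by (simp add: c_def)
  define K where "K = (c * T powr \<gamma> + 1) * (T powr \<gamma> + 1)"
  show ?thesis
  proof (rule that[of K])
    show "K \<ge> 0" using c0 by (simp add: K_def)
    fix t and A :: "nat \<Rightarrow> nat \<Rightarrow> 'v" and B
    assume g: "grid T t" and B: "(B::real) \<ge> 0"
      and A: "\<And>j k. j \<le> k \<Longrightarrow> norm (A j k) \<le> B * (t k - t j) powr \<gamma>"
      and dA: "\<And>i j k. i \<le> j \<Longrightarrow> j \<le> k \<Longrightarrow> norm (A i k - A i j - A j k) \<le> B * ((t k - t j) powr \<gamma> * (t j - t i) powr \<gamma>)"
    define S where "S k = (\<Sum>i<k. A i (Suc i))" for k
    have T1: "(t k - t j) powr \<gamma> \<le> T powr \<gamma>" if "j \<le> k" for j k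
      using gridD(4)[OF g that] gridD(2)[OF g, of j] gridD(3)[OF g, of k] \<gamma> by (intro powr_mono2) auto
    have inc: "norm (S k - S j) \<le> (c * T powr \<gamma> + 1) * B * (t k - t j) powr \<gamma>" if jk: "j \<le> k" for j k
    proof -
      have Sd: "S k - S j = (\<Sum>i=j..<k. A i (Suc i))"
        unfolding S_def using sum.atLeastLessThan_concat[of 0 j k "\<lambda>i. A i (Suc i)"] jk
        by (simp add: atLeast0LessThan algebra_simps)
      have "norm ((\<Sum>i=j..<k. A i (Suc i)) - A j k) \<le> 2 / (1 - 2 powr (1 - 2 * \<gamma>)) * B * (t k - t j) powr (2 * \<gamma>)"
      proof (rule discrete_sewing[OF gridD(1)[OF g] _ B _ _ jk])
        show "2 * \<gamma> > 1" using \<gamma> by simp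
        show "A k k = 0" for k using A[of k k] by simp
        fix i j k :: nat assume ij: "i \<le> j" "j \<le> k"
        show "norm (A i k - A i j - A j k) \<le> B * (t k - t i) powr (2 * \<gamma>)"
          using gridD(4)[OF g] ij \<gamma> B by (intro order_trans[OF dA[OF ij]] mult_left_mono powr_sewing) auto
      qed
      also have "\<dots> = c * B * ((t k - t j) powr \<gamma> * (t k - t j) powr \<gamma>)" by (simp add: c_def flip: powr_add)
      also have "\<dots> \<le> c * B * (T powr \<gamma> * (t k - t j) powr \<gamma>)"
        using c0 B T1[OF jk] by (intro mult_left_mono mult_right_mono) auto
      finally have 1: "norm ((\<Sum>i=j..<k. A i (Suc i)) - A j k) \<le> c * B * (T powr \<gamma> * (t k - t j) powr \<gamma>)" .
      have "norm (S k - S j) \<le> norm ((\<Sum>i=j..<k. A i (Suc i)) - A j k) + norm (A j k)"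
        unfolding Sd by (metis diff_add_cancel norm_triangle_ineq)
      also have "\<dots> \<le> c * B * (T powr \<gamma> * (t k - t j) powr \<gamma>) + B * (t k - t j) powr \<gamma>"
        by (intro add_mono 1 A jk)
      finally show ?thesis by (simp add: algebra_simps)
    qed
    let ?c = "(c * T powr \<gamma> + 1) * B"
    have c': "?c \<ge> 0" using c0 B by simp
    have KB: "K * B = ?c * T powr \<gamma> + ?c" by (simp add: K_def algebra_simps)
    show "holder_path \<gamma> t (K * B) (\<lambda>k. \<Sum>i<k. A i (Suc i))"
      unfolding S_def[symmetric]
    proof (rule holder_pathI)
      fix k
      have "norm (S k) \<le> ?c * (t k - t 0) powr \<gamma>" using inc[of 0 k] by (simp add: S_def)
      also have "\<dots> \<le> ?c * T powr \<gamma>" by (intro mult_left_mono T1 c') simp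
      finally show "norm (S k) \<le> K * B" using c' unfolding KB by linarith
    next
      fix j k :: nat assume "j \<le> k"
      then have "norm (S k - S j) \<le> ?c * (t k - t j) powr \<gamma>" by (rule inc)
      also have "\<dots> \<le> K * B * (t k - t j) powr \<gamma>"
        unfolding KB using c' by (intro mult_right_mono) auto
      finally show "norm (S k - S j) \<le> K * B * (t k - t j) powr \<gamma>" .
    qed
  qed
qed

definition young_sum :: "(real \<Rightarrow> 'a \<Rightarrow> real) \<Rightarrow> (nat \<Rightarrow> real) \<Rightarrow> (nat \<Rightarrow> 'a) \<Rightarrow> (nat \<Rightarrow> real) \<Rightarrow> nat \<Rightarrow> real" where
  "young_sum f t x a k = (\<Sum>j<k. incr f (t j) (t (Suc j)) (x j) * a j)"

text \<open>The defect of the germ splits into a change of the evaluation point of \<open>f\<close>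
  and a change of the integrand, each \<gamma>-Hoelder in time.\<close>

lemma young_sum_bound:
  fixes f :: "real \<Rightarrow> 'a::real_normed_vector \<Rightarrow> real"
  assumes \<gamma>: "\<gamma> > 1/2" and T: "T \<ge> 0" and f: "young_field \<gamma> \<epsilon> T C f" and E: "E \<ge> 0"
  obtains K where "K \<ge> 0"
    "\<And>t (x :: nat \<Rightarrow> 'a) (a :: nat \<Rightarrow> real) A. grid T t \<Longrightarrow> (\<And>j k. j \<le> k \<Longrightarrow> norm (x k - x j) \<le> E * (t k - t j) powr \<gamma>) \<Longrightarrow>
      holder_path \<gamma> t A a \<Longrightarrow> holder_path \<gamma> t (K * A) (young_sum f t x a)"
proof -
  note fD = young_fieldD[OF f]
  obtain K where K: "K \<ge> 0"
    "\<And>t (A :: nat \<Rightarrow> nat \<Rightarrow> real) B. grid T t \<Longrightarrow> B \<ge> 0 \<Longrightarrow>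
      (\<And>j k. j \<le> k \<Longrightarrow> norm (A j k) \<le> B * (t k - t j) powr \<gamma>) \<Longrightarrow>
      (\<And>i j k. i \<le> j \<Longrightarrow> j \<le> k \<Longrightarrow> norm (A i k - A i j - A j k) \<le> B * ((t k - t j) powr \<gamma> * (t j - t i) powr \<gamma>)) \<Longrightarrow>
      holder_path \<gamma> t (K * B) (\<lambda>k. \<Sum>i<k. A i (Suc i))"
    by (rule holder_path_sewing[OF \<gamma> T]) blast
  show ?thesis
  proof (rule that[of "K * (C * (1 + E))"])
    show "0 \<le> K * (C * (1 + E))" using K(1) fD(1) E by simp
    fix t A and x :: "nat \<Rightarrow> 'a" and a :: "nat \<Rightarrow> real"
    assume g: "grid T t" and x: "\<And>j k. j \<le> k \<Longrightarrow> norm (x k - x j) \<le> E * (t k - t j) powr \<gamma>"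
      and a: "holder_path \<gamma> t A a"
    note aD = holder_pathD[OF a]
    have "holder_path \<gamma> t (K * (C * (1 + E) * A)) (\<lambda>k. \<Sum>j<k. incr f (t j) (t (Suc j)) (x j) * a j)"
    proof (rule K(2)[OF g])
      show "0 \<le> C * (1 + E) * A" using aD fD(1) E by simp
      fix j k :: nat assume jk: "j \<le> k"
      have "norm (incr f (t j) (t k) (x j) * a j) \<le> C * (t k - t j) powr \<gamma> * A"
        unfolding norm_mult using gridD[OF g] jk aD fD(1) by (intro mult_mono fD) auto
      also have "\<dots> = C * 1 * A * (t k - t j) powr \<gamma>" by simp
      also have "\<dots> \<le> C * (1 + E) * A * (t k - t j) powr \<gamma>"
        using E fD(1) aD by (intro mult_right_mono mult_left_mono) auto
      finally show "norm (incr f (t j) (t k) (x j) * a j) \<le> C * (1 + E) * A * (t k - t j) powr \<gamma>" .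
    next
      fix i j k :: nat assume ij: "i \<le> j" "j \<le> k"
      let ?I = "incr f (t j) (t k)"
      have 1: "norm ((?I (x i) - ?I (x j)) * a i) \<le> (C * (t k - t j) powr \<gamma> * (E * (t j - t i) powr \<gamma>)) * A"
        unfolding norm_mult
      proof (intro mult_mono aD)
        have "norm (?I (x i) - ?I (x j)) \<le> C * (t k - t j) powr \<gamma> * norm (x i - x j)"
          using gridD[OF g] ij by (intro fD) auto
        also have "\<dots> \<le> C * (t k - t j) powr \<gamma> * (E * (t j - t i) powr \<gamma>)"
          using x[OF ij(1)] fD(1) by (intro mult_left_mono) (auto simp: norm_minus_commute)
        finally show "norm (?I (x i) - ?I (x j)) \<le> C * (t k - t j) powr \<gamma> * (E * (t j - t i) powr \<gamma>)" .
      qed (use fD(1) E in auto)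
      have 2: "norm (?I (x j) * (a i - a j)) \<le> (C * (t k - t j) powr \<gamma>) * (A * (t j - t i) powr \<gamma>)"
        unfolding norm_mult using gridD[OF g] ij aD(2)[OF ij(1)] fD(1)
        by (intro mult_mono fD) (auto simp: norm_minus_commute)
      have "incr f (t i) (t k) (x i) * a i - incr f (t i) (t j) (x i) * a i - ?I (x j) * a j
         = (?I (x i) - ?I (x j)) * a i + ?I (x j) * (a i - a j)"
        by (simp add: incr_split[of f "t i" "t k" _ "t j"] algebra_simps)
      then show "norm (incr f (t i) (t k) (x i) * a i - incr f (t i) (t j) (x i) * a i - ?I (x j) * a j)
        \<le> C * (1 + E) * A * ((t k - t j) powr \<gamma> * (t j - t i) powr \<gamma>)"
        using order_trans[OF norm_triangle_ineq add_mono[OF 1 2]] by (simp add: algebra_simps)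
    qed
    then show "holder_path \<gamma> t (K * (C * (1 + E)) * A) (young_sum f t x a)"
      by (simp add: young_sum_def[abs_def] mult.assoc)
  qed
qed

lemma powr_le_powr_unit:
  fixes d :: real
  assumes "0 \<le> d" "d \<le> 1" "\<epsilon> \<le> 1" "0 < \<epsilon>"
  shows "d \<le> d powr \<epsilon>"
proof (cases "d = 0")
  case False
  then have "d powr 1 \<le> d powr \<epsilon>" using assms by (intro powr_mono') auto
  then show ?thesis using assms False by simp
qed simp

text \<open>Here \<epsilon> < 1 is harmless, because the four-point inequality is used with the
  roles of \<open>euler_stability\<close> exchanged: the base points are the two paths at one time,
  the displacements are increments in time. The factor norm (x i - x' i) powr \<epsilon> becomes d
  powr \<epsilon>, while the displacement keeps the full order \<gamma> in time. The condition d <=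
  1 lets terms linear in d be absorbed.\<close>

lemma young_sum_diff_bound:
  fixes f :: "real \<Rightarrow> 'a::real_normed_vector \<Rightarrow> real"
  assumes \<gamma>: "\<gamma> > 1/2" and T: "T \<ge> 0" and f: "young_field \<gamma> \<epsilon> T C f" and E: "E \<ge> 1" and \<epsilon>: "0 < \<epsilon>" "\<epsilon> \<le> 1"
  obtains K where "K \<ge> 0"
    "\<And>t (x :: nat \<Rightarrow> 'a) x' d (a :: nat \<Rightarrow> real) A. grid T t \<Longrightarrow> (\<And>j k. j \<le> k \<Longrightarrow> norm (x k - x j) \<le> E * (t k - t j) powr \<gamma>) \<Longrightarrow>
      (\<And>k. norm (x k - x' k) \<le> E * d) \<Longrightarrow> (\<And>j k. j \<le> k \<Longrightarrow> norm (x' k - x' j) \<le> E * (t k - t j) powr \<gamma>) \<Longrightarrow>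
      (\<And>j k. j \<le> k \<Longrightarrow> norm ((x k - x' k) - (x j - x' j)) \<le> E * d * (t k - t j) powr \<gamma>) \<Longrightarrow> 0 \<le> d \<Longrightarrow> d \<le> 1 \<Longrightarrow>
      holder_path \<gamma> t A a \<Longrightarrow> holder_path \<gamma> t (K * A * d powr \<epsilon>) (\<lambda>k. young_sum f t x a k - young_sum f t x' a k)"
proof -
  note fD = young_fieldD[OF f]
  obtain K where K: "K \<ge> 0"
    "\<And>t (A :: nat \<Rightarrow> nat \<Rightarrow> real) B. grid T t \<Longrightarrow> B \<ge> 0 \<Longrightarrow>
      (\<And>j k. j \<le> k \<Longrightarrow> norm (A j k) \<le> B * (t k - t j) powr \<gamma>) \<Longrightarrow>
      (\<And>i j k. i \<le> j \<Longrightarrow> j \<le> k \<Longrightarrow> norm (A i k - A i j - A j k) \<le> B * ((t k - t j) powr \<gamma> * (t j - t i) powr \<gamma>)) \<Longrightarrow>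
      holder_path \<gamma> t (K * B) (\<lambda>k. \<Sum>i<k. A i (Suc i))"
    by (rule holder_path_sewing[OF \<gamma> T]) blast
  \<comment> \<open>Three contributions of size C * E * E: two from the four-point inequality, one
    from the change of the integrand.\<close>
  let ?c = "C * (3 * (E * E))"
  have EE: "E \<le> E * E" using E by (simp add: mult_le_cancel_left1)
  show ?thesis
  proof (rule that[of "K * ?c"])
    show "0 \<le> K * ?c" using K(1) fD(1) E by simp
    fix t d A and x x' :: "nat \<Rightarrow> 'a" and a :: "nat \<Rightarrow> real"
    assume g: "grid T t" and x: "\<And>j k. j \<le> k \<Longrightarrow> norm (x k - x j) \<le> E * (t k - t j) powr \<gamma>"
      and xx: "\<And>k. norm (x k - x' k) \<le> E * d" and x': "\<And>j k. j \<le> k \<Longrightarrow> norm (x' k - x' j) \<le> E * (t k - t j) powr \<gamma>"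
      and dx: "\<And>j k. j \<le> k \<Longrightarrow> norm ((x k - x' k) - (x j - x' j)) \<le> E * d * (t k - t j) powr \<gamma>"
      and d: "0 \<le> d" "d \<le> 1"
      and a: "holder_path \<gamma> t A a"
    note aD = holder_pathD[OF a]
    let ?d = "d powr \<epsilon>"
    have dd: "d \<le> ?d" using d \<epsilon> by (intro powr_le_powr_unit) auto
    have Ed: "E * d \<le> E * E * ?d" using EE dd d E by (intro mult_mono) auto
    have "holder_path \<gamma> t (K * (?c * A * ?d)) (\<lambda>k. \<Sum>j<k. (incr f (t j) (t (Suc j)) (x j) - incr f (t j) (t (Suc j)) (x' j)) * a j)"
    proof (rule K(2)[OF g])
      show "0 \<le> ?c * A * ?d" using aD fD(1) E by simp
      have I: "norm (incr f (t j) (t k) (x i) - incr f (t j) (t k) (x' i)) \<le> C * (t k - t j) powr \<gamma> * (E * E * ?d)" if "j \<le> k" for i j k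
      proof -
        have "norm (incr f (t j) (t k) (x i) - incr f (t j) (t k) (x' i)) \<le> C * (t k - t j) powr \<gamma> * norm (x i - x' i)"
          using gridD[OF g] that by (intro fD) auto
        also have "\<dots> \<le> C * (t k - t j) powr \<gamma> * (E * E * ?d)"
          using order_trans[OF xx Ed] fD(1) by (intro mult_left_mono) auto
        finally show ?thesis .
      qed
      fix j k :: nat assume jk: "j \<le> k"
      have "norm ((incr f (t j) (t k) (x j) - incr f (t j) (t k) (x' j)) * a j) \<le> C * (t k - t j) powr \<gamma> * (E * E * ?d) * A"
        unfolding norm_mult using aD fD(1) E I[OF jk] by (intro mult_mono) auto
      also have "\<dots> = C * (1 * (E * E)) * A * ?d * (t k - t j) powr \<gamma>" by simp
      also have "\<dots> \<le> ?c * A * ?d * (t k - t j) powr \<gamma>"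
        using E fD(1) aD by (intro mult_right_mono mult_left_mono) auto
      finally show "norm ((incr f (t j) (t k) (x j) - incr f (t j) (t k) (x' j)) * a j) \<le> ?c * A * ?d * (t k - t j) powr \<gamma>" .
    next
      fix i j k :: nat assume ij: "i \<le> j" "j \<le> k"
      let ?I = "incr f (t j) (t k)" and ?u = "(t k - t j) powr \<gamma>" and ?v = "(t j - t i) powr \<gamma>"
      have 1: "norm (((?I (x j) - ?I (x i)) - (?I (x' j) - ?I (x' i))) * a j) \<le> (C * ?u * (2 * (E * E) * ?d * ?v)) * A"
        unfolding norm_mult
      proof (intro mult_mono aD)
        have "norm ((?I (x j) - ?I (x i)) - (?I (x' j) - ?I (x' i))) \<le> C * ?u * (norm ((x j - x i) - (x' j - x' i)) + norm (x i - x' i) powr \<epsilon> * norm (x' j - x' i))"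
          using gridD[OF g] ij by (intro fD) auto
        also have "\<dots> \<le> C * ?u * (E * E * ?d * ?v + E * ?d * (E * ?v))"
        proof (intro mult_left_mono add_mono mult_mono)
          have "norm ((x j - x i) - (x' j - x' i)) \<le> E * d * ?v" using dx[OF ij(1)] by (simp add: algebra_simps)
          also have "\<dots> \<le> E * E * ?d * ?v" using Ed by (intro mult_right_mono) auto
          finally show "norm ((x j - x i) - (x' j - x' i)) \<le> E * E * ?d * ?v" .
          have "norm (x i - x' i) powr \<epsilon> \<le> (E * d) powr \<epsilon>" using \<epsilon> xx by (intro powr_mono2) auto
          also have "\<dots> = E powr \<epsilon> * ?d" using E d by (simp add: powr_mult)
          also have "\<dots> \<le> E powr 1 * ?d" using E \<epsilon> by (intro mult_right_mono powr_mono) auto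
          finally show "norm (x i - x' i) powr \<epsilon> \<le> E * ?d" using E by simp
          show "norm (x' j - x' i) \<le> E * ?v" by (rule x'[OF ij(1)])
        qed (use fD(1) E in auto)
        finally show "norm ((?I (x j) - ?I (x i)) - (?I (x' j) - ?I (x' i))) \<le> C * ?u * (2 * (E * E) * ?d * ?v)"
          by (simp add: algebra_simps)
      qed (use fD(1) E in auto)
      have 2: "norm ((?I (x i) - ?I (x' i)) * (a i - a j)) \<le> C * ?u * (E * E * ?d) * (A * ?v)"
        unfolding norm_mult
      proof (intro mult_mono)
        show "norm (?I (x i) - ?I (x' i)) \<le> C * ?u * (E * E * ?d)"
        proof -
          have "norm (?I (x i) - ?I (x' i)) \<le> C * ?u * norm (x i - x' i)"
            using gridD[OF g] ij by (intro fD) auto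
          also have "\<dots> \<le> C * ?u * (E * E * ?d)" using order_trans[OF xx Ed] fD(1) by (intro mult_left_mono) auto
          finally show ?thesis .
        qed
        show "norm (a i - a j) \<le> A * ?v" using aD(2)[OF ij(1)] by (simp add: norm_minus_commute)
      qed (use fD(1) E in auto)
      have "(incr f (t i) (t k) (x i) - incr f (t i) (t k) (x' i)) * a i - (incr f (t i) (t j) (x i) - incr f (t i) (t j) (x' i)) * a i - (?I (x j) - ?I (x' j)) * a j
         = - (((?I (x j) - ?I (x i)) - (?I (x' j) - ?I (x' i))) * a j) + (?I (x i) - ?I (x' i)) * (a i - a j)"
        by (simp add: incr_split[of f "t i" "t k" _ "t j"] algebra_simps)
      then have "norm ((incr f (t i) (t k) (x i) - incr f (t i) (t k) (x' i)) * a i - (incr f (t i) (t j) (x i) - incr f (t i) (t j) (x' i)) * a i - (?I (x j) - ?I (x' j)) * a j)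
        \<le> (C * ?u * (2 * (E * E) * ?d * ?v)) * A + C * ?u * (E * E * ?d) * (A * ?v)"
        using 1 2 by (metis (no_types, lifting) norm_minus_cancel norm_triangle_mono)
      then show "norm ((incr f (t i) (t k) (x i) - incr f (t i) (t k) (x' i)) * a i - (incr f (t i) (t j) (x i) - incr f (t i) (t j) (x' i)) * a i - (?I (x j) - ?I (x' j)) * a j)
        \<le> ?c * A * ?d * (?u * ?v)" by (simp add: algebra_simps)
    qed
    then show "holder_path \<gamma> t (K * ?c * A * ?d) (\<lambda>k. young_sum f t x a k - young_sum f t x' a k)"
      by (simp add: young_sum_def[abs_def] mult.assoc algebra_simps sum_subtractf)
  qed
qed

section \<open>Derivatives of the Euler flow\<close>

lemma young_field_mono:
  assumes "young_field \<gamma> \<epsilon> T C f" "C \<le> C'"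
  shows "young_field \<gamma> \<epsilon> T C' f"
  unfolding young_field_def
proof (intro conjI ballI allI)
  show "0 \<le> C'" using assms by (simp add: young_field_def)
  have *: "C * r \<le> C' * r" if "r \<ge> 0" for r using assms(2) that by (rule mult_right_mono)
  fix s t assume st: "s \<in> {0..T}" "t \<in> {0..T}"
  fix x x' y y'
  show "norm (incr f s t x) \<le> C' * \<bar>t - s\<bar> powr \<gamma>"
    using assms(1) st unfolding young_field_def by (intro order_trans[OF _ *]) auto
  show "norm (incr f s t x - incr f s t y) \<le> C' * \<bar>t - s\<bar> powr \<gamma> * norm (x - y)"
    unfolding mult.assoc using assms(1) st unfolding young_field_def by (intro order_trans[OF _ *]) (auto simp: mult.assoc)
  show "norm ((incr f s t x' - incr f s t x) - (incr f s t y' - incr f s t y))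
     \<le> C' * \<bar>t - s\<bar> powr \<gamma> * (norm ((x' - x) - (y' - y)) + norm (x - y) powr \<epsilon> * norm (y' - y))"
    unfolding mult.assoc using assms(1) st unfolding young_field_def by (intro order_trans[OF _ *]) (auto simp: mult.assoc)
qed

lemma norm_vec_le:
  fixes v :: "real^'d"
  assumes "\<And>i. \<bar>v $ i\<bar> \<le> B"
  shows "norm v \<le> real CARD('d) * B"
proof -
  have "norm v \<le> (\<Sum>i\<in>UNIV. \<bar>v $ i\<bar>)" by (rule norm_le_l1_cart)
  also have "\<dots> \<le> (\<Sum>i\<in>(UNIV::'d set). B)" by (intro sum_mono assms)
  finally show ?thesis by simp
qed

lemma abs_sum_le_card:
  fixes f :: "'d::finite \<Rightarrow> real"
  assumes "\<And>i. \<bar>f i\<bar> \<le> B"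
  shows "\<bar>\<Sum>i\<in>UNIV. f i\<bar> \<le> real CARD('d) * B"
  using sum_norm_le[of UNIV f "\<lambda>_. B"] assms by simp

text \<open>Collected into a vector, the unknowns form a Young germ with \<rho> = H: the increments
  of \<open>h\<close> are the inhomogeneity and the sums against \<open>B\<close> the linear part.
  At step 0 the sums are empty, so each initial component is bounded by \<open>H\<close> as well.
  The factors CARD('d) come from the sum over \<open>e\<close> and from passing from components to
  the norm.\<close>

lemma linear_young_bound:
  fixes B :: "'d::finite \<Rightarrow> 'd \<Rightarrow> real \<Rightarrow> 'a::real_normed_vector \<Rightarrow> real"
  assumes \<gamma>: "\<gamma> > 1/2" and T: "T \<ge> 0" and B: "\<And>l e. young_field \<gamma> \<epsilon> T C (B l e)" and E: "E \<ge> 0"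
  obtains K where "K \<ge> 0"
    "\<And>t (x :: nat \<Rightarrow> 'a) y h H l. grid T t \<Longrightarrow> (\<And>j k. j \<le> k \<Longrightarrow> norm (x k - x j) \<le> E * (t k - t j) powr \<gamma>) \<Longrightarrow>
      (\<And>l. holder_path \<gamma> t H (h l)) \<Longrightarrow>
      (\<And>l k. y l k = h l k + (\<Sum>e\<in>UNIV. young_sum (B l e) t x (y e) k)) \<Longrightarrow> holder_path \<gamma> t (K * H) (y l)"
proof -
  note BD = young_fieldD[OF B]
  define n where "n = real CARD('d)"
  have n: "n \<ge> 1" by (simp add: n_def Suc_leI)
  define C' where "C' = n * (n * (C * (1 + E)) + 1)"
  have CE: "0 \<le> n * (C * (1 + E))" using n BD(1) E by simp
  have C': "C' > 0" using n CE by (simp add: C'_def add_nonneg_pos)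
  obtain D where D: "D \<ge> 0"
    "\<And>t (Y :: nat \<Rightarrow> real^'d) A \<rho> k. grid T t \<Longrightarrow> \<rho> \<ge> 0 \<Longrightarrow> young_germ \<gamma> C' \<rho> t Y A \<Longrightarrow>
        norm (Y k) \<le> D * (norm (Y 0) + \<rho>)"
    "\<And>t (Y :: nat \<Rightarrow> real^'d) A \<rho> j k. grid T t \<Longrightarrow> \<rho> \<ge> 0 \<Longrightarrow> young_germ \<gamma> C' \<rho> t Y A \<Longrightarrow> j \<le> k \<Longrightarrow>
        norm (Y k - Y j) \<le> D * (norm (Y 0) + \<rho>) * (t k - t j) powr \<gamma>"
    by (rule discrete_gronwall[OF \<gamma> C' T]) blast
  show ?thesis
  proof (rule that[of "D * (n + 1)"])
    show "D * (n + 1) \<ge> 0" using D(1) n by simp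
    fix t H l and x :: "nat \<Rightarrow> 'a" and y h
    assume g: "grid T t" and x: "\<And>j k. j \<le> k \<Longrightarrow> norm (x k - x j) \<le> E * (t k - t j) powr \<gamma>"
      and h: "\<And>l::'d. holder_path \<gamma> t H (h l)"
      and y: "\<And>l k. y l k = h l k + (\<Sum>e\<in>UNIV. young_sum (B l e) t x (y e) k)"
    note hD = holder_pathD[OF h]
    define Y where "Y k = (\<chi> l. y l k)" for k
    define A where "A j k = (\<chi> l. h l k - h l j + (\<Sum>e\<in>UNIV. incr (B l e) (t j) (t k) (x j) * y e j))" for j k
    have yY: "\<bar>y l j\<bar> \<le> norm (Y j)" for l j using component_le_norm_cart[of "Y j" l] by (simp add: Y_def)
    have dyY: "\<bar>y l k - y l j\<bar> \<le> norm (Y k - Y j)" for l j k using component_le_norm_cart[of "Y k - Y j" l] by (simp add: Y_def)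
    have "young_germ \<gamma> C' H t Y A"
      unfolding young_germ_def
    proof (intro conjI allI impI)
      fix k show "Y (Suc k) - Y k = A k (Suc k)"
      proof (rule vec_eq_iff[THEN iffD2], rule allI)
        fix l
        show "(Y (Suc k) - Y k) $ l = A k (Suc k) $ l"
          unfolding Y_def A_def using y[of l k] y[of l "Suc k"] by (simp add: young_sum_def sum.distrib)
      qed
    next
      fix j k :: nat assume jk: "j \<le> k"
      let ?s = "(t k - t j) powr \<gamma>"
      have "\<bar>A j k $ l\<bar> \<le> ((n * (C * (1 + E)) + 1) * (?s * (norm (Y j) + H)))" for l
      proof -
        have 1: "\<bar>h l k - h l j\<bar> \<le> H * ?s" using hD(2)[OF jk, of l] by simp
        have 2: "\<bar>\<Sum>e\<in>UNIV. incr (B l e) (t j) (t k) (x j) * y e j\<bar> \<le> n * (C * ?s * norm (Y j))"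
          unfolding n_def
        proof (rule abs_sum_le_card)
          fix e show "\<bar>incr (B l e) (t j) (t k) (x j) * y e j\<bar> \<le> C * ?s * norm (Y j)"
            unfolding abs_mult using gridD[OF g] jk BD(1) yY BD(2)[of "t j" "t k" l e "x j"] by (intro mult_mono) auto
        qed
        have "\<bar>A j k $ l\<bar> \<le> H * ?s + n * (C * ?s * norm (Y j))" unfolding A_def using 1 2 by simp
        also have "\<dots> = H * ?s + (n * (C * 1)) * (?s * norm (Y j))" by simp
        also have "\<dots> \<le> (n * (C * (1 + E)) + 1) * (H * ?s) + (n * (C * (1 + E)) + 1) * (?s * norm (Y j))"
        proof (intro add_mono)
          show "H * ?s \<le> (n * (C * (1 + E)) + 1) * (H * ?s)"
            using CE hD(3) by (simp add: mult_le_cancel_right1 distrib_right)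
          have "n * (C * 1) \<le> n * (C * (1 + E))" using n BD(1) E by (intro mult_left_mono) auto
          then show "n * (C * 1) * (?s * norm (Y j)) \<le> (n * (C * (1 + E)) + 1) * (?s * norm (Y j))"
            by (intro mult_right_mono) auto
        qed
        finally show ?thesis by (simp add: algebra_simps)
      qed
      from norm_vec_le[OF this]
      show "norm (A j k) \<le> C' * ?s * (norm (Y j) + H)" by (simp add: C'_def n_def mult.assoc)
    next
      fix i j k :: nat assume ij: "i \<le> j" "j \<le> k"
      let ?s = "(t k - t j) powr \<gamma>" and ?r = "(t j - t i) powr \<gamma>"
      let ?W = "norm (Y j - Y i) + ?r * (norm (Y i) + H)"
      have "\<bar>(A i k - A i j - A j k) $ l\<bar> \<le> ((n * (C * (1 + E)) + 1) * (?s * ?W))" for l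
      proof -
        have "(A i k - A i j - A j k) $ l = (\<Sum>e\<in>UNIV. incr (B l e) (t j) (t k) (x i) * y e i - incr (B l e) (t j) (t k) (x j) * y e j)"
          unfolding A_def by (simp add: incr_split[of "B l _" "t i" "t k" _ "t j"] sum_subtractf distrib_right sum.distrib)
        also have "\<bar>\<dots>\<bar> \<le> n * (C * (1 + E) * (?s * ?W))"
          unfolding n_def
        proof (rule abs_sum_le_card)
          fix e
          let ?I = "incr (B l e) (t j) (t k)"
          have 1: "\<bar>(?I (x i) - ?I (x j)) * y e i\<bar> \<le> (C * ?s * (E * ?r)) * norm (Y i)"
            unfolding abs_mult
          proof (intro mult_mono yY)
            have "\<bar>?I (x i) - ?I (x j)\<bar> \<le> C * ?s * norm (x i - x j)"
              using gridD[OF g] ij BD(3)[of "t j" "t k" l e "x i" "x j"] by auto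
            also have "\<dots> \<le> C * ?s * (E * ?r)"
              using x[OF ij(1)] BD(1) by (intro mult_left_mono) (auto simp: norm_minus_commute)
            finally show "\<bar>?I (x i) - ?I (x j)\<bar> \<le> C * ?s * (E * ?r)" .
          qed (use BD(1) E in auto)
          have 2: "\<bar>?I (x j) * (y e i - y e j)\<bar> \<le> (C * ?s) * norm (Y j - Y i)"
            unfolding abs_mult using gridD[OF g] ij BD(1) BD(2)[of "t j" "t k" l e "x j"] dyY[of e i j]
            by (intro mult_mono) (auto simp: norm_minus_commute)
          have "?I (x i) * y e i - ?I (x j) * y e j = (?I (x i) - ?I (x j)) * y e i + ?I (x j) * (y e i - y e j)"
            by (simp add: algebra_simps)
          then have "\<bar>?I (x i) * y e i - ?I (x j) * y e j\<bar> \<le> (C * ?s * (E * ?r)) * norm (Y i) + (C * ?s) * norm (Y j - Y i)"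
            using 1 2 by linarith
          also have "\<dots> = C * ?s * (E * (?r * norm (Y i)) + 1 * norm (Y j - Y i))" by (simp add: algebra_simps)
          also have "\<dots> \<le> C * ?s * ((1 + E) * (?r * (norm (Y i) + H)) + (1 + E) * norm (Y j - Y i))"
            using BD(1) E hD(3) by (intro mult_left_mono add_mono mult_mono) auto
          finally show "\<bar>?I (x i) * y e i - ?I (x j) * y e j\<bar> \<le> C * (1 + E) * (?s * ?W)" by (simp add: algebra_simps)
        qed
        also have "\<dots> = (n * (C * (1 + E)) + 0) * (?s * ?W)" by simp
        also have "\<dots> \<le> (n * (C * (1 + E)) + 1) * (?s * ?W)"
          using hD(3) by (intro mult_right_mono) auto
        finally show ?thesis .
      qed
      from norm_vec_le[OF this]
      show "norm (A i k - A i j - A j k) \<le> C' * ?s * ?W" by (simp add: C'_def n_def mult.assoc)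
    qed
    note germ = D(2,3)[OF g hD(3) this]
    have "norm (Y 0) \<le> n * H" unfolding n_def
    proof (rule norm_vec_le)
      fix l show "\<bar>Y 0 $ l\<bar> \<le> H" using hD(1)[of l 0] y[of l 0] by (simp add: Y_def young_sum_def)
    qed
    then have DH: "D * (norm (Y 0) + H) \<le> D * (n + 1) * H"
      unfolding mult.assoc using D(1) by (intro mult_left_mono) (simp_all add: algebra_simps)
    show "holder_path \<gamma> t (D * (n + 1) * H) (y l)"
    proof (rule holder_pathI)
      show "norm (y l k) \<le> D * (n + 1) * H" for k using yY[of l k] germ(1)[of k] DH by simp
      fix j k :: nat assume jk: "j \<le> k"
      have "D * (norm (Y 0) + H) * (t k - t j) powr \<gamma> \<le> D * (n + 1) * H * (t k - t j) powr \<gamma>"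
        using DH by (intro mult_right_mono) auto
      then show "norm (y l k - y l j) \<le> D * (n + 1) * H * (t k - t j) powr \<gamma>"
        using dyY[of l k j] germ(2)[OF jk] by simp
    qed
  qed
qed

text \<open>The gradient is a family of scalars indexed by coordinates. Its members are again scalar
  functions of the point, so recursion over the order of differentiation stays within one
  type.\<close>

definition has_grad :: "(real^'d \<Rightarrow> real) \<Rightarrow> ('d \<Rightarrow> real) \<Rightarrow> real^'d \<Rightarrow> bool" where
  "has_grad F g x \<longleftrightarrow> (F has_derivative (\<lambda>v. \<Sum>i\<in>UNIV. v $ i * g i)) (at x)"

lemma has_grad_unique:
  assumes "has_grad F g x" "has_grad F h x"
  shows "g = h"
proof
  fix i
  have "(\<lambda>v::real^'a. \<Sum>i\<in>UNIV. v $ i * g i) = (\<lambda>v. \<Sum>i\<in>UNIV. v $ i * h i)"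
    using assms unfolding has_grad_def by (rule has_derivative_unique)
  from fun_cong[OF this, of "axis i 1"] show "g i = h i"
    by (simp add: axis_def if_distrib[of "\<lambda>x. x * _"] cong: if_cong)
qed

lemma has_grad_const: "has_grad (\<lambda>_. c) (\<lambda>_. 0) x"
  by (simp add: has_grad_def)

lemma has_grad_add:
  assumes "has_grad F g x" "has_grad G h x"
  shows "has_grad (\<lambda>x. F x + G x) (\<lambda>i. g i + h i) x"
  using has_derivative_add[OF assms[unfolded has_grad_def]]
  by (simp add: has_grad_def distrib_left sum.distrib)

lemma has_grad_diff:
  assumes "has_grad F g x" "has_grad G h x"
  shows "has_grad (\<lambda>x. F x - G x) (\<lambda>i. g i - h i) x"
  using has_derivative_diff[OF assms[unfolded has_grad_def]]
  by (simp add: has_grad_def right_diff_distrib sum_subtractf)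

lemma has_grad_mult:
  assumes "has_grad F g x" "has_grad G h x"
  shows "has_grad (\<lambda>x. F x * G x) (\<lambda>i. g i * G x + F x * h i) x"
  using has_derivative_mult[OF assms[unfolded has_grad_def]]
  by (simp add: has_grad_def distrib_left sum.distrib sum_distrib_left sum_distrib_right algebra_simps)

lemma has_grad_sum:
  assumes "finite I" "\<And>j. j \<in> I \<Longrightarrow> has_grad (F j) (g j) x"
  shows "has_grad (\<lambda>x. \<Sum>j\<in>I. F j x) (\<lambda>i. \<Sum>j\<in>I. g j i) x"
  using assms
proof (induction I)
  case empty then show ?case by (simp add: has_grad_const)
next
  case (insert j I) then show ?case using has_grad_add by fastforce
qed

lemma has_grad_chain:
  fixes X :: "real^'d \<Rightarrow> real^'d"
  assumes f: "has_grad f g (X x)" and X: "\<And>l. has_grad (\<lambda>x. X x $ l) (\<lambda>i. J i l) x"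
  shows "has_grad (\<lambda>x. f (X x)) (\<lambda>i. \<Sum>l\<in>UNIV. g l * J i l) x"
proof -
  have "(X has_derivative (\<lambda>v. \<chi> l. \<Sum>i\<in>UNIV. v $ i * J i l)) (at x)"
  proof (rule has_derivative_componentwise_within[THEN iffD2], rule ballI)
    fix b :: "real^'d" assume "b \<in> Basis"
    then obtain l where b: "b = axis l 1" by (auto simp: Basis_vec_def)
    show "((\<lambda>x. X x \<bullet> b) has_derivative (\<lambda>v. (\<chi> l. \<Sum>i\<in>UNIV. v $ i * J i l) \<bullet> b)) (at x)"
      using X[of l] by (simp add: b inner_axis has_grad_def)
  qed
  from has_derivative_compose[OF this f[unfolded has_grad_def]]
  have "((\<lambda>x. f (X x)) has_derivative (\<lambda>v. \<Sum>l\<in>UNIV. (\<Sum>i\<in>UNIV. v $ i * J i l) * g l)) (at x)" by simp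
  also have "(\<lambda>v. \<Sum>l\<in>UNIV. (\<Sum>i\<in>UNIV. v $ i * J i l) * g l) = (\<lambda>v::real^'d. \<Sum>i\<in>UNIV. v $ i * (\<Sum>l\<in>UNIV. g l * J i l))"
    unfolding sum_distrib_left sum_distrib_right by (subst sum.swap) (simp add: mult_ac)
  finally show ?thesis by (simp add: has_grad_def)
qed

text \<open>\<open>smooth_field n\<close> means class \<open>C^(n + 1 + \<epsilon>)\<close> in space.\<close>

primrec smooth_field :: "real \<Rightarrow> real \<Rightarrow> real \<Rightarrow> nat \<Rightarrow> (real \<Rightarrow> real^'d \<Rightarrow> real) \<Rightarrow> bool" where
  "smooth_field \<gamma> \<epsilon> T 0 f = (\<exists>C. young_field \<gamma> \<epsilon> T C f)"
| "smooth_field \<gamma> \<epsilon> T (Suc n) f = ((\<exists>C. young_field \<gamma> \<epsilon> T C f) \<and>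
     (\<exists>g. (\<forall>t\<in>{0..T}. \<forall>x. has_grad (f t) (\<lambda>i. g i t x) x) \<and> (\<forall>i. smooth_field \<gamma> \<epsilon> T n (g i))))"

text \<open>Bounds uniform over the grids \<open>m\<close>: a path bound along the steps
  \<open>k\<close>, and a modulus of order \<epsilon> in the initial point that is measured on whole
  paths. The restriction to distances up to 1 lets terms linear in the distance be dominated by its
  power \<epsilon>.\<close>

definition holder_family :: "real \<Rightarrow> real \<Rightarrow> (nat \<Rightarrow> nat \<Rightarrow> real) \<Rightarrow> (nat \<Rightarrow> nat \<Rightarrow> real^'d \<Rightarrow> real) \<Rightarrow> bool" where
  "holder_family \<gamma> \<epsilon> q a \<longleftrightarrow> (\<exists>A. \<forall>m x. holder_path \<gamma> (q m) A (\<lambda>k. a m k x) \<and>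
     (\<forall>x'. norm (x - x') \<le> 1 \<longrightarrow> holder_path \<gamma> (q m) (A * norm (x - x') powr \<epsilon>) (\<lambda>k. a m k x - a m k x')))"

primrec smooth_family :: "real \<Rightarrow> real \<Rightarrow> (nat \<Rightarrow> nat \<Rightarrow> real) \<Rightarrow> nat \<Rightarrow> (nat \<Rightarrow> nat \<Rightarrow> real^'d \<Rightarrow> real) \<Rightarrow> bool" where
  "smooth_family \<gamma> \<epsilon> q 0 a = holder_family \<gamma> \<epsilon> q a"
| "smooth_family \<gamma> \<epsilon> q (Suc n) a = (holder_family \<gamma> \<epsilon> q a \<and>
     (\<exists>a'. (\<forall>m k x. has_grad (a m k) (\<lambda>i. a' i m k x) x) \<and> (\<forall>i. smooth_family \<gamma> \<epsilon> q n (a' i))))"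

lemma smooth_family_holder: "smooth_family \<gamma> \<epsilon> q n a \<Longrightarrow> holder_family \<gamma> \<epsilon> q a"
  by (cases n) auto

lemma smooth_field_young: "smooth_field \<gamma> \<epsilon> T n f \<Longrightarrow> \<exists>C. young_field \<gamma> \<epsilon> T C f"
  by (cases n) auto

lemma smooth_family_Suc_le: "smooth_family \<gamma> \<epsilon> q (Suc n) a \<Longrightarrow> smooth_family \<gamma> \<epsilon> q n a"
proof (induction n arbitrary: a)
  case (Suc n)
  then show ?case by (metis smooth_family.simps(2))
qed simp

lemma smooth_field_Suc_le: "smooth_field \<gamma> \<epsilon> T (Suc n) f \<Longrightarrow> smooth_field \<gamma> \<epsilon> T n f"
proof (induction n arbitrary: f)
  case (Suc n)
  then show ?case by (metis smooth_field.simps(2))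
qed simp

lemma smooth_field_le: "m \<le> n \<Longrightarrow> smooth_field \<gamma> \<epsilon> T n f \<Longrightarrow> smooth_field \<gamma> \<epsilon> T m f"
  by (induction rule: dec_induct) (auto dest: smooth_field_Suc_le simp del: smooth_field.simps)

lemma holder_family_add:
  assumes "holder_family \<gamma> \<epsilon> q a" "holder_family \<gamma> \<epsilon> q b"
  shows "holder_family \<gamma> \<epsilon> q (\<lambda>m k x. a m k x + b m k x)"
proof -
  obtain A where A: "\<And>m x. holder_path \<gamma> (q m) A (\<lambda>k. a m k x)"
    "\<And>m x x'. norm (x - x') \<le> 1 \<Longrightarrow> holder_path \<gamma> (q m) (A * norm (x - x') powr \<epsilon>) (\<lambda>k. a m k x - a m k x')"
    using assms(1) unfolding holder_family_def by blast
  obtain B where B: "\<And>m x. holder_path \<gamma> (q m) B (\<lambda>k. b m k x)"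
    "\<And>m x x'. norm (x - x') \<le> 1 \<Longrightarrow> holder_path \<gamma> (q m) (B * norm (x - x') powr \<epsilon>) (\<lambda>k. b m k x - b m k x')"
    using assms(2) unfolding holder_family_def by blast
  show ?thesis unfolding holder_family_def
  proof (intro exI[of _ "A + B"] allI conjI impI)
    show "holder_path \<gamma> (q m) (A + B) (\<lambda>k. a m k x + b m k x)" for m x by (rule holder_path_add[OF A(1) B(1)])
    show "holder_path \<gamma> (q m) ((A + B) * norm (x - x') powr \<epsilon>) (\<lambda>k. a m k x + b m k x - (a m k x' + b m k x'))"
      if "norm (x - x') \<le> 1" for m x x'
      unfolding add_diff_add distrib_right by (rule holder_path_add[OF A(2)[OF that] B(2)[OF that]])
  qed
qed

lemma holder_family_const: "holder_family \<gamma> \<epsilon> q (\<lambda>m k x. c)"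
  unfolding holder_family_def holder_path_def by (intro exI[of _ "\<bar>c\<bar>"]) auto

lemma holder_family_mult:
  assumes "holder_family \<gamma> \<epsilon> q a" "holder_family \<gamma> \<epsilon> q b"
  shows "holder_family \<gamma> \<epsilon> q (\<lambda>m k x. a m k x * b m k x)"
proof -
  obtain A where A: "\<And>m x. holder_path \<gamma> (q m) A (\<lambda>k. a m k x)"
    "\<And>m x x'. norm (x - x') \<le> 1 \<Longrightarrow> holder_path \<gamma> (q m) (A * norm (x - x') powr \<epsilon>) (\<lambda>k. a m k x - a m k x')"
    using assms(1) unfolding holder_family_def by blast
  obtain B where B: "\<And>m x. holder_path \<gamma> (q m) B (\<lambda>k. b m k x)"
    "\<And>m x x'. norm (x - x') \<le> 1 \<Longrightarrow> holder_path \<gamma> (q m) (B * norm (x - x') powr \<epsilon>) (\<lambda>k. b m k x - b m k x')"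
    using assms(2) unfolding holder_family_def by blast
  have AB: "A \<ge> 0" "B \<ge> 0" using holder_pathD(3)[OF A(1)] holder_pathD(3)[OF B(1)] by auto
  show ?thesis unfolding holder_family_def
  \<comment> \<open>The product rule splits the difference into two products, and
    \<open>holder_path_mult\<close> costs a factor 2 for each.\<close>
  proof (intro exI[of _ "4 * A * B"] allI conjI impI)
    show "holder_path \<gamma> (q m) (4 * A * B) (\<lambda>k. a m k x * b m k x)" for m x
      by (rule holder_path_mono[OF holder_path_mult[OF A(1) B(1)]]) (use AB in simp)
    fix m and x x' :: "real^'a" assume xx: "norm (x - x') \<le> 1"
    have "holder_path \<gamma> (q m) (2 * A * (B * norm (x - x') powr \<epsilon>) + 2 * (A * norm (x - x') powr \<epsilon>) * B)
       (\<lambda>k. a m k x * (b m k x - b m k x') + (a m k x - a m k x') * b m k x')"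
      by (intro holder_path_add holder_path_mult A(1) B(1) A(2)[OF xx] B(2)[OF xx])
    then show "holder_path \<gamma> (q m) (4 * A * B * norm (x - x') powr \<epsilon>) (\<lambda>k. a m k x * b m k x - a m k x' * b m k x')"
      by (simp add: algebra_simps)
  qed
qed

lemma smooth_family_const: "smooth_family \<gamma> \<epsilon> q n (\<lambda>m k x. c)"
proof (induction n arbitrary: c)
  case (Suc n)
  have "has_grad (\<lambda>x. c) (\<lambda>i. 0) x" for x :: "real^'a" by (rule has_grad_const)
  with Suc holder_family_const show ?case by fastforce
qed (simp add: holder_family_const)

lemma smooth_family_add:
  "smooth_family \<gamma> \<epsilon> q n a \<Longrightarrow> smooth_family \<gamma> \<epsilon> q n b \<Longrightarrow> smooth_family \<gamma> \<epsilon> q n (\<lambda>m k x. a m k x + b m k x)"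
proof (induction n arbitrary: a b)
  case 0 then show ?case by (simp add: holder_family_add)
next
  case (Suc n)
  obtain a' where a': "\<And>m k x. has_grad (a m k) (\<lambda>i. a' i m k x) x" "\<And>i. smooth_family \<gamma> \<epsilon> q n (a' i)" using Suc.prems(1) by auto
  obtain b' where b': "\<And>m k x. has_grad (b m k) (\<lambda>i. b' i m k x) x" "\<And>i. smooth_family \<gamma> \<epsilon> q n (b' i)" using Suc.prems(2) by auto
  show ?case unfolding smooth_family.simps
  proof (intro conjI exI[of _ "\<lambda>i m k x. a' i m k x + b' i m k x"] allI)
    show "holder_family \<gamma> \<epsilon> q (\<lambda>m k x. a m k x + b m k x)" using Suc.prems by (intro holder_family_add) auto
  qed (intro has_grad_add a' b' Suc.IH)+
qed

lemma smooth_family_sum: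
  assumes "finite I" "\<And>j. j \<in> I \<Longrightarrow> smooth_family \<gamma> \<epsilon> q n (a j)"
  shows "smooth_family \<gamma> \<epsilon> q n (\<lambda>m k x. \<Sum>j\<in>I. a j m k x)"
  using assms
proof (induction I)
  case empty then show ?case by (simp add: smooth_family_const del: smooth_family.simps)
next
  case (insert j I)
  have "smooth_family \<gamma> \<epsilon> q n (\<lambda>m k x. a j m k x + (\<Sum>j\<in>I. a j m k x))"
    using insert by (intro smooth_family_add) auto
  then show ?case using insert by (simp del: smooth_family.simps)
qed

lemma smooth_family_mult:
  "smooth_family \<gamma> \<epsilon> q n a \<Longrightarrow> smooth_family \<gamma> \<epsilon> q n b \<Longrightarrow> smooth_family \<gamma> \<epsilon> q n (\<lambda>m k x. a m k x * b m k x)"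
proof (induction n arbitrary: a b)
  case 0 then show ?case by (simp add: holder_family_mult)
next
  case (Suc n)
  obtain a' where a': "\<And>m k x. has_grad (a m k) (\<lambda>i. a' i m k x) x" "\<And>i. smooth_family \<gamma> \<epsilon> q n (a' i)" using Suc.prems(1) by auto
  obtain b' where b': "\<And>m k x. has_grad (b m k) (\<lambda>i. b' i m k x) x" "\<And>i. smooth_family \<gamma> \<epsilon> q n (b' i)" using Suc.prems(2) by auto
  show ?case unfolding smooth_family.simps
  proof (intro conjI exI[of _ "\<lambda>i m k x. a' i m k x * b m k x + a m k x * b' i m k x"] allI)
    show "holder_family \<gamma> \<epsilon> q (\<lambda>m k x. a m k x * b m k x)" using Suc.prems by (intro holder_family_mult) auto
    show "smooth_family \<gamma> \<epsilon> q n (\<lambda>m k x. a' i m k x * b m k x + a m k x * b' i m k x)" for i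
      by (rule smooth_family_add[OF Suc.IH[OF a'(2) smooth_family_Suc_le[OF Suc.prems(2)]]
            Suc.IH[OF smooth_family_Suc_le[OF Suc.prems(1)] b'(2)]])
  qed (intro has_grad_mult a' b')
qed

text \<open>The recursion of the Euler scheme differentiated formally: \<open>i\<close> is the
  coordinate of the initial point, \<open>l\<close> the component of the position, and
  \<open>g l e\<close> stands for the partial derivative of component \<open>l\<close> in direction
  \<open>e\<close>.\<close>

primrec euler_jac ::
    "('d::finite \<Rightarrow> 'd \<Rightarrow> real \<Rightarrow> 'a \<Rightarrow> real) \<Rightarrow> (nat \<Rightarrow> real) \<Rightarrow> (nat \<Rightarrow> 'a) \<Rightarrow> nat \<Rightarrow> 'd \<Rightarrow> 'd \<Rightarrow> real" where
  "euler_jac g t x 0 = (\<lambda>i l. if i = l then 1 else 0)"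
| "euler_jac g t x (Suc k) = (\<lambda>i l. euler_jac g t x k i l
     + (\<Sum>e\<in>UNIV. incr (g l e) (t k) (t (Suc k)) (x k) * euler_jac g t x k i e))"

lemma euler_jac_eq:
  "euler_jac g t x k i l = (if i = l then 1 else 0) + (\<Sum>e\<in>UNIV. young_sum (g l e) t x (\<lambda>k. euler_jac g t x k i e) k)"
  by (induction k arbitrary: l) (auto simp: young_sum_def sum.distrib)

lemma incr_has_grad:
  assumes "has_grad (f s) (\<lambda>i. g i s x) x" "has_grad (f t) (\<lambda>i. g i t x) x"
  shows "has_grad (incr f s t) (\<lambda>i. incr (g i) s t x) x"
  using has_grad_diff[OF assms(2,1)] by (simp add: incr_def[abs_def])

section \<open>The Euler flow over a sequence of grids\<close>

locale euler_family =
  fixes \<gamma> \<epsilon> T C :: real and \<Gamma> :: "real \<Rightarrow> real^'d \<Rightarrow> real^'d" and q :: "nat \<Rightarrow> nat \<Rightarrow> real"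
  assumes \<gamma>: "\<gamma> > 1/2" and T: "T \<ge> 0" and \<epsilon>: "0 < \<epsilon>" "\<epsilon> \<le> 1"
    and \<Gamma>1: "young_field \<gamma> 1 T C \<Gamma>" and q: "\<And>m. grid T (q m)"
begin

definition X :: "nat \<Rightarrow> nat \<Rightarrow> real^'d \<Rightarrow> real^'d" where
  "X m k \<xi> = euler \<Gamma> (q m) \<xi> k"

lemma X_bounds:
  obtains E where "E \<ge> 1"
    "\<And>m j k \<xi>. j \<le> k \<Longrightarrow> norm (X m k \<xi> - X m j \<xi>) \<le> E * (q m k - q m j) powr \<gamma>"
    "\<And>m k \<xi> \<xi>'. norm (X m k \<xi> - X m k \<xi>') \<le> E * norm (\<xi> - \<xi>')"
    "\<And>m j k \<xi> \<xi>'. j \<le> k \<Longrightarrow> norm ((X m k \<xi> - X m k \<xi>') - (X m j \<xi> - X m j \<xi>')) \<le> E * norm (\<xi> - \<xi>') * (q m k - q m j) powr \<gamma>"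
proof -
  obtain D where D: "D \<ge> 0"
    "\<And>t \<xi> j k. grid T t \<Longrightarrow> j \<le> k \<Longrightarrow> norm (euler \<Gamma> t \<xi> k - euler \<Gamma> t \<xi> j) \<le> D * (t k - t j) powr \<gamma>"
    by (rule euler_bounds[OF \<gamma> T \<Gamma>1]) blast
  obtain S where S: "S \<ge> 0"
    "\<And>t \<xi> X r \<rho> k. grid T t \<Longrightarrow> \<rho> \<ge> 0 \<Longrightarrow>
       (\<And>k. X (Suc k) = X k + incr \<Gamma> (t k) (t (Suc k)) (X k) + (r (Suc k) - r k)) \<Longrightarrow>
       (\<And>j k. j \<le> k \<Longrightarrow> norm (r k - r j) \<le> \<rho> * (t k - t j) powr \<gamma>) \<Longrightarrow>
       norm (X k - euler \<Gamma> t \<xi> k) \<le> S * (norm (X 0 - \<xi>) + \<rho>)"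
    "\<And>t \<xi> X r \<rho> j k. grid T t \<Longrightarrow> \<rho> \<ge> 0 \<Longrightarrow>
       (\<And>k. X (Suc k) = X k + incr \<Gamma> (t k) (t (Suc k)) (X k) + (r (Suc k) - r k)) \<Longrightarrow>
       (\<And>j k. j \<le> k \<Longrightarrow> norm (r k - r j) \<le> \<rho> * (t k - t j) powr \<gamma>) \<Longrightarrow> j \<le> k \<Longrightarrow>
       norm ((X k - euler \<Gamma> t \<xi> k) - (X j - euler \<Gamma> t \<xi> j)) \<le> S * (norm (X 0 - \<xi>) + \<rho>) * (t k - t j) powr \<gamma>"
    by (rule euler_stability[OF \<gamma> T \<Gamma>1]) blast
  have st: "X m (Suc k) \<xi> = X m k \<xi> + incr \<Gamma> (q m k) (q m (Suc k)) (X m k \<xi>) + (0 - 0)" for m k \<xi>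
    by (simp add: X_def)
  define E where "E = D + S + 1"
  have E: "E \<ge> 1" "D \<le> E" "S \<le> E" using D(1) S(1) by (auto simp: E_def)
  show ?thesis
  proof (rule that[OF E(1)])
    fix m j k \<xi> \<xi>'
    show "norm (X m k \<xi> - X m j \<xi>) \<le> E * (q m k - q m j) powr \<gamma>" if "j \<le> k"
      using order_trans[OF D(2)[OF q that] mult_right_mono[OF E(2)]] by (simp add: X_def)
    have "norm (X m k \<xi> - euler \<Gamma> (q m) \<xi>' k) \<le> S * (norm (X m 0 \<xi> - \<xi>') + 0)"
      by (rule S(2)[where r="\<lambda>_. 0", OF q _ st]) auto
    also have "\<dots> \<le> E * norm (\<xi> - \<xi>')" using E by (auto simp: X_def intro!: mult_right_mono)
    finally show "norm (X m k \<xi> - X m k \<xi>') \<le> E * norm (\<xi> - \<xi>')" by (simp add: X_def)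
    assume jk: "j \<le> k"
    have "norm ((X m k \<xi> - euler \<Gamma> (q m) \<xi>' k) - (X m j \<xi> - euler \<Gamma> (q m) \<xi>' j)) \<le> S * (norm (X m 0 \<xi> - \<xi>') + 0) * (q m k - q m j) powr \<gamma>"
      by (rule S(3)[where r="\<lambda>_. 0", OF q _ st _ jk]) auto
    also have "\<dots> \<le> E * norm (\<xi> - \<xi>') * (q m k - q m j) powr \<gamma>" using E by (auto simp: X_def intro!: mult_right_mono)
    finally show "norm ((X m k \<xi> - X m k \<xi>') - (X m j \<xi> - X m j \<xi>')) \<le> E * norm (\<xi> - \<xi>') * (q m k - q m j) powr \<gamma>"
      by (simp add: X_def)
  qed
qed

definition S :: "(real \<Rightarrow> real^'d \<Rightarrow> real) \<Rightarrow> (nat \<Rightarrow> nat \<Rightarrow> real^'d \<Rightarrow> real) \<Rightarrow> nat \<Rightarrow> nat \<Rightarrow> real^'d \<Rightarrow> real" where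
  "S f a m k \<xi> = young_sum f (q m) (\<lambda>k. X m k \<xi>) (\<lambda>k. a m k \<xi>) k"

text \<open>Two initial points change both the integrand and the path. The first change is a Young
  sum of a difference along one path, the second a difference of sums for one integrand;
  \<open>young_sum_bound\<close> and \<open>young_sum_diff_bound\<close> estimate them.\<close>

lemma holder_family_S:
  assumes f: "young_field \<gamma> \<epsilon> T Cf f" and a: "holder_family \<gamma> \<epsilon> q a"
  shows "holder_family \<gamma> \<epsilon> q (S f a)"
proof -
  obtain E where E: "E \<ge> 1"
    "\<And>m j k \<xi>. j \<le> k \<Longrightarrow> norm (X m k \<xi> - X m j \<xi>) \<le> E * (q m k - q m j) powr \<gamma>"
    "\<And>m k \<xi> \<xi>'. norm (X m k \<xi> - X m k \<xi>') \<le> E * norm (\<xi> - \<xi>')"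
    "\<And>m j k \<xi> \<xi>'. j \<le> k \<Longrightarrow> norm ((X m k \<xi> - X m k \<xi>') - (X m j \<xi> - X m j \<xi>')) \<le> E * norm (\<xi> - \<xi>') * (q m k - q m j) powr \<gamma>"
    by (rule X_bounds) blast
  have E0: "E \<ge> 0" using E by simp
  obtain K where K: "K \<ge> 0"
    "\<And>t (x :: nat \<Rightarrow> real^'d) (a :: nat \<Rightarrow> real) A. grid T t \<Longrightarrow> (\<And>j k. j \<le> k \<Longrightarrow> norm (x k - x j) \<le> E * (t k - t j) powr \<gamma>) \<Longrightarrow>
      holder_path \<gamma> t A a \<Longrightarrow> holder_path \<gamma> t (K * A) (young_sum f t x a)"
    by (rule young_sum_bound[OF \<gamma> T f E0]) blast
  obtain K' where K': "K' \<ge> 0"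
    "\<And>t (x :: nat \<Rightarrow> real^'d) x' d (a :: nat \<Rightarrow> real) A. grid T t \<Longrightarrow> (\<And>j k. j \<le> k \<Longrightarrow> norm (x k - x j) \<le> E * (t k - t j) powr \<gamma>) \<Longrightarrow>
      (\<And>k. norm (x k - x' k) \<le> E * d) \<Longrightarrow> (\<And>j k. j \<le> k \<Longrightarrow> norm (x' k - x' j) \<le> E * (t k - t j) powr \<gamma>) \<Longrightarrow>
      (\<And>j k. j \<le> k \<Longrightarrow> norm ((x k - x' k) - (x j - x' j)) \<le> E * d * (t k - t j) powr \<gamma>) \<Longrightarrow> 0 \<le> d \<Longrightarrow> d \<le> 1 \<Longrightarrow>
      holder_path \<gamma> t A a \<Longrightarrow> holder_path \<gamma> t (K' * A * d powr \<epsilon>) (\<lambda>k. young_sum f t x a k - young_sum f t x' a k)"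
    by (rule young_sum_diff_bound[OF \<gamma> T f E(1) \<epsilon>]) blast
  obtain A where A: "\<And>m x. holder_path \<gamma> (q m) A (\<lambda>k. a m k x)"
    "\<And>m x x'. norm (x - x') \<le> 1 \<Longrightarrow> holder_path \<gamma> (q m) (A * norm (x - x') powr \<epsilon>) (\<lambda>k. a m k x - a m k x')"
    using a unfolding holder_family_def by blast
  have A0: "A \<ge> 0" by (rule holder_pathD(3)[OF A(1)])
  show ?thesis unfolding holder_family_def
  proof (intro exI[of _ "K * A + K' * A"] allI conjI impI)
    fix m and x x' :: "real^'d"
    have "holder_path \<gamma> (q m) (K * A) (\<lambda>k. S f a m k x)"
      unfolding S_def by (rule K(2)[OF q E(2) A(1)])
    then show "holder_path \<gamma> (q m) (K * A + K' * A) (\<lambda>k. S f a m k x)"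
      by (rule holder_path_mono) (use K'(1) A0 in simp)
    assume xx: "norm (x - x') \<le> 1"
    let ?d = "norm (x - x') powr \<epsilon>"
    have 1: "holder_path \<gamma> (q m) (K * (A * ?d)) (young_sum f (q m) (\<lambda>k. X m k x) (\<lambda>k. a m k x - a m k x'))"
      by (rule K(2)[OF q E(2) A(2)[OF xx]])
    have 2: "holder_path \<gamma> (q m) (K' * A * ?d)
      (\<lambda>k. young_sum f (q m) (\<lambda>k. X m k x) (\<lambda>k. a m k x') k - young_sum f (q m) (\<lambda>k. X m k x') (\<lambda>k. a m k x') k)"
      by (rule K'(2)[OF q E(2) E(3) E(2) E(4) norm_ge_zero xx A(1)])
    have "(\<lambda>k. S f a m k x - S f a m k x') = (\<lambda>k. young_sum f (q m) (\<lambda>k. X m k x) (\<lambda>k. a m k x - a m k x') k +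
      (young_sum f (q m) (\<lambda>k. X m k x) (\<lambda>k. a m k x') k - young_sum f (q m) (\<lambda>k. X m k x') (\<lambda>k. a m k x') k))"
      by (simp add: S_def young_sum_def right_diff_distrib sum_subtractf)
    then show "holder_path \<gamma> (q m) ((K * A + K' * A) * ?d) (\<lambda>k. S f a m k x - S f a m k x')"
      using holder_path_add[OF 1 2] by (simp add: algebra_simps)
  qed
qed

text \<open>The linear bound is applied twice. The first time it bounds \<open>y\<close>. The
  difference of \<open>y\<close> at two initial points then solves the same system along the path
  from the first one, and the change of path, acting on the already bounded \<open>y\<close>, goes
  into the inhomogeneity, where it is of size norm (x - x') powr \<epsilon>.\<close>

lemma holder_family_linear:
  assumes B: "\<And>l e. \<exists>C. young_field \<gamma> \<epsilon> T C (B l e)" and h: "\<And>l. holder_family \<gamma> \<epsilon> q (h l)"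
    and y: "\<And>l m k x. y l m k x = h l m k x + (\<Sum>e\<in>UNIV. S (B l e) (y e) m k x)"
  shows "holder_family \<gamma> \<epsilon> q (y (l :: 'd))"
proof -
  obtain E where E: "E \<ge> 1"
    "\<And>m j k \<xi>. j \<le> k \<Longrightarrow> norm (X m k \<xi> - X m j \<xi>) \<le> E * (q m k - q m j) powr \<gamma>"
    "\<And>m k \<xi> \<xi>'. norm (X m k \<xi> - X m k \<xi>') \<le> E * norm (\<xi> - \<xi>')"
    "\<And>m j k \<xi> \<xi>'. j \<le> k \<Longrightarrow> norm ((X m k \<xi> - X m k \<xi>') - (X m j \<xi> - X m j \<xi>')) \<le> E * norm (\<xi> - \<xi>') * (q m k - q m j) powr \<gamma>"
    by (rule X_bounds) blast
  have E0: "E \<ge> 0" using E by simp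
  obtain CC where CC: "\<And>l e. young_field \<gamma> \<epsilon> T (CC l e) (B l e)" using B by metis
  define CB where "CB = (\<Sum>l\<in>UNIV. \<Sum>e\<in>UNIV. CC l e)"
  have CC0: "CC l e \<ge> 0" for l e using young_fieldD(1)[OF CC] .
  have "CC l e \<le> CB" for l e
  proof -
    have "CC l e \<le> (\<Sum>e\<in>UNIV. CC l e)" using CC0 by (intro member_le_sum) auto
    also have "\<dots> \<le> CB" unfolding CB_def by (intro member_le_sum[where f="\<lambda>l. \<Sum>e\<in>UNIV. CC l e"]) (auto intro!: sum_nonneg CC0)
    finally show ?thesis .
  qed
  then have BC: "young_field \<gamma> \<epsilon> T CB (B l e)" for l e by (rule young_field_mono[OF CC])
  obtain K where K: "K \<ge> 0"
    "\<And>t (x :: nat \<Rightarrow> real^'d) y h H l. grid T t \<Longrightarrow> (\<And>j k. j \<le> k \<Longrightarrow> norm (x k - x j) \<le> E * (t k - t j) powr \<gamma>) \<Longrightarrow>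
      (\<And>l. holder_path \<gamma> t H (h l)) \<Longrightarrow>
      (\<And>l k. y l k = h l k + (\<Sum>e\<in>UNIV. young_sum (B l e) t x (y e) k)) \<Longrightarrow> holder_path \<gamma> t (K * H) (y l)"
    by (rule linear_young_bound[where B=B, OF \<gamma> T BC E0]) blast
  \<comment> \<open>Reifies the conclusion of \<open>young_sum_diff_bound\<close> as a predicate, so
    that its constants can be chosen simultaneously for all pairs \<open>l\<close>,
    \<open>e\<close>.\<close>
  define P where "P f K' \<longleftrightarrow> K' \<ge> 0 \<and> (\<forall>t (x :: nat \<Rightarrow> real^'d) x' d (a :: nat \<Rightarrow> real) A. grid T t \<longrightarrow> (\<forall>j k. j \<le> k \<longrightarrow> norm (x k - x j) \<le> E * (t k - t j) powr \<gamma>) \<longrightarrow>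
      (\<forall>k. norm (x k - x' k) \<le> E * d) \<longrightarrow> (\<forall>j k. j \<le> k \<longrightarrow> norm (x' k - x' j) \<le> E * (t k - t j) powr \<gamma>) \<longrightarrow>
      (\<forall>j k. j \<le> k \<longrightarrow> norm ((x k - x' k) - (x j - x' j)) \<le> E * d * (t k - t j) powr \<gamma>) \<longrightarrow> 0 \<le> d \<longrightarrow> d \<le> 1 \<longrightarrow>
      holder_path \<gamma> t A a \<longrightarrow> holder_path \<gamma> t (K' * A * d powr \<epsilon>) (\<lambda>k. young_sum f t x a k - young_sum f t x' a k))" for f K'
  have "\<exists>K'. P (B l e) K'" for l e
  proof -
    obtain K' where "P (B l e) K'"
    proof (rule young_sum_diff_bound[OF \<gamma> T BC[of l e] E(1) \<epsilon>], goal_cases)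
      case (1 K')
      have "P (B l e) K'" unfolding P_def
      proof (intro conjI allI impI)
        show "K' \<ge> 0" by (rule 1(2))
      qed (rule 1(3); blast)
      then show ?case by (rule 1(1))
    qed
    then show ?thesis ..
  qed
  then obtain K' where P: "\<And>l e. P (B l e) (K' l e)" by metis
  have K'1: "K' l e \<ge> 0" for l e using P[of l e] by (simp add: P_def)
  have K'2: "holder_path \<gamma> t (K' l e * A * d powr \<epsilon>) (\<lambda>k. young_sum (B l e) t x a k - young_sum (B l e) t x' a k)"
    if "grid T t" "\<And>j k. j \<le> k \<Longrightarrow> norm (x k - x j) \<le> E * (t k - t j) powr \<gamma>"
      "\<And>k. norm (x k - x' k) \<le> E * d" "\<And>j k. j \<le> k \<Longrightarrow> norm (x' k - x' j) \<le> E * (t k - t j) powr \<gamma>"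
      "\<And>j k. j \<le> k \<Longrightarrow> norm ((x k - x' k) - (x j - x' j)) \<le> E * d * (t k - t j) powr \<gamma>" "0 \<le> d" "d \<le> 1"
      "holder_path \<gamma> t A a" for l e t and x x' :: "nat \<Rightarrow> real^'d" and d A and a :: "nat \<Rightarrow> real"
    using P[of l e, unfolded P_def, THEN conjunct2, rule_format, OF that] .
  obtain HH where HH: "\<And>l m x. holder_path \<gamma> (q m) (HH l) (\<lambda>k. h l m k x)"
    "\<And>l m x x'. norm (x - x') \<le> 1 \<Longrightarrow> holder_path \<gamma> (q m) (HH l * norm (x - x') powr \<epsilon>) (\<lambda>k. h l m k x - h l m k x')"
    using h unfolding holder_family_def by metis
  have HH0: "HH l \<ge> 0" for l by (rule holder_pathD(3)[OF HH(1)])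
  define H where "H = (\<Sum>l\<in>UNIV. HH l)"
  have HHH: "HH l \<le> H" for l unfolding H_def by (intro member_le_sum HH0) auto
  have H0: "H \<ge> 0" using HH0[of l] HHH[of l] by linarith
  have hp: "holder_path \<gamma> (q m) (K * H) (\<lambda>k. y l m k x)" for l m x
  proof (rule K(2)[OF q E(2), where y="\<lambda>l k. y l m k x" and h="\<lambda>l k. h l m k x"])
    show "holder_path \<gamma> (q m) H (\<lambda>k. h l m k x)" for l by (rule holder_path_mono[OF HH(1) HHH])
    show "y l m k x = h l m k x + (\<Sum>e\<in>UNIV. young_sum (B l e) (q m) (\<lambda>k. X m k x) (\<lambda>k. y e m k x) k)" for l k
      unfolding y[of l m k x] by (simp add: S_def)
  qed
  define H' where "H' = H + (\<Sum>l\<in>UNIV. \<Sum>e\<in>UNIV. K' l e * (K * H))"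
  have KH0: "K * H \<ge> 0" using K(1) H0 by simp
  have hp': "holder_path \<gamma> (q m) (K * (H' * norm (x - x') powr \<epsilon>)) (\<lambda>k. y l m k x - y l m k x')"
    if xx: "norm (x - x') \<le> 1" for l m x x'
  proof -
    let ?d = "norm (x - x') powr \<epsilon>"
    define h' where "h' l k = (h l m k x - h l m k x') +
      (\<Sum>e\<in>UNIV. young_sum (B l e) (q m) (\<lambda>k. X m k x) (\<lambda>k. y e m k x') k - young_sum (B l e) (q m) (\<lambda>k. X m k x') (\<lambda>k. y e m k x') k)" for l k
    show ?thesis
    proof (rule K(2)[OF q E(2), where y="\<lambda>l k. y l m k x - y l m k x'" and h=h'])
      fix l
      have "holder_path \<gamma> (q m) (HH l * ?d + (\<Sum>e\<in>UNIV. K' l e * (K * H) * ?d)) (h' l)"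
        unfolding h'_def
        by (intro holder_path_add HH(2)[OF xx] holder_path_sum finite K'2[OF q E(2) E(3) E(2) E(4) norm_ge_zero xx hp])
      then show "holder_path \<gamma> (q m) (H' * ?d) (h' l)"
      proof (rule holder_path_mono)
        have "(\<Sum>e\<in>UNIV. K' l e * (K * H)) \<le> (\<Sum>l\<in>UNIV. \<Sum>e\<in>UNIV. K' l e * (K * H))"
          using K'1 KH0 by (intro member_le_sum[where f="\<lambda>l. \<Sum>e\<in>UNIV. K' l e * (K * H)"]) (auto intro!: sum_nonneg mult_nonneg_nonneg)
        then have "HH l + (\<Sum>e\<in>UNIV. K' l e * (K * H)) \<le> H'" using HHH[of l] by (simp add: H'_def)
        then have "(HH l + (\<Sum>e\<in>UNIV. K' l e * (K * H))) * ?d \<le> H' * ?d" by (intro mult_right_mono) auto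
        then show "HH l * ?d + (\<Sum>e\<in>UNIV. K' l e * (K * H) * ?d) \<le> H' * ?d"
          by (simp add: distrib_right sum_distrib_right)
      qed
    next
      show "y l m k x - y l m k x' = h' l k + (\<Sum>e\<in>UNIV. young_sum (B l e) (q m) (\<lambda>k. X m k x) (\<lambda>k. y e m k x - y e m k x') k)" for l k
        unfolding y[of l m k x] y[of l m k x'] h'_def S_def
        by (simp add: young_sum_def right_diff_distrib sum_subtractf)
    qed
  qed
  have H'0: "H' \<ge> H" unfolding H'_def using K'1 KH0 by (auto intro!: sum_nonneg mult_nonneg_nonneg)
  show ?thesis unfolding holder_family_def
  proof (intro exI[of _ "K * H'"] allI conjI impI)
    show "holder_path \<gamma> (q m) (K * H') (\<lambda>k. y l m k x)" for m x
      by (rule holder_path_mono[OF hp]) (use H'0 K(1) in \<open>simp add: mult_left_mono\<close>)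
    show "holder_path \<gamma> (q m) (K * H' * norm (x - x') powr \<epsilon>) (\<lambda>k. y l m k x - y l m k x')"
      if "norm (x - x') \<le> 1" for m x x' using hp'[OF that, of m l] by (simp add: mult.assoc)
  qed
qed

end

locale euler_family_jac = euler_family \<gamma> \<epsilon> T C \<Gamma> q
  for \<gamma> \<epsilon> T C :: real and \<Gamma> :: "real \<Rightarrow> real^'d \<Rightarrow> real^'d" and q :: "nat \<Rightarrow> nat \<Rightarrow> real" +
  fixes g :: "'d \<Rightarrow> 'd \<Rightarrow> real \<Rightarrow> real^'d \<Rightarrow> real"
  assumes g: "\<And>l t x. t \<in> {0..T} \<Longrightarrow> has_grad (\<lambda>x. \<Gamma> t x $ l) (\<lambda>e. g l e t x) x"
begin

definition J :: "'d \<Rightarrow> 'd \<Rightarrow> nat \<Rightarrow> nat \<Rightarrow> real^'d \<Rightarrow> real" where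
  "J i l m k x = euler_jac g (q m) (\<lambda>k. X m k x) k i l"

lemma q_mem: "q m k \<in> {0..T}"
  using gridD[OF q] by auto

lemma X_has_grad: "has_grad (\<lambda>x. X m k x $ l) (\<lambda>i. J i l m k x) x"
proof (induction k arbitrary: l)
  case 0
  have "((\<lambda>x::real^'d. x $ l) has_derivative (\<lambda>v. v $ l)) (at x)"
    by (rule bounded_linear_imp_has_derivative) (rule bounded_linear_vec_nth)
  then have "((\<lambda>x::real^'d. x $ l) has_derivative (\<lambda>v. \<Sum>i\<in>UNIV. v $ i * (if i = l then 1 else 0))) (at x)"
    by (rule has_derivative_eq_rhs) (simp add: fun_eq_iff if_distrib cong: if_cong)
  then show ?case by (simp add: has_grad_def X_def J_def)
next
  case (Suc k)
  let ?s = "q m k" and ?t = "q m (Suc k)"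
  have 1: "has_grad (incr (\<lambda>t x. \<Gamma> t x $ l) ?s ?t) (\<lambda>e. incr (g l e) ?s ?t (X m k x)) (X m k x)"
    by (rule incr_has_grad) (intro g q_mem)+
  have "has_grad (\<lambda>x. X m k x $ l + incr (\<lambda>t x. \<Gamma> t x $ l) ?s ?t (X m k x))
     (\<lambda>i. J i l m k x + (\<Sum>e\<in>UNIV. incr (g l e) ?s ?t (X m k x) * J i e m k x)) x"
    by (rule has_grad_add[OF Suc.IH has_grad_chain[OF 1 Suc.IH]])
  moreover have "(\<lambda>x. X m (Suc k) x $ l) = (\<lambda>x. X m k x $ l + incr (\<lambda>t x. \<Gamma> t x $ l) ?s ?t (X m k x))"
    by (simp add: X_def incr_def)
  moreover have "(\<lambda>i. J i l m (Suc k) x) = (\<lambda>i. J i l m k x + (\<Sum>e\<in>UNIV. incr (g l e) ?s ?t (X m k x) * J i e m k x))"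
    by (simp add: J_def)
  ultimately show ?case by simp
qed

text \<open>A sum up to step \<open>k\<close> reads its integrand at earlier steps only.
  Differentiability of \<open>a\<close> is therefore demanded below \<open>n\<close> alone, which
  lets recursively defined integrands be differentiated step by step.\<close>

lemma S_has_grad:
  assumes f: "\<And>t x. t \<in> {0..T} \<Longrightarrow> has_grad (f t) (\<lambda>i. f' i t x) x"
    and a: "\<And>k. k < n \<Longrightarrow> has_grad (a m k) (\<lambda>i. a' i m k x) x" and k: "k \<le> n"
  shows "has_grad (S f a m k) (\<lambda>i. S f (a' i) m k x + (\<Sum>l\<in>UNIV. S (f' l) (\<lambda>m k x. J i l m k x * a m k x) m k x)) x"
proof -
  have "has_grad (\<lambda>x. incr f (q m j) (q m (Suc j)) (X m j x) * a m j x)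
     (\<lambda>i. (\<Sum>l\<in>UNIV. incr (f' l) (q m j) (q m (Suc j)) (X m j x) * J i l m j x) * a m j x + incr f (q m j) (q m (Suc j)) (X m j x) * a' i m j x) x" if "j < k" for j
  proof (rule has_grad_mult)
    have "has_grad (incr f (q m j) (q m (Suc j))) (\<lambda>l. incr (f' l) (q m j) (q m (Suc j)) (X m j x)) (X m j x)"
      by (rule incr_has_grad) (intro f q_mem)+
    then show "has_grad (\<lambda>x. incr f (q m j) (q m (Suc j)) (X m j x)) (\<lambda>i. \<Sum>l\<in>UNIV. incr (f' l) (q m j) (q m (Suc j)) (X m j x) * J i l m j x) x"
      by (rule has_grad_chain) (rule X_has_grad)
    show "has_grad (a m j) (\<lambda>i. a' i m j x) x" using that k by (intro a) auto
  qed
  then have "has_grad (S f a m k)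
    (\<lambda>i. \<Sum>j<k. (\<Sum>l\<in>UNIV. incr (f' l) (q m j) (q m (Suc j)) (X m j x) * J i l m j x) * a m j x + incr f (q m j) (q m (Suc j)) (X m j x) * a' i m j x) x"
    unfolding S_def[abs_def] young_sum_def by (intro has_grad_sum) auto
  also have "(\<lambda>i. \<Sum>j<k. (\<Sum>l\<in>UNIV. incr (f' l) (q m j) (q m (Suc j)) (X m j x) * J i l m j x) * a m j x + incr f (q m j) (q m (Suc j)) (X m j x) * a' i m j x)
    = (\<lambda>i. S f (a' i) m k x + (\<Sum>l\<in>UNIV. S (f' l) (\<lambda>m k x. J i l m k x * a m k x) m k x))"
    unfolding S_def young_sum_def sum.distrib sum_distrib_right
    by (subst (2) sum.swap) (simp add: mult_ac add.commute)
  finally show ?thesis .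
qed

text \<open>Differentiating once brings in the Jacobian as a factor, but then only n - 1 further
  derivatives of it are taken. The orders of \<open>J\<close> used are thus strictly below
  \<open>n\<close>, and this breaks the circle between smoothness of Young sums and smoothness of
  the Jacobian, which is itself given by Young sums.\<close>

lemma smooth_family_S:
  "smooth_field \<gamma> \<epsilon> T n f \<Longrightarrow> smooth_family \<gamma> \<epsilon> q n a \<Longrightarrow> (\<And>n' i l. n' < n \<Longrightarrow> smooth_family \<gamma> \<epsilon> q n' (J i l)) \<Longrightarrow>
    smooth_family \<gamma> \<epsilon> q n (S f a)"
proof (induction n arbitrary: f a)
  case 0
  then show ?case using holder_family_S by auto
next
  case (Suc n)
  obtain Cf where Cf: "young_field \<gamma> \<epsilon> T Cf f" using Suc.prems(1) by auto
  obtain f' where f': "\<And>t x. t \<in> {0..T} \<Longrightarrow> has_grad (f t) (\<lambda>i. f' i t x) x" "\<And>i. smooth_field \<gamma> \<epsilon> T n (f' i)"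
    using Suc.prems(1) unfolding smooth_field.simps by blast
  obtain a' where a': "\<And>m k x. has_grad (a m k) (\<lambda>i. a' i m k x) x" "\<And>i. smooth_family \<gamma> \<epsilon> q n (a' i)"
    using Suc.prems(2) by auto
  have Jn: "smooth_family \<gamma> \<epsilon> q n' (J i l)" if "n' < n" for n' i l using Suc.prems(3) that by simp
  have an: "smooth_family \<gamma> \<epsilon> q n a" by (rule smooth_family_Suc_le[OF Suc.prems(2)])
  have fn: "smooth_field \<gamma> \<epsilon> T n f" by (rule smooth_field_Suc_le[OF Suc.prems(1)])
  show ?case unfolding smooth_family.simps
  proof (intro conjI exI[of _ "\<lambda>i m k x. S f (a' i) m k x + (\<Sum>l\<in>UNIV. S (f' l) (\<lambda>m k x. J i l m k x * a m k x) m k x)"] allI)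
    show "holder_family \<gamma> \<epsilon> q (S f a)" by (rule holder_family_S[OF Cf smooth_family_holder[OF Suc.prems(2)]])
    show "has_grad (S f a m k) (\<lambda>i. S f (a' i) m k x + (\<Sum>l\<in>UNIV. S (f' l) (\<lambda>m k x. J i l m k x * a m k x) m k x)) x" for m k x
      by (rule S_has_grad[OF f'(1) a'(1) order_refl])
    fix i
    have "smooth_family \<gamma> \<epsilon> q n (S (f' l) (\<lambda>m k x. J i l m k x * a m k x))" for l
      by (rule Suc.IH[OF f'(2) smooth_family_mult[OF Suc.prems(3)[OF lessI] an] Jn])
    then have "smooth_family \<gamma> \<epsilon> q n (\<lambda>m k x. \<Sum>l\<in>UNIV. S (f' l) (\<lambda>m k x. J i l m k x * a m k x) m k x)"
      by (intro smooth_family_sum) auto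
    then show "smooth_family \<gamma> \<epsilon> q n (\<lambda>m k x. S f (a' i) m k x + (\<Sum>l\<in>UNIV. S (f' l) (\<lambda>m k x. J i l m k x * a m k x) m k x))"
      by (rule smooth_family_add[rotated]) (rule Suc.IH[OF fn a'(2)], rule Jn)
  qed
qed

text \<open>The derivative of a linear system is a linear system with the same \<open>B\<close>; the
  terms with derivatives of \<open>B\<close>, the Jacobian and \<open>y\<close> move into the new
  inhomogeneity \<open>h2\<close>. Their smoothness of order \<open>n\<close> is available when
  order \<open>Suc n\<close> is treated, so the induction over the order runs with \<open>B\<close>
  fixed and \<open>h\<close> varying.\<close>

lemma smooth_family_linear:
  assumes "\<And>l e. smooth_field \<gamma> \<epsilon> T n (B l e)" "\<And>l. smooth_family \<gamma> \<epsilon> q n (h l)"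
    and "\<And>l m k x. y l m k x = h l m k x + (\<Sum>e\<in>UNIV. S (B l e) (y e) m k x)"
    and "\<And>n' i l. n' < n \<Longrightarrow> smooth_family \<gamma> \<epsilon> q n' (J i l)"
  shows "smooth_family \<gamma> \<epsilon> q n (y (l :: 'd))"
  using assms
proof (induction n arbitrary: y h l)
  case 0
  then have "\<And>l e. \<exists>C. young_field \<gamma> \<epsilon> T C (B l e)" "\<And>l. holder_family \<gamma> \<epsilon> q (h l)" by auto
  then show ?case using holder_family_linear[OF _ _ 0(3)] by auto
next
  case (Suc n)
  note y = Suc.prems(3)
  have "\<exists>f'. \<forall>l e. (\<forall>t\<in>{0..T}. \<forall>x. has_grad (B l e t) (\<lambda>i. f' l e i t x) x) \<and> (\<forall>i. smooth_field \<gamma> \<epsilon> T n (f' l e i))"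
    using Suc.prems(1) unfolding smooth_field.simps by metis
  then obtain B' where B': "\<And>l e t x. t \<in> {0..T} \<Longrightarrow> has_grad (B l e t) (\<lambda>i. B' l e i t x) x" "\<And>l e i. smooth_field \<gamma> \<epsilon> T n (B' l e i)"
    by blast
  have "\<exists>h'. \<forall>l. (\<forall>m k x. has_grad (h l m k) (\<lambda>i. h' l i m k x) x) \<and> (\<forall>i. smooth_family \<gamma> \<epsilon> q n (h' l i))"
    using Suc.prems(2) unfolding smooth_family.simps by metis
  then obtain h' where h': "\<And>l m k x. has_grad (h l m k) (\<lambda>i. h' l i m k x) x" "\<And>l i. smooth_family \<gamma> \<epsilon> q n (h' l i)"
    by blast
  have Jn: "smooth_family \<gamma> \<epsilon> q n' (J i l)" if "n' < n" for n' i l using Suc.prems(4) that by simp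
  have yn: "smooth_family \<gamma> \<epsilon> q n (y l)" for l
    by (rule Suc.IH[OF smooth_field_Suc_le[OF Suc.prems(1)] smooth_family_Suc_le[OF Suc.prems(2)] y Jn])
  have yS: "y l m k = (\<lambda>x. h l m k x + (\<Sum>e\<in>UNIV. S (B l e) (y e) m k x))" for l m k by (rule ext) (rule y)
  \<comment> \<open>Induction over the grid steps: the right-hand side at step \<open>k\<close>
    involves \<open>y\<close> at earlier steps only.\<close>
  have ex: "\<exists>c. has_grad (y l m k) c x" for l m k x
  proof (induction k arbitrary: l rule: less_induct)
    case (less k)
    then have "\<forall>e j. \<exists>c. j < k \<longrightarrow> has_grad (y e m j) c x" by blast
    then obtain c where c: "\<And>e j. j < k \<Longrightarrow> has_grad (y e m j) (c e j) x" by metis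
    have hS: "has_grad (S (B l e) (y e) m k) (\<lambda>i. S (B l e) (\<lambda>m j x. c e j i) m k x + (\<Sum>c\<in>UNIV. S (B' l e c) (\<lambda>m k x. J i c m k x * y e m k x) m k x)) x" for e
      by (rule S_has_grad[where a'="\<lambda>i m j x. c e j i" and n=k, OF B'(1) _ order_refl]) (use c in auto)
    show ?case unfolding yS[of l m k] by (rule exI) (rule has_grad_add[OF h'(1) has_grad_sum[OF finite hS]])
  qed
  \<comment> \<open>Existence at each point is turned into a function by choice; uniqueness of
    gradients then shows that this function solves the differentiated system.\<close>
  define y' where "y' l i m k x = (SOME c. has_grad (y l m k) c x) i" for l i m k x
  have y': "has_grad (y l m k) (\<lambda>i. y' l i m k x) x" for l m k x
    unfolding y'_def by (rule someI_ex[OF ex])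
  define h2 where "h2 i l m k x = h' l i m k x + (\<Sum>e\<in>UNIV. \<Sum>c\<in>UNIV. S (B' l e c) (\<lambda>m k x. J i c m k x * y e m k x) m k x)" for i l m k x
  have y'_eq: "y' l i m k x = h2 i l m k x + (\<Sum>e\<in>UNIV. S (B l e) (y' e i) m k x)" for l i m k x
  proof -
    have "has_grad (y l m k) (\<lambda>i. h' l i m k x + (\<Sum>e\<in>UNIV. S (B l e) (y' e i) m k x + (\<Sum>c\<in>UNIV. S (B' l e c) (\<lambda>m k x. J i c m k x * y e m k x) m k x))) x"
      unfolding yS[of l m k] by (intro has_grad_add h' has_grad_sum finite S_has_grad[OF B'(1) y' order_refl])
    from fun_cong[OF has_grad_unique[OF y' this], of i] show ?thesis by (simp add: h2_def sum.distrib)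
  qed
  have h2: "smooth_family \<gamma> \<epsilon> q n (h2 i l)" for i l
  proof -
    have "smooth_family \<gamma> \<epsilon> q n (S (B' l e c) (\<lambda>m k x. J i c m k x * y e m k x))" for e c
      by (rule smooth_family_S[OF B'(2) smooth_family_mult[OF Suc.prems(4)[OF lessI] yn] Jn])
    then have "smooth_family \<gamma> \<epsilon> q n (\<lambda>m k x. \<Sum>e\<in>UNIV. \<Sum>c\<in>UNIV. S (B' l e c) (\<lambda>m k x. J i c m k x * y e m k x) m k x)"
      by (intro smooth_family_sum finite)
    from smooth_family_add[OF h'(2) this] show ?thesis by (simp add: h2_def[abs_def])
  qed
  show ?case unfolding smooth_family.simps
  proof (intro conjI exI[of _ "\<lambda>i. y' l i"] allI)
    have "\<exists>C. young_field \<gamma> \<epsilon> T C (B l e)" for l e using Suc.prems(1) by (rule smooth_field_young)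
    then show "holder_family \<gamma> \<epsilon> q (y l)"
      by (rule holder_family_linear[OF _ smooth_family_holder[OF Suc.prems(2)] y])
    show "has_grad (y l m k) (\<lambda>i. y' l i m k x) x" for m k x by (rule y')
    show "smooth_family \<gamma> \<epsilon> q n (y' l i)" for i
      by (rule Suc.IH[where y="\<lambda>l. y' l i", OF smooth_field_Suc_le[OF Suc.prems(1)] h2 y'_eq Jn])
  qed
qed

text \<open>Strong induction on the order: \<open>J\<close> solves a linear system with coefficients
  \<open>g\<close>, and order n' takes as input the orders of \<open>J\<close> below n'.\<close>

lemma smooth_family_J:
  assumes "\<And>l e. smooth_field \<gamma> \<epsilon> T n (g l e)"
  shows "n' \<le> n \<Longrightarrow> smooth_family \<gamma> \<epsilon> q n' (J i l)"
proof (induction n' arbitrary: i l rule: less_induct)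
  case (less n')
  show ?case
  proof (rule smooth_family_linear[where y="J i" and B=g and h="\<lambda>l m k x. if i = l then 1 else 0"])
    show "smooth_field \<gamma> \<epsilon> T n' (g l e)" for l e by (rule smooth_field_le[OF less.prems assms])
    show "smooth_family \<gamma> \<epsilon> q n' (\<lambda>m k x. if i = l then 1 else 0)" for l by (rule smooth_family_const)
    show "J i l m k x = (if i = l then 1 else 0) + (\<Sum>e\<in>UNIV. S (g l e) (J i e) m k x)" for l m k x
      unfolding J_def S_def by (rule euler_jac_eq)
    show "smooth_family \<gamma> \<epsilon> q n'' (J i l)" if "n'' < n'" for n'' i l using less that by simp
  qed
qed

end

section \<open>Differentiability of limits\<close>

lemma cont_diff_const: "cont_diff n (\<lambda>_. c)"
proof (induction n arbitrary: c)
  case (Suc n)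
  then show ?case by (auto intro!: exI[of _ "\<lambda>_ _. 0"])
qed simp

lemma cont_diff_add: "cont_diff n f \<Longrightarrow> cont_diff n g \<Longrightarrow> cont_diff n (\<lambda>x. f x + g x)"
proof (induction n arbitrary: f g)
  case 0 then show ?case by (simp add: continuous_on_add)
next
  case (Suc n)
  obtain f' where f': "\<And>x. (f has_derivative f' x) (at x)" "\<And>v. cont_diff n (\<lambda>x. f' x v)" using Suc.prems(1) by auto
  obtain g' where g': "\<And>x. (g has_derivative g' x) (at x)" "\<And>v. cont_diff n (\<lambda>x. g' x v)" using Suc.prems(2) by auto
  show ?case unfolding cont_diff.simps
    by (intro exI[of _ "\<lambda>x v. f' x v + g' x v"] conjI allI has_derivative_add f' Suc.IH g')
qed

lemma cont_diff_sum:
  "finite I \<Longrightarrow> (\<And>i. i \<in> I \<Longrightarrow> cont_diff n (f i)) \<Longrightarrow> cont_diff n (\<lambda>x. \<Sum>i\<in>I. f i x)"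
  by (induction I rule: finite_induct) (simp_all add: cont_diff_const cont_diff_add del: cont_diff.simps)

lemma cont_diff_bounded_linear:
  assumes "bounded_linear h"
  shows "cont_diff n f \<Longrightarrow> cont_diff n (\<lambda>x. h (f x))"
proof (induction n arbitrary: f)
  case 0 then show ?case using bounded_linear.continuous_on[OF assms] by simp
next
  case (Suc n)
  obtain f' where f': "\<And>x. (f has_derivative f' x) (at x)" "\<And>v. cont_diff n (\<lambda>x. f' x v)" using Suc.prems by auto
  show ?case unfolding cont_diff.simps
    by (intro exI[of _ "\<lambda>x v. h (f' x v)"] conjI allI bounded_linear.has_derivative[OF assms] f' Suc.IH)
qed

text \<open>What survives of \<open>smooth_family\<close> when one step is read off each grid. Only
  the moduli in the initial point are kept, uniformly in \<open>m\<close>: the positions of the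
  scheme, which are unbounded in the initial point, must qualify too.\<close>

primrec smooth_seq :: "real \<Rightarrow> nat \<Rightarrow> (nat \<Rightarrow> real^'d \<Rightarrow> real) \<Rightarrow> bool" where
  "smooth_seq \<epsilon> 0 u = (\<exists>A. \<forall>m x x'. norm (x - x') \<le> 1 \<longrightarrow> \<bar>u m x - u m x'\<bar> \<le> A * norm (x - x') powr \<epsilon>)"
| "smooth_seq \<epsilon> (Suc n) u = ((\<exists>A. \<forall>m x x'. norm (x - x') \<le> 1 \<longrightarrow> \<bar>u m x - u m x'\<bar> \<le> A * norm (x - x') powr \<epsilon>) \<and>
     (\<exists>u'. (\<forall>m x. has_grad (u m) (\<lambda>i. u' i m x) x) \<and> (\<forall>i. smooth_seq \<epsilon> n (u' i))))"

lemma smooth_seq_holder: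
  "smooth_seq \<epsilon> n u \<Longrightarrow> \<exists>A. \<forall>m x x'. norm (x - x') \<le> 1 \<longrightarrow> \<bar>u m x - u m x'\<bar> \<le> A * norm (x - x') powr \<epsilon>"
  by (cases n) auto

lemma holder_seq_of_family:
  assumes "holder_family \<gamma> \<epsilon> q a"
  shows "\<exists>A. \<forall>m x x'. norm (x - x') \<le> 1 \<longrightarrow> \<bar>a m (K m) x - a m (K m) x'\<bar> \<le> A * norm (x - x') powr \<epsilon>"
proof -
  obtain A where A: "\<And>m x x'. norm (x - x') \<le> 1 \<Longrightarrow> holder_path \<gamma> (q m) (A * norm (x - x') powr \<epsilon>) (\<lambda>k. a m k x - a m k x')"
    using assms unfolding holder_family_def by blast
  show ?thesis using holder_pathD(1)[OF A] by (intro exI[of _ A]) simp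
qed

lemma smooth_seq_of_family:
  "smooth_family \<gamma> \<epsilon> q n a \<Longrightarrow> smooth_seq \<epsilon> n (\<lambda>m. a m (K m))"
proof (induction n arbitrary: a)
  case 0
  then show ?case using holder_seq_of_family by (simp only: smooth_family.simps smooth_seq.simps)
next
  case (Suc n)
  obtain a' where a': "\<And>m k x. has_grad (a m k) (\<lambda>i. a' i m k x) x" "\<And>i. smooth_family \<gamma> \<epsilon> q n (a' i)"
    using Suc.prems by auto
  show ?case unfolding smooth_seq.simps
    by (intro conjI exI[of _ "\<lambda>i m. a' i m (K m)"] allI a'(1) Suc.IH a'(2)
        holder_seq_of_family[OF smooth_family_holder[OF Suc.prems]])
qed

text \<open>Mean value theorem on the segment from x to x + v: the intermediate point is within norm
  v of x, where the modulus of the gradient applies. Estimating by components costs the factor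
  CARD('d).\<close>

lemma has_grad_remainder:
  fixes u :: "real^'d \<Rightarrow> real"
  assumes u: "\<And>x. has_grad u (\<lambda>i. u' i x) x" and A: "A \<ge> 0" and \<epsilon>: "\<epsilon> > 0"
    and u': "\<And>i x x'. norm (x - x') \<le> 1 \<Longrightarrow> \<bar>u' i x - u' i x'\<bar> \<le> A * norm (x - x') powr \<epsilon>"
    and v: "norm v \<le> 1"
  shows "\<bar>u (x + v) - u x - (\<Sum>i\<in>UNIV. v $ i * u' i x)\<bar> \<le> real CARD('d) * A * norm v powr \<epsilon> * norm v"
proof -
  let ?\<phi> = "\<lambda>s::real. u (x + s *\<^sub>R v)"
  have d: "(?\<phi> has_derivative (\<lambda>h. \<Sum>i\<in>UNIV. (h *\<^sub>R v) $ i * u' i (x + s *\<^sub>R v))) (at s)" for s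
  proof -
    have 1: "((\<lambda>s::real. x + s *\<^sub>R v) has_derivative (\<lambda>h. h *\<^sub>R v)) (at s)" by (auto intro!: derivative_eq_intros)
    show ?thesis using has_derivative_compose[OF 1 u[unfolded has_grad_def]] by simp
  qed
  have "\<exists>s\<in>{0<..<1}. ?\<phi> 1 - ?\<phi> 0 = (\<Sum>i\<in>UNIV. ((1 - 0) *\<^sub>R v) $ i * u' i (x + s *\<^sub>R v))"
    by (rule mvt_simple) (use has_derivative_at_withinI[OF d] in auto)
  then obtain s where s: "0 < s" "s < 1" "?\<phi> 1 - ?\<phi> 0 = (\<Sum>i\<in>UNIV. ((1 - 0) *\<^sub>R v) $ i * u' i (x + s *\<^sub>R v))"
    by auto
  have "u (x + v) - u x - (\<Sum>i\<in>UNIV. v $ i * u' i x) = (\<Sum>i\<in>UNIV. v $ i * (u' i (x + s *\<^sub>R v) - u' i x))"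
    using s(3) by (simp add: right_diff_distrib sum_subtractf)
  also have "\<bar>\<dots>\<bar> \<le> real CARD('d) * (norm v * (A * norm v powr \<epsilon>))"
  proof (rule abs_sum_le_card)
    fix i
    have sv: "norm (s *\<^sub>R v) \<le> norm v" using s mult_right_mono[of s 1 "norm v"] by simp
    have "\<bar>u' i (x + s *\<^sub>R v) - u' i x\<bar> \<le> A * norm (s *\<^sub>R v) powr \<epsilon>" using u'[of "x + s *\<^sub>R v" x i] sv v by simp
    also have "\<dots> \<le> A * norm v powr \<epsilon>" using sv \<epsilon> A by (intro mult_left_mono powr_mono2) auto
    finally show "\<bar>v $ i * (u' i (x + s *\<^sub>R v) - u' i x)\<bar> \<le> norm v * (A * norm v powr \<epsilon>)"
      unfolding abs_mult by (intro mult_mono component_le_norm_cart) auto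
  qed
  finally show ?thesis by (simp add: mult_ac)
qed

text \<open>Taylor remainders are uniform in \<open>m\<close>. For fixed h the difference quotients
  converge with \<open>u\<close>, and they differ from the partial derivatives by at most B * h powr
  \<epsilon>; hence the latter are Cauchy too. Passing to the limit in the remainder identifies
  their limits as the gradient of \<open>F\<close>, and the induction hypothesis applies to each
  component of it.\<close>

lemma smooth_seq_limit:
  assumes \<epsilon>: "\<epsilon> > 0"
  shows "smooth_seq \<epsilon> n u \<Longrightarrow> (\<And>x. (\<lambda>m. u m x) \<longlonglongrightarrow> F x) \<Longrightarrow> cont_diff n F"
proof (induction n arbitrary: u F)
  case 0
  obtain A where A: "\<And>m x x'. norm (x - x') \<le> 1 \<Longrightarrow> \<bar>u m x - u m x'\<bar> \<le> A * norm (x - x') powr \<epsilon>"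
    using smooth_seq_holder[OF 0(1)] by blast
  have FA: "\<bar>F x - F x'\<bar> \<le> A * norm (x - x') powr \<epsilon>" if "norm (x - x') \<le> 1" for x x'
  proof (rule LIMSEQ_le_const2)
    show "(\<lambda>m. \<bar>u m x - u m x'\<bar>) \<longlonglongrightarrow> \<bar>F x - F x'\<bar>" by (intro tendsto_intros 0)
    show "\<exists>N. \<forall>n\<ge>N. \<bar>u n x - u n x'\<bar> \<le> A * norm (x - x') powr \<epsilon>" using A[OF that] by blast
  qed
  have "isCont F x" for x
  proof -
    have "((\<lambda>y. A * norm (y - x) powr \<epsilon>) \<longlongrightarrow> A * norm (x - x) powr \<epsilon>) (at x)"
      using \<epsilon> by (intro tendsto_intros tendsto_powr') auto
    then have 1: "((\<lambda>y. A * norm (y - x) powr \<epsilon>) \<longlongrightarrow> 0) (at x)" by simp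
    have "((\<lambda>y. F y - F x) \<longlongrightarrow> 0) (at x)"
    proof (rule Lim_null_comparison[OF _ 1])
      have "eventually (\<lambda>y. dist y x < 1) (at x)" by (auto simp: eventually_at intro: exI[of _ 1])
      then show "eventually (\<lambda>y. norm (F y - F x) \<le> A * norm (y - x) powr \<epsilon>) (at x)"
        by eventually_elim (use FA in \<open>simp add: dist_norm\<close>)
    qed
    then show ?thesis by (simp add: isCont_def LIM_zero_iff)
  qed
  then show ?case by (simp add: continuous_at_imp_continuous_on)
next
  case (Suc n)
  obtain u' where u': "\<And>m x. has_grad (u m) (\<lambda>i. u' i m x) x" "\<And>i. smooth_seq \<epsilon> n (u' i)" using Suc.prems(1) by auto
  have "\<forall>i. \<exists>A. \<forall>m x x'. norm (x - x') \<le> 1 \<longrightarrow> \<bar>u' i m x - u' i m x'\<bar> \<le> A * norm (x - x') powr \<epsilon>"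
    using smooth_seq_holder[OF u'(2)] by blast
  then obtain a where a: "\<And>i m x x'. norm (x - x') \<le> 1 \<Longrightarrow> \<bar>u' i m x - u' i m x'\<bar> \<le> a i * norm (x - x') powr \<epsilon>" by metis
  define A where "A = (\<Sum>i\<in>UNIV. \<bar>a i\<bar>)"
  have A0: "A \<ge> 0" by (simp add: A_def sum_nonneg)
  have A: "\<bar>u' i m x - u' i m x'\<bar> \<le> A * norm (x - x') powr \<epsilon>" if "norm (x - x') \<le> 1" for i m x x'
  proof -
    have "a i \<le> \<bar>a i\<bar>" by simp
    also have "\<dots> \<le> A" unfolding A_def by (rule member_le_sum) auto
    finally show ?thesis using order_trans[OF a[OF that] mult_right_mono[of "a i" A]] by simp
  qed
  define B where "B = real CARD('a) * A"
  have B0: "B \<ge> 0" using A0 by (simp add: B_def)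
  have rem: "\<bar>u m (x + v) - u m x - (\<Sum>i\<in>UNIV. v $ i * u' i m x)\<bar> \<le> B * norm v powr \<epsilon> * norm v" if "norm v \<le> 1" for m x v
    unfolding B_def by (rule has_grad_remainder[OF u'(1) A0 \<epsilon> A that])
  have conv: "convergent (\<lambda>m. u' i m x)" for i x
  proof (rule Cauchy_convergent, rule CauchyI)
    fix e :: real assume e: "e > 0"
    \<comment> \<open>Step size at which the Taylor remainder per unit of \<open>h\<close> is at
      most e / 4; B + 1 in place of \<open>B\<close> avoids division by zero, and the minimum keeps
      the increment within the range of \<open>rem\<close>.\<close>
    define h where "h = min 1 ((e / (4 * (B + 1))) powr (1 / \<epsilon>))"
    have h: "0 < h" "h \<le> 1" using e B0 by (auto simp: h_def)
    have "h powr \<epsilon> \<le> ((e / (4 * (B + 1))) powr (1 / \<epsilon>)) powr \<epsilon>" using h \<epsilon> by (intro powr_mono2) (auto simp: h_def)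
    also have "\<dots> = e / (4 * (B + 1))" using e B0 \<epsilon> by (simp add: powr_powr)
    finally have "B * h powr \<epsilon> \<le> B * (e / (4 * (B + 1)))" by (intro mult_left_mono B0)
    also have "\<dots> \<le> (B + 1) * (e / (4 * (B + 1)))" using e B0 by (intro mult_right_mono) auto
    also have "\<dots> = e / 4" using B0 by (simp add: field_simps)
    finally have Bh: "B * h powr \<epsilon> \<le> e / 4" .
    define w where "w m = (u m (x + h *\<^sub>R axis i 1) - u m x) / h" for m
    have wu: "\<bar>w m - u' i m x\<bar> \<le> e / 4" for m
    proof -
      have "(\<Sum>k\<in>UNIV. (h *\<^sub>R axis i 1 :: real^'a) $ k * u' k m x) = h * u' i m x"
        by (simp add: axis_def if_distrib[of "\<lambda>x. x * _"] if_distrib[of "\<lambda>x. _ * x"] cong: if_cong)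
      then have "\<bar>u m (x + h *\<^sub>R axis i 1) - u m x - h * u' i m x\<bar> \<le> B * h powr \<epsilon> * h"
        using rem[of "h *\<^sub>R axis i 1" m x] h by (simp add: norm_axis_1)
      moreover have "u m (x + h *\<^sub>R axis i 1) - u m x - h * u' i m x = h * (w m - u' i m x)"
        using h by (simp add: w_def field_simps)
      ultimately have "h * \<bar>w m - u' i m x\<bar> \<le> h * (B * h powr \<epsilon>)" using h by (simp add: abs_mult mult_ac)
      then show ?thesis using h Bh by simp
    qed
    have "Cauchy w" unfolding w_def
      by (intro convergent_Cauchy convergentI[of _ "(F (x + h *\<^sub>R axis i 1) - F x) / h"] tendsto_intros Suc.prems(2)) (use h in auto)
    then obtain M where M: "\<And>m n. m \<ge> M \<Longrightarrow> n \<ge> M \<Longrightarrow> norm (w m - w n) < e / 2" using CauchyD[of w "e / 2"] e by auto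
    show "\<exists>M. \<forall>m\<ge>M. \<forall>n\<ge>M. norm (u' i m x - u' i n x) < e"
    proof (intro exI[of _ M] allI impI)
      fix m n assume "m \<ge> M" "n \<ge> M"
      from M[OF this] wu[of m] wu[of n] show "norm (u' i m x - u' i n x) < e" unfolding real_norm_def by linarith
    qed
  qed
  define g where "g i x = lim (\<lambda>m. u' i m x)" for i x
  have g: "(\<lambda>m. u' i m x) \<longlonglongrightarrow> g i x" for i x using conv by (simp add: g_def convergent_LIMSEQ_iff)
  have gn: "cont_diff n (g i)" for i by (rule Suc.IH[OF u'(2) g])
  have remF: "\<bar>F (x + v) - F x - (\<Sum>i\<in>UNIV. v $ i * g i x)\<bar> \<le> B * norm v powr \<epsilon> * norm v" if "norm v \<le> 1" for x v
  proof (rule LIMSEQ_le_const2)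
    show "(\<lambda>m. \<bar>u m (x + v) - u m x - (\<Sum>i\<in>UNIV. v $ i * u' i m x)\<bar>) \<longlonglongrightarrow> \<bar>F (x + v) - F x - (\<Sum>i\<in>UNIV. v $ i * g i x)\<bar>"
      by (intro tendsto_intros Suc.prems(2) g)
    show "\<exists>N. \<forall>m\<ge>N. \<bar>u m (x + v) - u m x - (\<Sum>i\<in>UNIV. v $ i * u' i m x)\<bar> \<le> B * norm v powr \<epsilon> * norm v"
      using rem[OF that] by blast
  qed
  show ?case unfolding cont_diff.simps
  proof (intro exI[of _ "\<lambda>x v. \<Sum>i\<in>UNIV. v $ i * g i x"] conjI allI)
    fix x
    have lin: "bounded_linear (\<lambda>v::real^'a. \<Sum>i\<in>UNIV. v $ i * g i x)"
      by (intro bounded_linear_sum bounded_linear_mult_const bounded_linear_vec_nth)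
    have "((\<lambda>v::real^'a. B * norm v powr \<epsilon>) \<longlongrightarrow> B * norm (0::real^'a) powr \<epsilon>) (at 0)"
      using \<epsilon> by (intro tendsto_intros tendsto_powr') auto
    then have 1: "((\<lambda>v::real^'a. B * norm v powr \<epsilon>) \<longlongrightarrow> 0) (at 0)" by simp
    have "((\<lambda>v. norm (F (x + v) - F x - (\<Sum>i\<in>UNIV. v $ i * g i x)) / norm v) \<longlongrightarrow> 0) (at 0)"
    proof (rule Lim_null_comparison[OF _ 1])
      have "eventually (\<lambda>v::real^'a. v \<noteq> 0 \<and> dist v 0 < 1) (at 0)" by (auto simp: eventually_at intro: exI[of _ 1])
      then show "eventually (\<lambda>v. norm (norm (F (x + v) - F x - (\<Sum>i\<in>UNIV. v $ i * g i x)) / norm v) \<le> B * norm v powr \<epsilon>) (at 0)"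
        by eventually_elim (use remF[of _ x] in \<open>simp add: divide_le_eq\<close>)
    qed
    with lin show "(F has_derivative (\<lambda>v. \<Sum>i\<in>UNIV. v $ i * g i x)) (at x)" by (simp add: has_derivative_at)
  next
    fix v :: "real^'a"
    show "cont_diff n (\<lambda>x. \<Sum>i\<in>UNIV. v $ i * g i x)"
      by (intro cont_diff_sum finite cont_diff_bounded_linear[OF bounded_linear_mult_right] gn)
  qed
qed

text \<open>The positions of the scheme are unbounded in the initial point and hence form no
  \<open>holder_family\<close>. At order 0 their Lipschitz modulus is used instead, and
  \<open>smooth_family_J\<close> takes over from the first derivative on.\<close>

theorem flow_cont_diff:
  fixes \<Gamma> :: "real \<Rightarrow> real^'d \<Rightarrow> real^'d"
  assumes \<gamma>: "\<gamma> > 1/2" "\<gamma> \<le> 1" and \<epsilon>: "0 < \<epsilon>" "\<epsilon> \<le> 1"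
    and \<Gamma>1: "young_field \<gamma> 1 T C \<Gamma>" and \<Gamma>n: "\<And>l. smooth_field \<gamma> \<epsilon> T n (\<lambda>t x. \<Gamma> t x $ l)" and n: "n \<ge> 1"
    and sol: "\<And>\<xi>. davie_solution \<gamma> T \<Gamma> \<xi> (\<theta> \<xi>)" and t: "0 \<le> t" "t \<le> T"
  shows "cont_diff n (\<lambda>\<xi>. \<theta> \<xi> t)"
proof -
  obtain n' where n': "n = Suc n'" using n by (cases n) auto
  have "\<exists>g. \<forall>l. (\<forall>t\<in>{0..T}. \<forall>x. has_grad (\<lambda>x. \<Gamma> t x $ l) (\<lambda>e. g l e t x) x) \<and> (\<forall>e. smooth_field \<gamma> \<epsilon> T n' (g l e))"
    using \<Gamma>n unfolding n' smooth_field.simps by metis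
  then obtain g where gg: "\<And>l t x. t \<in> {0..T} \<Longrightarrow> has_grad (\<lambda>x. \<Gamma> t x $ l) (\<lambda>e. g l e t x) x"
    "\<And>l e. smooth_field \<gamma> \<epsilon> T n' (g l e)" by blast
  \<comment> \<open>The m-th grid has \<open>Suc m\<close> steps, so none is empty, and its step
    number \<open>Suc m\<close> is at time \<open>t\<close>; this is the step read off
    below.\<close>
  interpret euler_family_jac \<gamma> \<epsilon> T C \<Gamma> "\<lambda>m. ugrid t (Suc m)" g
    using \<gamma> \<epsilon> t \<Gamma>1 gg(1) by unfold_locales (auto intro: grid_ugrid)
  have lim: "(\<lambda>m. X m (Suc m) \<xi>) \<longlonglongrightarrow> \<theta> \<xi> t" for \<xi>
    unfolding X_def by (rule davie_euler_limit[OF assms(1,2) \<Gamma>1 sol t])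
  obtain E where E: "E \<ge> 1" "\<And>m k \<xi> \<xi>'. norm (X m k \<xi> - X m k \<xi>') \<le> E * norm (\<xi> - \<xi>')"
    by (rule X_bounds) blast
  have sm: "smooth_seq \<epsilon> n (\<lambda>m \<xi>. X m (Suc m) \<xi> $ l)" for l
    unfolding n' smooth_seq.simps
  proof (intro conjI exI[of _ E] exI[of _ "\<lambda>i m. J i l m (Suc m)"] allI impI)
    fix m and x x' :: "real^'d" assume xx: "norm (x - x') \<le> 1"
    have "\<bar>X m (Suc m) x $ l - X m (Suc m) x' $ l\<bar> \<le> norm (X m (Suc m) x - X m (Suc m) x')"
      using component_le_norm_cart[of "X m (Suc m) x - X m (Suc m) x'" l] by simp
    also have "\<dots> \<le> E * norm (x - x')" by (rule E(2))
    also have "\<dots> \<le> E * norm (x - x') powr \<epsilon>" using E(1) xx \<epsilon> by (intro mult_left_mono powr_le_powr_unit) auto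
    finally show "\<bar>X m (Suc m) x $ l - X m (Suc m) x' $ l\<bar> \<le> E * norm (x - x') powr \<epsilon>" .
  next
    show "has_grad (\<lambda>x. X m (Suc m) x $ l) (\<lambda>i. J i l m (Suc m) x) x" for m x by (rule X_has_grad)
    show "smooth_seq \<epsilon> n' (\<lambda>m. J i l m (Suc m))" for i
      by (rule smooth_seq_of_family[OF smooth_family_J[OF gg(2) order_refl]])
  qed
  have comp: "cont_diff n (\<lambda>\<xi>. \<theta> \<xi> t $ l)" for l
    by (rule smooth_seq_limit[OF assms(3) sm[of l]]) (rule tendsto_vec_nth[OF lim])
  have "cont_diff n (\<lambda>\<xi>. \<Sum>l\<in>UNIV. (\<theta> \<xi> t $ l) *\<^sub>R axis l (1::real))"
    by (intro cont_diff_sum finite cont_diff_bounded_linear[OF bounded_linear_scaleR_left] comp)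
  also have "(\<lambda>\<xi>. \<Sum>l\<in>UNIV. (\<theta> \<xi> t $ l) *\<^sub>R axis l (1::real)) = (\<lambda>\<xi>. \<theta> \<xi> t)"
    using basis_expansion[of "\<theta> _ t"] by (simp add: scalar_mult_eq_scaleR)
  finally show ?thesis .
qed

section \<open>Schwartz functions and the Fourier transform\<close>

definition rapid :: "('a::real_normed_vector \<Rightarrow> complex) \<Rightarrow> bool" where
  "rapid f \<longleftrightarrow> (\<forall>k. \<exists>C. \<forall>x. (1 + norm x) ^ k * norm (f x) \<le> C)"

lemma rapidE:
  assumes "rapid f"
  obtains C where "C \<ge> 0" "\<And>x. (1 + norm x) ^ k * norm (f x) \<le> C"
proof -
  obtain C where "\<And>x. (1 + norm x) ^ k * norm (f x) \<le> C" using assms unfolding rapid_def by blast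
  then show ?thesis using that[of "max C 0"] by (meson le_max_iff_disj max.cobounded2 order_trans)
qed

lemma rapidI: "(\<And>k. \<exists>C. \<forall>x. (1 + norm x) ^ k * norm (f x) \<le> C) \<Longrightarrow> rapid f"
  by (simp add: rapid_def)

lemma rapid_lin:
  assumes "rapid f" "rapid g"
  shows "rapid (\<lambda>x. c * f x + d * g x)"
proof (rule rapidI)
  fix k
  obtain C where C: "\<And>x. (1 + norm x) ^ k * norm (f x) \<le> C" using rapidE[OF assms(1)] by blast
  obtain D where D: "\<And>x. (1 + norm x) ^ k * norm (g x) \<le> D" using rapidE[OF assms(2)] by blast
  have "(1 + norm x) ^ k * norm (c * f x + d * g x) \<le> norm c * C + norm d * D" for x
  proof -
    have "(1 + norm x) ^ k * norm (c * f x + d * g x) \<le> (1 + norm x) ^ k * (norm c * norm (f x) + norm d * norm (g x))"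
      by (intro mult_left_mono) (auto intro!: norm_triangle_le simp: norm_mult)
    also have "\<dots> = norm c * ((1 + norm x) ^ k * norm (f x)) + norm d * ((1 + norm x) ^ k * norm (g x))"
      by (simp add: algebra_simps)
    also have "\<dots> \<le> norm c * C + norm d * D" by (intro add_mono mult_left_mono C D) auto
    finally show ?thesis .
  qed
  then show "\<exists>C. \<forall>x. (1 + norm x) ^ k * norm (c * f x + d * g x) \<le> C" by blast
qed

lemma rapid_le:
  assumes f: "rapid f" and g: "\<And>x. norm (g x) \<le> c * (1 + norm x) ^ m * norm (f x)"
  shows "rapid g"
proof (rule rapidI)
  fix k
  obtain C where C: "\<And>x. (1 + norm x) ^ (k + m) * norm (f x) \<le> C" using rapidE[OF f] by blast
  have "(1 + norm x) ^ k * norm (g x) \<le> \<bar>c\<bar> * C" for x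
  proof -
    have "(1 + norm x) ^ k * norm (g x) \<le> (1 + norm x) ^ k * (\<bar>c\<bar> * (1 + norm x) ^ m * norm (f x))"
      by (intro mult_left_mono order_trans[OF g] mult_right_mono) auto
    also have "\<dots> = \<bar>c\<bar> * ((1 + norm x) ^ (k + m) * norm (f x))" by (simp add: power_add algebra_simps)
    also have "\<dots> \<le> \<bar>c\<bar> * C" by (intro mult_left_mono C) auto
    finally show ?thesis .
  qed
  then show "\<exists>C. \<forall>x. (1 + norm x) ^ k * norm (g x) \<le> C" by blast
qed

definition has_partials :: "('a::euclidean_space \<Rightarrow> complex) \<Rightarrow> ('a \<Rightarrow> 'a \<Rightarrow> complex) \<Rightarrow> bool" where
  "has_partials f g \<longleftrightarrow> (\<forall>x. (f has_derivative (\<lambda>v. \<Sum>b\<in>Basis. (v \<bullet> b) *\<^sub>R g b x)) (at x))"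

text \<open>The Schwartz space is the largest class of rapidly decreasing functions that is closed
  under first partial derivatives. Closure properties are thus proved by exhibiting an invariant set
  of functions, and no formula for iterated derivatives of products or compositions has to be
  written down.\<close>

lemma schwartz_coinduct:
  assumes "\<phi> \<in> S" and rap: "\<And>f. f \<in> S \<Longrightarrow> rapid f"
    and der: "\<And>f. f \<in> S \<Longrightarrow> \<exists>g. has_partials f g \<and> (\<forall>b\<in>Basis. g b \<in> S)"
  shows "\<phi> \<in> schwartz"
proof -
  have cd: "f \<in> S \<Longrightarrow> cont_diff n f" for n f
  proof (induction n arbitrary: f)
    case 0
    then obtain g where "has_partials f g" using der by blast
    then show ?case unfolding has_partials_def cont_diff.simps
      by (meson continuous_at_imp_continuous_on has_derivative_continuous)
  next
    case (Suc n)
    then obtain g where g: "has_partials f g" "\<And>b. b \<in> Basis \<Longrightarrow> g b \<in> S" using der by blast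
    show ?case unfolding cont_diff.simps
    proof (intro exI[of _ "\<lambda>x v. \<Sum>b\<in>Basis. (v \<bullet> b) *\<^sub>R g b x"] conjI allI)
      show "(f has_derivative (\<lambda>v. \<Sum>b\<in>Basis. (v \<bullet> b) *\<^sub>R g b x)) (at x)" for x
        using g by (simp add: has_partials_def)
      show "cont_diff n (\<lambda>x. \<Sum>b\<in>Basis. (v \<bullet> b) *\<^sub>R g b x)" for v
        by (intro cont_diff_sum finite_Basis cont_diff_bounded_linear[OF bounded_linear_scaleR_right] Suc.IH g)
    qed
  qed
  have it: "set vs \<subseteq> Basis \<Longrightarrow> iter_deriv vs \<phi> \<in> S" for vs
  proof (induction vs)
    case Nil then show ?case using assms(1) by simp
  next
    case (Cons b vs)
    then have "iter_deriv vs \<phi> \<in> S" by simp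
    then obtain g where g: "has_partials (iter_deriv vs \<phi>) g" "\<And>b. b \<in> Basis \<Longrightarrow> g b \<in> S" using der by blast
    have "frechet_derivative (iter_deriv vs \<phi>) (at x) b = g b x" for x
    proof -
      have "frechet_derivative (iter_deriv vs \<phi>) (at x) = (\<lambda>v. \<Sum>b\<in>Basis. (v \<bullet> b) *\<^sub>R g b x)"
        using g(1) frechet_derivative_at unfolding has_partials_def by metis
      then show ?thesis using Cons.prems
        by (simp add: inner_Basis if_distrib[of "\<lambda>r. r *\<^sub>R _"] cong: if_cong)
    qed
    then have "iter_deriv (b # vs) \<phi> = g b" by auto
    then show ?case using g Cons.prems by simp
  qed
  have "bounded (range (\<lambda>x. (1 + norm x) ^ k *\<^sub>R iter_deriv vs \<phi> x))" if vs: "set vs \<subseteq> Basis" for vs k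
  proof -
    obtain C where C: "\<And>x. (1 + norm x) ^ k * norm (iter_deriv vs \<phi> x) \<le> C" using rapidE[OF rap[OF it[OF vs]]] by blast
    show ?thesis unfolding bounded_iff using C by (intro exI[of _ C]) (auto simp: norm_power)
  qed
  with cd[OF assms(1)] show ?thesis by (simp add: schwartz_def)
qed

lemma schwartz_rapid: "\<phi> \<in> schwartz \<Longrightarrow> rapid \<phi>"
proof (rule rapidI)
  fix k assume "\<phi> \<in> schwartz"
  then have "\<forall>vs k. set vs \<subseteq> Basis \<longrightarrow> bounded (range (\<lambda>x. (1 + norm x) ^ k *\<^sub>R iter_deriv vs \<phi> x))"
    by (simp add: schwartz_def)
  from this[rule_format, of "[]" k] show "\<exists>C. \<forall>x. (1 + norm x) ^ k * norm (\<phi> x) \<le> C"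
    unfolding bounded_iff by (auto simp: norm_power)
qed

text \<open>Destructor to \<open>schwartz_coinduct\<close>. The derivatives that
  \<open>cont_diff\<close> provides for different orders agree by uniqueness, so a single
  \<open>D\<close> serves all orders. \<open>iter_deriv\<close> differentiates along the last list
  entry first, hence the entry appended at the end.\<close>

lemma schwartz_partials:
  assumes "\<phi> \<in> schwartz"
  obtains g where "has_partials \<phi> g" "\<And>b. b \<in> Basis \<Longrightarrow> g b \<in> schwartz"
proof -
  have cd: "\<And>n. cont_diff n \<phi>" and bd: "\<And>vs k. set vs \<subseteq> Basis \<Longrightarrow> bounded (range (\<lambda>x. (1 + norm x) ^ k *\<^sub>R iter_deriv vs \<phi> x))"
    using assms by (auto simp: schwartz_def)
  define D where "D x = frechet_derivative \<phi> (at x)" for x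
  have D: "(\<phi> has_derivative D x) (at x)" for x
  proof -
    have "cont_diff (Suc 0) \<phi>" by (rule cd)
    then have "\<phi> differentiable at x" unfolding cont_diff.simps differentiable_def by blast
    then show ?thesis by (simp add: D_def flip: frechet_derivative_works)
  qed
  have Dn: "cont_diff n (\<lambda>x. D x v)" for n v
  proof -
    have "cont_diff (Suc n) \<phi>" by (rule cd)
    then obtain f' where f': "\<And>x. (\<phi> has_derivative f' x) (at x)" "\<And>v. cont_diff n (\<lambda>x. f' x v)" by auto
    have "f' x = D x" for x using has_derivative_unique[OF f'(1) D] .
    then show ?thesis using f'(2)[of v] by simp
  qed
  have it: "iter_deriv vs (\<lambda>x. D x b) = iter_deriv (vs @ [b]) \<phi>" for vs b
    by (induction vs) (simp_all add: D_def)
  show ?thesis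
  proof (rule that[of "\<lambda>b x. D x b"])
    show "has_partials \<phi> (\<lambda>b x. D x b)"
      unfolding has_partials_def
    proof
      fix x
      interpret bounded_linear "D x" using D by (rule has_derivative_bounded_linear)
      have "D x = (\<lambda>v. \<Sum>b\<in>Basis. (v \<bullet> b) *\<^sub>R D x b)"
        by (rule ext) (metis (no_types, lifting) euclidean_representation scale sum sum.cong)
      then show "(\<phi> has_derivative (\<lambda>v. \<Sum>b\<in>Basis. (v \<bullet> b) *\<^sub>R D x b)) (at x)" using D[of x] by simp
    qed
    show "(\<lambda>x. D x b) \<in> schwartz" if "b \<in> Basis" for b
      using Dn that unfolding schwartz_def by (auto simp: it intro!: bd)
  qed
qed

lemma schwartz_continuous: "\<phi> \<in> schwartz \<Longrightarrow> continuous_on UNIV \<phi>"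
  using cont_diff.simps(1)[of \<phi>] by (simp add: schwartz_def del: cont_diff.simps)

lemma schwartz_measurable [measurable_dest]: "\<phi> \<in> schwartz \<Longrightarrow> \<phi> \<in> borel_measurable borel"
  by (intro borel_measurable_continuous_onI schwartz_continuous)

lemma schwartz_lin:
  assumes "\<phi> \<in> schwartz" "\<zeta> \<in> schwartz"
  shows "(\<lambda>x. c * \<phi> x + d * \<zeta> x) \<in> schwartz"
proof (rule schwartz_coinduct[of _ "{f. \<exists>\<phi>\<in>schwartz. \<exists>\<zeta>\<in>schwartz. f = (\<lambda>x. c * \<phi> x + d * \<zeta> x)}"])
  fix f assume "f \<in> {f. \<exists>\<phi>\<in>schwartz. \<exists>\<zeta>\<in>schwartz. f = (\<lambda>x. c * \<phi> x + d * \<zeta> x)}"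
  then obtain \<phi> \<zeta> where f: "\<phi> \<in> schwartz" "\<zeta> \<in> schwartz" "f = (\<lambda>x. c * \<phi> x + d * \<zeta> x)" by auto
  show "rapid f" unfolding f(3) by (intro rapid_lin schwartz_rapid f)
  obtain g where g: "has_partials \<phi> g" "\<And>b. b \<in> Basis \<Longrightarrow> g b \<in> schwartz" using schwartz_partials[OF f(1)] by blast
  obtain h where h: "has_partials \<zeta> h" "\<And>b. b \<in> Basis \<Longrightarrow> h b \<in> schwartz" using schwartz_partials[OF f(2)] by blast
  show "\<exists>g. has_partials f g \<and> (\<forall>b\<in>Basis. g b \<in> {f. \<exists>\<phi>\<in>schwartz. \<exists>\<zeta>\<in>schwartz. f = (\<lambda>x. c * \<phi> x + d * \<zeta> x)})"
  proof (intro exI[of _ "\<lambda>b x. c * g b x + d * h b x"] conjI ballI)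
    show "has_partials f (\<lambda>b x. c * g b x + d * h b x)" unfolding has_partials_def f(3)
    proof
      fix x
      have "((\<lambda>x. c * \<phi> x + d * \<zeta> x) has_derivative (\<lambda>v. c * (\<Sum>b\<in>Basis. (v \<bullet> b) *\<^sub>R g b x) + d * (\<Sum>b\<in>Basis. (v \<bullet> b) *\<^sub>R h b x))) (at x)"
        using g(1) h(1) unfolding has_partials_def by (intro has_derivative_add has_derivative_mult_right) auto
      then show "((\<lambda>x. c * \<phi> x + d * \<zeta> x) has_derivative (\<lambda>v. \<Sum>b\<in>Basis. (v \<bullet> b) *\<^sub>R (c * g b x + d * h b x))) (at x)"
        by (rule has_derivative_eq_rhs) (simp add: fun_eq_iff sum_distrib_left scaleR_add_right sum.distrib)
    qed
  qed (use g h in blast)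
qed (use assms in blast)

lemma schwartz_add: "\<phi> \<in> schwartz \<Longrightarrow> \<zeta> \<in> schwartz \<Longrightarrow> (\<lambda>x. \<phi> x + \<zeta> x) \<in> schwartz"
  using schwartz_lin[of \<phi> \<zeta> 1 1] by simp

lemma schwartz_cmult: "\<phi> \<in> schwartz \<Longrightarrow> (\<lambda>x. c * \<phi> x) \<in> schwartz"
  using schwartz_lin[of \<phi> \<phi> c 0] by simp

lemma schwartz_affine:
  fixes \<phi> :: "'a::euclidean_space \<Rightarrow> complex"
  assumes "\<phi> \<in> schwartz" "\<bar>\<sigma>\<bar> = 1"
  shows "(\<lambda>x. \<phi> (\<sigma> *\<^sub>R x + a)) \<in> schwartz"
proof (rule schwartz_coinduct[of _ "{f. \<exists>\<phi>\<in>schwartz. f = (\<lambda>x. \<phi> (\<sigma> *\<^sub>R x + a))}"])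
  fix f :: "'a \<Rightarrow> complex" assume "f \<in> {f. \<exists>\<phi>\<in>schwartz. f = (\<lambda>x. \<phi> (\<sigma> *\<^sub>R x + a))}"
  then obtain \<phi> where f: "\<phi> \<in> schwartz" "f = (\<lambda>x. \<phi> (\<sigma> *\<^sub>R x + a))" by auto
  show "rapid f"
  proof (rule rapidI)
    fix k
    obtain C where C: "C \<ge> 0" "\<And>x. (1 + norm x) ^ k * norm (\<phi> x) \<le> C" using rapidE[OF schwartz_rapid[OF f(1)]] by blast
    have "(1 + norm x) ^ k * norm (f x) \<le> (1 + norm a) ^ k * C" for x
    proof -
      have "norm x = norm (\<sigma> *\<^sub>R x)" using assms(2) by simp
      also have "\<dots> \<le> norm (\<sigma> *\<^sub>R x + a) + norm a" by (metis add_diff_cancel_right' norm_triangle_ineq4)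
      finally have "1 + norm x \<le> (1 + norm a) * (1 + norm (\<sigma> *\<^sub>R x + a))" 
        using mult_nonneg_nonneg[OF norm_ge_zero[of a] norm_ge_zero[of "\<sigma> *\<^sub>R x + a"]]
        unfolding distrib_left distrib_right mult_1_left mult_1_right by linarith
      then have "(1 + norm x) ^ k \<le> (1 + norm a) ^ k * (1 + norm (\<sigma> *\<^sub>R x + a)) ^ k"
        unfolding power_mult_distrib[symmetric] by (intro power_mono) auto
      then have "(1 + norm x) ^ k * norm (f x) \<le> (1 + norm a) ^ k * (1 + norm (\<sigma> *\<^sub>R x + a)) ^ k * norm (f x)"
        by (intro mult_right_mono) auto
      also have "\<dots> \<le> (1 + norm a) ^ k * C"
        unfolding mult.assoc f(2) by (intro mult_left_mono C) auto
      finally show ?thesis .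
    qed
    then show "\<exists>C. \<forall>x. (1 + norm x) ^ k * norm (f x) \<le> C" by blast
  qed
  obtain g where g: "has_partials \<phi> g" "\<And>b. b \<in> Basis \<Longrightarrow> g b \<in> schwartz" using schwartz_partials[OF f(1)] by blast
  show "\<exists>g. has_partials f g \<and> (\<forall>b\<in>Basis. g b \<in> {f. \<exists>\<phi>\<in>schwartz. f = (\<lambda>x. \<phi> (\<sigma> *\<^sub>R x + a))})"
  proof (intro exI[of _ "\<lambda>b x. \<sigma> * g b (\<sigma> *\<^sub>R x + a)"] conjI ballI)
    show "has_partials f (\<lambda>b x. \<sigma> * g b (\<sigma> *\<^sub>R x + a))" unfolding has_partials_def f(2)
    proof
      fix x
      have 1: "((\<lambda>x. \<sigma> *\<^sub>R x + a) has_derivative (\<lambda>v. \<sigma> *\<^sub>R v)) (at x)" by (auto intro!: derivative_eq_intros)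
      have "((\<lambda>x. \<phi> (\<sigma> *\<^sub>R x + a)) has_derivative (\<lambda>v. \<Sum>b\<in>Basis. ((\<sigma> *\<^sub>R v) \<bullet> b) *\<^sub>R g b (\<sigma> *\<^sub>R x + a))) (at x)"
        by (rule has_derivative_compose[OF 1]) (use g(1) in \<open>simp add: has_partials_def\<close>)
      then show "((\<lambda>x. \<phi> (\<sigma> *\<^sub>R x + a)) has_derivative (\<lambda>v. \<Sum>b\<in>Basis. (v \<bullet> b) *\<^sub>R (\<sigma> * g b (\<sigma> *\<^sub>R x + a)))) (at x)"
        by (rule has_derivative_eq_rhs) (simp add: fun_eq_iff scaleR_conv_of_real mult_ac)
    qed
    fix b :: 'a assume "b \<in> Basis"
    then have "(\<lambda>x. \<sigma> * g b x) \<in> schwartz" using schwartz_cmult g(2) by blast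
    then show "(\<lambda>x. \<sigma> * g b (\<sigma> *\<^sub>R x + a)) \<in> {f. \<exists>\<phi>\<in>schwartz. f = (\<lambda>x. \<phi> (\<sigma> *\<^sub>R x + a))}" by force
  qed
qed (use assms in blast)

lemma schwartz_shift: "\<phi> \<in> schwartz \<Longrightarrow> (\<lambda>x. \<phi> (x + a)) \<in> schwartz"
  using schwartz_affine[of \<phi> 1 a] by simp

lemma schwartz_uminus: "\<phi> \<in> schwartz \<Longrightarrow> (\<lambda>x. \<phi> (- x)) \<in> schwartz"
  using schwartz_affine[of \<phi> "-1" 0] by simp

lemma schwartz_cnj:
  fixes \<phi> :: "'a::euclidean_space \<Rightarrow> complex"
  assumes "\<phi> \<in> schwartz"
  shows "(\<lambda>x. cnj (\<phi> x)) \<in> schwartz"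
proof (rule schwartz_coinduct[of _ "{f. \<exists>\<phi>\<in>schwartz. f = (\<lambda>x. cnj (\<phi> x))}"])
  fix f :: "'a \<Rightarrow> complex" assume "f \<in> {f. \<exists>\<phi>\<in>schwartz. f = (\<lambda>x. cnj (\<phi> x))}"
  then obtain \<phi> where f: "\<phi> \<in> schwartz" "f = (\<lambda>x. cnj (\<phi> x))" by auto
  show "rapid f" using schwartz_rapid[OF f(1)] unfolding f(2) rapid_def by simp
  obtain g where g: "has_partials \<phi> g" "\<And>b. b \<in> Basis \<Longrightarrow> g b \<in> schwartz" using schwartz_partials[OF f(1)] by blast
  show "\<exists>g. has_partials f g \<and> (\<forall>b\<in>Basis. g b \<in> {f. \<exists>\<phi>\<in>schwartz. f = (\<lambda>x. cnj (\<phi> x))})"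
  proof (intro exI[of _ "\<lambda>b x. cnj (g b x)"] conjI ballI)
    show "has_partials f (\<lambda>b x. cnj (g b x))" unfolding has_partials_def f(2)
    proof
      fix x
      have "((\<lambda>x. cnj (\<phi> x)) has_derivative (\<lambda>v. cnj (\<Sum>b\<in>Basis. (v \<bullet> b) *\<^sub>R g b x))) (at x)"
        by (rule bounded_linear.has_derivative[OF bounded_linear_cnj]) (use g(1) in \<open>simp add: has_partials_def\<close>)
      then show "((\<lambda>x. cnj (\<phi> x)) has_derivative (\<lambda>v. \<Sum>b\<in>Basis. (v \<bullet> b) *\<^sub>R cnj (g b x))) (at x)"
        by (rule has_derivative_eq_rhs) (simp add: fun_eq_iff)
    qed
  qed (use g in blast)
qed (use assms in blast)

lemma inner_sum_Basis: "(\<Sum>b\<in>Basis. (v \<bullet> b) * (b \<bullet> w)) = v \<bullet> (w :: 'a::euclidean_space)"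
  by (simp add: euclidean_inner[of v w] inner_commute)

lemma schwartz_modulate:
  fixes \<phi> :: "'a::euclidean_space \<Rightarrow> complex"
  assumes "\<phi> \<in> schwartz"
  shows "(\<lambda>x. exp (\<i> * of_real (x \<bullet> w)) * \<phi> x) \<in> schwartz"
proof (rule schwartz_coinduct[of _ "{f. \<exists>\<phi>\<in>schwartz. f = (\<lambda>x. exp (\<i> * of_real (x \<bullet> w)) * \<phi> x)}"])
  fix f :: "'a \<Rightarrow> complex" assume "f \<in> {f. \<exists>\<phi>\<in>schwartz. f = (\<lambda>x. exp (\<i> * of_real (x \<bullet> w)) * \<phi> x)}"
  then obtain \<phi> where f: "\<phi> \<in> schwartz" "f = (\<lambda>x. exp (\<i> * of_real (x \<bullet> w)) * \<phi> x)" by auto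
  show "rapid f" using schwartz_rapid[OF f(1)] unfolding f(2) rapid_def by (simp add: norm_mult)
  obtain g where g: "has_partials \<phi> g" "\<And>b. b \<in> Basis \<Longrightarrow> g b \<in> schwartz" using schwartz_partials[OF f(1)] by blast
  let ?e = "\<lambda>x. exp (\<i> * of_real (x \<bullet> w))"
  show "\<exists>g. has_partials f g \<and> (\<forall>b\<in>Basis. g b \<in> {f. \<exists>\<phi>\<in>schwartz. f = (\<lambda>x. ?e x * \<phi> x)})"
  proof (intro exI[of _ "\<lambda>b x. ?e x * (\<i> * of_real (b \<bullet> w) * \<phi> x + 1 * g b x)"] conjI ballI)
    show "has_partials f (\<lambda>b x. ?e x * (\<i> * of_real (b \<bullet> w) * \<phi> x + 1 * g b x))" unfolding has_partials_def f(2)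
    proof
      fix x
      have 1: "(?e has_derivative (\<lambda>v. ?e x * (\<i> * of_real (v \<bullet> w)))) (at x)"
      proof -
        have "((\<lambda>x. \<i> * of_real (x \<bullet> w)) has_derivative (\<lambda>v. \<i> * of_real (v \<bullet> w))) (at x)"
          by (auto intro!: derivative_eq_intros)
        from has_derivative_compose[OF this DERIV_exp[unfolded has_field_derivative_def]] show ?thesis by simp
      qed
      have "((\<lambda>x. ?e x * \<phi> x) has_derivative (\<lambda>v. ?e x * (\<Sum>b\<in>Basis. (v \<bullet> b) *\<^sub>R g b x) + ?e x * (\<i> * of_real (v \<bullet> w)) * \<phi> x)) (at x)"
        by (rule has_derivative_mult[OF 1]) (use g(1) in \<open>simp add: has_partials_def\<close>)
      then show "((\<lambda>x. ?e x * \<phi> x) has_derivative (\<lambda>v. \<Sum>b\<in>Basis. (v \<bullet> b) *\<^sub>R (?e x * (\<i> * of_real (b \<bullet> w) * \<phi> x + 1 * g b x)))) (at x)"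
      proof (rule has_derivative_eq_rhs, intro ext)
        fix v
        have "(\<Sum>b\<in>Basis. (v \<bullet> b) *\<^sub>R (?e x * (\<i> * of_real (b \<bullet> w) * \<phi> x + 1 * g b x)))
          = (\<Sum>b\<in>Basis. ?e x * \<i> * \<phi> x * of_real ((v \<bullet> b) * (b \<bullet> w)) + ?e x * ((v \<bullet> b) *\<^sub>R g b x))"
          by (intro sum.cong refl) (simp add: scaleR_conv_of_real algebra_simps)
        also have "\<dots> = ?e x * \<i> * \<phi> x * of_real (v \<bullet> w) + ?e x * (\<Sum>b\<in>Basis. (v \<bullet> b) *\<^sub>R g b x)"
          unfolding sum.distrib sum_distrib_left[symmetric] of_real_sum[symmetric] inner_sum_Basis ..
        finally show "?e x * (\<Sum>b\<in>Basis. (v \<bullet> b) *\<^sub>R g b x) + ?e x * (\<i> * of_real (v \<bullet> w)) * \<phi> x =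
          (\<Sum>b\<in>Basis. (v \<bullet> b) *\<^sub>R (?e x * (\<i> * of_real (b \<bullet> w) * \<phi> x + 1 * g b x)))" by (simp add: mult_ac)
      qed
    qed
    fix b :: 'a assume "b \<in> Basis"
    from schwartz_lin[OF f(1) g(2)[OF this]]
    have "(\<lambda>x. \<i> * of_real (b \<bullet> w) * \<phi> x + 1 * g b x) \<in> schwartz" .
    then show "(\<lambda>x. ?e x * (\<i> * of_real (b \<bullet> w) * \<phi> x + 1 * g b x)) \<in> {f. \<exists>\<phi>\<in>schwartz. f = (\<lambda>x. ?e x * \<phi> x)}"
      by (intro CollectI bexI[of _ "\<lambda>x. \<i> * of_real (b \<bullet> w) * \<phi> x + 1 * g b x"] refl)
  qed
qed (use assms in blast)

text \<open>Products of x \<bullet> w with a Schwartz function are not by themselves invariant under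
  derivatives, since the product rule releases a term without the factor. The invariant set
  therefore consists of sums of such a product and a second Schwartz function.\<close>

lemma schwartz_mult_inner:
  fixes \<phi> :: "'a::euclidean_space \<Rightarrow> complex"
  assumes "\<phi> \<in> schwartz"
  shows "(\<lambda>x. of_real (x \<bullet> w) * \<phi> x) \<in> schwartz"
proof -
  define S where "S = {f. \<exists>\<phi>\<in>schwartz. \<exists>\<zeta>\<in>schwartz. f = (\<lambda>x. of_real (x \<bullet> w) * \<phi> x + \<zeta> x)}"
  have "(\<lambda>x. of_real (x \<bullet> w) * \<phi> x + 0 * \<phi> x) \<in> schwartz"
  proof (rule schwartz_coinduct[of _ S])
    show "(\<lambda>x. of_real (x \<bullet> w) * \<phi> x + 0 * \<phi> x) \<in> S"
      unfolding S_def using assms schwartz_cmult[OF assms, of 0]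
      by (intro CollectI bexI[of _ \<phi>] bexI[of _ "\<lambda>x. 0 * \<phi> x"]) auto
    fix f :: "'a \<Rightarrow> complex" assume "f \<in> S"
    then obtain \<phi> \<zeta> where f: "\<phi> \<in> schwartz" "\<zeta> \<in> schwartz" "f = (\<lambda>x. of_real (x \<bullet> w) * \<phi> x + \<zeta> x)" by (auto simp: S_def)
    have "rapid (\<lambda>x. of_real (x \<bullet> w) * \<phi> x)"
    proof (rule rapid_le[OF schwartz_rapid[OF f(1)], where m=1 and c="norm w"])
      fix x
      have "\<bar>x \<bullet> w\<bar> \<le> norm w * (1 + norm x)" using Cauchy_Schwarz_ineq2[of x w] by (simp add: algebra_simps add_increasing)
      then have "\<bar>x \<bullet> w\<bar> * norm (\<phi> x) \<le> norm w * (1 + norm x) * norm (\<phi> x)" by (intro mult_right_mono) auto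
      then show "norm (complex_of_real (x \<bullet> w) * \<phi> x) \<le> norm w * (1 + norm x) ^ 1 * norm (\<phi> x)"
        by (simp add: norm_mult)
    qed
    from rapid_lin[OF this schwartz_rapid[OF f(2)], of 1 1] show "rapid f" by (simp add: f(3))
    obtain g where g: "has_partials \<phi> g" "\<And>b. b \<in> Basis \<Longrightarrow> g b \<in> schwartz" using schwartz_partials[OF f(1)] by blast
    obtain h where h: "has_partials \<zeta> h" "\<And>b. b \<in> Basis \<Longrightarrow> h b \<in> schwartz" using schwartz_partials[OF f(2)] by blast
    show "\<exists>g. has_partials f g \<and> (\<forall>b\<in>Basis. g b \<in> S)"
    proof (intro exI[of _ "\<lambda>b x. of_real (x \<bullet> w) * g b x + (of_real (b \<bullet> w) * \<phi> x + 1 * h b x)"] conjI ballI)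
      show "has_partials f (\<lambda>b x. of_real (x \<bullet> w) * g b x + (of_real (b \<bullet> w) * \<phi> x + 1 * h b x))" unfolding has_partials_def f(3)
      proof
        fix x
        have 1: "((\<lambda>x. complex_of_real (x \<bullet> w)) has_derivative (\<lambda>v. of_real (v \<bullet> w))) (at x)"
          by (auto intro!: derivative_eq_intros)
        have "((\<lambda>x. of_real (x \<bullet> w) * \<phi> x + \<zeta> x) has_derivative (\<lambda>v. (of_real (x \<bullet> w) * (\<Sum>b\<in>Basis. (v \<bullet> b) *\<^sub>R g b x) + of_real (v \<bullet> w) * \<phi> x) + (\<Sum>b\<in>Basis. (v \<bullet> b) *\<^sub>R h b x))) (at x)"
          by (intro has_derivative_add has_derivative_mult 1) (use g(1) h(1) in \<open>simp_all add: has_partials_def\<close>)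
        then show "((\<lambda>x. of_real (x \<bullet> w) * \<phi> x + \<zeta> x) has_derivative (\<lambda>v. \<Sum>b\<in>Basis. (v \<bullet> b) *\<^sub>R (of_real (x \<bullet> w) * g b x + (of_real (b \<bullet> w) * \<phi> x + 1 * h b x)))) (at x)"
        proof (rule has_derivative_eq_rhs, intro ext)
          fix v
          have "(\<Sum>b\<in>Basis. (v \<bullet> b) *\<^sub>R (of_real (x \<bullet> w) * g b x + (of_real (b \<bullet> w) * \<phi> x + 1 * h b x)))
            = (\<Sum>b\<in>Basis. of_real (x \<bullet> w) * ((v \<bullet> b) *\<^sub>R g b x) + \<phi> x * of_real ((v \<bullet> b) * (b \<bullet> w)) + (v \<bullet> b) *\<^sub>R h b x)"
            by (intro sum.cong refl) (simp add: scaleR_conv_of_real algebra_simps)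
          also have "\<dots> = of_real (x \<bullet> w) * (\<Sum>b\<in>Basis. (v \<bullet> b) *\<^sub>R g b x) + \<phi> x * of_real (v \<bullet> w) + (\<Sum>b\<in>Basis. (v \<bullet> b) *\<^sub>R h b x)"
            unfolding sum.distrib sum_distrib_left[symmetric] of_real_sum[symmetric] inner_sum_Basis ..
          finally show "(of_real (x \<bullet> w) * (\<Sum>b\<in>Basis. (v \<bullet> b) *\<^sub>R g b x) + of_real (v \<bullet> w) * \<phi> x) + (\<Sum>b\<in>Basis. (v \<bullet> b) *\<^sub>R h b x) =
            (\<Sum>b\<in>Basis. (v \<bullet> b) *\<^sub>R (of_real (x \<bullet> w) * g b x + (of_real (b \<bullet> w) * \<phi> x + 1 * h b x)))" by (simp add: mult_ac)
        qed
      qed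
      fix b :: 'a assume b: "b \<in> Basis"
      from schwartz_lin[OF f(1) h(2)[OF b]]
      have "(\<lambda>x. of_real (b \<bullet> w) * \<phi> x + 1 * h b x) \<in> schwartz" .
      with g(2)[OF b] show "(\<lambda>x. of_real (x \<bullet> w) * g b x + (of_real (b \<bullet> w) * \<phi> x + 1 * h b x)) \<in> S"
        unfolding S_def by (intro CollectI bexI[of _ "g b"] bexI[of _ "\<lambda>x. of_real (b \<bullet> w) * \<phi> x + 1 * h b x"] refl)
    qed
  qed
  then show ?thesis by simp
qed

text \<open>Smooth functions vanishing outside a fixed ball form an invariant set: off the closed
  ball such a function is locally 0, and so is its derivative. Rapid decay is boundedness of a
  continuous function on the ball.\<close>

lemma schwartz_compact_support:
  fixes \<phi> :: "'a::euclidean_space \<Rightarrow> complex"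
  assumes "\<And>n. cont_diff n \<phi>" "\<And>x. \<phi> x \<noteq> 0 \<Longrightarrow> norm x \<le> R"
  shows "\<phi> \<in> schwartz"
proof (rule schwartz_coinduct[of _ "{f. (\<forall>n. cont_diff n f) \<and> (\<forall>x. f x \<noteq> 0 \<longrightarrow> norm x \<le> R)}"])
  fix f :: "'a \<Rightarrow> complex" assume "f \<in> {f. (\<forall>n. cont_diff n f) \<and> (\<forall>x. f x \<noteq> 0 \<longrightarrow> norm x \<le> R)}"
  then have f: "\<And>n. cont_diff n f" "\<And>x. f x \<noteq> 0 \<Longrightarrow> norm x \<le> R" by auto
  have cf: "continuous_on UNIV f" using f(1)[of 0] by simp
  show "rapid f"
  proof (rule rapidI)
    fix k
    have "compact ((\<lambda>x. (1 + norm x) ^ k * norm (f x)) ` cball 0 R)"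
      by (intro compact_continuous_image continuous_intros continuous_on_subset[OF cf]) auto
    then obtain C where C: "\<And>x. x \<in> cball 0 R \<Longrightarrow> (1 + norm x) ^ k * norm (f x) \<le> C"
      by (meson bounded_imp_bdd_above compact_imp_bounded bdd_above.unfold image_eqI)
    have "(1 + norm x) ^ k * norm (f x) \<le> max C 0" for x
      using C[of x] f(2)[of x] by (cases "f x = 0") auto
    then show "\<exists>C. \<forall>x. (1 + norm x) ^ k * norm (f x) \<le> C" by blast
  qed
  define D where "D x = frechet_derivative f (at x)" for x
  have D: "(f has_derivative D x) (at x)" for x
  proof -
    have "cont_diff (Suc 0) f" by (rule f)
    then have "f differentiable at x" unfolding cont_diff.simps differentiable_def by blast
    then show ?thesis by (simp add: D_def flip: frechet_derivative_works)
  qed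
  have Dn: "cont_diff n (\<lambda>x. D x v)" for n v
  proof -
    have "cont_diff (Suc n) f" by (rule f)
    then obtain f' where f': "\<And>x. (f has_derivative f' x) (at x)" "\<And>v. cont_diff n (\<lambda>x. f' x v)" by auto
    have "f' x = D x" for x using has_derivative_unique[OF f'(1) D] .
    then show ?thesis using f'(2)[of v] by simp
  qed
  have D0: "D x v = 0" if "norm x > R" for x v
  proof -
    have "(f has_derivative (\<lambda>_. 0)) (at x)"
    proof (rule has_derivative_transform_within_open[where f="\<lambda>_. 0" and s="- cball 0 R"])
      show "0 = f y" if "y \<in> - cball 0 R" for y using f(2)[of y] that by auto
    qed (use that in auto)
    then have "D x = (\<lambda>_. 0)" using D has_derivative_unique by blast
    then show ?thesis by simp
  qed
  show "\<exists>g. has_partials f g \<and> (\<forall>b\<in>Basis. g b \<in> {f. (\<forall>n. cont_diff n f) \<and> (\<forall>x. f x \<noteq> 0 \<longrightarrow> norm x \<le> R)})"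
  proof (intro exI[of _ "\<lambda>b x. D x b"] conjI ballI)
    show "has_partials f (\<lambda>b x. D x b)"
      unfolding has_partials_def
    proof
      fix x
      interpret bounded_linear "D x" using D by (rule has_derivative_bounded_linear)
      have "D x = (\<lambda>v. \<Sum>b\<in>Basis. (v \<bullet> b) *\<^sub>R D x b)"
        by (rule ext) (metis (no_types, lifting) euclidean_representation scale sum sum.cong)
      then show "(f has_derivative (\<lambda>v. \<Sum>b\<in>Basis. (v \<bullet> b) *\<^sub>R D x b)) (at x)" using D[of x] by simp
    qed
    show "(\<lambda>x. D x b) \<in> {f. (\<forall>n. cont_diff n f) \<and> (\<forall>x. f x \<noteq> 0 \<longrightarrow> norm x \<le> R)}" for b
      using Dn D0 by (auto simp: not_le[symmetric])
  qed
qed (use assms in blast)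

section \<open>Integration on Euclidean spaces\<close>

lemma lborel_integral_prod:
  fixes f :: "'a::euclidean_space \<Rightarrow> real \<Rightarrow> 'b::{real_normed_field, banach, second_countable_topology}"
  assumes "\<And>b. b \<in> Basis \<Longrightarrow> integrable lborel (f b)"
  shows "integrable lborel (\<lambda>x::'a. \<Prod>b\<in>Basis. f b (x \<bullet> b))"
    and "(LINT x|lborel. (\<Prod>b\<in>Basis. f b (x \<bullet> b))) = (\<Prod>b\<in>Basis. LINT x|lborel. f b x)"
proof -
  interpret product_sigma_finite "\<lambda>_::'a. lborel :: real measure" ..
  let ?T = "\<lambda>f. \<Sum>b\<in>Basis. f b *\<^sub>R b :: 'a"
  have meas [measurable]: "f b \<in> borel_measurable borel" if "b \<in> Basis" for b
    using borel_measurable_integrable[OF assms[OF that]] by simp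
  have T: "?T \<in> (\<Pi>\<^sub>M b\<in>(Basis::'a set). lborel) \<rightarrow>\<^sub>M borel" by measurable
  have m: "(\<lambda>x::'a. \<Prod>b\<in>Basis. f b (x \<bullet> b)) \<in> borel_measurable borel" by measurable
  have comp: "(\<Prod>b\<in>Basis. f b (?T x \<bullet> b)) = (\<Prod>b\<in>Basis. f b (x b))" for x
    by (intro prod.cong refl) (simp add: inner_sum_left inner_Basis if_distrib cong: if_cong)
  show "integrable lborel (\<lambda>x::'a. \<Prod>b\<in>Basis. f b (x \<bullet> b))"
    by (subst lborel_eq, subst integrable_distr_eq[OF T m], unfold comp)
       (intro product_integrable_prod assms finite_Basis)
  show "(LINT x|lborel. (\<Prod>b\<in>Basis. f b (x \<bullet> b))) = (\<Prod>b\<in>Basis. LINT x|lborel. f b x)"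
    by (subst lborel_eq, subst integral_distr[OF T m], unfold comp)
       (intro product_integral_prod assms finite_Basis)
qed

text \<open>Integrable majorant for rapid decay. The product form reduces integrability to the
  one-dimensional 1 / (1 + s^2), and since each 1 + (x \<bullet> b)^2 is at most (1 + norm x)^2,
  decay of order 2 * DIM('a) suffices for comparison.\<close>

definition poly_weight :: "'a::euclidean_space \<Rightarrow> real" where
  "poly_weight x = (\<Prod>b\<in>Basis. inverse (1 + (x \<bullet> b)\<^sup>2))"

lemma integrable_poly_weight: "integrable lborel (poly_weight :: 'a::euclidean_space \<Rightarrow> real)"
proof -
  have "integrable lborel (\<lambda>x::real. inverse (1 + x\<^sup>2))"
    using integrable_inverse_1_plus_square by (simp add: set_integrable_def einterval_def)
  then show ?thesis unfolding poly_weight_def[abs_def] by (intro lborel_integral_prod)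
qed

lemma poly_weight_nonneg: "0 \<le> poly_weight x"
  unfolding poly_weight_def by (intro prod_nonneg) (simp add: add_nonneg_nonneg)

lemma poly_weight_bound:
  fixes x :: "'a::euclidean_space"
  assumes "(1 + norm x) ^ (2 * DIM('a)) * r \<le> C" "0 \<le> r"
  shows "r \<le> C * poly_weight x"
proof -
  have 1: "1 \<le> (1 + norm x) ^ (2 * DIM('a)) * poly_weight x"
  proof -
    have "(\<Prod>b\<in>(Basis::'a set). 1) \<le> (\<Prod>b\<in>(Basis::'a set). (1 + norm x)\<^sup>2 * inverse (1 + (x \<bullet> b)\<^sup>2))"
    proof (intro prod_mono conjI)
      fix b :: 'a assume b: "b \<in> Basis"
      have "(x \<bullet> b)\<^sup>2 \<le> (norm x)\<^sup>2" using Basis_le_norm[OF b, of x] by (metis abs_le_square_iff abs_norm_cancel)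
      then have "1 + (x \<bullet> b)\<^sup>2 \<le> (1 + norm x)\<^sup>2" by (simp add: power2_sum add_increasing2)
      then show "1 \<le> (1 + norm x)\<^sup>2 * inverse (1 + (x \<bullet> b)\<^sup>2)"
        by (simp add: divide_inverse[symmetric] le_divide_eq add_pos_nonneg)
    qed simp
    then show ?thesis by (simp add: poly_weight_def prod.distrib power_mult)
  qed
  have "r \<le> r * ((1 + norm x) ^ (2 * DIM('a)) * poly_weight x)" using mult_left_mono[OF 1 assms(2)] by simp
  also have "\<dots> = ((1 + norm x) ^ (2 * DIM('a)) * r) * poly_weight x" by simp
  also have "\<dots> \<le> C * poly_weight x" by (intro mult_right_mono assms poly_weight_nonneg)
  finally show ?thesis .
qed

lemma rapid_integrable_power:
  fixes f :: "'a::euclidean_space \<Rightarrow> complex"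
  assumes f: "rapid f" and m [measurable]: "f \<in> borel_measurable borel"
  shows "integrable lborel (\<lambda>x. (1 + norm x) ^ k * norm (f x))"
proof -
  obtain C where C: "C \<ge> 0" "\<And>x. (1 + norm x) ^ (2 * DIM('a) + k) * norm (f x) \<le> C" using rapidE[OF f] by blast
  show ?thesis
  proof (rule Bochner_Integration.integrable_bound)
    show "integrable lborel (\<lambda>x. C * poly_weight x :: real)" by (intro integrable_mult_right integrable_poly_weight)
    show "AE x in lborel. norm ((1 + norm x) ^ k * norm (f x)) \<le> norm (C * poly_weight x)"
    proof (rule AE_I2)
      fix x :: 'a
      have "(1 + norm x) ^ k * norm (f x) \<le> C * poly_weight x"
        by (rule poly_weight_bound) (use C(2)[of x] in \<open>simp_all add: power_add mult.assoc\<close>)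
      then show "norm ((1 + norm x) ^ k * norm (f x)) \<le> norm (C * poly_weight x)"
        using C(1) poly_weight_nonneg[of x] by (simp add: abs_mult)
    qed
  qed simp
qed

lemma schwartz_integrable_power:
  "\<phi> \<in> schwartz \<Longrightarrow> integrable lborel (\<lambda>x. (1 + norm x) ^ k * norm (\<phi> x))"
  by (intro rapid_integrable_power schwartz_rapid schwartz_measurable)

lemma schwartz_integrable: "\<phi> \<in> schwartz \<Longrightarrow> integrable lborel \<phi>"
  using schwartz_integrable_power[of \<phi> 0] schwartz_measurable[of \<phi>]
  by (simp add: integrable_norm_iff)

lemma lborel_affine_integrable:
  fixes f :: "'a::euclidean_space \<Rightarrow> 'b::{banach, second_countable_topology}"
  assumes f: "integrable lborel f" and c: "c \<noteq> 0"
  shows "integrable lborel (\<lambda>x. f (t + c *\<^sub>R x))"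
proof -
  have m: "f \<in> borel_measurable borel" using borel_measurable_integrable[OF f] by simp
  have T: "(\<lambda>x. t + c *\<^sub>R x) \<in> lborel \<rightarrow>\<^sub>M (borel :: 'a measure)" by simp
  have "integrable (density (distr lborel borel (\<lambda>x. t + c *\<^sub>R x)) (\<lambda>_. ennreal (\<bar>c\<bar> ^ DIM('a)))) f"
    using f lborel_affine[OF c, of t] by simp
  then have "integrable (distr lborel borel (\<lambda>x. t + c *\<^sub>R x)) (\<lambda>x. (\<bar>c\<bar> ^ DIM('a)) *\<^sub>R f x)"
    by (subst (asm) integrable_density) (use m in auto)
  then have "integrable lborel (\<lambda>x. (\<bar>c\<bar> ^ DIM('a)) *\<^sub>R f (t + c *\<^sub>R x))"
    by (subst (asm) integrable_distr_eq[OF T]) (use m in auto)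
  then have "integrable lborel (\<lambda>x. inverse (\<bar>c\<bar> ^ DIM('a)) *\<^sub>R ((\<bar>c\<bar> ^ DIM('a)) *\<^sub>R f (t + c *\<^sub>R x)))"
    by (rule integrable_scaleR_right)
  then show ?thesis using c by simp
qed

lemma lborel_affine_integral:
  fixes f :: "'a::euclidean_space \<Rightarrow> 'b::{banach, second_countable_topology}"
  assumes m: "f \<in> borel_measurable borel" and c: "c \<noteq> 0"
  shows "(LINT x|lborel. f x) = (\<bar>c\<bar> ^ DIM('a)) *\<^sub>R (LINT x|lborel. f (t + c *\<^sub>R x))"
proof -
  have T: "(\<lambda>x. t + c *\<^sub>R x) \<in> lborel \<rightarrow>\<^sub>M (borel :: 'a measure)" by simp
  have "(LINT x|lborel. f x) = (LINT x|density (distr lborel borel (\<lambda>x. t + c *\<^sub>R x)) (\<lambda>_. ennreal (\<bar>c\<bar> ^ DIM('a))). f x)"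
    using lborel_affine[OF c, of t] by simp
  also have "\<dots> = (LINT x|distr lborel borel (\<lambda>x. t + c *\<^sub>R x). (\<bar>c\<bar> ^ DIM('a)) *\<^sub>R f x)"
    by (subst integral_density) (use m in auto)
  also have "\<dots> = (LINT x|lborel. (\<bar>c\<bar> ^ DIM('a)) *\<^sub>R f (t + c *\<^sub>R x))"
    by (subst integral_distr[OF T]) (use m in auto)
  finally show ?thesis by simp
qed

text \<open>The exchanges of integrals below have this shape, a bounded kernel between two
  integrable functions: characters for Fourier transforms and convolutions, rescaled Gaussians for
  mollification. Integrability on the product space is inherited from f x * g y.\<close>

lemma fubini_kernel:
  fixes f :: "'a::euclidean_space \<Rightarrow> complex" and g :: "'b::euclidean_space \<Rightarrow> complex"
  assumes f: "integrable lborel f" and g: "integrable lborel g"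
    and k [measurable]: "(\<lambda>(x, y). k x y) \<in> borel_measurable (borel \<Otimes>\<^sub>M borel)" and k1: "\<And>x y. norm (k x y) \<le> 1"
  shows "(LINT x|lborel. f x * (LINT y|lborel. g y * k x y)) = (LINT y|lborel. g y * (LINT x|lborel. f x * k x y))"
    and "integrable lborel (\<lambda>x. f x * (LINT y|lborel. g y * k x y))"
proof -
  note [measurable] = borel_measurable_integrable[OF f] borel_measurable_integrable[OF g]
  have I0: "integrable (lborel \<Otimes>\<^sub>M lborel) (\<lambda>(x, y). f x * g y)"
  proof (rule lborel_pair.Fubini_integrable)
    have "(\<lambda>x. LINT y|lborel. norm (case (x, y) of (x, y) \<Rightarrow> f x * g y)) = (\<lambda>x. norm (f x) * (LINT y|lborel. norm (g y)))"
      by (simp add: norm_mult)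
    then show "integrable lborel (\<lambda>x. LINT y|lborel. norm (case (x, y) of (x, y) \<Rightarrow> f x * g y))"
      using f by simp
    show "AE x in lborel. integrable lborel (\<lambda>y. case (x, y) of (x, y) \<Rightarrow> f x * g y)" using g by simp
  qed measurable
  have I: "integrable (lborel \<Otimes>\<^sub>M lborel) (\<lambda>(x, y). f x * g y * k x y)"
  proof (rule Bochner_Integration.integrable_bound[OF I0])
    show "(\<lambda>(x, y). f x * g y * k x y) \<in> borel_measurable (lborel \<Otimes>\<^sub>M lborel)" by measurable
    show "AE z in lborel \<Otimes>\<^sub>M lborel. norm (case z of (x, y) \<Rightarrow> f x * g y * k x y) \<le> norm (case z of (x, y) \<Rightarrow> f x * g y)"
      using k1 by (auto simp: norm_mult split: prod.split intro!: AE_I2 mult_left_le)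
  qed
  have e1: "(LINT y|lborel. f x * g y * k x y) = f x * (LINT y|lborel. g y * k x y)" for x
    by (simp add: mult.assoc)
  have e2: "(LINT x|lborel. f x * g y * k x y) = g y * (LINT x|lborel. f x * k x y)" for y
  proof -
    have "(LINT x|lborel. f x * g y * k x y) = (LINT x|lborel. g y * (f x * k x y))" by (simp add: mult_ac)
    then show ?thesis by simp
  qed
  show "(LINT x|lborel. f x * (LINT y|lborel. g y * k x y)) = (LINT y|lborel. g y * (LINT x|lborel. f x * k x y))"
    using lborel_pair.Fubini_integral[OF I] unfolding e1 e2 by simp
  show "integrable lborel (\<lambda>x. f x * (LINT y|lborel. g y * k x y))"
    using lborel_pair.integrable_fst'[OF I] by (simp add: e1)
qed

section \<open>Fourier transform of Schwartz functions\<close>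

lemma integrable_kernel:
  fixes f :: "'a::euclidean_space \<Rightarrow> complex"
  assumes "integrable lborel f"
  shows "integrable lborel (\<lambda>x. exp (- \<i> * of_real (x \<bullet> \<xi>)) * f x)"
proof (rule Bochner_Integration.integrable_bound[OF assms])
  note [measurable] = borel_measurable_integrable[OF assms]
  show "(\<lambda>x. exp (- \<i> * of_real (x \<bullet> \<xi>)) * f x) \<in> borel_measurable lborel" by measurable
qed (simp add: norm_mult)

text \<open>Differentiation under the integral sign along sequences h i tending to 0. The remainder
  quotient of the character is at most norm x ^ 2 * norm (h i) / 2, so it tends to 0 at each x, and
  at most 2 * norm x, which together with the moment hypothesis gives a dominating function.\<close>

lemma fourier_has_derivative:
  fixes f :: "'a::euclidean_space \<Rightarrow> complex"
  assumes f: "integrable lborel f" and xf: "integrable lborel (\<lambda>x. norm x * norm (f x))"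
  shows "(fourier f has_derivative (\<lambda>v. \<Sum>b\<in>Basis. (v \<bullet> b) *\<^sub>R fourier (\<lambda>x. - \<i> * of_real (x \<bullet> b) * f x) \<xi>)) (at \<xi>)"
proof -
  note [measurable] = borel_measurable_integrable[OF f]
  let ?e = "\<lambda>x \<xi>. exp (- \<i> * complex_of_real (x \<bullet> \<xi>))"
  have int1: "integrable lborel (\<lambda>x. - \<i> * of_real (x \<bullet> v) * f x)" for v
  proof (rule Bochner_Integration.integrable_bound)
    show "integrable lborel (\<lambda>x. norm v * (norm x * norm (f x)))" using xf by simp
    show "AE x in lborel. norm (- \<i> * of_real (x \<bullet> v) * f x) \<le> norm (norm v * (norm x * norm (f x)))"
    proof (rule AE_I2)
      fix x
      have "\<bar>x \<bullet> v\<bar> * norm (f x) \<le> (norm x * norm v) * norm (f x)" by (intro mult_right_mono Cauchy_Schwarz_ineq2) auto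
      then show "norm (- \<i> * of_real (x \<bullet> v) * f x) \<le> norm (norm v * (norm x * norm (f x)))" by (simp add: norm_mult mult_ac)
    qed
  qed measurable
  define D where "D v = (\<Sum>b\<in>Basis. (v \<bullet> b) *\<^sub>R fourier (\<lambda>x. - \<i> * of_real (x \<bullet> b) * f x) \<xi>)" for v
  have D: "D v = fourier (\<lambda>x. - \<i> * of_real (x \<bullet> v) * f x) \<xi>" for v
  proof -
    have "D v = (LINT x|lborel. (\<Sum>b\<in>Basis. (v \<bullet> b) *\<^sub>R (?e x \<xi> * (- \<i> * of_real (x \<bullet> b) * f x))))"
      unfolding D_def fourier_def
      by (subst Bochner_Integration.integral_sum) (use integrable_kernel[OF int1] in auto)
    also have "\<dots> = (LINT x|lborel. ?e x \<xi> * (- \<i> * of_real (x \<bullet> v) * f x))"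
    proof (intro Bochner_Integration.integral_cong refl)
      fix x
      have "(\<Sum>b\<in>Basis. (v \<bullet> b) *\<^sub>R (?e x \<xi> * (- \<i> * of_real (x \<bullet> b) * f x)))
        = (\<Sum>b\<in>Basis. ?e x \<xi> * - \<i> * f x * of_real ((v \<bullet> b) * (b \<bullet> x)))"
        by (intro sum.cong refl) (simp add: scaleR_conv_of_real inner_commute mult_ac)
      also have "\<dots> = ?e x \<xi> * - \<i> * f x * of_real (v \<bullet> x)"
        unfolding sum_distrib_left[symmetric] of_real_sum[symmetric] inner_sum_Basis ..
      finally show "(\<Sum>b\<in>Basis. (v \<bullet> b) *\<^sub>R (?e x \<xi> * (- \<i> * of_real (x \<bullet> b) * f x))) = ?e x \<xi> * (- \<i> * of_real (x \<bullet> v) * f x)"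
        by (simp add: inner_commute mult_ac)
    qed
    finally show ?thesis by (simp add: fourier_def)
  qed
  have bl: "bounded_linear D" unfolding D_def[abs_def]
    by (intro bounded_linear_sum bounded_linear_scaleR_const bounded_linear_inner_left)
  have "((\<lambda>h. norm (fourier f (\<xi> + h) - fourier f \<xi> - D h) / norm h) \<longlongrightarrow> 0) (at 0)"
    unfolding tendsto_at_iff_sequentially o_def
  proof (intro allI impI)
    fix h :: "nat \<Rightarrow> 'a" assume h: "\<forall>i. h i \<in> UNIV - {0}" "h \<longlonglongrightarrow> 0"
    then have h0: "norm (h i) > 0" for i by auto
    define r where "r i x = (?e x (h i) - 1 - (- \<i> * of_real (x \<bullet> h i))) / of_real (norm (h i))" for i x
    have ra: "norm (r i x) \<le> norm x ^ 2 * norm (h i) / 2" and rb: "norm (r i x) \<le> 2 * norm x" for i x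
    proof -
      let ?a = "- (x \<bullet> h i)"
      have a: "\<bar>?a\<bar> \<le> norm x * norm (h i)" using Cauchy_Schwarz_ineq2[of x "h i"] by simp
      define w where "w = ?e x (h i) - 1 - (- \<i> * of_real (x \<bullet> h i))"
      have w: "w = iexp ?a - (\<Sum>k\<le>1. (\<i> * of_real ?a) ^ k / fact k)" by (simp add: w_def)
      have rw: "norm (r i x) = norm w / norm (h i)" by (simp add: r_def w_def norm_divide)
      have "norm w \<le> \<bar>?a\<bar> ^ 2 / 2" using iexp_approx1[of ?a 1] unfolding w[symmetric] by (simp add: power2_eq_square)
      moreover have "\<bar>?a\<bar> ^ 2 / 2 \<le> (norm x * norm (h i)) ^ 2 / 2" by (intro divide_right_mono power_mono a) auto
      ultimately have "norm w \<le> (norm x * norm (h i)) ^ 2 / 2" by (rule order_trans)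
      then have "norm (r i x) \<le> (norm x * norm (h i)) ^ 2 / 2 / norm (h i)" unfolding rw by (rule divide_right_mono) simp
      moreover have "(norm x * norm (h i)) ^ 2 / 2 / norm (h i) = norm x ^ 2 * norm (h i) / 2"
        using h0[of i] by (simp add: power2_eq_square)
      ultimately show "norm (r i x) \<le> norm x ^ 2 * norm (h i) / 2" by simp
      have "norm w \<le> 2 * \<bar>?a\<bar>" using iexp_approx2[of ?a 1] unfolding w[symmetric] by simp
      then have "norm w \<le> 2 * (norm x * norm (h i))" using a by linarith
      then have "norm (r i x) \<le> 2 * (norm x * norm (h i)) / norm (h i)" unfolding rw by (rule divide_right_mono) simp
      then show "norm (r i x) \<le> 2 * norm x" using h0[of i] by simp
    qed
    have rm [measurable]: "r i \<in> borel_measurable borel" for i unfolding r_def[abs_def] by measurable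
    have eq: "(fourier f (\<xi> + h i) - fourier f \<xi> - D (h i)) / of_real (norm (h i)) = (LINT x|lborel. ?e x \<xi> * f x * r i x)" for i
    proof -
      have "fourier f (\<xi> + h i) - fourier f \<xi> - D (h i)
        = (LINT x|lborel. ?e x (\<xi> + h i) * f x - ?e x \<xi> * f x - ?e x \<xi> * (- \<i> * of_real (x \<bullet> h i) * f x))"
        unfolding D unfolding fourier_def using integrable_kernel[OF f] integrable_kernel[OF int1]
        by (simp only: Bochner_Integration.integral_diff Bochner_Integration.integrable_diff)
      also have "(LINT x|lborel. ?e x (\<xi> + h i) * f x - ?e x \<xi> * f x - ?e x \<xi> * (- \<i> * of_real (x \<bullet> h i) * f x))
        = (LINT x|lborel. of_real (norm (h i)) * (?e x \<xi> * f x * r i x))"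
      proof (intro Bochner_Integration.integral_cong refl)
        fix x
        have e: "?e x (\<xi> + h i) = ?e x \<xi> * ?e x (h i)" by (simp add: inner_add_right exp_add[symmetric] algebra_simps)
        have "of_real (norm (h i)) * r i x = ?e x (h i) - 1 - (- \<i> * of_real (x \<bullet> h i))" using h0[of i] by (simp add: r_def)
        then have "of_real (norm (h i)) * (?e x \<xi> * f x * r i x) = ?e x \<xi> * f x * (?e x (h i) - 1 - (- \<i> * of_real (x \<bullet> h i)))" by (metis mult.left_commute)
        then show "?e x (\<xi> + h i) * f x - ?e x \<xi> * f x - ?e x \<xi> * (- \<i> * of_real (x \<bullet> h i) * f x) = of_real (norm (h i)) * (?e x \<xi> * f x * r i x)"
          unfolding e by (simp add: algebra_simps)
      qed
      finally show ?thesis using h0[of i] by simp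
    qed
    have "(\<lambda>i. LINT x|lborel. ?e x \<xi> * f x * r i x) \<longlonglongrightarrow> integral\<^sup>L (lborel :: 'a measure) (\<lambda>x. 0 :: complex)"
    proof (rule integral_dominated_convergence[where w="\<lambda>x. 2 * (norm x * norm (f x))"])
      show "AE x in lborel. (\<lambda>i. ?e x \<xi> * f x * r i x) \<longlonglongrightarrow> 0"
      proof (rule AE_I2)
        fix x :: 'a
        have "(\<lambda>i. norm x ^ 2 * norm (h i) / 2) \<longlonglongrightarrow> norm x ^ 2 * norm (0::'a) / 2" by (intro tendsto_intros h(2)) auto
        then have "(\<lambda>i. norm x ^ 2 * norm (h i) / 2) \<longlonglongrightarrow> 0" by simp
        then have "(\<lambda>i. r i x) \<longlonglongrightarrow> 0" by (rule Lim_null_comparison[rotated]) (use ra in auto)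
        then show "(\<lambda>i. ?e x \<xi> * f x * r i x) \<longlonglongrightarrow> 0" by (rule tendsto_mult_right_zero)
      qed
      show "AE x in lborel. norm (?e x \<xi> * f x * r i x) \<le> 2 * (norm x * norm (f x))" for i
      proof (rule AE_I2)
        fix x
        have "norm (f x) * norm (r i x) \<le> norm (f x) * (2 * norm x)" by (intro mult_left_mono rb) auto
        then show "norm (?e x \<xi> * f x * r i x) \<le> 2 * (norm x * norm (f x))" by (simp add: norm_mult mult_ac)
      qed
    qed (use xf in auto)
    then have "(\<lambda>i. (fourier f (\<xi> + h i) - fourier f \<xi> - D (h i)) / of_real (norm (h i))) \<longlonglongrightarrow> 0" by (simp add: eq)
    from tendsto_norm[OF this] show "(\<lambda>i. norm (fourier f (\<xi> + h i) - fourier f \<xi> - D (h i)) / norm (h i)) \<longlonglongrightarrow> 0"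
      by (simp add: norm_divide)
  qed
  with bl show ?thesis unfolding has_derivative_at D_def[abs_def] by simp
qed

lemma fourier_bound:
  assumes "integrable lborel f"
  shows "norm (fourier f \<xi>) \<le> (LINT x|lborel. norm (f x))"
proof -
  have "norm (fourier f \<xi>) \<le> (LINT x|lborel. norm (exp (- \<i> * of_real (x \<bullet> \<xi>)) * f x))"
    unfolding fourier_def by (rule integral_norm_bound)
  then show ?thesis by (simp add: norm_mult)
qed

lemma fourier_shift:
  fixes f :: "'a::euclidean_space \<Rightarrow> complex"
  assumes "integrable lborel f"
  shows "fourier (\<lambda>x. f (x + a)) \<xi> = exp (\<i> * of_real (a \<bullet> \<xi>)) * fourier f \<xi>"
proof -
  note [measurable] = borel_measurable_integrable[OF assms]
  have "fourier f \<xi> = (LINT x|lborel. exp (- \<i> * of_real ((a + 1 *\<^sub>R x) \<bullet> \<xi>)) * f (a + 1 *\<^sub>R x))"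
    unfolding fourier_def by (subst lborel_affine_integral[where t=a and c=1]) auto
  also have "\<dots> = (LINT x|lborel. exp (- \<i> * of_real (a \<bullet> \<xi>)) * (exp (- \<i> * of_real (x \<bullet> \<xi>)) * f (x + a)))"
    by (intro Bochner_Integration.integral_cong refl) (simp add: inner_add_left exp_add[symmetric] algebra_simps mult_exp_exp)
  also have "\<dots> = exp (- \<i> * of_real (a \<bullet> \<xi>)) * fourier (\<lambda>x. f (x + a)) \<xi>" by (simp add: fourier_def)
  finally show ?thesis by (simp add: mult_exp_exp flip: mult.assoc)
qed

lemma difference_quotient_limit:
  fixes f :: "real \<Rightarrow> complex"
  assumes f: "(f has_derivative (\<lambda>s. s *\<^sub>R d)) (at 0)" and h: "h \<longlonglongrightarrow> 0" "\<And>n. h n > 0"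
  shows "(\<lambda>n. (f (h n) - f 0) / of_real (h n)) \<longlonglongrightarrow> d"
proof -
  have "((\<lambda>s. norm (f (0 + s) - f 0 - s *\<^sub>R d) / norm s) \<longlongrightarrow> 0) (at 0)"
    using f unfolding has_derivative_at by blast
  moreover have "filterlim h (at 0) sequentially"
    using h(1) less_imp_neq[OF h(2)] by (simp add: filterlim_at)
  ultimately have "(\<lambda>n. norm (f (0 + h n) - f 0 - h n *\<^sub>R d) / norm (h n)) \<longlonglongrightarrow> 0"
    by (rule filterlim_compose)
  moreover have "norm ((f (h n) - f 0) / of_real (h n) - d) = norm (f (0 + h n) - f 0 - h n *\<^sub>R d) / norm (h n)" for n
  proof -
    have "(f (h n) - f 0) / of_real (h n) - d = (f (0 + h n) - f 0 - h n *\<^sub>R d) / of_real (h n)"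
      using h(2)[of n] by (simp add: scaleR_conv_of_real field_simps)
    then show ?thesis by (simp add: norm_divide)
  qed
  ultimately have "(\<lambda>n. norm ((f (h n) - f 0) / of_real (h n) - d)) \<longlonglongrightarrow> 0" by simp
  then show ?thesis by (simp add: tendsto_norm_zero_iff LIM_zero_iff)
qed

text \<open>Difference quotients replace integration by parts. The shift rule gives the transform of
  a quotient the multiplier (exp (\<i> * h * (b \<bullet> \<xi>)) - 1) / h, which tends to \<i> * (b
  \<bullet> \<xi>), while the quotients themselves converge to the partial derivative under an
  integrable bound.\<close>

lemma fourier_partial:
  fixes \<phi> :: "'a::euclidean_space \<Rightarrow> complex"
  assumes \<phi>: "\<phi> \<in> schwartz" and g: "has_partials \<phi> g" and b: "b \<in> Basis" and gb: "g b \<in> schwartz"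
  shows "fourier (g b) \<xi> = \<i> * of_real (b \<bullet> \<xi>) * fourier \<phi> \<xi>"
proof -
  let ?e = "\<lambda>x. exp (- \<i> * complex_of_real (x \<bullet> \<xi>))"
  note [measurable] = schwartz_measurable[OF \<phi>] schwartz_measurable[OF gb]
  define h where "h n = inverse (real (Suc n))" for n
  have h: "0 < h n" "h n \<le> 1" for n by (auto simp: h_def inverse_le_1_iff)
  have hlim: "h \<longlonglongrightarrow> 0" unfolding h_def by (rule LIMSEQ_inverse_real_of_nat)
  define q where "q n x = (\<phi> (x + h n *\<^sub>R b) - \<phi> x) / of_real (h n)" for n x
  have vd: "((\<lambda>s. \<phi> (x + s *\<^sub>R b)) has_derivative (\<lambda>s. s *\<^sub>R g b (x + u *\<^sub>R b))) (at u)" for x u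
  proof -
    have 1: "((\<lambda>s. x + s *\<^sub>R b) has_derivative (\<lambda>s. s *\<^sub>R b)) (at u)" by (auto intro!: derivative_eq_intros)
    have "((\<lambda>s. \<phi> (x + s *\<^sub>R b)) has_derivative (\<lambda>s. \<Sum>c\<in>Basis. ((s *\<^sub>R b) \<bullet> c) *\<^sub>R g c (x + u *\<^sub>R b))) (at u)"
      by (rule has_derivative_compose[OF 1]) (use g in \<open>simp add: has_partials_def\<close>)
    then show ?thesis
      by (rule has_derivative_eq_rhs) (use b in \<open>simp add: fun_eq_iff inner_Basis if_distrib[of "\<lambda>r. r *\<^sub>R _"] if_distrib[of "\<lambda>r. _ * r"] cong: if_cong\<close>)
  qed
  obtain C where C: "C \<ge> 0" "\<And>x. (1 + norm x) ^ (2 * DIM('a)) * norm (g b x) \<le> C" using rapidE[OF schwartz_rapid[OF gb]] by blast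
  \<comment> \<open>A translation by at most 1 changes 1 + norm x by a factor of at most 2, raised
    here to the power 2 * DIM('a) of the weight.\<close>
  let ?C = "2 ^ (2 * DIM('a)) * C"
  have gbd: "norm (g b (x + u *\<^sub>R b)) \<le> ?C * poly_weight x" if u: "0 \<le> u" "u \<le> 1" for x u
  proof (rule poly_weight_bound)
    have "norm x \<le> norm (x + u *\<^sub>R b) + norm (u *\<^sub>R b)" by (metis add_diff_cancel_right' norm_triangle_ineq4)
    moreover have "norm (u *\<^sub>R b) \<le> 1" using u b by simp
    ultimately have "1 + norm x \<le> 2 * (1 + norm (x + u *\<^sub>R b))"
      using norm_ge_zero[of "x + u *\<^sub>R b"] by argo
    then have "(1 + norm x) ^ (2 * DIM('a)) \<le> 2 ^ (2 * DIM('a)) * (1 + norm (x + u *\<^sub>R b)) ^ (2 * DIM('a))"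
      unfolding power_mult_distrib[symmetric] by (intro power_mono) auto
    then have "(1 + norm x) ^ (2 * DIM('a)) * norm (g b (x + u *\<^sub>R b)) \<le> 2 ^ (2 * DIM('a)) * (1 + norm (x + u *\<^sub>R b)) ^ (2 * DIM('a)) * norm (g b (x + u *\<^sub>R b))"
      by (intro mult_right_mono) auto
    also have "\<dots> \<le> ?C" unfolding mult.assoc by (intro mult_left_mono C) auto
    finally show "(1 + norm x) ^ (2 * DIM('a)) * norm (g b (x + u *\<^sub>R b)) \<le> ?C" .
  qed simp
  have qbd: "norm (q n x) \<le> ?C * poly_weight x" for n x
  proof -
    have "norm (\<phi> (x + h n *\<^sub>R b) - \<phi> (x + 0 *\<^sub>R b)) \<le> (?C * poly_weight x) * norm (h n - 0)"
    proof (rule differentiable_bound[where S="{0..h n}" and f="\<lambda>s. \<phi> (x + s *\<^sub>R b)"])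
      show "((\<lambda>s. \<phi> (x + s *\<^sub>R b)) has_derivative (\<lambda>s. s *\<^sub>R g b (x + u *\<^sub>R b))) (at u within {0..h n})" if "u \<in> {0..h n}" for u
        by (rule has_derivative_at_withinI[OF vd])
      show "onorm (\<lambda>s. s *\<^sub>R g b (x + u *\<^sub>R b)) \<le> ?C * poly_weight x" if "u \<in> {0..h n}" for u
      proof (rule onorm_le)
        fix s :: real
        have "norm (g b (x + u *\<^sub>R b)) \<le> ?C * poly_weight x" using that h[of n] by (intro gbd) auto
        then show "norm (s *\<^sub>R g b (x + u *\<^sub>R b)) \<le> ?C * poly_weight x * norm s"
          using mult_left_mono[of "norm (g b (x + u *\<^sub>R b))" "?C * poly_weight x" "\<bar>s\<bar>"] by (simp add: mult_ac)
      qed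
    qed (use h[of n] in auto)
    then show ?thesis using h[of n] by (simp add: q_def norm_divide divide_le_eq mult_ac)
  qed
  have qlim: "(\<lambda>n. q n x) \<longlonglongrightarrow> g b x" for x
    using difference_quotient_limit[OF _ hlim h(1), of "\<lambda>s. \<phi> (x + s *\<^sub>R b)" "g b x"] vd[of x 0] by (simp add: q_def)
  have qF: "fourier (q n) \<xi> = (exp (\<i> * of_real (h n * (b \<bullet> \<xi>))) - 1) / of_real (h n) * fourier \<phi> \<xi>" for n
  proof -
    have i: "integrable lborel \<phi>" "integrable lborel (\<lambda>x. \<phi> (x + h n *\<^sub>R b))"
      by (intro schwartz_integrable \<phi> schwartz_shift)+
    have "fourier (q n) \<xi> = (LINT x|lborel. (?e x * \<phi> (x + h n *\<^sub>R b) - ?e x * \<phi> x) / of_real (h n))"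
      unfolding fourier_def q_def by (intro Bochner_Integration.integral_cong refl) (simp add: field_simps)
    also have "\<dots> = (LINT x|lborel. ?e x * \<phi> (x + h n *\<^sub>R b) - ?e x * \<phi> x) / of_real (h n)" by simp
    also have "\<dots> = (fourier (\<lambda>x. \<phi> (x + h n *\<^sub>R b)) \<xi> - fourier \<phi> \<xi>) / of_real (h n)"
      unfolding fourier_def by (subst Bochner_Integration.integral_diff) (use integrable_kernel[OF i(1)] integrable_kernel[OF i(2)] in auto)
    finally show ?thesis by (simp add: fourier_shift[OF i(1)] algebra_simps diff_divide_distrib)
  qed
  have "(\<lambda>n. fourier (q n) \<xi>) \<longlonglongrightarrow> fourier (g b) \<xi>"
    unfolding fourier_def
  proof (rule integral_dominated_convergence[where w="\<lambda>x. ?C * poly_weight x"])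
    show "integrable lborel (\<lambda>x::'a. ?C * poly_weight x)" by (intro integrable_mult_right integrable_poly_weight)
    show "AE x in lborel. (\<lambda>n. ?e x * q n x) \<longlonglongrightarrow> ?e x * g b x" by (intro AE_I2 tendsto_intros qlim)
    show "AE x in lborel. norm (?e x * q n x) \<le> ?C * poly_weight x" for n
      using qbd[of n] by (simp add: norm_mult)
    show "(\<lambda>x. ?e x * q n x) \<in> borel_measurable lborel" for n unfolding q_def by measurable
  qed measurable
  moreover have "(\<lambda>n. fourier (q n) \<xi>) \<longlonglongrightarrow> \<i> * of_real (b \<bullet> \<xi>) * fourier \<phi> \<xi>"
  proof -
    let ?z = "\<i> * complex_of_real (b \<bullet> \<xi>)"
    have "((\<lambda>s::real. exp (of_real s * ?z)) has_derivative (\<lambda>s. s *\<^sub>R ?z)) (at 0)"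
    proof -
      have "((\<lambda>w. exp (w * ?z)) has_field_derivative ?z) (at (of_real 0))"
        by (auto intro!: derivative_eq_intros)
      then show ?thesis using has_vector_derivative_real_field has_vector_derivative_def by blast
    qed
    from difference_quotient_limit[OF this hlim h(1)]
    have "(\<lambda>n. (exp (of_real (h n) * ?z) - 1) / of_real (h n)) \<longlonglongrightarrow> ?z" by simp
    then have "(\<lambda>n. (exp (of_real (h n) * ?z) - 1) / of_real (h n) * fourier \<phi> \<xi>) \<longlonglongrightarrow> ?z * fourier \<phi> \<xi>" by (intro tendsto_intros)
    then show ?thesis unfolding qF by (simp add: mult_ac)
  qed
  ultimately show ?thesis by (rule LIMSEQ_unique)
qed

lemma fourier_schwartz:
  fixes \<phi> :: "'a::euclidean_space \<Rightarrow> complex"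
  assumes "\<phi> \<in> schwartz"
  shows "fourier \<phi> \<in> schwartz"
proof (rule schwartz_coinduct[of _ "fourier ` schwartz"])
  \<comment> \<open>One power of decay at a time: 1 + norm \<xi> is at most 1 plus the sum of the
    absolute coordinates, and each coordinate is absorbed into the transform of a partial
    derivative, which is a Schwartz function again.\<close>
  have rap: "\<exists>C. \<forall>\<xi>. (1 + norm \<xi>) ^ k * norm (fourier \<phi> \<xi>) \<le> C" if "\<phi> \<in> schwartz" for k and \<phi> :: "'a \<Rightarrow> complex"
    using that
  proof (induction k arbitrary: \<phi>)
    case 0
    then show ?case using fourier_bound[OF schwartz_integrable[OF 0]] by auto
  next
    case (Suc k)
    obtain g where g: "has_partials \<phi> g" "\<And>b. b \<in> Basis \<Longrightarrow> g b \<in> schwartz" using schwartz_partials[OF Suc.prems] by blast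
    have "\<forall>b. \<exists>C. b \<in> Basis \<longrightarrow> (\<forall>\<xi>. (1 + norm \<xi>) ^ k * norm (fourier (g b) \<xi>) \<le> C)" using Suc.IH g by blast
    then obtain c where c: "\<And>b \<xi>. b \<in> Basis \<Longrightarrow> (1 + norm \<xi>) ^ k * norm (fourier (g b) \<xi>) \<le> c b" by metis
    obtain C where C: "\<And>\<xi>. (1 + norm \<xi>) ^ k * norm (fourier \<phi> \<xi>) \<le> C" using Suc.IH[OF Suc.prems] by blast
    have "(1 + norm \<xi>) ^ Suc k * norm (fourier \<phi> \<xi>) \<le> C + (\<Sum>b\<in>Basis. c b)" for \<xi>
    proof -
      have "(1 + norm \<xi>) * norm (fourier \<phi> \<xi>) \<le> (1 + (\<Sum>b\<in>Basis. \<bar>\<xi> \<bullet> b\<bar>)) * norm (fourier \<phi> \<xi>)"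
        by (intro mult_right_mono add_left_mono norm_le_l1) auto
      also have "\<dots> = norm (fourier \<phi> \<xi>) + (\<Sum>b\<in>Basis. norm (fourier (g b) \<xi>))"
        unfolding distrib_right sum_distrib_right
        by (auto intro!: sum.cong simp: fourier_partial[OF Suc.prems g(1) _ g(2)] norm_mult inner_commute)
      finally have "(1 + norm \<xi>) ^ k * ((1 + norm \<xi>) * norm (fourier \<phi> \<xi>)) \<le> (1 + norm \<xi>) ^ k * (norm (fourier \<phi> \<xi>) + (\<Sum>b\<in>Basis. norm (fourier (g b) \<xi>)))"
        by (intro mult_left_mono) auto
      also have "\<dots> = (1 + norm \<xi>) ^ k * norm (fourier \<phi> \<xi>) + (\<Sum>b\<in>Basis. (1 + norm \<xi>) ^ k * norm (fourier (g b) \<xi>))"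
        by (simp add: distrib_left sum_distrib_left)
      also have "\<dots> \<le> C + (\<Sum>b\<in>Basis. c b)" by (intro add_mono C sum_mono c)
      finally show ?thesis by (simp add: mult_ac)
    qed
    then show ?case by blast
  qed
  fix f :: "'a \<Rightarrow> complex" assume "f \<in> fourier ` schwartz"
  then obtain \<phi> where f: "\<phi> \<in> schwartz" "f = fourier \<phi>" by auto
  show "rapid f" using rap[OF f(1)] by (simp add: rapid_def f(2))
  show "\<exists>g. has_partials f g \<and> (\<forall>b\<in>Basis. g b \<in> fourier ` schwartz)"
  proof (intro exI[of _ "\<lambda>b. fourier (\<lambda>x. - \<i> * of_real (x \<bullet> b) * \<phi> x)"] conjI ballI imageI)
    have "integrable lborel (\<lambda>x. norm x * norm (\<phi> x))"
    proof (rule Bochner_Integration.integrable_bound[OF schwartz_integrable_power[OF f(1), of 1]])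
      note [measurable] = schwartz_measurable[OF f(1)]
      show "(\<lambda>x. norm x * norm (\<phi> x)) \<in> borel_measurable lborel" by measurable
    qed (auto simp: abs_mult intro!: mult_right_mono)
    then show "has_partials f (\<lambda>b. fourier (\<lambda>x. - \<i> * of_real (x \<bullet> b) * \<phi> x))"
      unfolding has_partials_def f(2) using fourier_has_derivative[OF schwartz_integrable[OF f(1)]] by blast
    show "(\<lambda>x. - \<i> * of_real (x \<bullet> b) * \<phi> x) \<in> schwartz" for b
      using schwartz_cmult[OF schwartz_mult_inner[OF f(1)], of "- \<i>" b] by (simp add: mult.assoc)
  qed
qed (use assms in blast)

section \<open>Gaussian regularisation: inversion and injectivity\<close>

definition gauss :: "'a::euclidean_space \<Rightarrow> real" where
  "gauss x = exp (- (norm x)\<^sup>2 / 2)"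

lemma gauss_le_1: "gauss x \<le> 1" and gauss_nonneg: "0 \<le> gauss x" and gauss_0: "gauss 0 = 1"
  and gauss_uminus: "gauss (- x) = gauss x"
  by (simp_all add: gauss_def)

lemma gauss_measurable [measurable]: "gauss \<in> borel_measurable borel"
  unfolding gauss_def[abs_def] by measurable

lemma gauss_prod:
  fixes x :: "'a::euclidean_space"
  shows "gauss x = (\<Prod>b\<in>Basis. exp (- (x \<bullet> b)\<^sup>2 / 2))"
proof -
  have "(norm x)\<^sup>2 = (\<Sum>b\<in>Basis. (x \<bullet> b)\<^sup>2)"
    unfolding dot_square_norm[symmetric] euclidean_inner[of x x] by (simp add: power2_eq_square)
  then have "- (norm x)\<^sup>2 / 2 = (\<Sum>b\<in>Basis. - (x \<bullet> b)\<^sup>2 / 2)"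
    by (simp add: sum_negf sum_divide_distrib)
  then show ?thesis unfolding gauss_def by (simp add: exp_sum)
qed

text \<open>Up to the factor sqrt (2 * pi), the characteristic function of the standard normal
  law.\<close>

lemma gauss_1d:
  fixes s :: real
  shows "integrable lborel (\<lambda>x::real. iexp (s * x) * complex_of_real (exp (- x\<^sup>2 / 2)))"
    and "(LINT x|lborel. iexp (s * x) * complex_of_real (exp (- x\<^sup>2 / 2))) = of_real (sqrt (2 * pi) * exp (- s\<^sup>2 / 2))"
proof -
  have e: "complex_of_real (exp (- x\<^sup>2 / 2)) = of_real (sqrt (2 * pi)) * of_real (std_normal_density x)" for x :: real
    unfolding of_real_mult[symmetric] of_real_eq_iff by (simp add: std_normal_density_def)
  have i1: "integrable lborel (\<lambda>x::real. complex_of_real (std_normal_density x))"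
    by simp
  have i2: "integrable lborel (\<lambda>x::real. iexp (s * x) * of_real (std_normal_density x))"
    by (rule Bochner_Integration.integrable_bound[OF i1]) (auto simp: norm_mult)
  have eq: "iexp (s * x) * complex_of_real (exp (- x\<^sup>2 / 2)) = of_real (sqrt (2 * pi)) * (iexp (s * x) * of_real (std_normal_density x))" for x :: real
    unfolding e by (simp add: mult_ac)
  show "integrable lborel (\<lambda>x::real. iexp (s * x) * complex_of_real (exp (- x\<^sup>2 / 2)))"
    unfolding eq by (intro integrable_mult_right i2)
  have "(LINT x|lborel. iexp (s * x) * of_real (std_normal_density x)) = char std_normal_distribution s"
    unfolding char_def by (subst integral_density) (auto simp: scaleR_conv_of_real mult_ac)
  also have "\<dots> = of_real (exp (- s\<^sup>2 / 2))" by (simp add: char_std_normal_distribution)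
  finally show "(LINT x|lborel. iexp (s * x) * complex_of_real (exp (- x\<^sup>2 / 2))) = of_real (sqrt (2 * pi) * exp (- s\<^sup>2 / 2))"
    unfolding eq by simp
qed

lemma gauss_fourier:
  fixes \<xi> :: "'a::euclidean_space"
  shows "integrable lborel (\<lambda>x::'a. iexp (x \<bullet> \<xi>) * complex_of_real (gauss x))"
    and "(LINT x|lborel. iexp (x \<bullet> \<xi>) * complex_of_real (gauss x)) = of_real (sqrt (2 * pi) ^ DIM('a) * gauss \<xi>)"
proof -
  have eq: "iexp (x \<bullet> \<xi>) * complex_of_real (gauss x) = (\<Prod>b\<in>Basis. iexp ((\<xi> \<bullet> b) * (x \<bullet> b)) * complex_of_real (exp (- (x \<bullet> b)\<^sup>2 / 2)))" for x
  proof -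
    have "iexp (x \<bullet> \<xi>) = (\<Prod>b\<in>Basis. iexp ((\<xi> \<bullet> b) * (x \<bullet> b)))"
      unfolding exp_sum[OF finite_Basis, symmetric]
      by (simp add: euclidean_inner[of x \<xi>] sum_distrib_left mult_ac)
    then show ?thesis unfolding gauss_prod of_real_prod by (simp add: prod.distrib)
  qed
  show "integrable lborel (\<lambda>x::'a. iexp (x \<bullet> \<xi>) * complex_of_real (gauss x))"
    unfolding eq by (rule lborel_integral_prod(1)) (rule gauss_1d)
  have "(LINT x|lborel. iexp (x \<bullet> \<xi>) * complex_of_real (gauss x)) = (\<Prod>b\<in>(Basis::'a set). of_real (sqrt (2 * pi) * exp (- (\<xi> \<bullet> b)\<^sup>2 / 2)))"
    unfolding eq by (subst lborel_integral_prod(2)) (auto simp only: gauss_1d)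
  also have "\<dots> = of_real (sqrt (2 * pi) ^ DIM('a) * gauss \<xi>)"
    unfolding gauss_prod of_real_mult prod.distrib by (simp flip: of_real_prod)
  finally show "(LINT x|lborel. iexp (x \<bullet> \<xi>) * complex_of_real (gauss x)) = of_real (sqrt (2 * pi) ^ DIM('a) * gauss \<xi>)" .
qed

lemma gauss_integrable: "integrable lborel (gauss :: 'a::euclidean_space \<Rightarrow> real)"
  using integrable_norm[OF gauss_fourier(1)[of "0::'a"]] by (simp add: norm_mult abs_of_nonneg[OF gauss_nonneg])

lemma gauss_integral: "integral\<^sup>L lborel (gauss :: 'a::euclidean_space \<Rightarrow> real) = sqrt (2 * pi) ^ DIM('a)"
proof -
  have "complex_of_real (integral\<^sup>L lborel (gauss :: 'a \<Rightarrow> real)) = complex_of_real (sqrt (2 * pi) ^ DIM('a))"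
    using gauss_fourier(2)[of "0::'a"] by (simp add: gauss_0)
  then show ?thesis by (simp only: of_real_eq_iff)
qed

text \<open>A Gaussian cut-off makes the inversion integral absolutely convergent for every
  integrable \<open>f\<close>, and Fubini then moves the transform onto the Gaussian, whose own
  transform is known. The result is a Gaussian mollification of \<open>f\<close> at scale \<delta>,
  the common source of the inversion formula and of injectivity.\<close>

lemma gauss_convolution:
  fixes f :: "'a::euclidean_space \<Rightarrow> complex"
  assumes f: "integrable lborel f" and \<delta>: "\<delta> > 0"
  shows "(LINT \<xi>|lborel. fourier f \<xi> * (iexp (x \<bullet> \<xi>) * of_real (gauss (\<delta> *\<^sub>R \<xi>))))
    = of_real ((sqrt (2 * pi) / \<delta>) ^ DIM('a)) * (LINT y|lborel. f y * of_real (gauss ((1 / \<delta>) *\<^sub>R (x - y))))"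
proof -
  note [measurable] = borel_measurable_integrable[OF f]
  let ?h = "\<lambda>\<xi>. iexp (x \<bullet> \<xi>) * complex_of_real (gauss (\<delta> *\<^sub>R \<xi>))"
  have "integrable lborel (\<lambda>\<xi>::'a. complex_of_real (gauss (0 + \<delta> *\<^sub>R \<xi>)))"
    by (rule lborel_affine_integrable[where f="\<lambda>\<xi>. complex_of_real (gauss \<xi>)"]) (use gauss_integrable \<delta> in auto)
  then have ig: "integrable lborel (\<lambda>\<xi>::'a. complex_of_real (gauss (\<delta> *\<^sub>R \<xi>)))" by simp
  have h: "integrable lborel ?h"
    by (rule Bochner_Integration.integrable_bound[OF ig]) (auto simp: norm_mult)
  have inner: "(LINT \<xi>|lborel. ?h \<xi> * exp (- \<i> * of_real (y \<bullet> \<xi>))) = of_real ((sqrt (2 * pi) / \<delta>) ^ DIM('a)) * of_real (gauss ((1 / \<delta>) *\<^sub>R (x - y)))" for y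
  proof -
    let ?w = "(1 / \<delta>) *\<^sub>R (x - y)"
    have "of_real (sqrt (2 * pi) ^ DIM('a) * gauss ?w) = (LINT \<eta>|lborel. iexp (\<eta> \<bullet> ?w) * complex_of_real (gauss \<eta>))"
      by (rule gauss_fourier(2)[symmetric])
    also have "\<dots> = (\<bar>\<delta>\<bar> ^ DIM('a)) *\<^sub>R (LINT \<xi>|lborel. iexp ((0 + \<delta> *\<^sub>R \<xi>) \<bullet> ?w) * complex_of_real (gauss (0 + \<delta> *\<^sub>R \<xi>)))"
      by (rule lborel_affine_integral) (use \<delta> in auto)
    also have "(LINT \<xi>|lborel. iexp ((0 + \<delta> *\<^sub>R \<xi>) \<bullet> ?w) * complex_of_real (gauss (0 + \<delta> *\<^sub>R \<xi>))) = (LINT \<xi>|lborel. ?h \<xi> * exp (- \<i> * of_real (y \<bullet> \<xi>)))"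
    proof (intro Bochner_Integration.integral_cong refl)
      fix \<xi>
      have "(0 + \<delta> *\<^sub>R \<xi>) \<bullet> ?w = x \<bullet> \<xi> - y \<bullet> \<xi>" using \<delta> by (simp add: inner_diff_right inner_commute field_simps)
      then have "iexp ((0 + \<delta> *\<^sub>R \<xi>) \<bullet> ?w) = iexp (x \<bullet> \<xi> - y \<bullet> \<xi>)" by simp
      also have "\<dots> = iexp (x \<bullet> \<xi>) * exp (- \<i> * of_real (y \<bullet> \<xi>))"
        unfolding mult_exp_exp by (simp add: algebra_simps)
      finally have "iexp ((0 + \<delta> *\<^sub>R \<xi>) \<bullet> ?w) = iexp (x \<bullet> \<xi>) * exp (- \<i> * of_real (y \<bullet> \<xi>))" .
      then show "iexp ((0 + \<delta> *\<^sub>R \<xi>) \<bullet> ?w) * complex_of_real (gauss (0 + \<delta> *\<^sub>R \<xi>)) = ?h \<xi> * exp (- \<i> * of_real (y \<bullet> \<xi>))"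
        by (simp only: add_0_left mult_ac)
    qed
    finally show ?thesis using \<delta> by (simp add: scaleR_conv_of_real field_simps)
  qed
  have "(LINT \<xi>|lborel. fourier f \<xi> * ?h \<xi>) = (LINT \<xi>|lborel. ?h \<xi> * (LINT y|lborel. f y * exp (- \<i> * of_real (y \<bullet> \<xi>))))"
    by (simp add: fourier_def mult_ac)
  also have "\<dots> = (LINT y|lborel. f y * (LINT \<xi>|lborel. ?h \<xi> * exp (- \<i> * of_real (y \<bullet> \<xi>))))"
    by (rule fubini_kernel(1)[OF h f]) (simp_all, measurable)
  also have "\<dots> = (LINT y|lborel. of_real ((sqrt (2 * pi) / \<delta>) ^ DIM('a)) * (f y * of_real (gauss ((1 / \<delta>) *\<^sub>R (x - y)))))"
    unfolding inner by (simp add: mult_ac)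
  finally show ?thesis by simp
qed

text \<open>Both sides of the Gaussian identity are evaluated as \<delta> tends to 0: the left by
  domination with the integrable transform, the right after the substitution y = x - \<delta> * u,
  by domination with a multiple of the Gaussian. One factor sqrt (2 * pi) ^ DIM('a) comes from the
  identity, a second from the integral of \<open>gauss\<close>.\<close>

theorem fourier_inversion:
  fixes \<phi> :: "'a::euclidean_space \<Rightarrow> complex"
  assumes \<phi>: "\<phi> \<in> schwartz"
  shows "inv_fourier (fourier \<phi>) x = \<phi> x"
proof -
  let ?c = "sqrt (2 * pi) ^ DIM('a)"
  define \<delta> where "\<delta> n = inverse (real (Suc n))" for n
  have \<delta>: "\<delta> n > 0" for n by (simp add: \<delta>_def)
  have \<delta>lim: "\<delta> \<longlonglongrightarrow> 0" unfolding \<delta>_def by (rule LIMSEQ_inverse_real_of_nat)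
  note [measurable] = schwartz_measurable[OF \<phi>] schwartz_measurable[OF fourier_schwartz[OF \<phi>]]
  have cg: "isCont gauss (y :: 'a)" for y unfolding gauss_def by (intro continuous_intros) auto
  define I where "I n = (LINT \<xi>|lborel. fourier \<phi> \<xi> * (iexp (x \<bullet> \<xi>) * of_real (gauss (\<delta> n *\<^sub>R \<xi>))))" for n
  have "I \<longlonglongrightarrow> (LINT \<xi>|lborel. fourier \<phi> \<xi> * (iexp (x \<bullet> \<xi>) * 1))"
    unfolding I_def
  proof (rule integral_dominated_convergence[where w="\<lambda>\<xi>. norm (fourier \<phi> \<xi>)"])
    show "integrable lborel (\<lambda>\<xi>. norm (fourier \<phi> \<xi>))" by (intro integrable_norm schwartz_integrable fourier_schwartz \<phi>)
    show "AE \<xi> in lborel. (\<lambda>n. fourier \<phi> \<xi> * (iexp (x \<bullet> \<xi>) * of_real (gauss (\<delta> n *\<^sub>R \<xi>)))) \<longlonglongrightarrow> fourier \<phi> \<xi> * (iexp (x \<bullet> \<xi>) * 1)"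
    proof (rule AE_I2)
      fix \<xi> :: 'a
      have "(\<lambda>n. \<delta> n *\<^sub>R \<xi>) \<longlonglongrightarrow> 0 *\<^sub>R \<xi>" by (intro tendsto_intros \<delta>lim)
      then have "(\<lambda>n. gauss (\<delta> n *\<^sub>R \<xi>)) \<longlonglongrightarrow> gauss (0 *\<^sub>R \<xi>)" by (rule isCont_tendsto_compose[OF cg])
      then have "(\<lambda>n. gauss (\<delta> n *\<^sub>R \<xi>)) \<longlonglongrightarrow> gauss (0 :: 'a)" by simp
      then have "(\<lambda>n. complex_of_real (gauss (\<delta> n *\<^sub>R \<xi>))) \<longlonglongrightarrow> of_real 1" by (intro tendsto_of_real) (simp add: gauss_0)
      then show "(\<lambda>n. fourier \<phi> \<xi> * (iexp (x \<bullet> \<xi>) * of_real (gauss (\<delta> n *\<^sub>R \<xi>)))) \<longlonglongrightarrow> fourier \<phi> \<xi> * (iexp (x \<bullet> \<xi>) * 1)"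
        by (intro tendsto_intros) simp
    qed
    show "AE \<xi> in lborel. norm (fourier \<phi> \<xi> * (iexp (x \<bullet> \<xi>) * of_real (gauss (\<delta> n *\<^sub>R \<xi>)))) \<le> norm (fourier \<phi> \<xi>)" for n
      by (intro AE_I2) (simp add: norm_mult gauss_nonneg gauss_le_1 mult_left_le)
  qed measurable
  moreover have "I \<longlonglongrightarrow> of_real ?c * (LINT u|lborel. \<phi> x * of_real (gauss (u::'a)))"
  proof -
    have Ieq: "I n = of_real ?c * (LINT u|lborel. \<phi> (x + (- \<delta> n) *\<^sub>R u) * of_real (gauss u))" for n
    proof -
      have "(LINT y|lborel. \<phi> y * of_real (gauss ((1 / \<delta> n) *\<^sub>R (x - y)))) =
        (\<bar>- \<delta> n\<bar> ^ DIM('a)) *\<^sub>R (LINT u|lborel. \<phi> (x + (- \<delta> n) *\<^sub>R u) * of_real (gauss ((1 / \<delta> n) *\<^sub>R (x - (x + (- \<delta> n) *\<^sub>R u)))))"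
        by (rule lborel_affine_integral) (use \<delta>[of n] in auto)
      then show ?thesis unfolding I_def gauss_convolution[OF schwartz_integrable[OF \<phi>] \<delta>]
        using \<delta>[of n] by (simp add: scaleR_conv_of_real power_divide)
    qed
    have lim: "(\<lambda>n. LINT u|lborel. \<phi> (x + (- \<delta> n) *\<^sub>R u) * of_real (gauss u)) \<longlonglongrightarrow> (LINT u|lborel. \<phi> x * of_real (gauss (u::'a)))"
    proof -
      obtain C where C: "\<And>y. (1 + norm y) ^ 0 * norm (\<phi> y) \<le> C" using rapidE[OF schwartz_rapid[OF \<phi>], of 0] by blast
      show ?thesis
      proof (rule integral_dominated_convergence[where w="\<lambda>u. C * gauss u"])
        show "integrable lborel (\<lambda>u::'a. C * gauss u)" by (intro integrable_mult_right gauss_integrable)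
        show "AE u in lborel. (\<lambda>n. \<phi> (x + (- \<delta> n) *\<^sub>R u) * of_real (gauss u)) \<longlonglongrightarrow> \<phi> x * of_real (gauss u)"
        proof (rule AE_I2)
          fix u :: 'a
          have "(\<lambda>n. x + (- \<delta> n) *\<^sub>R u) \<longlonglongrightarrow> x + (- 0) *\<^sub>R u" by (intro tendsto_intros \<delta>lim)
          moreover have "isCont \<phi> x" using schwartz_continuous[OF \<phi>] by (simp add: continuous_on_eq_continuous_at)
          ultimately have "(\<lambda>n. \<phi> (x + (- \<delta> n) *\<^sub>R u)) \<longlonglongrightarrow> \<phi> x" using isCont_tendsto_compose by fastforce
          then show "(\<lambda>n. \<phi> (x + (- \<delta> n) *\<^sub>R u) * of_real (gauss u)) \<longlonglongrightarrow> \<phi> x * of_real (gauss u)" by (intro tendsto_intros)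
        qed
        show "AE u in lborel. norm (\<phi> (x + (- \<delta> n) *\<^sub>R u) * of_real (gauss u)) \<le> C * gauss u" for n
          using C by (intro AE_I2) (simp add: norm_mult gauss_nonneg mult_right_mono)
      qed measurable
    qed
    have "I = (\<lambda>n. of_real ?c * (LINT u|lborel. \<phi> (x + (- \<delta> n) *\<^sub>R u) * of_real (gauss u)))"
      by (rule ext) (rule Ieq)
    then show ?thesis using tendsto_mult_left[OF lim] by simp
  qed
  ultimately have "(LINT \<xi>|lborel. fourier \<phi> \<xi> * (iexp (x \<bullet> \<xi>) * 1)) = of_real ?c * (LINT u|lborel. \<phi> x * of_real (gauss (u::'a)))"
    by (rule LIMSEQ_unique)
  also have "\<dots> = of_real ((2 * pi) ^ DIM('a)) * \<phi> x"
  proof -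
    have "?c * ?c = (sqrt (2 * pi) * sqrt (2 * pi)) ^ DIM('a)" by (rule power_mult_distrib[symmetric])
    then have "?c * ?c = (2 * pi) ^ DIM('a)" by simp
    then have "complex_of_real ?c * of_real ?c = of_real ((2 * pi) ^ DIM('a))" by (simp only: of_real_mult[symmetric])
    then show ?thesis by (simp add: gauss_integral)
  qed
  finally show ?thesis by (simp add: inv_fourier_def mult_ac)
qed

lemma inv_fourier_eq_fourier: "inv_fourier f x = fourier f (- x) / of_real ((2 * pi) ^ DIM('a))"
  for f :: "'a::euclidean_space \<Rightarrow> complex"
  unfolding inv_fourier_def fourier_def by (simp add: inner_commute)

lemma inv_fourier_schwartz:
  fixes \<phi> :: "'a::euclidean_space \<Rightarrow> complex"
  assumes "\<phi> \<in> schwartz"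
  shows "inv_fourier \<phi> \<in> schwartz"
proof -
  have "(\<lambda>x. (1 / of_real ((2 * pi) ^ DIM('a))) * fourier \<phi> (- x)) \<in> schwartz"
    by (intro schwartz_cmult schwartz_uminus fourier_schwartz assms)
  also have "(\<lambda>x. (1 / of_real ((2 * pi) ^ DIM('a))) * fourier \<phi> (- x)) = inv_fourier \<phi>"
    by (rule ext) (simp add: inv_fourier_eq_fourier)
  finally show ?thesis .
qed

lemma fourier_inv_fourier:
  fixes \<phi> :: "'a::euclidean_space \<Rightarrow> complex"
  assumes \<phi>: "\<phi> \<in> schwartz"
  shows "fourier (inv_fourier \<phi>) x = \<phi> x"
proof -
  let ?c = "complex_of_real ((2 * pi) ^ DIM('a))"
  have m: "(\<lambda>y. exp (- \<i> * of_real (y \<bullet> x)) * (fourier \<phi> (- y) / ?c)) \<in> borel_measurable borel"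
    using schwartz_measurable[OF schwartz_modulate[OF inv_fourier_schwartz[OF \<phi>], of "- x"]]
    by (simp add: inv_fourier_eq_fourier)
  have "fourier (inv_fourier \<phi>) x = (LINT y|lborel. exp (- \<i> * of_real (y \<bullet> x)) * (fourier \<phi> (- y) / ?c))"
    unfolding fourier_def[of "inv_fourier \<phi>"] inv_fourier_eq_fourier ..
  also have "\<dots> = (\<bar>- 1\<bar> ^ DIM('a)) *\<^sub>R (LINT y|lborel. exp (- \<i> * of_real ((0 + (- 1) *\<^sub>R y) \<bullet> x)) * (fourier \<phi> (- (0 + (- 1) *\<^sub>R y)) / ?c))"
    by (rule lborel_affine_integral[OF m]) simp
  also have "\<dots> = inv_fourier (fourier \<phi>) x" by (simp add: inv_fourier_def inner_commute)
  finally show ?thesis by (simp add: fourier_inversion[OF \<phi>])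
qed

text \<open>The positive and the negative part of \<open>f\<close> are densities of finite measures
  that agree on boxes, an intersection-stable generator, hence everywhere. Equality of
  \<open>ennreal (f x)\<close> and \<open>ennreal (- f x)\<close> then leaves only the value
  0.\<close>

lemma integrable_zero_on_boxes:
  fixes f :: "'a::euclidean_space \<Rightarrow> real"
  assumes f: "integrable lborel f" and z: "\<And>a b. (LINT x|lborel. indicator (box a b) x * f x) = 0"
  shows "AE x in lborel. f x = 0"
proof -
  have [measurable]: "f \<in> borel_measurable borel" using borel_measurable_integrable[OF f] by simp
  define P where "P = density lborel (\<lambda>x. ennreal (f x))"
  define N where "N = density lborel (\<lambda>x. ennreal (- f x))"
  have fin: "(\<integral>\<^sup>+x. ennreal (norm (f x)) \<partial>lborel) < top"
    using f by (simp add: integrable_iff_bounded infinity_ennreal_def)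
  have fP: "(\<integral>\<^sup>+x. ennreal (f x) \<partial>lborel) < top"
    by (rule le_less_trans[OF nn_integral_mono fin]) (auto intro: ennreal_leI)
  have fN: "(\<integral>\<^sup>+x. ennreal (- f x) \<partial>lborel) < top"
    by (rule le_less_trans[OF nn_integral_mono fin]) (auto intro: ennreal_leI)
  have box: "emeasure P (box a b) = emeasure N (box a b)" for a b
  proof -
    let ?f = "\<lambda>x. indicator (box a b) x * f x"
    have i: "integrable lborel ?f"
      by (rule Bochner_Integration.integrable_bound[OF f]) (auto simp: indicator_def)
    have 1: "emeasure P (box a b) = (\<integral>\<^sup>+x. ennreal (?f x) \<partial>lborel)"
      unfolding P_def by (subst emeasure_density) (auto intro!: nn_integral_cong simp: indicator_def)
    have 2: "emeasure N (box a b) = (\<integral>\<^sup>+x. ennreal (- ?f x) \<partial>lborel)"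
      unfolding N_def by (subst emeasure_density) (auto intro!: nn_integral_cong simp: indicator_def)
    have f1: "(\<integral>\<^sup>+x. ennreal (?f x) \<partial>lborel) < top"
      by (rule le_less_trans[OF nn_integral_mono fP]) (auto simp: indicator_def)
    have f2: "(\<integral>\<^sup>+x. ennreal (- ?f x) \<partial>lborel) < top"
      by (rule le_less_trans[OF nn_integral_mono fN]) (auto simp: indicator_def)
    have "integral\<^sup>L lborel ?f = enn2real (\<integral>\<^sup>+x. ennreal (?f x) \<partial>lborel) - enn2real (\<integral>\<^sup>+x. ennreal (- ?f x) \<partial>lborel)"
      by (rule real_lebesgue_integral_def[OF i])
    with z[of a b] have "enn2real (\<integral>\<^sup>+x. ennreal (?f x) \<partial>lborel) = enn2real (\<integral>\<^sup>+x. ennreal (- ?f x) \<partial>lborel)"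
      by linarith
    then have "ennreal (enn2real (\<integral>\<^sup>+x. ennreal (?f x) \<partial>lborel)) = ennreal (enn2real (\<integral>\<^sup>+x. ennreal (- ?f x) \<partial>lborel))"
      by (rule arg_cong)
    then show ?thesis unfolding 1 2 ennreal_enn2real[OF f1] ennreal_enn2real[OF f2] .
  qed
  have "P = N"
  proof (rule measure_eqI_generator_eq)
    let ?E = "range (\<lambda>(a, b). box a b::'a set)"
    show "Int_stable ?E" by (auto simp: Int_stable_def box_Int_box)
    show "?E \<subseteq> Pow UNIV" "sets P = sigma_sets UNIV ?E" "sets N = sigma_sets UNIV ?E"
      by (simp_all add: borel_eq_box P_def N_def)
    let ?A = "\<lambda>n::nat. box (- (real n *\<^sub>R One)) (real n *\<^sub>R One) :: 'a set"
    show "range ?A \<subseteq> ?E" "(\<Union>i. ?A i) = UNIV" unfolding UN_box_eq_UNIV by auto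
    show "emeasure P (?A i) \<noteq> \<infinity>" for i
    proof -
      have "emeasure P (?A i) \<le> (\<integral>\<^sup>+x. ennreal (f x) \<partial>lborel)"
        unfolding P_def by (subst emeasure_density) (auto intro!: nn_integral_mono simp: indicator_def)
      then have "emeasure P (?A i) < top" using fP by (rule le_less_trans)
      then show ?thesis by (simp add: infinity_ennreal_def)
    qed
    show "emeasure P X = emeasure N X" if "X \<in> ?E" for X using that box by auto
  qed
  then have "AE x in lborel. ennreal (f x) = ennreal (- f x)"
    unfolding P_def N_def using finite_density_unique[of "\<lambda>x. ennreal (f x)" lborel "\<lambda>x. ennreal (- f x)"] fP by auto
  then show ?thesis
  proof eventually_elim
    case (elim x)
    then show ?case by (cases "0 \<le> f x") (auto simp: ennreal_neg ennreal_eq_0_iff)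
  qed
qed

text \<open>A vanishing transform kills every Gaussian mollification of \<open>f\<close>. When this
  is integrated over a box, the mollification is transferred to the indicator of the box, which is
  recovered as \<delta> tends to 0 except on the frontier, a null set. So \<open>f\<close> has
  integral 0 over every box.\<close>

theorem fourier_injective:
  fixes f :: "'a::euclidean_space \<Rightarrow> complex"
  assumes f: "integrable lborel f" and z: "\<And>\<xi>. fourier f \<xi> = 0"
  shows "AE x in lborel. f x = 0"
proof -
  note [measurable] = borel_measurable_integrable[OF f]
  have conv0: "(LINT y|lborel. f y * of_real (gauss ((1 / \<delta>) *\<^sub>R (x - y)))) = 0" if "\<delta> > 0" for x \<delta>
    using gauss_convolution[OF f that, of x] that by (simp add: z)
  define \<delta> where "\<delta> n = inverse (real (Suc n))" for n
  have \<delta>: "\<delta> n > 0" for n by (simp add: \<delta>_def)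
  have \<delta>lim: "\<delta> \<longlonglongrightarrow> 0" unfolding \<delta>_def by (rule LIMSEQ_inverse_real_of_nat)
  have box: "(LINT y|lborel. f y * indicator (box a b) y) = 0" for a b
  proof -
    let ?B = "\<lambda>x. indicator (box a b) x :: complex"
    have iB: "integrable lborel ?B" by (rule integrable_real_indicator[THEN integrable_of_real, where 'a=complex, simplified of_real_indicator])
      (use emeasure_lborel_box_finite[of a b] in \<open>auto simp: less_top infinity_ennreal_def\<close>)
    define p where "p n y = (LINT u|lborel. ?B (y + \<delta> n *\<^sub>R u) * of_real (gauss u))" for n and y :: 'a
    have pB: "norm (p n y) \<le> (LINT u|lborel. gauss (u::'a))" for n y
    proof -
      have "norm (p n y) \<le> (LINT u|lborel. norm (?B (y + \<delta> n *\<^sub>R u) * of_real (gauss u)))"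
        unfolding p_def by (rule integral_norm_bound)
      also have "\<dots> \<le> (LINT u|lborel. gauss (u::'a))"
      proof (rule integral_mono)
        show "integrable lborel (\<lambda>u. norm (?B (y + \<delta> n *\<^sub>R u) * of_real (gauss u)))"
          by (rule Bochner_Integration.integrable_bound[OF gauss_integrable])
             (auto simp: norm_mult gauss_nonneg indicator_def)
      qed (auto simp: norm_mult gauss_nonneg indicator_def gauss_integrable)
      finally show ?thesis .
    qed
    have zero: "(LINT y|lborel. f y * p n y) = 0" for n
    proof -
      have "0 = (LINT x|lborel. ?B x * (LINT y|lborel. f y * of_real (gauss ((1 / \<delta> n) *\<^sub>R (x - y)))))"
        by (simp add: conv0[OF \<delta>])
      also have "\<dots> = (LINT y|lborel. f y * (LINT x|lborel. ?B x * of_real (gauss ((1 / \<delta> n) *\<^sub>R (x - y)))))"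
        by (rule fubini_kernel(1)[OF iB f]) (measurable, simp add: gauss_nonneg gauss_le_1)
      also have "\<dots> = (LINT y|lborel. of_real (\<delta> n ^ DIM('a)) * (f y * p n y))"
      proof (intro Bochner_Integration.integral_cong refl)
        fix y
        have "(LINT x|lborel. ?B x * of_real (gauss ((1 / \<delta> n) *\<^sub>R (x - y)))) =
          (\<bar>\<delta> n\<bar> ^ DIM('a)) *\<^sub>R (LINT u|lborel. ?B (y + \<delta> n *\<^sub>R u) * of_real (gauss ((1 / \<delta> n) *\<^sub>R ((y + \<delta> n *\<^sub>R u) - y))))"
          by (rule lborel_affine_integral) (use \<delta>[of n] in auto)
        then show "f y * (LINT x|lborel. ?B x * of_real (gauss ((1 / \<delta> n) *\<^sub>R (x - y)))) = of_real (\<delta> n ^ DIM('a)) * (f y * p n y)"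
          using \<delta>[of n] by (simp add: p_def scaleR_conv_of_real mult_ac)
      qed
      finally show ?thesis using \<delta>[of n] by simp
    qed
    have plim: "(\<lambda>n. p n y) \<longlonglongrightarrow> ?B y * of_real (sqrt (2 * pi) ^ DIM('a))" if "y \<notin> frontier (box a b)" for y
    proof -
      have "(\<lambda>n. p n y) \<longlonglongrightarrow> (LINT u|lborel. ?B y * of_real (gauss (u::'a)))"
        unfolding p_def
      proof (rule integral_dominated_convergence[where w=gauss])
        show "AE u in lborel. (\<lambda>n. ?B (y + \<delta> n *\<^sub>R u) * of_real (gauss u)) \<longlonglongrightarrow> ?B y * of_real (gauss u)"
        proof (rule AE_I2)
          fix u :: 'a
          have l: "(\<lambda>n. y + \<delta> n *\<^sub>R u) \<longlonglongrightarrow> y + 0 *\<^sub>R u" by (intro tendsto_intros \<delta>lim)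
          have "eventually (\<lambda>n. ?B (y + \<delta> n *\<^sub>R u) = ?B y) sequentially"
          proof (cases "y \<in> box a b")
            case True
            have "eventually (\<lambda>n. y + \<delta> n *\<^sub>R u \<in> box a b) sequentially"
              using l True by (intro topological_tendstoD[OF l]) auto
            then show ?thesis by eventually_elim (use True in simp)
          next
            case False
            then have "y \<in> - closure (box a b)" using that by (auto simp: frontier_def interior_open[OF open_box])
            then have "eventually (\<lambda>n. y + \<delta> n *\<^sub>R u \<in> - closure (box a b)) sequentially"
              by (intro topological_tendstoD[OF l]) auto
            then show ?thesis by eventually_elim (use False closure_subset in \<open>auto simp: indicator_def\<close>)
          qed
          then have "eventually (\<lambda>n. ?B (y + \<delta> n *\<^sub>R u) * of_real (gauss u) = ?B y * of_real (gauss u)) sequentially"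
            by eventually_elim simp
          then show "(\<lambda>n. ?B (y + \<delta> n *\<^sub>R u) * of_real (gauss u)) \<longlonglongrightarrow> ?B y * of_real (gauss u)" by (rule tendsto_eventually)
        qed
        show "AE u in lborel. norm (?B (y + \<delta> n *\<^sub>R u) * of_real (gauss u)) \<le> gauss u" for n
          by (intro AE_I2) (auto simp: norm_mult gauss_nonneg indicator_def)
      qed (auto simp: gauss_integrable)
      then show ?thesis by (simp add: gauss_integral)
    qed
    have pm [measurable]: "p n \<in> borel_measurable borel" for n unfolding p_def[abs_def] by measurable
    have fr: "AE y in lborel. y \<notin> frontier (box a b)"
    proof (rule AE_not_in)
      have "negligible (frontier (box a b))" by (intro negligible_convex_frontier convex_box)
      then show "frontier (box a b) \<in> null_sets lborel"
        using negligible_iff_null_sets null_sets_completion_iff by (metis borel_closed frontier_closed sets_lborel)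
    qed
    have "(\<lambda>n. LINT y|lborel. f y * p n y) \<longlonglongrightarrow> (LINT y|lborel. f y * (?B y * of_real (sqrt (2 * pi) ^ DIM('a))))"
    proof (rule integral_dominated_convergence[where w="\<lambda>y. norm (f y) * (LINT u|lborel. gauss (u::'a))"])
      show "AE y in lborel. (\<lambda>n. f y * p n y) \<longlonglongrightarrow> f y * (?B y * of_real (sqrt (2 * pi) ^ DIM('a)))"
        using fr by eventually_elim (intro tendsto_intros plim)
      show "AE y in lborel. norm (f y * p n y) \<le> norm (f y) * (LINT u|lborel. gauss (u::'a))" for n
        using pB by (intro AE_I2) (simp add: norm_mult mult_left_mono)
      show "integrable lborel (\<lambda>y. norm (f y) * (LINT u|lborel. gauss (u::'a)))" using f by simp
    qed measurable
    then have "(\<lambda>n. 0::complex) \<longlonglongrightarrow> (LINT y|lborel. f y * (?B y * of_real (sqrt (2 * pi) ^ DIM('a))))" by (simp add: zero)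
    then have "(LINT y|lborel. f y * (?B y * of_real (sqrt (2 * pi) ^ DIM('a)))) = 0" using LIMSEQ_unique tendsto_const by blast
    then have "(LINT y|lborel. (f y * ?B y) * of_real (sqrt (2 * pi) ^ DIM('a))) = 0" by (simp add: mult.assoc)
    then show ?thesis by simp
  qed
  have ib: "integrable lborel (\<lambda>y. f y * indicator (box a b) y)" for a b
    by (rule Bochner_Integration.integrable_bound[OF f]) (auto simp: norm_mult indicator_def)
  have "AE x in lborel. Re (f x) = 0"
  proof (rule integrable_zero_on_boxes)
    show "integrable lborel (\<lambda>x. Re (f x))" using f by simp
    fix a b
    have e: "(LINT x|lborel. indicator (box a b) x * Re (f x)) = (LINT x|lborel. Re (f x * indicator (box a b) x))"
      by (intro Bochner_Integration.integral_cong refl) (simp add: indicator_def)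
    show "(LINT x|lborel. indicator (box a b) x * Re (f x)) = 0" unfolding e integral_Re[OF ib] box by simp
  qed
  moreover have "AE x in lborel. Im (f x) = 0"
  proof (rule integrable_zero_on_boxes)
    show "integrable lborel (\<lambda>x. Im (f x))" using f by simp
    fix a b
    have e: "(LINT x|lborel. indicator (box a b) x * Im (f x)) = (LINT x|lborel. Im (f x * indicator (box a b) x))"
      by (intro Bochner_Integration.integral_cong refl) (simp add: indicator_def)
    show "(LINT x|lborel. indicator (box a b) x * Im (f x)) = 0" unfolding e integral_Im[OF ib] box by simp
  qed
  ultimately show ?thesis by eventually_elim (simp add: complex_eq_iff)
qed

section \<open>Distributions with integrable Fourier transform\<close>

lemma cont_diff_scale: "cont_diff n f \<Longrightarrow> cont_diff n (\<lambda>x. f (c *\<^sub>R x))"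
proof (induction n arbitrary: f)
  case 0
  then have "continuous_on UNIV f" by simp
  then have "continuous_on UNIV (f \<circ> (\<lambda>x. c *\<^sub>R x))"
    by (intro continuous_on_compose continuous_intros) (auto intro: continuous_on_subset)
  then show ?case by (simp add: o_def)
next
  case (Suc n)
  obtain f' where f': "\<And>x. (f has_derivative f' x) (at x)" "\<And>v. cont_diff n (\<lambda>x. f' x v)" using Suc.prems by auto
  show ?case unfolding cont_diff.simps
  proof (intro exI[of _ "\<lambda>x v. f' (c *\<^sub>R x) (c *\<^sub>R v)"] conjI allI)
    show "((\<lambda>x. f (c *\<^sub>R x)) has_derivative (\<lambda>v. f' (c *\<^sub>R x) (c *\<^sub>R v))) (at x)" for x
      by (rule has_derivative_compose[OF _ f'(1)]) (auto intro!: derivative_eq_intros)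
    show "cont_diff n (\<lambda>x. f' (c *\<^sub>R x) (c *\<^sub>R v))" for v by (rule Suc.IH[OF f'(2)])
  qed
qed

lemma dyadic_partitionD:
  fixes \<psi> :: "'a::euclidean_space \<Rightarrow> real"
  assumes dp: "dyadic_partition \<psi> \<rho>"
  shows "cont_diff n \<psi>" "cont_diff n \<rho>" "0 \<le> \<psi> \<xi>" "0 \<le> \<rho> \<xi>"
    "\<exists>R. \<forall>\<xi>. \<psi> \<xi> \<noteq> 0 \<longrightarrow> norm \<xi> \<le> R"
    "\<exists>r>0. \<exists>R. \<forall>\<xi>. \<rho> \<xi> \<noteq> 0 \<longrightarrow> r \<le> norm \<xi> \<and> norm \<xi> \<le> R"
    "(\<lambda>j. lp_symbol \<psi> \<rho> j \<xi>) sums 1"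
proof -
  note D1 = dp[unfolded dyadic_partition_def]
  note D2 = D1[THEN conjunct2]
  note D3 = D2[THEN conjunct2]
  note D5 = D3[THEN conjunct2, THEN conjunct2]
  note D6 = D5[THEN conjunct2]
  note D7 = D6[THEN conjunct2]
  show "cont_diff n \<psi>" by (rule D1[THEN conjunct1, THEN spec])
  show "cont_diff n \<rho>" by (rule D2[THEN conjunct1, THEN spec])
  show "0 \<le> \<psi> \<xi>" by (rule D3[THEN conjunct1, THEN spec, THEN conjunct1])
  show "0 \<le> \<rho> \<xi>" by (rule D3[THEN conjunct1, THEN spec, THEN conjunct2])
  show "\<exists>R. \<forall>\<xi>. \<psi> \<xi> \<noteq> 0 \<longrightarrow> norm \<xi> \<le> R" by (rule D5[THEN conjunct1])
  show "\<exists>r>0. \<exists>R. \<forall>\<xi>. \<rho> \<xi> \<noteq> 0 \<longrightarrow> r \<le> norm \<xi> \<and> norm \<xi> \<le> R" by (rule D6[THEN conjunct1])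
  show "(\<lambda>j. lp_symbol \<psi> \<rho> j \<xi>) sums 1" by (rule D7[THEN conjunct1, THEN spec])
qed

lemma
  fixes \<psi> :: "'a::euclidean_space \<Rightarrow> real"
  assumes dp: "dyadic_partition \<psi> \<rho>"
  shows lp_nonneg: "0 \<le> lp_symbol \<psi> \<rho> j \<xi>"
    and lp_sums: "(\<lambda>j. lp_symbol \<psi> \<rho> j \<xi>) sums 1"
    and lp_le_1: "lp_symbol \<psi> \<rho> j \<xi> \<le> 1"
    and lp_schwartz: "(\<lambda>\<xi>. complex_of_real (lp_symbol \<psi> \<rho> j \<xi>)) \<in> schwartz"
proof -
  show nn: "0 \<le> lp_symbol \<psi> \<rho> j \<xi>" for j \<xi>
    unfolding lp_symbol_def by (cases j) (simp_all add: dyadic_partitionD(3,4)[OF dp])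
  show s: "(\<lambda>j. lp_symbol \<psi> \<rho> j \<xi>) sums 1" for \<xi> by (rule dyadic_partitionD(7)[OF dp])
  have "sum (\<lambda>j. lp_symbol \<psi> \<rho> j \<xi>) {j} \<le> suminf (\<lambda>j. lp_symbol \<psi> \<rho> j \<xi>)"
    by (rule sum_le_suminf) (use s nn in \<open>auto simp: sums_iff\<close>)
  then show "lp_symbol \<psi> \<rho> j \<xi> \<le> 1" using s[of \<xi>] by (simp add: sums_iff)
  obtain R where R: "\<And>\<xi>. \<psi> \<xi> \<noteq> 0 \<Longrightarrow> norm \<xi> \<le> R" using dyadic_partitionD(5)[OF dp] by blast
  obtain R' where R': "\<And>\<xi>. \<rho> \<xi> \<noteq> 0 \<Longrightarrow> norm \<xi> \<le> R'" using dyadic_partitionD(6)[OF dp] by blast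
  note cd = dyadic_partitionD(1,2)[OF dp]
  have "\<exists>R. \<forall>\<xi>. lp_symbol \<psi> \<rho> j \<xi> \<noteq> 0 \<longrightarrow> norm \<xi> \<le> R"
  proof (cases j)
    case 0 then show ?thesis using R by (auto simp: lp_symbol_def)
  next
    case (Suc i)
    have "norm \<xi> \<le> R' * 2 ^ i" if "\<rho> ((1 / 2 ^ i) *\<^sub>R \<xi>) \<noteq> 0" for \<xi>
      using R'[OF that] by (simp add: divide_le_eq)
    then show ?thesis using Suc by (auto simp: lp_symbol_def)
  qed
  then obtain R2 where R2: "\<And>\<xi>. lp_symbol \<psi> \<rho> j \<xi> \<noteq> 0 \<Longrightarrow> norm \<xi> \<le> R2" by blast
  have "cont_diff n (lp_symbol \<psi> \<rho> j)" for n
    using cd cont_diff_scale[OF cd(2)] by (cases j) (simp_all add: lp_symbol_def del: cont_diff.simps)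
  then have "cont_diff n (\<lambda>\<xi>. complex_of_real (lp_symbol \<psi> \<rho> j \<xi>))" for n
    by (rule cont_diff_bounded_linear[OF bounded_linear_of_real])
  then show "(\<lambda>\<xi>. complex_of_real (lp_symbol \<psi> \<rho> j \<xi>)) \<in> schwartz"
    by (rule schwartz_compact_support) (use R2 in auto)
qed

text \<open>On the support of block \<open>Suc i\<close> the frequency is at least r * 2 ^ i, so the
  weight (2 ^ i) powr \<theta> of that block is at most (norm \<xi> / r) powr \<theta>. Block 0
  carries the weight 2 powr (- \<theta>), at most 1.\<close>

lemma lp_weight:
  fixes \<psi> :: "'a::euclidean_space \<Rightarrow> real"
  assumes dp: "dyadic_partition \<psi> \<rho>" and \<theta>: "\<theta> \<ge> 0"
  obtains K where "K \<ge> 0" "\<And>j \<xi>. 2 powr ((real j - 1) * \<theta>) * lp_symbol \<psi> \<rho> j \<xi> \<le> K * (1 + norm \<xi>) powr \<theta>"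
proof -
  obtain r where r: "r > 0" "\<And>\<xi>. \<rho> \<xi> \<noteq> 0 \<Longrightarrow> r \<le> norm \<xi>" using dyadic_partitionD(6)[OF dp] by blast
  define K where "K = max 1 (r powr (- \<theta>))"
  have K: "K \<ge> 1" "K \<ge> r powr (- \<theta>)" by (auto simp: K_def)
  show ?thesis
  proof (rule that[of K])
    show "K \<ge> 0" using K by linarith
    fix j \<xi>
    let ?s = "lp_symbol \<psi> \<rho> j \<xi>"
    note s = lp_nonneg[OF dp, of j \<xi>] lp_le_1[OF dp, of j \<xi>]
    show "2 powr ((real j - 1) * \<theta>) * ?s \<le> K * (1 + norm \<xi>) powr \<theta>"
    proof (cases j)
      case 0
      have "2 powr ((real j - 1) * \<theta>) * ?s \<le> 1 * 1"
        using 0 \<theta> s powr_mono[of "- \<theta>" 0 "2::real"] by (intro mult_mono) auto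
      also have "\<dots> \<le> K * (1 + norm \<xi>) powr \<theta>" using K \<theta> by (intro mult_mono ge_one_powr_ge_zero) auto
      finally show ?thesis .
    next
      case (Suc i)
      show ?thesis
      proof (cases "?s = 0")
        case False
        then have "\<rho> ((1 / 2 ^ i) *\<^sub>R \<xi>) \<noteq> 0" using Suc by (simp add: lp_symbol_def)
        from r(2)[OF this] have "2 ^ i \<le> norm \<xi> / r" using r(1) by (simp add: field_simps)
        then have "(2 ^ i) powr \<theta> \<le> (norm \<xi> / r) powr \<theta>" using \<theta> by (intro powr_mono2) auto
        also have "\<dots> = r powr (- \<theta>) * norm \<xi> powr \<theta>" using r(1) by (simp add: powr_divide powr_minus_divide)
        also have "\<dots> \<le> K * (1 + norm \<xi>) powr \<theta>" using K \<theta> r(1) by (intro mult_mono powr_mono2) auto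
        finally have 1: "(2 ^ i) powr \<theta> \<le> K * (1 + norm \<xi>) powr \<theta>" .
        have "2 powr ((real j - 1) * \<theta>) = (2 ^ i) powr \<theta>" using Suc by (simp add: powr_powr flip: powr_realpow)
        then have "2 powr ((real j - 1) * \<theta>) * ?s \<le> (2 ^ i) powr \<theta> * 1" using s by (simp add: mult_left_le)
        with 1 show ?thesis by simp
      qed (use K in simp)
    qed
  qed
qed

text \<open>The symbols of the partition serve as cut-offs: multiplied by one of them,
  \<open>h\<close> becomes integrable, and the modulated symbols are test functions that make its
  Fourier transform vanish. Since the symbols sum to 1, some symbol is nonzero at each
  point.\<close>

lemma schwartz_test_unique:
  fixes \<psi> :: "'a::euclidean_space \<Rightarrow> real" and h :: "'a \<Rightarrow> complex"
  assumes dp: "dyadic_partition \<psi> \<rho>"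
    and h: "\<And>\<phi>. \<phi> \<in> schwartz \<Longrightarrow> integrable lborel (\<lambda>x. h x * \<phi> x)" "\<And>\<phi>. \<phi> \<in> schwartz \<Longrightarrow> (LINT x|lborel. h x * \<phi> x) = 0"
  shows "AE x in lborel. h x = 0"
proof -
  have "AE x in lborel. h x * of_real (lp_symbol \<psi> \<rho> j x) = 0" for j
  proof (rule fourier_injective)
    show "integrable lborel (\<lambda>x. h x * of_real (lp_symbol \<psi> \<rho> j x))" by (rule h(1)[OF lp_schwartz[OF dp]])
    fix \<xi>
    have "(LINT x|lborel. h x * (exp (\<i> * of_real (x \<bullet> (- \<xi>))) * of_real (lp_symbol \<psi> \<rho> j x))) = 0"
      by (rule h(2)[OF schwartz_modulate[OF lp_schwartz[OF dp]]])
    then show "fourier (\<lambda>x. h x * of_real (lp_symbol \<psi> \<rho> j x)) \<xi> = 0" by (simp add: fourier_def mult_ac)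
  qed
  then have "AE x in lborel. \<forall>j. h x * of_real (lp_symbol \<psi> \<rho> j x) = 0" by (subst AE_all_countable) blast
  then show ?thesis
  proof eventually_elim
    case (elim x)
    show ?case
    proof (rule ccontr)
      assume "h x \<noteq> 0"
      then have "\<And>j. lp_symbol \<psi> \<rho> j x = 0" using elim by simp
      then have "(\<lambda>j. 0::real) sums 1" using lp_sums[OF dp, of x] by simp
      then show False using sums_unique2 sums_zero by fastforce
    qed
  qed
qed

text \<open>The duality of \<open>has_fourier\<close>, read through inversion and with an integrable
  transform: \<open>u\<close> is integration against \<open>inv_fourier G\<close>. This is the
  representation in which all estimates of the convolutions are carried out.\<close>

definition has_symbol :: "'a::euclidean_space distribution \<Rightarrow> ('a \<Rightarrow> complex) \<Rightarrow> bool" where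
  "has_symbol u G \<longleftrightarrow> integrable lborel G \<and>
     (\<forall>\<phi>\<in>schwartz. u \<phi> = (LINT \<xi>|lborel. G \<xi> * inv_fourier \<phi> \<xi>))"

lemma inv_fourier_bound:
  fixes f :: "'a::euclidean_space \<Rightarrow> complex"
  assumes "integrable lborel f"
  shows "norm (inv_fourier f x) \<le> (LINT x|lborel. norm (f x))"
proof -
  have "1 \<le> (2 * pi) ^ DIM('a)" using pi_gt3 by (intro one_le_power) simp
  moreover have "norm (inv_fourier f x) = norm (fourier f (- x)) / (2 * pi) ^ DIM('a)"
    unfolding inv_fourier_eq_fourier norm_divide norm_of_real by simp
  ultimately have "norm (inv_fourier f x) \<le> norm (fourier f (- x)) / 1"
    by (simp only:) (intro divide_left_mono, auto)
  also have "\<dots> \<le> (LINT x|lborel. norm (f x))" using fourier_bound[OF assms] by simp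
  finally show ?thesis .
qed

lemma integrable_mult_schwartz:
  assumes G: "integrable lborel G" and \<phi>: "\<phi> \<in> schwartz"
  shows "integrable lborel (\<lambda>\<xi>. G \<xi> * \<phi> \<xi>)"
proof -
  note [measurable] = borel_measurable_integrable[OF G] schwartz_measurable[OF \<phi>]
  obtain C where C: "C \<ge> 0" "\<And>y. (1 + norm y) ^ 0 * norm (\<phi> y) \<le> C" using rapidE[OF schwartz_rapid[OF \<phi>], of 0] by blast
  show ?thesis
  proof (rule Bochner_Integration.integrable_bound)
    show "integrable lborel (\<lambda>\<xi>. norm (G \<xi>) * C)" using G by simp
    show "AE \<xi> in lborel. norm (G \<xi> * \<phi> \<xi>) \<le> norm (norm (G \<xi>) * C)"
      using C by (intro AE_I2) (simp add: norm_mult mult_left_mono)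
  qed measurable
qed

lemma has_symbol_diff:
  assumes "has_symbol u G" "has_symbol v H"
  shows "has_symbol (u - v) (\<lambda>\<xi>. G \<xi> - H \<xi>)"
  unfolding has_symbol_def
proof (intro conjI ballI)
  have i: "integrable lborel G" "integrable lborel H" using assms by (auto simp: has_symbol_def)
  then show "integrable lborel (\<lambda>\<xi>. G \<xi> - H \<xi>)" by simp
  fix \<phi> :: "'a \<Rightarrow> complex" assume \<phi>: "\<phi> \<in> schwartz"
  note p = inv_fourier_schwartz[OF \<phi>]
  show "(u - v) \<phi> = (LINT \<xi>|lborel. (G \<xi> - H \<xi>) * inv_fourier \<phi> \<xi>)"
    using assms \<phi> integrable_mult_schwartz[OF i(1) p] integrable_mult_schwartz[OF i(2) p]
    by (simp add: has_symbol_def left_diff_distrib)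
qed

lemma inv_fourier_lin:
  assumes "\<phi> \<in> schwartz" "\<zeta> \<in> schwartz"
  shows "inv_fourier (\<lambda>x. \<phi> x + \<zeta> x) \<xi> = inv_fourier \<phi> \<xi> + inv_fourier \<zeta> \<xi>"
    and "inv_fourier (\<lambda>x. c * \<phi> x) \<xi> = c * inv_fourier \<phi> \<xi>"
proof -
  have "fourier (\<lambda>x. \<phi> x + \<zeta> x) (- \<xi>) = fourier \<phi> (- \<xi>) + fourier \<zeta> (- \<xi>)"
    unfolding fourier_def distrib_left
    by (rule Bochner_Integration.integral_add) (intro integrable_kernel schwartz_integrable assms)+
  then show "inv_fourier (\<lambda>x. \<phi> x + \<zeta> x) \<xi> = inv_fourier \<phi> \<xi> + inv_fourier \<zeta> \<xi>"
    unfolding inv_fourier_eq_fourier by (simp add: add_divide_distrib)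
  have "fourier (\<lambda>x. c * \<phi> x) (- \<xi>) = c * fourier \<phi> (- \<xi>)"
    unfolding fourier_def by (simp only: mult.left_commute[of _ c] integral_mult_right_zero)
  then show "inv_fourier (\<lambda>x. c * \<phi> x) \<xi> = c * inv_fourier \<phi> \<xi>"
    unfolding inv_fourier_eq_fourier by simp
qed

lemma schwartz_seminorm_upper:
  fixes \<phi> :: "'a::euclidean_space \<Rightarrow> complex"
  assumes "\<phi> \<in> schwartz"
  shows "(1 + norm x) ^ N * norm (\<phi> x) \<le> schwartz_seminorm N \<phi>"
proof -
  define A where "A = {vs :: 'a list. set vs \<subseteq> Basis \<and> length vs \<le> N}"
  have fin: "finite A" unfolding A_def by (rule finite_lists_length_le) simp
  have "\<forall>vs. \<exists>C. vs \<in> A \<longrightarrow> (\<forall>x. (1 + norm x) ^ N * norm (iter_deriv vs \<phi> x) \<le> C)"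
  proof (intro allI)
    fix vs
    show "\<exists>C. vs \<in> A \<longrightarrow> (\<forall>x. (1 + norm x) ^ N * norm (iter_deriv vs \<phi> x) \<le> C)"
    proof (cases "vs \<in> A")
      case True
      then have "bounded (range (\<lambda>x. (1 + norm x) ^ N *\<^sub>R iter_deriv vs \<phi> x))"
        using assms by (simp add: schwartz_def A_def)
      then show ?thesis unfolding bounded_iff by (auto simp: norm_power)
    qed simp
  qed
  then obtain C where C: "\<And>vs x. vs \<in> A \<Longrightarrow> (1 + norm x) ^ N * norm (iter_deriv vs \<phi> x) \<le> C vs" by metis
  have "bdd_above ((\<lambda>(vs, x). (1 + norm x) ^ N * norm (iter_deriv vs \<phi> x)) ` (A \<times> UNIV))"
  proof (rule bdd_aboveI2[where M="\<Sum>vs\<in>A. \<bar>C vs\<bar>"], clarify)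
    fix vs x assume vs: "vs \<in> A"
    have "C vs \<le> \<bar>C vs\<bar>" by simp
    also have "\<dots> \<le> (\<Sum>vs\<in>A. \<bar>C vs\<bar>)" by (rule member_le_sum) (use vs fin in auto)
    finally show "(1 + norm x) ^ N * norm (iter_deriv vs \<phi> x) \<le> (\<Sum>vs\<in>A. \<bar>C vs\<bar>)" using C[OF vs, of x] by linarith
  qed
  then have "(case ([], x) of (vs, x) \<Rightarrow> (1 + norm x) ^ N * norm (iter_deriv vs \<phi> x)) \<le> schwartz_seminorm N \<phi>"
    unfolding schwartz_seminorm_def A_def[symmetric] by (intro cSUP_upper) (auto simp: A_def)
  then show ?thesis by simp
qed

text \<open>The supremum of the inverse transform is bounded by the L^1 norm of \<phi>, and
  \<open>poly_weight\<close> bounds the latter by the seminorm of order 2 * DIM('a).\<close>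

lemma has_symbol_tempered:
  fixes u :: "'a::euclidean_space distribution"
  assumes "has_symbol u G"
  shows "tempered u"
proof -
  have G: "integrable lborel G" and u: "\<And>\<phi>. \<phi> \<in> schwartz \<Longrightarrow> u \<phi> = (LINT \<xi>|lborel. G \<xi> * inv_fourier \<phi> \<xi>)"
    using assms by (auto simp: has_symbol_def)
  have int: "integrable lborel (\<lambda>\<xi>. G \<xi> * inv_fourier \<phi> \<xi>)" if "\<phi> \<in> schwartz" for \<phi>
    by (rule integrable_mult_schwartz[OF G inv_fourier_schwartz[OF that]])
  show ?thesis unfolding tempered_def
  proof (intro conjI ballI allI)
    fix \<phi> \<zeta> :: "'a \<Rightarrow> complex" assume s: "\<phi> \<in> schwartz" "\<zeta> \<in> schwartz"
    show "u (\<lambda>x. \<phi> x + \<zeta> x) = u \<phi> + u \<zeta>"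
      by (simp add: u schwartz_add s inv_fourier_lin(1)[OF s] distrib_left int)
  next
    fix c and \<phi> :: "'a \<Rightarrow> complex" assume s: "\<phi> \<in> schwartz"
    show "u (\<lambda>x. c * \<phi> x) = c * u \<phi>"
      by (simp add: u schwartz_cmult s inv_fourier_lin(2)[OF s s] mult.left_commute[of _ c])
  next
    let ?g = "LINT \<xi>|lborel. norm (G \<xi>)" and ?w = "LINT x|lborel. poly_weight (x::'a)"
    show "\<exists>C N. \<forall>\<phi>\<in>schwartz. norm (u \<phi>) \<le> C * schwartz_seminorm N \<phi>"
    proof (intro exI[of _ "?g * ?w"] exI[of _ "2 * DIM('a)"] ballI)
      fix \<phi> :: "'a \<Rightarrow> complex" assume s: "\<phi> \<in> schwartz"
      let ?S = "schwartz_seminorm (2 * DIM('a)) \<phi>"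
      have "(LINT x|lborel. norm (\<phi> x)) \<le> (LINT x|lborel. ?S * poly_weight (x::'a))"
      proof (rule integral_mono)
        show "integrable lborel (\<lambda>x. norm (\<phi> x))" by (intro integrable_norm schwartz_integrable s)
        show "integrable lborel (\<lambda>x::'a. ?S * poly_weight x)" by (intro integrable_mult_right integrable_poly_weight)
        show "norm (\<phi> x) \<le> ?S * poly_weight x" for x
          by (rule poly_weight_bound[OF schwartz_seminorm_upper[OF s]]) simp
      qed
      then have b: "norm (inv_fourier \<phi> \<xi>) \<le> ?S * ?w" for \<xi>
        using order_trans[OF inv_fourier_bound[OF schwartz_integrable[OF s]]] by simp
      have "norm (u \<phi>) \<le> (LINT \<xi>|lborel. norm (G \<xi> * inv_fourier \<phi> \<xi>))"
        unfolding u[OF s] by (rule integral_norm_bound)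
      also have "\<dots> \<le> (LINT \<xi>|lborel. norm (G \<xi>) * (?S * ?w))"
      proof (rule integral_mono)
        show "integrable lborel (\<lambda>\<xi>. norm (G \<xi> * inv_fourier \<phi> \<xi>))" by (intro integrable_norm int s)
        show "norm (G \<xi> * inv_fourier \<phi> \<xi>) \<le> norm (G \<xi>) * (?S * ?w)" for \<xi>
          unfolding norm_mult by (intro mult_left_mono b) simp
      qed (use G in simp)
      also have "\<dots> = ?g * ?w * ?S" by (simp add: mult_ac)
      finally show "norm (u \<phi>) \<le> ?g * ?w * ?S" .
    qed
  qed
qed

text \<open>The kernel of a block, seen from \<open>x\<close>, is the Fourier transform of a
  multiple of the symbol modulated by exp (\<i> * (\<xi> \<bullet> x)). Pairing with
  \<open>u\<close> undoes this transform and leaves an integral of \<open>G\<close> against the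
  modulated symbol.\<close>

lemma has_symbol_lp_block:
  fixes u :: "'a::euclidean_space distribution"
  assumes dp: "dyadic_partition \<psi> \<rho>" and u: "has_symbol u G"
  shows "norm (lp_block \<psi> \<rho> j u x) \<le> (LINT \<xi>|lborel. lp_symbol \<psi> \<rho> j \<xi> * norm (G \<xi>))"
proof -
  let ?s = "\<lambda>\<xi>. complex_of_real (lp_symbol \<psi> \<rho> j \<xi>)"
  define c where "c = 1 / complex_of_real ((2 * pi) ^ DIM('a))"
  let ?t = "\<lambda>\<xi>. c * (iexp (\<xi> \<bullet> x) * ?s \<xi>)"
  have t: "?t \<in> schwartz" by (intro schwartz_cmult schwartz_modulate lp_schwartz[OF dp])
  have eq: "(\<lambda>y. inv_fourier ?s (x - y)) = fourier ?t"
  proof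
    fix y
    have "inv_fourier ?s (x - y) = c * (LINT \<xi>|lborel. iexp ((x - y) \<bullet> \<xi>) * ?s \<xi>)" by (simp add: inv_fourier_def c_def)
    also have "\<dots> = (LINT \<xi>|lborel. c * (iexp ((x - y) \<bullet> \<xi>) * ?s \<xi>))" by simp
    also have "\<dots> = (LINT \<xi>|lborel. exp (- \<i> * of_real (\<xi> \<bullet> y)) * ?t \<xi>)"
    proof (intro Bochner_Integration.integral_cong refl)
      fix \<xi>
      have "iexp ((x - y) \<bullet> \<xi>) = exp (- \<i> * of_real (\<xi> \<bullet> y)) * iexp (\<xi> \<bullet> x)"
        unfolding mult_exp_exp by (simp add: inner_diff_left inner_commute algebra_simps)
      then show "c * (iexp ((x - y) \<bullet> \<xi>) * ?s \<xi>) = exp (- \<i> * of_real (\<xi> \<bullet> y)) * ?t \<xi>" by (simp only: mult_ac)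
    qed
    finally show "inv_fourier ?s (x - y) = fourier ?t y" by (simp add: fourier_def)
  qed
  have "lp_block \<psi> \<rho> j u x = (LINT \<xi>|lborel. G \<xi> * ?t \<xi>)"
    unfolding lp_block_def eq using u fourier_schwartz[OF t] by (simp add: has_symbol_def fourier_inversion[OF t])
  also have "norm \<dots> \<le> (LINT \<xi>|lborel. norm (G \<xi> * ?t \<xi>))" by (rule integral_norm_bound)
  also have "\<dots> \<le> (LINT \<xi>|lborel. lp_symbol \<psi> \<rho> j \<xi> * norm (G \<xi>))"
  proof (rule integral_mono)
    have G: "integrable lborel G" using u by (simp add: has_symbol_def)
    show "integrable lborel (\<lambda>\<xi>. norm (G \<xi> * ?t \<xi>))" by (intro integrable_norm integrable_mult_schwartz G t)
    have "integrable lborel (\<lambda>\<xi>. norm (G \<xi> * ?s \<xi>))" by (intro integrable_norm integrable_mult_schwartz G lp_schwartz[OF dp])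
    then show "integrable lborel (\<lambda>\<xi>. lp_symbol \<psi> \<rho> j \<xi> * norm (G \<xi>))"
      by (simp add: norm_mult abs_of_nonneg[OF lp_nonneg[OF dp]] mult.commute)
    fix \<xi>
    have "1 \<le> (2 * pi) ^ DIM('a)" using pi_gt3 by (intro one_le_power) simp
    then have "1 / \<bar>(2 * pi) ^ DIM('a)\<bar> \<le> 1" unfolding divide_le_eq_1 by linarith
    then have c: "norm c \<le> 1" by (simp only: c_def norm_divide norm_one norm_of_real)
    have "norm (G \<xi> * ?t \<xi>) = norm c * (lp_symbol \<psi> \<rho> j \<xi> * norm (G \<xi>))"
      by (simp add: norm_mult abs_of_nonneg[OF lp_nonneg[OF dp]])
    also have "\<dots> \<le> 1 * (lp_symbol \<psi> \<rho> j \<xi> * norm (G \<xi>))"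
      using c lp_nonneg[OF dp] by (intro mult_right_mono) auto
    finally show "norm (G \<xi> * ?t \<xi>) \<le> lp_symbol \<psi> \<rho> j \<xi> * norm (G \<xi>)" by simp
  qed
  finally show ?thesis .
qed

text \<open>Each block is bounded by an integral of its symbol against the modulus of
  \<open>G\<close>, where \<open>lp_weight\<close> absorbs the Besov weight. The constant is fixed
  before \<open>u\<close>, since the bound is to be applied to time increments.\<close>

lemma besov_of_symbol:
  fixes \<psi> :: "'a::euclidean_space \<Rightarrow> real"
  assumes dp: "dyadic_partition \<psi> \<rho>" and \<theta>: "\<theta> \<ge> 0"
  obtains K where "K \<ge> 0" 
    "\<And>u G. has_symbol u G \<Longrightarrow> integrable lborel (\<lambda>\<xi>. (1 + norm \<xi>) powr \<theta> * norm (G \<xi>)) \<Longrightarrow> u \<in> besov \<psi> \<rho> \<theta>"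
    "\<And>u G. has_symbol u G \<Longrightarrow> integrable lborel (\<lambda>\<xi>. (1 + norm \<xi>) powr \<theta> * norm (G \<xi>)) \<Longrightarrow>
       besov_norm \<psi> \<rho> \<theta> u \<le> K * (LINT \<xi>|lborel. (1 + norm \<xi>) powr \<theta> * norm (G \<xi>))"
proof -
  obtain K where K: "K \<ge> 0" "\<And>j \<xi>. 2 powr ((real j - 1) * \<theta>) * lp_symbol \<psi> \<rho> j \<xi> \<le> K * (1 + norm \<xi>) powr \<theta>"
    by (rule lp_weight[OF dp \<theta>]) blast
  have b: "2 powr ((real j - 1) * \<theta>) * norm (lp_block \<psi> \<rho> j u x) \<le> K * (LINT \<xi>|lborel. (1 + norm \<xi>) powr \<theta> * norm (G \<xi>))"
    if u: "has_symbol u G" and i: "integrable lborel (\<lambda>\<xi>. (1 + norm \<xi>) powr \<theta> * norm (G \<xi>))" for u G j x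
  proof -
    let ?p = "2 powr ((real j - 1) * \<theta>)"
    have G: "integrable lborel G" using u by (simp add: has_symbol_def)
    have "integrable lborel (\<lambda>\<xi>. norm (G \<xi> * complex_of_real (lp_symbol \<psi> \<rho> j \<xi>)))"
      by (intro integrable_norm integrable_mult_schwartz G lp_schwartz[OF dp])
    then have i2: "integrable lborel (\<lambda>\<xi>. lp_symbol \<psi> \<rho> j \<xi> * norm (G \<xi>))"
      by (simp add: norm_mult abs_of_nonneg[OF lp_nonneg[OF dp]] mult.commute)
    have "?p * norm (lp_block \<psi> \<rho> j u x) \<le> ?p * (LINT \<xi>|lborel. lp_symbol \<psi> \<rho> j \<xi> * norm (G \<xi>))"
      by (intro mult_left_mono has_symbol_lp_block[OF dp u]) simp
    also have "\<dots> = (LINT \<xi>|lborel. ?p * (lp_symbol \<psi> \<rho> j \<xi> * norm (G \<xi>)))" by simp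
    also have "\<dots> \<le> (LINT \<xi>|lborel. K * ((1 + norm \<xi>) powr \<theta> * norm (G \<xi>)))"
    proof (rule integral_mono)
      show "?p * (lp_symbol \<psi> \<rho> j \<xi> * norm (G \<xi>)) \<le> K * ((1 + norm \<xi>) powr \<theta> * norm (G \<xi>))" for \<xi>
        unfolding mult.assoc[symmetric] by (intro mult_right_mono K) simp
    qed (use i i2 in auto)
    finally show ?thesis by simp
  qed
  show ?thesis
  proof (rule that[OF K(1)])
    fix u :: "'a distribution" and G assume u: "has_symbol u G" and i: "integrable lborel (\<lambda>\<xi>. (1 + norm \<xi>) powr \<theta> * norm (G \<xi>))"
    show "u \<in> besov \<psi> \<rho> \<theta>" unfolding besov_def
      using has_symbol_tempered[OF u] b[OF u i] by (auto intro!: bdd_aboveI2)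
    show "besov_norm \<psi> \<rho> \<theta> u \<le> K * (LINT \<xi>|lborel. (1 + norm \<xi>) powr \<theta> * norm (G \<xi>))"
      unfolding besov_norm_def by (rule cSUP_least) (use b[OF u i] in auto)
  qed
qed

text \<open>\<open>u\<close> is integration against h = \<open>inv_fourier G\<close>. Realness of
  \<open>u\<close> shows that the conjugate of h represents it too, and averaging the two leaves the
  real part; realness is thus used on the spatial side, not as a symmetry of
  \<open>G\<close>.\<close>

lemma has_symbol_represented:
  fixes u :: "'a::euclidean_space distribution"
  assumes u: "has_symbol u G" and real: "\<And>\<phi>. \<phi> \<in> schwartz \<Longrightarrow> u (\<lambda>x. cnj (\<phi> x)) = cnj (u \<phi>)"
  shows "represented_by u (\<lambda>x. Re (inv_fourier G x))"
proof -
  have G: "integrable lborel G" using u by (simp add: has_symbol_def)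
  let ?c = "1 / complex_of_real ((2 * pi) ^ DIM('a))"
  let ?h = "inv_fourier G"
  have [measurable]: "G \<in> borel_measurable borel" using borel_measurable_integrable[OF G] by simp
  have meas: "?h \<in> borel_measurable borel" unfolding inv_fourier_def[abs_def] by measurable
  have rep: "integrable lborel (\<lambda>x. \<phi> x * ?h x)" "u \<phi> = (LINT x|lborel. \<phi> x * ?h x)" if \<phi>: "\<phi> \<in> schwartz" for \<phi>
  proof -
    note i = schwartz_integrable[OF \<phi>]
    have k: "(\<lambda>(x, \<xi>). iexp (x \<bullet> \<xi>)) \<in> borel_measurable (borel \<Otimes>\<^sub>M borel :: ('a \<times> 'a) measure)" by measurable
    have "integrable lborel (\<lambda>x. \<phi> x * (LINT \<xi>|lborel. G \<xi> * iexp (x \<bullet> \<xi>)))"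
      by (rule fubini_kernel(2)[OF i G k]) simp
    then have "integrable lborel (\<lambda>x. ?c * (\<phi> x * (LINT \<xi>|lborel. G \<xi> * iexp (x \<bullet> \<xi>))))" by (rule integrable_mult_right)
    then show "integrable lborel (\<lambda>x. \<phi> x * ?h x)" by (simp add: inv_fourier_def mult_ac)
    have "u \<phi> = (LINT \<xi>|lborel. G \<xi> * inv_fourier \<phi> \<xi>)" using u \<phi> by (simp add: has_symbol_def)
    also have "\<dots> = (LINT \<xi>|lborel. ?c * (G \<xi> * (LINT x|lborel. \<phi> x * iexp (x \<bullet> \<xi>))))" by (simp add: inv_fourier_def inner_commute mult_ac)
    also have "\<dots> = ?c * (LINT \<xi>|lborel. G \<xi> * (LINT x|lborel. \<phi> x * iexp (x \<bullet> \<xi>)))" by (rule integral_mult_right_zero)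
    also have "(LINT \<xi>|lborel. G \<xi> * (LINT x|lborel. \<phi> x * iexp (x \<bullet> \<xi>))) = (LINT x|lborel. \<phi> x * (LINT \<xi>|lborel. G \<xi> * iexp (x \<bullet> \<xi>)))"
      by (rule fubini_kernel(1)[OF i G k, symmetric]) simp
    also have "?c * \<dots> = (LINT x|lborel. ?c * (\<phi> x * (LINT \<xi>|lborel. G \<xi> * iexp (x \<bullet> \<xi>))))" by (rule integral_mult_right_zero[symmetric])
    also have "\<dots> = (LINT x|lborel. \<phi> x * ?h x)" by (simp add: inv_fourier_def mult_ac)
    finally show "u \<phi> = (LINT x|lborel. \<phi> x * ?h x)" .
  qed
  have hb: "norm (?h x) \<le> (LINT x|lborel. norm (G x))" for x by (rule inv_fourier_bound[OF G])
  show ?thesis unfolding represented_by_def reg_dist_def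
  proof (intro ballI conjI)
    fix \<phi> :: "'a \<Rightarrow> complex" assume \<phi>: "\<phi> \<in> schwartz"
    note [measurable] = schwartz_measurable[OF \<phi>] meas
    have b: "norm (complex_of_real (Re (?h x)) * \<phi> x) \<le> norm (\<phi> x * ?h x)" for x
      by (simp add: norm_mult abs_Re_le_cmod mult.commute mult_left_mono)
    show i1: "integrable lborel (\<lambda>x. complex_of_real (Re (?h x)) * \<phi> x)"
      by (rule Bochner_Integration.integrable_bound[OF rep(1)[OF \<phi>]]) (measurable, use b in auto)
    have \<phi>': "(\<lambda>x. cnj (\<phi> x)) \<in> schwartz" by (rule schwartz_cnj[OF \<phi>])
    have "cnj (u (\<lambda>x. cnj (\<phi> x))) = (LINT x|lborel. \<phi> x * cnj (?h x))"
      unfolding rep(2)[OF \<phi>'] Bochner_Integration.integral_cnj[symmetric] by (simp only: complex_cnj_mult complex_cnj_cnj)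
    moreover have "cnj (u (\<lambda>x. cnj (\<phi> x))) = u \<phi>" using real[OF \<phi>] by simp
    ultimately have c: "u \<phi> = (LINT x|lborel. \<phi> x * cnj (?h x))" by simp
    have i2: "integrable lborel (\<lambda>x. \<phi> x * cnj (?h x))"
      using Bochner_Integration.integrable_cnj[OF rep(1)[OF \<phi>']] by (simp only: complex_cnj_mult complex_cnj_cnj)
    have "u \<phi> + u \<phi> = (LINT x|lborel. \<phi> x * ?h x + \<phi> x * cnj (?h x))"
      using rep[OF \<phi>] c i2 by simp
    also have "\<dots> = (LINT x|lborel. 2 * (complex_of_real (Re (?h x)) * \<phi> x))"
      by (intro Bochner_Integration.integral_cong refl) (simp add: distrib_left[symmetric] complex_add_cnj)
    finally show "u \<phi> = (LINT x|lborel. complex_of_real (Re (?h x)) * \<phi> x)" by simp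
  qed
qed

text \<open>The translate of \<phi> by y is the transform of \<open>inv_fourier \<phi>\<close> times
  exp (- \<i> * (y \<bullet> \<xi>)). So \<open>b\<close> paired with it is itself a Fourier
  integral in y, and integrating against \<open>f\<close> by Fubini produces the transform of
  \<open>f\<close> as a factor.\<close>

lemma conv_has_symbol:
  fixes b :: "'a::euclidean_space distribution"
  assumes b: "has_fourier b g" and f: "integrable lborel (f :: 'a \<Rightarrow> real)"
    and G: "integrable lborel (\<lambda>\<xi>. g \<xi> * fourier (\<lambda>x. of_real (f x)) \<xi>)"
  shows "convolvable b f" "has_symbol (conv b f) (\<lambda>\<xi>. g \<xi> * fourier (\<lambda>x. of_real (f x)) \<xi>)"
proof -
  have f': "integrable lborel (\<lambda>x. complex_of_real (f x))" using f by simp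
  have main: "integrable lborel (\<lambda>y. of_real (f y) * b (\<lambda>x. \<phi> (x + y)))"
    "conv b f \<phi> = (LINT \<xi>|lborel. (g \<xi> * fourier (\<lambda>x. of_real (f x)) \<xi>) * inv_fourier \<phi> \<xi>)"
    if \<phi>: "\<phi> \<in> schwartz" for \<phi>
  proof -
    let ?p = "inv_fourier \<phi>"
    have p: "?p \<in> schwartz" by (rule inv_fourier_schwartz[OF \<phi>])
    have gp: "integrable lborel (\<lambda>\<xi>. g \<xi> * ?p \<xi>)" using b p by (simp add: has_fourier_def)
    have bs: "b (\<lambda>x. \<phi> (x + y)) = (LINT \<xi>|lborel. (g \<xi> * ?p \<xi>) * exp (- \<i> * of_real (y \<bullet> \<xi>)))" for y
    proof -
      let ?q = "\<lambda>\<xi>. iexp (\<xi> \<bullet> (- y)) * ?p \<xi>"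
      have q: "?q \<in> schwartz" by (rule schwartz_modulate[OF p])
      have "(\<lambda>x. \<phi> (x + y)) = fourier ?q"
      proof
        fix x
        have "\<phi> (x + y) = fourier ?p (x + y)" by (rule fourier_inv_fourier[OF \<phi>, symmetric])
        also have "\<dots> = fourier ?q x" unfolding fourier_def
        proof (intro Bochner_Integration.integral_cong refl)
          fix \<xi>
          have "exp (- \<i> * of_real (\<xi> \<bullet> (x + y))) = exp (- \<i> * of_real (\<xi> \<bullet> x)) * iexp (\<xi> \<bullet> (- y))"
            unfolding mult_exp_exp by (simp add: inner_add_right algebra_simps)
          then show "exp (- \<i> * of_real (\<xi> \<bullet> (x + y))) * ?p \<xi> = exp (- \<i> * of_real (\<xi> \<bullet> x)) * ?q \<xi>" by (simp only: mult_ac)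
        qed
        finally show "\<phi> (x + y) = fourier ?q x" .
      qed
      then have "b (\<lambda>x. \<phi> (x + y)) = (LINT \<xi>|lborel. g \<xi> * ?q \<xi>)" using b q by (simp add: has_fourier_def)
      then show ?thesis by (simp add: inner_commute mult_ac)
    qed
    have k: "(\<lambda>(x, \<xi>). exp (- \<i> * complex_of_real (x \<bullet> \<xi>))) \<in> borel_measurable (borel \<Otimes>\<^sub>M borel :: ('a \<times> 'a) measure)" by measurable
    show "integrable lborel (\<lambda>y. of_real (f y) * b (\<lambda>x. \<phi> (x + y)))"
      unfolding bs by (rule fubini_kernel(2)[OF f' gp k]) simp
    have "conv b f \<phi> = (LINT y|lborel. of_real (f y) * (LINT \<xi>|lborel. (g \<xi> * ?p \<xi>) * exp (- \<i> * of_real (y \<bullet> \<xi>))))"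
      by (simp add: conv_def bs)
    also have "\<dots> = (LINT \<xi>|lborel. (g \<xi> * ?p \<xi>) * (LINT y|lborel. of_real (f y) * exp (- \<i> * of_real (y \<bullet> \<xi>))))"
      by (rule fubini_kernel(1)[OF f' gp k]) simp
    also have "\<dots> = (LINT \<xi>|lborel. (g \<xi> * fourier (\<lambda>x. of_real (f x)) \<xi>) * ?p \<xi>)"
      by (simp add: fourier_def mult_ac)
    finally show "conv b f \<phi> = (LINT \<xi>|lborel. (g \<xi> * fourier (\<lambda>x. of_real (f x)) \<xi>) * ?p \<xi>)" .
  qed
  show "convolvable b f" using main(1) by (simp add: convolvable_def)
  show "has_symbol (conv b f) (\<lambda>\<xi>. g \<xi> * fourier (\<lambda>x. of_real (f x)) \<xi>)" using main(2) G by (simp add: has_symbol_def)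
qed

lemma conv_real:
  assumes "real_valued_distribution b" "\<phi> \<in> schwartz"
  shows "conv b f (\<lambda>x. cnj (\<phi> x)) = cnj (conv b f \<phi>)"
proof -
  have "b (\<lambda>x. cnj (\<phi> (x + y))) = cnj (b (\<lambda>x. \<phi> (x + y)))" for y
    using assms schwartz_shift[OF assms(2)] by (simp add: real_valued_distribution_def)
  then show ?thesis
    unfolding conv_def Bochner_Integration.integral_cnj[symmetric] by (simp only: complex_cnj_mult complex_cnj_complex_of_real)
qed

lemma has_fourier_unique:
  fixes \<psi> :: "'a::euclidean_space \<Rightarrow> real" and u :: "'a distribution"
  assumes dp: "dyadic_partition \<psi> \<rho>" and g: "has_fourier u g" and h: "has_fourier u h"
  shows "AE \<xi> in lborel. g \<xi> = h \<xi>"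
proof -
  have "AE \<xi> in lborel. g \<xi> - h \<xi> = 0"
  proof (rule schwartz_test_unique[OF dp])
    fix \<phi> :: "'a \<Rightarrow> complex" assume \<phi>: "\<phi> \<in> schwartz"
    have i: "integrable lborel (\<lambda>\<xi>. g \<xi> * \<phi> \<xi>)" "integrable lborel (\<lambda>\<xi>. h \<xi> * \<phi> \<xi>)"
      and e: "(LINT \<xi>|lborel. g \<xi> * \<phi> \<xi>) = (LINT \<xi>|lborel. h \<xi> * \<phi> \<xi>)"
      using g h \<phi> unfolding has_fourier_def by auto
    show "integrable lborel (\<lambda>\<xi>. (g \<xi> - h \<xi>) * \<phi> \<xi>)" using i by (simp add: left_diff_distrib)
    show "(LINT \<xi>|lborel. (g \<xi> - h \<xi>) * \<phi> \<xi>) = 0" using i e by (simp add: left_diff_distrib)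
  qed
  then show ?thesis by eventually_elim simp
qed

lemma fourier_measurable:
  assumes "integrable lborel f"
  shows "fourier f \<in> borel_measurable borel"
proof -
  note [measurable] = borel_measurable_integrable[OF assms]
  show ?thesis unfolding fourier_def[abs_def] by measurable
qed

text \<open>An integrable function has a bounded transform, which is thus square integrable on
  compact sets; the duality is Fubini. The difference is taken between functionals because that is
  the argument of the norm in \<open>holder_on\<close>; off integrable products it need not be
  \<open>reg_dist\<close> of the difference.\<close>

lemma reg_dist_diff_has_fourier:
  fixes f h :: "'a::euclidean_space \<Rightarrow> real"
  assumes f: "integrable lborel f" and h: "integrable lborel h"
  shows "has_fourier (reg_dist f - reg_dist h) (\<lambda>\<xi>. fourier (\<lambda>x. of_real (f x)) \<xi> - fourier (\<lambda>x. of_real (h x)) \<xi>)"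
    and "has_fourier (reg_dist f) (fourier (\<lambda>x. of_real (f x)))"
proof -
  have one: "has_fourier (reg_dist f) (fourier (\<lambda>x. of_real (f x)))" and bd: "\<And>\<xi>. norm (fourier (\<lambda>x. of_real (f x)) \<xi>) \<le> (LINT x|lborel. \<bar>f x\<bar>)"
    if f: "integrable lborel f" for f :: "'a \<Rightarrow> real"
  proof -
    have f': "integrable lborel (\<lambda>x. complex_of_real (f x))" using f by simp
    note [measurable] = fourier_measurable[OF f']
    show bd: "norm (fourier (\<lambda>x. of_real (f x)) \<xi>) \<le> (LINT x|lborel. \<bar>f x\<bar>)" for \<xi> using fourier_bound[OF f', of \<xi>] by simp
    show "has_fourier (reg_dist f) (fourier (\<lambda>x. of_real (f x)))"
      unfolding has_fourier_def
    proof (intro conjI allI impI ballI)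
      show "fourier (\<lambda>x. of_real (f x)) \<in> borel_measurable borel" by measurable
      fix K :: "'a set" assume K: "compact K"
      let ?b = "(LINT x|lborel. \<bar>f x\<bar>)\<^sup>2"
      have "integrable lborel (\<lambda>\<xi>. ?b * indicator K \<xi>)"
        by (intro integrable_mult_right integrable_real_indicator) (use K in \<open>auto intro: borel_compact simp: emeasure_compact_finite[unfolded infinity_ennreal_def]\<close>)
      then show "set_integrable lborel K (\<lambda>\<xi>. (norm (fourier (\<lambda>x. of_real (f x)) \<xi>))\<^sup>2)"
        unfolding set_integrable_def
      proof (rule Bochner_Integration.integrable_bound)
        have [measurable]: "K \<in> sets borel" using K by (simp add: borel_compact)
        show "(\<lambda>x. indicat_real K x *\<^sub>R (cmod (fourier (\<lambda>x. complex_of_real (f x)) x))\<^sup>2) \<in> borel_measurable lborel" by measurable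
        show "AE x in lborel. norm (indicat_real K x *\<^sub>R (cmod (fourier (\<lambda>x. complex_of_real (f x)) x))\<^sup>2) \<le> norm (?b * indicator K x)"
          by (intro AE_I2) (auto simp: indicator_def intro!: power_mono bd)
      qed
    next
      fix \<phi> :: "'a \<Rightarrow> complex" assume \<phi>: "\<phi> \<in> schwartz"
      have k: "(\<lambda>(x, \<xi>). exp (- \<i> * complex_of_real (x \<bullet> \<xi>))) \<in> borel_measurable (borel \<Otimes>\<^sub>M borel :: ('a \<times> 'a) measure)" by measurable
      have k2: "(\<lambda>(\<xi>, x). exp (- \<i> * complex_of_real (x \<bullet> \<xi>))) \<in> borel_measurable (borel \<Otimes>\<^sub>M borel :: ('a \<times> 'a) measure)" by measurable
      note i = schwartz_integrable[OF \<phi>]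
      have "integrable lborel (\<lambda>\<xi>. \<phi> \<xi> * (LINT x|lborel. of_real (f x) * exp (- \<i> * of_real (x \<bullet> \<xi>))))"
        by (rule fubini_kernel(2)[OF i f' k2]) simp
      then show "integrable lborel (\<lambda>\<xi>. fourier (\<lambda>x. of_real (f x)) \<xi> * \<phi> \<xi>)" by (simp add: fourier_def mult_ac)
      have "reg_dist f (fourier \<phi>) = (LINT x|lborel. of_real (f x) * (LINT \<xi>|lborel. \<phi> \<xi> * exp (- \<i> * of_real (x \<bullet> \<xi>))))"
        by (simp add: reg_dist_def fourier_def inner_commute mult_ac)
      also have "\<dots> = (LINT \<xi>|lborel. \<phi> \<xi> * (LINT x|lborel. of_real (f x) * exp (- \<i> * of_real (x \<bullet> \<xi>))))"
        by (rule fubini_kernel(1)[OF f' i k]) simp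
      finally show "reg_dist f (fourier \<phi>) = (LINT \<xi>|lborel. fourier (\<lambda>x. of_real (f x)) \<xi> * \<phi> \<xi>)"
        by (simp add: fourier_def mult_ac)
    qed
  qed
  show "has_fourier (reg_dist f) (fourier (\<lambda>x. of_real (f x)))" by (rule one[OF f])
  let ?F = "fourier (\<lambda>x. complex_of_real (f x))" and ?H = "fourier (\<lambda>x. complex_of_real (h x))"
  note F = one[OF f, unfolded has_fourier_def] and H = one[OF h, unfolded has_fourier_def]
  have [measurable]: "?F \<in> borel_measurable borel" "?H \<in> borel_measurable borel" using F H by auto
  show "has_fourier (reg_dist f - reg_dist h) (\<lambda>\<xi>. ?F \<xi> - ?H \<xi>)"
    unfolding has_fourier_def
  proof (intro conjI allI impI ballI)
    show "(\<lambda>\<xi>. ?F \<xi> - ?H \<xi>) \<in> borel_measurable borel" by measurable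
    fix K :: "'a set" assume K: "compact K"
    let ?b = "((LINT x|lborel. \<bar>f x\<bar>) + (LINT x|lborel. \<bar>h x\<bar>))\<^sup>2"
    have "integrable lborel (\<lambda>\<xi>. ?b * indicator K \<xi>)"
      by (intro integrable_mult_right integrable_real_indicator) (use K in \<open>auto intro: borel_compact simp: emeasure_compact_finite[unfolded infinity_ennreal_def]\<close>)
    then show "set_integrable lborel K (\<lambda>\<xi>. (norm (?F \<xi> - ?H \<xi>))\<^sup>2)"
      unfolding set_integrable_def
    proof (rule Bochner_Integration.integrable_bound)
      have [measurable]: "K \<in> sets borel" using K by (simp add: borel_compact)
      show "(\<lambda>x. indicat_real K x *\<^sub>R (cmod (?F x - ?H x))\<^sup>2) \<in> borel_measurable lborel" by measurable
      show "AE x in lborel. norm (indicat_real K x *\<^sub>R (cmod (?F x - ?H x))\<^sup>2) \<le> norm (?b * indicator K x)"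
      proof (rule AE_I2)
        fix x
        have "norm (?F x - ?H x) \<le> norm (?F x) + norm (?H x)" by (rule norm_triangle_ineq4)
        also have "\<dots> \<le> (LINT x|lborel. \<bar>f x\<bar>) + (LINT x|lborel. \<bar>h x\<bar>)" by (intro add_mono bd f h)
        finally have "(norm (?F x - ?H x))\<^sup>2 \<le> ?b" by (intro power_mono) auto
        then show "norm (indicat_real K x *\<^sub>R (cmod (?F x - ?H x))\<^sup>2) \<le> norm (?b * indicator K x)" by (simp add: indicator_def)
      qed
    qed
  next
    fix \<phi> :: "'a \<Rightarrow> complex" assume \<phi>: "\<phi> \<in> schwartz"
    have i: "integrable lborel (\<lambda>\<xi>. ?F \<xi> * \<phi> \<xi>)" "integrable lborel (\<lambda>\<xi>. ?H \<xi> * \<phi> \<xi>)" using F H \<phi> by auto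
    show "integrable lborel (\<lambda>\<xi>. (?F \<xi> - ?H \<xi>) * \<phi> \<xi>)" using i by (simp add: left_diff_distrib)
    show "(reg_dist f - reg_dist h) (fourier \<phi>) = (LINT \<xi>|lborel. (?F \<xi> - ?H \<xi>) * \<phi> \<xi>)"
      using i F H \<phi> by (simp add: left_diff_distrib)
  qed
qed

section \<open>Time-dependent symbols and the fields they generate\<close>

definition symbol_family :: "real \<Rightarrow> real \<Rightarrow> real \<Rightarrow> (real \<Rightarrow> 'a::euclidean_space \<Rightarrow> complex) \<Rightarrow> bool" where
  "symbol_family \<gamma> T p G \<longleftrightarrow>
     (\<forall>t\<in>{0..T}. G t \<in> borel_measurable borel \<and> integrable lborel (\<lambda>\<xi>. (1 + norm \<xi>) powr p * norm (G t \<xi>))) \<and>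
     (\<exists>C\<ge>0. \<forall>s\<in>{0..T}. \<forall>t\<in>{0..T}.
        (LINT \<xi>|lborel. (1 + norm \<xi>) powr p * norm (G t \<xi> - G s \<xi>)) \<le> C * \<bar>t - s\<bar> powr \<gamma>)"

lemma weight_integrable_diff:
  fixes G H :: "'a::euclidean_space \<Rightarrow> complex"
  assumes G: "G \<in> borel_measurable borel" "integrable lborel (\<lambda>\<xi>. (1 + norm \<xi>) powr p * norm (G \<xi>))"
    and H: "H \<in> borel_measurable borel" "integrable lborel (\<lambda>\<xi>. (1 + norm \<xi>) powr p * norm (H \<xi>))"
  shows "integrable lborel (\<lambda>\<xi>. (1 + norm \<xi>) powr p * norm (G \<xi> - H \<xi>))"
proof (rule Bochner_Integration.integrable_bound)
  note [measurable] = G(1) H(1)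
  show "integrable lborel (\<lambda>\<xi>. (1 + norm \<xi>) powr p * norm (G \<xi>) + (1 + norm \<xi>) powr p * norm (H \<xi>))" using G H by simp
  show "(\<lambda>\<xi>. (1 + norm \<xi>) powr p * norm (G \<xi> - H \<xi>)) \<in> borel_measurable lborel" by measurable
  show "AE \<xi> in lborel. norm ((1 + norm \<xi>) powr p * norm (G \<xi> - H \<xi>)) \<le> norm ((1 + norm \<xi>) powr p * norm (G \<xi>) + (1 + norm \<xi>) powr p * norm (H \<xi>))"
    by (intro AE_I2) (simp add: abs_mult norm_triangle_ineq4 mult_left_mono flip: distrib_left)
qed

lemma weight_bound:
  fixes H :: "'a::euclidean_space \<Rightarrow> complex"
  assumes H: "H \<in> borel_measurable borel" "integrable lborel (\<lambda>\<xi>. (1 + norm \<xi>) powr p * norm (H \<xi>))"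
    and k: "k \<in> borel_measurable borel" "\<And>\<xi>. norm (k \<xi>) \<le> B * (1 + norm \<xi>) powr p"
  shows "integrable lborel (\<lambda>\<xi>. k \<xi> * H \<xi>)"
    and "norm (LINT \<xi>|lborel. k \<xi> * H \<xi>) \<le> B * (LINT \<xi>|lborel. (1 + norm \<xi>) powr p * norm (H \<xi>))"
proof -
  note [measurable] = H(1) k(1)
  have b: "norm (k \<xi> * H \<xi>) \<le> B * ((1 + norm \<xi>) powr p * norm (H \<xi>))" for \<xi>
    using mult_right_mono[OF k(2)[of \<xi>], of "norm (H \<xi>)"] by (simp add: norm_mult mult.assoc)
  show i: "integrable lborel (\<lambda>\<xi>. k \<xi> * H \<xi>)"
  proof (rule Bochner_Integration.integrable_bound)
    show "integrable lborel (\<lambda>\<xi>. B * ((1 + norm \<xi>) powr p * norm (H \<xi>)))" by (intro integrable_mult_right H)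
    show "AE \<xi> in lborel. norm (k \<xi> * H \<xi>) \<le> norm (B * ((1 + norm \<xi>) powr p * norm (H \<xi>)))"
      using b by (intro AE_I2) (smt (verit) real_norm_def)
  qed measurable
  have "norm (LINT \<xi>|lborel. k \<xi> * H \<xi>) \<le> (LINT \<xi>|lborel. norm (k \<xi> * H \<xi>))" by (rule integral_norm_bound)
  also have "\<dots> \<le> (LINT \<xi>|lborel. B * ((1 + norm \<xi>) powr p * norm (H \<xi>)))"
    by (rule integral_mono) (use i H(2) b in auto)
  finally show "norm (LINT \<xi>|lborel. k \<xi> * H \<xi>) \<le> B * (LINT \<xi>|lborel. (1 + norm \<xi>) powr p * norm (H \<xi>))" by simp
qed

lemma weight_integrable:
  fixes H :: "'a::euclidean_space \<Rightarrow> complex"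
  assumes H: "H \<in> borel_measurable borel" "integrable lborel (\<lambda>\<xi>. (1 + norm \<xi>) powr p * norm (H \<xi>))" and p: "p \<ge> 0"
  shows "integrable lborel H"
proof -
  have "integrable lborel (\<lambda>\<xi>. 1 * H \<xi>)"
    by (rule weight_bound(1)[OF H, where B=1]) (use p in \<open>auto intro: ge_one_powr_ge_zero\<close>)
  then show ?thesis by simp
qed

lemma iexp_diff_le: "norm (iexp a - iexp b) \<le> \<bar>a - b\<bar>"
proof -
  have "iexp a - iexp b = iexp b * (iexp (a - b) - 1)" by (simp add: algebra_simps exp_diff)
  then have "norm (iexp a - iexp b) = norm (iexp (a - b) - 1)" by (simp add: norm_mult)
  also have "\<dots> \<le> \<bar>a - b\<bar>" using iexp_approx1[of "a - b" 0] by simp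
  finally show ?thesis .
qed

lemma iexp_diff_le_powr:
  assumes "0 < \<epsilon>" "\<epsilon> \<le> 1"
  shows "norm (iexp a - iexp b) \<le> 2 * \<bar>a - b\<bar> powr \<epsilon>"
proof (cases "\<bar>a - b\<bar> \<le> 1")
  case True
  then have "\<bar>a - b\<bar> \<le> \<bar>a - b\<bar> powr \<epsilon>" using assms by (intro powr_le_powr_unit) auto
  with iexp_diff_le[of a b] show ?thesis using powr_ge_zero[of "\<bar>a - b\<bar>" \<epsilon>] by linarith
next
  case False
  have "norm (iexp a - iexp b) \<le> 2" using norm_triangle_ineq4[of "iexp a" "iexp b"] by simp
  moreover have "1 \<le> \<bar>a - b\<bar> powr \<epsilon>" using False assms by (intro ge_one_powr_ge_zero) auto
  ultimately show ?thesis by linarith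
qed

text \<open>Writing \<open>iexp a' = iexp a * iexp (a' - a)\<close> separates displacements from
  base points: the difference of the displacements enters linearly, the difference of the base
  points through the Hoelder bound with exponent \<epsilon>.\<close>

lemma iexp_four_point:
  assumes "0 < \<epsilon>" "\<epsilon> \<le> 1"
  shows "norm ((iexp a' - iexp a) - (iexp b' - iexp b)) \<le> \<bar>(a' - a) - (b' - b)\<bar> + 2 * \<bar>a - b\<bar> powr \<epsilon> * \<bar>b' - b\<bar>"
proof -
  have e: "iexp x = iexp y * iexp (x - y)" for x y by (simp flip: exp_add add: algebra_simps)
  have "(A' - A) - (B' - B) = A * (P - Q) + (A - B) * (Q - E)"
    if "A' = A * P" "B' = B * Q" "E = 1" for A A' B B' P Q E :: complex
    using that by (simp add: algebra_simps)
  from this[OF e e, of "iexp 0"]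
  have "(iexp a' - iexp a) - (iexp b' - iexp b) = iexp a * (iexp (a' - a) - iexp (b' - b)) + (iexp a - iexp b) * (iexp (b' - b) - iexp 0)"
    by simp
  also have "norm \<dots> \<le> norm (iexp (a' - a) - iexp (b' - b)) + norm (iexp a - iexp b) * norm (iexp (b' - b) - iexp 0)"
    by (rule order_trans[OF norm_triangle_ineq]) (simp add: norm_mult)
  also have "\<dots> \<le> \<bar>(a' - a) - (b' - b)\<bar> + 2 * \<bar>a - b\<bar> powr \<epsilon> * \<bar>(b' - b) - 0\<bar>"
    by (intro add_mono iexp_diff_le mult_mono iexp_diff_le_powr assms) auto
  finally show ?thesis by simp
qed

text \<open>\<open>symbol_family\<close> is the Fourier side of time-Hoelder maps into functions of
  smoothness p: differences of the field in space are integrals of the same differences of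
  characters against the increment of the symbol. Each clause reduces to a pointwise bound of
  characters by a multiple of (1 + norm \<xi>) powr (1 + \<epsilon>); the factor 2 in the constant
  is that of \<open>iexp_diff_le_powr\<close>.\<close>

lemma young_field_of_symbol:
  fixes G :: "real \<Rightarrow> 'a::euclidean_space \<Rightarrow> complex"
  assumes \<epsilon>: "0 < \<epsilon>" "\<epsilon> \<le> 1" and G: "symbol_family \<gamma> T (1 + \<epsilon>) G"
  shows "\<exists>C. young_field \<gamma> \<epsilon> T C (\<lambda>t x. Re (inv_fourier (G t) x))"
proof -
  have m: "\<And>t. t \<in> {0..T} \<Longrightarrow> G t \<in> borel_measurable borel"
    and i: "\<And>t. t \<in> {0..T} \<Longrightarrow> integrable lborel (\<lambda>\<xi>. (1 + norm \<xi>) powr (1 + \<epsilon>) * norm (G t \<xi>))"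
    using G by (auto simp: symbol_family_def)
  obtain C where C: "C \<ge> 0" "\<And>s t. s \<in> {0..T} \<Longrightarrow> t \<in> {0..T} \<Longrightarrow>
        (LINT \<xi>|lborel. (1 + norm \<xi>) powr (1 + \<epsilon>) * norm (G t \<xi> - G s \<xi>)) \<le> C * \<bar>t - s\<bar> powr \<gamma>"
    using G unfolding symbol_family_def by blast
  let ?f = "\<lambda>t x. Re (inv_fourier (G t) x)"
  let ?c = "complex_of_real ((2 * pi) ^ DIM('a))"
  have c1: "norm (1 / ?c) \<le> 1"
  proof -
    have "1 \<le> (2 * pi) ^ DIM('a)" using pi_gt3 by (intro one_le_power) simp
    then have "1 / \<bar>(2 * pi) ^ DIM('a)\<bar> \<le> 1" unfolding divide_le_eq_1 by linarith
    then show ?thesis by (simp only: norm_divide norm_one norm_of_real)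
  qed
  have Gi: "integrable lborel (\<lambda>\<xi>. iexp (x \<bullet> \<xi>) * G t \<xi>)" if "t \<in> {0..T}" for t x
    by (rule weight_bound(1)[OF m[OF that] i[OF that], where B=1])
       (use \<epsilon> in \<open>auto intro!: ge_one_powr_ge_zero borel_measurable_continuous_onI continuous_intros\<close>)
  have incr_eq: "incr ?f s t x = Re ((1 / ?c) * (LINT \<xi>|lborel. iexp (x \<bullet> \<xi>) * (G t \<xi> - G s \<xi>)))"
    if "s \<in> {0..T}" "t \<in> {0..T}" for s t x
    unfolding incr_def inv_fourier_def right_diff_distrib
    using Gi[OF that(1)] Gi[OF that(2)] by (simp add: diff_divide_distrib)
  have main: "\<bar>Re ((1 / ?c) * (LINT \<xi>|lborel. k \<xi> * (G t \<xi> - G s \<xi>)))\<bar> \<le> B * (C * \<bar>t - s\<bar> powr \<gamma>)"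
    if st: "s \<in> {0..T}" "t \<in> {0..T}" and k: "k \<in> borel_measurable borel" "\<And>\<xi>. norm (k \<xi>) \<le> B * (1 + norm \<xi>) powr (1 + \<epsilon>)" and B: "B \<ge> 0" for s t k B
  proof -
    have H: "(\<lambda>\<xi>. G t \<xi> - G s \<xi>) \<in> borel_measurable borel" using m[OF st(1)] m[OF st(2)] by simp
    have Hi: "integrable lborel (\<lambda>\<xi>. (1 + norm \<xi>) powr (1 + \<epsilon>) * norm (G t \<xi> - G s \<xi>))"
      by (rule weight_integrable_diff[OF m[OF st(2)] i[OF st(2)] m[OF st(1)] i[OF st(1)]])
    have "\<bar>Re ((1 / ?c) * (LINT \<xi>|lborel. k \<xi> * (G t \<xi> - G s \<xi>)))\<bar> \<le> norm (1 / ?c) * norm (LINT \<xi>|lborel. k \<xi> * (G t \<xi> - G s \<xi>))"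
      unfolding norm_mult[symmetric] by (rule abs_Re_le_cmod)
    also have "\<dots> \<le> 1 * norm (LINT \<xi>|lborel. k \<xi> * (G t \<xi> - G s \<xi>))" by (intro mult_right_mono c1) simp
    also have "\<dots> \<le> B * (LINT \<xi>|lborel. (1 + norm \<xi>) powr (1 + \<epsilon>) * norm (G t \<xi> - G s \<xi>))"
      using weight_bound(2)[OF H Hi k] by simp
    also have "\<dots> \<le> B * (C * \<bar>t - s\<bar> powr \<gamma>)" by (intro mult_left_mono C st B)
    finally show ?thesis .
  qed
  have Gd: "integrable lborel (\<lambda>\<xi>. iexp (x \<bullet> \<xi>) * (G t \<xi> - G s \<xi>))" if "s \<in> {0..T}" "t \<in> {0..T}" for s t x
    unfolding right_diff_distrib using Gi[OF that(1)] Gi[OF that(2)] by simp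
  have w1: "1 \<le> (1 + norm \<xi>) powr (1 + \<epsilon>)" for \<xi> :: 'a using \<epsilon> by (intro ge_one_powr_ge_zero) auto
  have w2: "norm \<xi> \<le> (1 + norm \<xi>) powr (1 + \<epsilon>)" for \<xi> :: 'a
  proof -
    have "norm \<xi> \<le> (1 + norm \<xi>) powr 1" by simp
    also have "\<dots> \<le> (1 + norm \<xi>) powr (1 + \<epsilon>)" using \<epsilon> by (intro powr_mono) auto
    finally show ?thesis .
  qed
  have w3: "norm \<xi> powr \<epsilon> * norm \<xi> \<le> (1 + norm \<xi>) powr (1 + \<epsilon>)" for \<xi> :: 'a
  proof -
    have "norm \<xi> powr \<epsilon> * norm \<xi> \<le> (1 + norm \<xi>) powr \<epsilon> * (1 + norm \<xi>)" using \<epsilon> by (intro mult_mono powr_mono2) auto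
    also have "\<dots> = (1 + norm \<xi>) powr (1 + \<epsilon>)" by (simp add: powr_add add.commute[of _ \<epsilon>])
    finally show ?thesis .
  qed
  show ?thesis
  proof (intro exI[of _ "2 * C"], unfold young_field_def, intro conjI ballI allI)
    show "0 \<le> 2 * C" using C(1) by simp
    fix s t assume st: "s \<in> {0..T}" "t \<in> {0..T}"
    let ?D = "C * \<bar>t - s\<bar> powr \<gamma>"
    have D0: "?D \<ge> 0" using C(1) by simp
    fix x x' y y' :: 'a
    have "\<bar>incr ?f s t x\<bar> \<le> 1 * ?D" unfolding incr_eq[OF st]
      by (rule main[OF st]) (use w1 in \<open>auto intro!: borel_measurable_continuous_onI continuous_intros\<close>)
    then show "norm (incr ?f s t x) \<le> 2 * C * \<bar>t - s\<bar> powr \<gamma>" using D0 by simp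
    have "incr ?f s t x - incr ?f s t y = Re ((1 / ?c) * (LINT \<xi>|lborel. (iexp (x \<bullet> \<xi>) - iexp (y \<bullet> \<xi>)) * (G t \<xi> - G s \<xi>)))"
      unfolding incr_eq[OF st] left_diff_distrib[of _ _ "G t _ - G s _"]
      using Gd[OF st, of x] Gd[OF st, of y] by (simp add: right_diff_distrib diff_divide_distrib)
    also have "\<bar>\<dots>\<bar> \<le> norm (x - y) * ?D"
    proof (rule main[OF st])
      show "(\<lambda>\<xi>. iexp (x \<bullet> \<xi>) - iexp (y \<bullet> \<xi>)) \<in> borel_measurable borel"
        by (intro borel_measurable_continuous_onI continuous_intros)
      fix \<xi>
      have "norm (iexp (x \<bullet> \<xi>) - iexp (y \<bullet> \<xi>)) \<le> \<bar>x \<bullet> \<xi> - y \<bullet> \<xi>\<bar>" by (rule iexp_diff_le)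
      also have "\<dots> \<le> norm (x - y) * norm \<xi>" using Cauchy_Schwarz_ineq2[of "x - y" \<xi>] by (simp add: inner_diff_left)
      also have "\<dots> \<le> norm (x - y) * (1 + norm \<xi>) powr (1 + \<epsilon>)" by (intro mult_left_mono w2) simp
      finally show "norm (iexp (x \<bullet> \<xi>) - iexp (y \<bullet> \<xi>)) \<le> norm (x - y) * (1 + norm \<xi>) powr (1 + \<epsilon>)" .
    qed simp
    also have "\<dots> \<le> 2 * (norm (x - y) * ?D)" using mult_nonneg_nonneg[OF norm_ge_zero[of "x - y"] D0] by linarith
    finally show "norm (incr ?f s t x - incr ?f s t y) \<le> 2 * C * \<bar>t - s\<bar> powr \<gamma> * norm (x - y)" by (simp add: mult_ac)
    let ?E = "norm ((x' - x) - (y' - y))" and ?F = "norm (x - y) powr \<epsilon> * norm (y' - y)"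
    have "(incr ?f s t x' - incr ?f s t x) - (incr ?f s t y' - incr ?f s t y)
      = Re ((1 / ?c) * (LINT \<xi>|lborel. ((iexp (x' \<bullet> \<xi>) - iexp (x \<bullet> \<xi>)) - (iexp (y' \<bullet> \<xi>) - iexp (y \<bullet> \<xi>))) * (G t \<xi> - G s \<xi>)))"
      unfolding incr_eq[OF st] left_diff_distrib[of _ _ "G t _ - G s _"]
      using Gd[OF st, of x] Gd[OF st, of y] Gd[OF st, of x'] Gd[OF st, of y'] by (simp add: right_diff_distrib diff_divide_distrib)
    also have "\<bar>\<dots>\<bar> \<le> (?E + 2 * ?F) * ?D"
    proof (rule main[OF st])
      show "(\<lambda>\<xi>. (iexp (x' \<bullet> \<xi>) - iexp (x \<bullet> \<xi>)) - (iexp (y' \<bullet> \<xi>) - iexp (y \<bullet> \<xi>))) \<in> borel_measurable borel"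
        by (intro borel_measurable_continuous_onI continuous_intros)
      fix \<xi>
      have "norm ((iexp (x' \<bullet> \<xi>) - iexp (x \<bullet> \<xi>)) - (iexp (y' \<bullet> \<xi>) - iexp (y \<bullet> \<xi>)))
        \<le> \<bar>(x' \<bullet> \<xi> - x \<bullet> \<xi>) - (y' \<bullet> \<xi> - y \<bullet> \<xi>)\<bar> + 2 * \<bar>x \<bullet> \<xi> - y \<bullet> \<xi>\<bar> powr \<epsilon> * \<bar>y' \<bullet> \<xi> - y \<bullet> \<xi>\<bar>"
        by (rule iexp_four_point[OF \<epsilon>])
      also have "\<dots> \<le> ?E * norm \<xi> + 2 * (norm (x - y) * norm \<xi>) powr \<epsilon> * (norm (y' - y) * norm \<xi>)"
      proof (intro add_mono mult_mono powr_mono2)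
        show "\<bar>(x' \<bullet> \<xi> - x \<bullet> \<xi>) - (y' \<bullet> \<xi> - y \<bullet> \<xi>)\<bar> \<le> ?E * norm \<xi>"
          using Cauchy_Schwarz_ineq2[of "(x' - x) - (y' - y)" \<xi>] by (simp add: inner_diff_left)
        show "\<bar>x \<bullet> \<xi> - y \<bullet> \<xi>\<bar> \<le> norm (x - y) * norm \<xi>" using Cauchy_Schwarz_ineq2[of "x - y" \<xi>] by (simp add: inner_diff_left)
        show "\<bar>y' \<bullet> \<xi> - y \<bullet> \<xi>\<bar> \<le> norm (y' - y) * norm \<xi>" using Cauchy_Schwarz_ineq2[of "y' - y" \<xi>] by (simp add: inner_diff_left)
      qed (use \<epsilon> in auto)
      also have "\<dots> = ?E * norm \<xi> + 2 * ?F * (norm \<xi> powr \<epsilon> * norm \<xi>)" by (simp add: powr_mult mult_ac)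
      also have "\<dots> \<le> ?E * (1 + norm \<xi>) powr (1 + \<epsilon>) + 2 * ?F * (1 + norm \<xi>) powr (1 + \<epsilon>)"
        by (intro add_mono mult_left_mono w2 w3) auto
      finally show "norm ((iexp (x' \<bullet> \<xi>) - iexp (x \<bullet> \<xi>)) - (iexp (y' \<bullet> \<xi>) - iexp (y \<bullet> \<xi>))) \<le> (?E + 2 * ?F) * (1 + norm \<xi>) powr (1 + \<epsilon>)"
        by (simp add: distrib_right)
    qed simp
    also have "\<dots> \<le> (2 * ?E + 2 * ?F) * ?D" using D0 by (intro mult_right_mono) auto
    finally show "norm ((incr ?f s t x' - incr ?f s t x) - (incr ?f s t y' - incr ?f s t y)) \<le> 2 * C * \<bar>t - s\<bar> powr \<gamma> * (?E + ?F)"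
      by (simp add: algebra_simps)
  qed
qed

lemma sum_Basis_vec: "(\<Sum>b\<in>(Basis :: (real^'d) set). F b) = (\<Sum>i\<in>UNIV. F (axis i 1))"
proof -
  have B: "(Basis :: (real^'d) set) = range (\<lambda>i. axis i 1)" by (auto simp: Basis_vec_def)
  have "inj (\<lambda>i. axis i 1 :: real^'d)" by (auto simp: inj_on_def axis_eq_axis)
  then show ?thesis unfolding B by (rule sum.reindex[unfolded o_def])
qed

text \<open>\<open>inv_fourier\<close> is, up to a constant, the transform at - x, so the inner
  derivative - v and the factor - \<i> of the transform combine to + \<i>.\<close>

lemma field_has_grad:
  fixes G :: "real^'d \<Rightarrow> complex"
  assumes G: "integrable lborel G" and xG: "integrable lborel (\<lambda>\<xi>. norm \<xi> * norm (G \<xi>))"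
  shows "has_grad (\<lambda>x. Re (inv_fourier G x)) (\<lambda>i. Re (inv_fourier (\<lambda>\<xi>. \<i> * of_real (\<xi> $ i) * G \<xi>) x)) x"
proof -
  let ?c = "complex_of_real ((2 * pi) ^ DIM(real^'d))"
  have 1: "((\<lambda>x. - x :: real^'d) has_derivative (\<lambda>v. - v)) (at x)" by (auto intro!: derivative_eq_intros)
  have "((\<lambda>x. fourier G (- x)) has_derivative (\<lambda>v. \<Sum>b\<in>Basis. ((- v) \<bullet> b) *\<^sub>R fourier (\<lambda>\<xi>. - \<i> * of_real (\<xi> \<bullet> b) * G \<xi>) (- x))) (at x)"
    by (rule has_derivative_compose[OF 1 fourier_has_derivative[OF G xG]])
  from bounded_linear.has_derivative[OF bounded_linear_Re bounded_linear.has_derivative[OF bounded_linear_divide this]]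
  have "((\<lambda>x. Re (fourier G (- x) / ?c)) has_derivative (\<lambda>v. Re ((\<Sum>b\<in>Basis. ((- v) \<bullet> b) *\<^sub>R fourier (\<lambda>\<xi>. - \<i> * of_real (\<xi> \<bullet> b) * G \<xi>) (- x)) / ?c))) (at x)" .
  then have "((\<lambda>x. Re (inv_fourier G x)) has_derivative (\<lambda>v. \<Sum>i\<in>UNIV. v $ i * Re (inv_fourier (\<lambda>\<xi>. \<i> * of_real (\<xi> $ i) * G \<xi>) x))) (at x)"
    unfolding inv_fourier_eq_fourier
  proof (rule has_derivative_eq_rhs, intro ext)
    fix v :: "real^'d"
    have neg: "fourier (\<lambda>\<xi>. - \<i> * of_real (\<xi> $ i) * G \<xi>) (- x) = - fourier (\<lambda>\<xi>. \<i> * of_real (\<xi> $ i) * G \<xi>) (- x)" for i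
      unfolding fourier_def by simp
    show "Re ((\<Sum>b\<in>Basis. ((- v) \<bullet> b) *\<^sub>R fourier (\<lambda>\<xi>. - \<i> * of_real (\<xi> \<bullet> b) * G \<xi>) (- x)) / ?c) =
      (\<Sum>i\<in>UNIV. v $ i * Re (fourier (\<lambda>\<xi>. \<i> * of_real (\<xi> $ i) * G \<xi>) (- x) / ?c))"
      unfolding sum_Basis_vec sum_divide_distrib Re_sum
    proof (intro sum.cong refl)
      fix i
      have "((- v) \<bullet> axis i 1) *\<^sub>R fourier (\<lambda>\<xi>. - \<i> * of_real (\<xi> \<bullet> axis i 1) * G \<xi>) (- x) / ?c
         = of_real (v $ i) * (fourier (\<lambda>\<xi>. \<i> * of_real (\<xi> $ i) * G \<xi>) (- x) / ?c)"
        unfolding inner_axis by (simp add: neg[simplified] scaleR_conv_of_real)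
      then show "Re (((- v) \<bullet> axis i 1) *\<^sub>R fourier (\<lambda>\<xi>. - \<i> * of_real (\<xi> \<bullet> axis i 1) * G \<xi>) (- x) / ?c) =
         v $ i * Re (fourier (\<lambda>\<xi>. \<i> * of_real (\<xi> $ i) * G \<xi>) (- x) / ?c)"
        by (simp only: Re_complex_of_real Im_complex_of_real times_complex.sel)
    qed
  qed
  then show ?thesis by (simp add: has_grad_def)
qed

lemma symbol_family_mono:
  assumes G: "symbol_family \<gamma> T p G" and p': "p' \<le> p"
  shows "symbol_family \<gamma> T p' G"
proof -
  have m: "\<And>t. t \<in> {0..T} \<Longrightarrow> G t \<in> borel_measurable borel"
    and i: "\<And>t. t \<in> {0..T} \<Longrightarrow> integrable lborel (\<lambda>\<xi>. (1 + norm \<xi>) powr p * norm (G t \<xi>))"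
    using G by (auto simp: symbol_family_def)
  have w: "(1 + norm \<xi>) powr p' * norm z \<le> (1 + norm \<xi>) powr p * norm z" for \<xi> :: 'a and z :: complex
    using p' by (intro mult_right_mono powr_mono) auto
  have i': "integrable lborel (\<lambda>\<xi>. (1 + norm \<xi>) powr p' * norm (G t \<xi>))" if "t \<in> {0..T}" for t
  proof (rule Bochner_Integration.integrable_bound[OF i[OF that]])
    note [measurable] = m[OF that]
    show "(\<lambda>\<xi>. (1 + norm \<xi>) powr p' * norm (G t \<xi>)) \<in> borel_measurable lborel" by measurable
  qed (use w in \<open>auto simp: abs_mult\<close>)
  obtain C where C: "C \<ge> 0" "\<And>s t. s \<in> {0..T} \<Longrightarrow> t \<in> {0..T} \<Longrightarrow>
        (LINT \<xi>|lborel. (1 + norm \<xi>) powr p * norm (G t \<xi> - G s \<xi>)) \<le> C * \<bar>t - s\<bar> powr \<gamma>"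
    using G unfolding symbol_family_def by blast
  show ?thesis unfolding symbol_family_def
  proof (intro conjI ballI m i' exI[of _ C] C(1))
    fix s t assume st: "s \<in> {0..T}" "t \<in> {0..T}"
    have "(LINT \<xi>|lborel. (1 + norm \<xi>) powr p' * norm (G t \<xi> - G s \<xi>)) \<le> (LINT \<xi>|lborel. (1 + norm \<xi>) powr p * norm (G t \<xi> - G s \<xi>))"
      by (rule integral_mono[OF weight_integrable_diff[OF m[OF st(2)] i'[OF st(2)] m[OF st(1)] i'[OF st(1)]]
            weight_integrable_diff[OF m[OF st(2)] i[OF st(2)] m[OF st(1)] i[OF st(1)]] w])
    also have "\<dots> \<le> C * \<bar>t - s\<bar> powr \<gamma>" by (rule C(2)[OF st])
    finally show "(LINT \<xi>|lborel. (1 + norm \<xi>) powr p' * norm (G t \<xi> - G s \<xi>)) \<le> C * \<bar>t - s\<bar> powr \<gamma>" .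
  qed
qed

lemma symbol_family_partial:
  fixes G :: "real \<Rightarrow> real^'d \<Rightarrow> complex"
  assumes G: "symbol_family \<gamma> T (p + 1) G"
  shows "symbol_family \<gamma> T p (\<lambda>t \<xi>. \<i> * of_real (\<xi> $ i) * G t \<xi>)"
proof -
  have m: "\<And>t. t \<in> {0..T} \<Longrightarrow> G t \<in> borel_measurable borel"
    and i: "\<And>t. t \<in> {0..T} \<Longrightarrow> integrable lborel (\<lambda>\<xi>. (1 + norm \<xi>) powr (p + 1) * norm (G t \<xi>))"
    using G by (auto simp: symbol_family_def)
  have w: "(1 + norm \<xi>) powr p * norm (\<i> * of_real (\<xi> $ i) * z) \<le> (1 + norm \<xi>) powr (p + 1) * norm z" for \<xi> :: "real^'d" and z :: complex
  proof -
    have "\<bar>\<xi> $ i\<bar> \<le> 1 + norm \<xi>" using component_le_norm_cart[of \<xi> i] by simp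
    then have "(1 + norm \<xi>) powr p * (\<bar>\<xi> $ i\<bar> * norm z) \<le> (1 + norm \<xi>) powr p * ((1 + norm \<xi>) * norm z)"
      by (intro mult_left_mono mult_right_mono) auto
    then show ?thesis by (simp add: norm_mult powr_add mult.assoc)
  qed
  have m' [measurable]: "(\<lambda>\<xi>. \<i> * of_real (\<xi> $ i) * G t \<xi>) \<in> borel_measurable borel" if "t \<in> {0..T}" for t
    using m[OF that] by (intro borel_measurable_times) (auto intro!: borel_measurable_continuous_onI continuous_intros)
  have i': "integrable lborel (\<lambda>\<xi>. (1 + norm \<xi>) powr p * norm (\<i> * of_real (\<xi> $ i) * G t \<xi>))" if "t \<in> {0..T}" for t
  proof (rule Bochner_Integration.integrable_bound[OF i[OF that]])
    note [measurable] = m'[OF that]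
    show "(\<lambda>\<xi>. (1 + norm \<xi>) powr p * norm (\<i> * of_real (\<xi> $ i) * G t \<xi>)) \<in> borel_measurable lborel" by measurable
    show "AE x in lborel. norm ((1 + norm x) powr p * cmod (\<i> * complex_of_real (x $ i) * G t x)) \<le> norm ((1 + norm x) powr (p + 1) * cmod (G t x))"
      using w by (intro AE_I2) (auto simp: abs_mult)
  qed
  obtain C where C: "C \<ge> 0" "\<And>s t. s \<in> {0..T} \<Longrightarrow> t \<in> {0..T} \<Longrightarrow>
        (LINT \<xi>|lborel. (1 + norm \<xi>) powr (p + 1) * norm (G t \<xi> - G s \<xi>)) \<le> C * \<bar>t - s\<bar> powr \<gamma>"
    using G unfolding symbol_family_def by blast
  show ?thesis unfolding symbol_family_def
  proof (intro conjI ballI m' i' exI[of _ C] C(1))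
    fix s t assume st: "s \<in> {0..T}" "t \<in> {0..T}"
    have "(LINT \<xi>|lborel. (1 + norm \<xi>) powr p * norm (\<i> * of_real (\<xi> $ i) * G t \<xi> - \<i> * of_real (\<xi> $ i) * G s \<xi>)) \<le> (LINT \<xi>|lborel. (1 + norm \<xi>) powr (p + 1) * norm (G t \<xi> - G s \<xi>))"
    proof (rule integral_mono[OF weight_integrable_diff[OF m'[OF st(2)] i'[OF st(2)] m'[OF st(1)] i'[OF st(1)]]
            weight_integrable_diff[OF m[OF st(2)] i[OF st(2)] m[OF st(1)] i[OF st(1)]]])
      fix \<xi>
      show "(1 + norm \<xi>) powr p * norm (\<i> * of_real (\<xi> $ i) * G t \<xi> - \<i> * of_real (\<xi> $ i) * G s \<xi>) \<le> (1 + norm \<xi>) powr (p + 1) * norm (G t \<xi> - G s \<xi>)"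
        using w[of \<xi> "G t \<xi> - G s \<xi>"] by (simp only: right_diff_distrib)
    qed
    also have "\<dots> \<le> C * \<bar>t - s\<bar> powr \<gamma>" by (rule C(2)[OF st])
    finally show "(LINT \<xi>|lborel. (1 + norm \<xi>) powr p * norm (\<i> * of_real (\<xi> $ i) * G t \<xi> - \<i> * of_real (\<xi> $ i) * G s \<xi>)) \<le> C * \<bar>t - s\<bar> powr \<gamma>" .
  qed
qed

lemma symbol_family_integrable:
  fixes G :: "real \<Rightarrow> 'a::euclidean_space \<Rightarrow> complex"
  assumes G: "symbol_family \<gamma> T p G" and t: "t \<in> {0..T}"
  shows "p \<ge> 0 \<Longrightarrow> integrable lborel (G t)"
    and "p \<ge> 1 \<Longrightarrow> integrable lborel (\<lambda>\<xi>. norm \<xi> * norm (G t \<xi>))"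
proof -
  have m: "G t \<in> borel_measurable borel" and i: "integrable lborel (\<lambda>\<xi>. (1 + norm \<xi>) powr p * norm (G t \<xi>))"
    using G t by (auto simp: symbol_family_def)
  show "p \<ge> 0 \<Longrightarrow> integrable lborel (G t)" by (rule weight_integrable[OF m i])
  assume p: "p \<ge> 1"
  note [measurable] = m
  show "integrable lborel (\<lambda>\<xi>. norm \<xi> * norm (G t \<xi>))"
  proof (rule Bochner_Integration.integrable_bound[OF i])
    show "AE \<xi> in lborel. norm (norm \<xi> * norm (G t \<xi>)) \<le> norm ((1 + norm \<xi>) powr p * norm (G t \<xi>))"
    proof (rule AE_I2)
      fix \<xi> :: 'a
      have "norm \<xi> \<le> (1 + norm \<xi>) powr 1" by simp
      also have "\<dots> \<le> (1 + norm \<xi>) powr p" using p by (intro powr_mono) auto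
      finally show "norm (norm \<xi> * norm (G t \<xi>)) \<le> norm ((1 + norm \<xi>) powr p * norm (G t \<xi>))"
        by (simp add: abs_mult mult_right_mono)
    qed
  qed measurable
qed

text \<open>Each spatial derivative multiplies the symbol by \<i> * \<xi> $ i and uses up one power
  of the weight.\<close>

lemma smooth_field_of_symbol:
  fixes G :: "real \<Rightarrow> real^'d \<Rightarrow> complex"
  assumes \<epsilon>: "0 < \<epsilon>" "\<epsilon> \<le> 1"
  shows "symbol_family \<gamma> T (real n + (1 + \<epsilon>)) G \<Longrightarrow> smooth_field \<gamma> \<epsilon> T n (\<lambda>t x. Re (inv_fourier (G t) x))"
proof (induction n arbitrary: G)
  case 0
  then show ?case using young_field_of_symbol[OF \<epsilon>] by simp
next
  case (Suc n)
  have G1: "symbol_family \<gamma> T (1 + \<epsilon>) G" by (rule symbol_family_mono[OF Suc.prems]) simp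
  have G2: "symbol_family \<gamma> T (real n + (1 + \<epsilon>) + 1) G" using Suc.prems by (simp add: add_ac)
  show ?case unfolding smooth_field.simps
  proof (intro conjI exI[of _ "\<lambda>i t x. Re (inv_fourier (\<lambda>\<xi>. \<i> * of_real (\<xi> $ i) * G t \<xi>) x)"] ballI allI)
    show "\<exists>C. young_field \<gamma> \<epsilon> T C (\<lambda>t x. Re (inv_fourier (G t) x))" by (rule young_field_of_symbol[OF \<epsilon> G1])
    show "has_grad (\<lambda>x. Re (inv_fourier (G t) x)) (\<lambda>i. Re (inv_fourier (\<lambda>\<xi>. \<i> * of_real (\<xi> $ i) * G t \<xi>) x)) x" if "t \<in> {0..T}" for t x
      by (rule field_has_grad) (use symbol_family_integrable[OF G1 that] \<epsilon> in auto)
    show "smooth_field \<gamma> \<epsilon> T n (\<lambda>t x. Re (inv_fourier (\<lambda>\<xi>. \<i> * of_real (\<xi> $ i) * G t \<xi>) x))" for i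
      by (rule Suc.IH[OF symbol_family_partial[OF G2]])
  qed
qed

lemma holder_on_besov:
  fixes \<psi> :: "'a::euclidean_space \<Rightarrow> real"
  assumes dp: "dyadic_partition \<psi> \<rho>" and \<theta>: "\<theta> \<ge> 0"
    and u: "\<And>t. t \<in> {0..T} \<Longrightarrow> has_symbol (u t) (G t)" and G: "symbol_family \<gamma> T \<theta> G"
  shows "holder_on \<gamma> T (besov \<psi> \<rho> \<theta>) (besov_norm \<psi> \<rho> \<theta>) u"
proof -
  have m: "\<And>t. t \<in> {0..T} \<Longrightarrow> G t \<in> borel_measurable borel"
    and i: "\<And>t. t \<in> {0..T} \<Longrightarrow> integrable lborel (\<lambda>\<xi>. (1 + norm \<xi>) powr \<theta> * norm (G t \<xi>))"
    using G by (auto simp: symbol_family_def)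
  obtain C where C: "C \<ge> 0" "\<And>s t. s \<in> {0..T} \<Longrightarrow> t \<in> {0..T} \<Longrightarrow>
        (LINT \<xi>|lborel. (1 + norm \<xi>) powr \<theta> * norm (G t \<xi> - G s \<xi>)) \<le> C * \<bar>t - s\<bar> powr \<gamma>"
    using G unfolding symbol_family_def by blast
  obtain K where K: "K \<ge> 0" 
    "\<And>u G. has_symbol u G \<Longrightarrow> integrable lborel (\<lambda>\<xi>. (1 + norm \<xi>) powr \<theta> * norm (G \<xi>)) \<Longrightarrow> u \<in> besov \<psi> \<rho> \<theta>"
    "\<And>u G. has_symbol u G \<Longrightarrow> integrable lborel (\<lambda>\<xi>. (1 + norm \<xi>) powr \<theta> * norm (G \<xi>)) \<Longrightarrow>
       besov_norm \<psi> \<rho> \<theta> u \<le> K * (LINT \<xi>|lborel. (1 + norm \<xi>) powr \<theta> * norm (G \<xi>))"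
    by (rule besov_of_symbol[OF dp \<theta>]) blast
  show ?thesis unfolding holder_on_def
  proof (intro conjI ballI exI[of _ "K * C"])
    show "u t \<in> besov \<psi> \<rho> \<theta>" if "t \<in> {0..T}" for t by (rule K(2)[OF u[OF that] i[OF that]])
    fix s t assume st: "s \<in> {0..T}" "t \<in> {0..T}"
    have "besov_norm \<psi> \<rho> \<theta> (u t - u s) \<le> K * (LINT \<xi>|lborel. (1 + norm \<xi>) powr \<theta> * norm (G t \<xi> - G s \<xi>))"
      by (rule K(3)[OF has_symbol_diff[OF u[OF st(2)] u[OF st(1)]] weight_integrable_diff[OF m[OF st(2)] i[OF st(2)] m[OF st(1)] i[OF st(1)]]])
    also have "\<dots> \<le> K * (C * \<bar>t - s\<bar> powr \<gamma>)" by (intro mult_left_mono C st K)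
    finally show "besov_norm \<psi> \<rho> \<theta> (u t - u s) \<le> K * C * \<bar>t - s\<bar> powr \<gamma>" by simp
  qed
qed

lemma symbol_family_product:
  fixes g :: "'a::euclidean_space \<Rightarrow> complex"
  assumes g: "g \<in> borel_measurable borel" "integrable lborel (\<lambda>\<xi>. (1 + (norm \<xi>)\<^sup>2) powr \<beta> * (norm (g \<xi>))\<^sup>2)"
    and f: "\<And>t. t \<in> {0..T} \<Longrightarrow> F t \<in> borel_measurable borel"
      "\<And>t. t \<in> {0..T} \<Longrightarrow> integrable lborel (\<lambda>\<xi>. (1 + (norm \<xi>)\<^sup>2) powr \<kappa> * (norm (F t \<xi>))\<^sup>2)"
      "\<And>s t. s \<in> {0..T} \<Longrightarrow> t \<in> {0..T} \<Longrightarrow> integrable lborel (\<lambda>\<xi>. (1 + (norm \<xi>)\<^sup>2) powr \<kappa> * (norm (F t \<xi> - F s \<xi>))\<^sup>2)"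
      "\<And>s t. s \<in> {0..T} \<Longrightarrow> t \<in> {0..T} \<Longrightarrow>
         (LINT \<xi>|lborel. (1 + (norm \<xi>)\<^sup>2) powr \<kappa> * (norm (F t \<xi> - F s \<xi>))\<^sup>2) \<le> (C * \<bar>t - s\<bar> powr \<gamma>)\<^sup>2"
    and p: "0 \<le> p" "p \<le> \<beta> + \<kappa>"
  shows "symbol_family \<gamma> T p (\<lambda>t \<xi>. g \<xi> * F t \<xi>)"
proof -
  note [measurable] = g(1)
  \<comment> \<open>From (1 + r)^2 <= 2 * (1 + r^2), raised to the power p / 2: the weight of
    \<open>symbol_family\<close> is compared with the Sobolev weight, whose exponent (\<beta> +
    \<kappa>) / 2 is then shared between the two factors.\<close>
  define K where "K = 2 powr (p / 2)"
  have K0: "K \<ge> 0" by (simp add: K_def)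
  \<comment> \<open>AM-GM with a free weight: \<open>l = |t - s| powr \<gamma>\<close> turns the squared Sobolev increment into a linear bound\<close>
  have pt: "(1 + norm \<xi>) powr p * (a * b) \<le> K * (l * ((1 + (norm \<xi>)\<^sup>2) powr \<beta> * a\<^sup>2) + inverse l * ((1 + (norm \<xi>)\<^sup>2) powr \<kappa> * b\<^sup>2))"
    if l: "l > 0" and ab: "0 \<le> a" "0 \<le> b" for \<xi> :: 'a and a b l :: real
  proof -
    let ?w = "1 + (norm \<xi>)\<^sup>2"
    have w1: "?w \<ge> 1" by simp
    have "(1 + norm \<xi>)\<^sup>2 \<le> 2 * ?w" using sum_squares_bound[of 1 "norm \<xi>"] by (simp add: power2_sum)
    then have "((1 + norm \<xi>)\<^sup>2) powr (p / 2) \<le> (2 * ?w) powr (p / 2)" using p by (intro powr_mono2) auto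
    also have "((1 + norm \<xi>)\<^sup>2) powr (p / 2) = (1 + norm \<xi>) powr p"
      by (simp add: powr_powr add_nonneg_pos flip: powr_numeral)
    also have "(2 * ?w) powr (p / 2) = K * ?w powr (p / 2)" unfolding K_def by (rule powr_mult; simp)
    also have "\<dots> \<le> K * ?w powr ((\<beta> + \<kappa>) / 2)" using p w1 K0 by (intro mult_left_mono powr_mono) auto
    finally have 1: "(1 + norm \<xi>) powr p \<le> K * ?w powr ((\<beta> + \<kappa>) / 2)" .
    define u where "u = ?w powr (\<beta> / 2) * a"
    define v where "v = ?w powr (\<kappa> / 2) * b"
    have u2: "u\<^sup>2 = ?w powr \<beta> * a\<^sup>2" and v2: "v\<^sup>2 = ?w powr \<kappa> * b\<^sup>2"
      by (simp_all add: u_def v_def power_mult_distrib power2_eq_square flip: powr_add)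
    have uv: "?w powr ((\<beta> + \<kappa>) / 2) * (a * b) = u * v" by (simp add: u_def v_def add_divide_distrib powr_add)
    have uv0: "0 \<le> u" "0 \<le> v" using ab by (auto simp: u_def v_def)
    have "(sqrt l * u) * (v / sqrt l) = u * v" using l by simp
    moreover have "(v / sqrt l)\<^sup>2 = v\<^sup>2 / l" "(sqrt l * u)\<^sup>2 = l * u\<^sup>2"
      using l by (simp_all add: power_mult_distrib power_divide)
    moreover have "0 \<le> (sqrt l * u - v / sqrt l)\<^sup>2" by simp
    ultimately have "0 \<le> l * u\<^sup>2 + v\<^sup>2 / l - 2 * (u * v)"
      by (simp only: power2_diff mult.assoc)
    then have "2 * (u * v) \<le> l * u\<^sup>2 + inverse l * v\<^sup>2" by (simp add: divide_inverse mult.commute)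
    moreover have "0 \<le> u * v" using uv0 by simp
    ultimately have 2: "u * v \<le> l * u\<^sup>2 + inverse l * v\<^sup>2" by linarith
    have "(1 + norm \<xi>) powr p * (a * b) \<le> K * ?w powr ((\<beta> + \<kappa>) / 2) * (a * b)" using 1 ab by (intro mult_right_mono) auto
    also have "\<dots> = K * (u * v)" by (simp add: uv mult.assoc)
    also have "\<dots> \<le> K * (l * u\<^sup>2 + inverse l * v\<^sup>2)" by (intro mult_left_mono 2 K0)
    finally show ?thesis by (simp add: u2 v2)
  qed
  have m: "(\<lambda>\<xi>. g \<xi> * F t \<xi>) \<in> borel_measurable borel" if "t \<in> {0..T}" for t using f(1)[OF that] by simp
  have i: "integrable lborel (\<lambda>\<xi>. (1 + norm \<xi>) powr p * norm (g \<xi> * F t \<xi>))" if "t \<in> {0..T}" for t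
  proof (rule Bochner_Integration.integrable_bound)
    note [measurable] = m[OF that]
    show "integrable lborel (\<lambda>\<xi>. K * (1 * ((1 + (norm \<xi>)\<^sup>2) powr \<beta> * (norm (g \<xi>))\<^sup>2) + inverse 1 * ((1 + (norm \<xi>)\<^sup>2) powr \<kappa> * (norm (F t \<xi>))\<^sup>2)))"
      by (intro integrable_mult_right Bochner_Integration.integrable_add g(2) f(2) that)
    show "(\<lambda>\<xi>. (1 + norm \<xi>) powr p * norm (g \<xi> * F t \<xi>)) \<in> borel_measurable lborel" by measurable
    show "AE \<xi> in lborel. norm ((1 + norm \<xi>) powr p * norm (g \<xi> * F t \<xi>)) \<le> norm (K * (1 * ((1 + (norm \<xi>)\<^sup>2) powr \<beta> * (norm (g \<xi>))\<^sup>2) + inverse 1 * ((1 + (norm \<xi>)\<^sup>2) powr \<kappa> * (norm (F t \<xi>))\<^sup>2)))"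
    proof (rule AE_I2)
      fix \<xi>
      have "(1 + norm \<xi>) powr p * norm (g \<xi> * F t \<xi>) \<le> K * (1 * ((1 + (norm \<xi>)\<^sup>2) powr \<beta> * (norm (g \<xi>))\<^sup>2) + inverse 1 * ((1 + (norm \<xi>)\<^sup>2) powr \<kappa> * (norm (F t \<xi>))\<^sup>2))"
        unfolding norm_mult by (rule pt) auto
      also have "\<dots> \<le> norm (K * (1 * ((1 + (norm \<xi>)\<^sup>2) powr \<beta> * (norm (g \<xi>))\<^sup>2) + inverse 1 * ((1 + (norm \<xi>)\<^sup>2) powr \<kappa> * (norm (F t \<xi>))\<^sup>2)))"
        unfolding real_norm_def by (rule abs_ge_self)
      finally show "norm ((1 + norm \<xi>) powr p * norm (g \<xi> * F t \<xi>)) \<le> norm (K * (1 * ((1 + (norm \<xi>)\<^sup>2) powr \<beta> * (norm (g \<xi>))\<^sup>2) + inverse 1 * ((1 + (norm \<xi>)\<^sup>2) powr \<kappa> * (norm (F t \<xi>))\<^sup>2)))"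
        by (simp add: abs_mult)
    qed
  qed
  let ?N = "LINT \<xi>|lborel. (1 + (norm \<xi>)\<^sup>2) powr \<beta> * (norm (g \<xi>))\<^sup>2"
  have N0: "?N \<ge> 0" by (intro integral_nonneg_AE AE_I2) simp
  show ?thesis unfolding symbol_family_def
  proof (intro conjI ballI m i exI[of _ "K * (?N + C\<^sup>2)"])
    show "0 \<le> K * (?N + C\<^sup>2)" using K0 N0 by simp
    fix s t assume st: "s \<in> {0..T}" "t \<in> {0..T}"
    show "(LINT \<xi>|lborel. (1 + norm \<xi>) powr p * norm (g \<xi> * F t \<xi> - g \<xi> * F s \<xi>)) \<le> K * (?N + C\<^sup>2) * \<bar>t - s\<bar> powr \<gamma>"
    proof (cases "s = t")
      case True then show ?thesis by simp
    next
      case False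
      define l where "l = \<bar>t - s\<bar> powr \<gamma>"
      have l: "l > 0" using False by (simp add: l_def)
      let ?d = "\<lambda>\<xi>. (1 + (norm \<xi>)\<^sup>2) powr \<kappa> * (norm (F t \<xi> - F s \<xi>))\<^sup>2"
      have "(LINT \<xi>|lborel. (1 + norm \<xi>) powr p * norm (g \<xi> * F t \<xi> - g \<xi> * F s \<xi>))
        \<le> (LINT \<xi>|lborel. K * (l * ((1 + (norm \<xi>)\<^sup>2) powr \<beta> * (norm (g \<xi>))\<^sup>2) + inverse l * ?d \<xi>))"
      proof (rule integral_mono)
        show "integrable lborel (\<lambda>\<xi>. (1 + norm \<xi>) powr p * norm (g \<xi> * F t \<xi> - g \<xi> * F s \<xi>))"
          by (rule weight_integrable_diff[OF m[OF st(2)] i[OF st(2)] m[OF st(1)] i[OF st(1)]])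
        show "integrable lborel (\<lambda>\<xi>. K * (l * ((1 + (norm \<xi>)\<^sup>2) powr \<beta> * (norm (g \<xi>))\<^sup>2) + inverse l * ?d \<xi>))"
          by (intro integrable_mult_right Bochner_Integration.integrable_add g(2) f(3) st)
        show "(1 + norm \<xi>) powr p * norm (g \<xi> * F t \<xi> - g \<xi> * F s \<xi>) \<le> K * (l * ((1 + (norm \<xi>)\<^sup>2) powr \<beta> * (norm (g \<xi>))\<^sup>2) + inverse l * ?d \<xi>)" for \<xi>
          unfolding right_diff_distrib[symmetric] norm_mult by (rule pt[OF l]) auto
      qed
      also have "\<dots> = K * (l * ?N + inverse l * (LINT \<xi>|lborel. ?d \<xi>))"
        using g(2) f(3)[OF st] by simp
      also have "\<dots> \<le> K * (l * ?N + inverse l * (C * l)\<^sup>2)"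
        using f(4)[OF st] K0 l by (intro mult_left_mono add_left_mono) (auto simp: l_def)
      also have "\<dots> = K * (?N + C\<^sup>2) * l" using l by (simp add: power2_eq_square field_simps)
      finally show ?thesis by (simp add: l_def)
    qed
  qed
qed

section \<open>The averaged drift\<close>

lemma sobolev_weight_cong:
  fixes g h :: "'a::euclidean_space \<Rightarrow> complex"
  assumes "AE \<xi> in lborel. g \<xi> = h \<xi>" and [measurable]: "g \<in> borel_measurable borel" "h \<in> borel_measurable borel"
  shows "integrable lborel (\<lambda>\<xi>. (1 + (norm \<xi>)\<^sup>2) powr s * (norm (g \<xi>))\<^sup>2) \<longleftrightarrow>
           integrable lborel (\<lambda>\<xi>. (1 + (norm \<xi>)\<^sup>2) powr s * (norm (h \<xi>))\<^sup>2)"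
    and "(LINT \<xi>|lborel. (1 + (norm \<xi>)\<^sup>2) powr s * (norm (g \<xi>))\<^sup>2) = (LINT \<xi>|lborel. (1 + (norm \<xi>)\<^sup>2) powr s * (norm (h \<xi>))\<^sup>2)"
proof -
  have ae: "AE \<xi> in lborel. (1 + (norm \<xi>)\<^sup>2) powr s * (norm (g \<xi>))\<^sup>2 = (1 + (norm \<xi>)\<^sup>2) powr s * (norm (h \<xi>))\<^sup>2"
    using assms(1) by eventually_elim simp
  have m: "(\<lambda>\<xi>. (1 + (norm \<xi>)\<^sup>2) powr s * (norm (g \<xi>))\<^sup>2) \<in> borel_measurable lborel"
    "(\<lambda>\<xi>. (1 + (norm \<xi>)\<^sup>2) powr s * (norm (h \<xi>))\<^sup>2) \<in> borel_measurable lborel"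
    by measurable
  show "integrable lborel (\<lambda>\<xi>. (1 + (norm \<xi>)\<^sup>2) powr s * (norm (g \<xi>))\<^sup>2) \<longleftrightarrow>
           integrable lborel (\<lambda>\<xi>. (1 + (norm \<xi>)\<^sup>2) powr s * (norm (h \<xi>))\<^sup>2)"
    by (rule integrable_cong_AE[OF m ae])
  show "(LINT \<xi>|lborel. (1 + (norm \<xi>)\<^sup>2) powr s * (norm (g \<xi>))\<^sup>2) = (LINT \<xi>|lborel. (1 + (norm \<xi>)\<^sup>2) powr s * (norm (h \<xi>))\<^sup>2)"
    by (rule integral_cong_AE[OF m ae])
qed

lemma has_fourier_measurable: "has_fourier u g \<Longrightarrow> g \<in> borel_measurable borel"
  by (simp add: has_fourier_def)

lemma sobolev_integrable:
  fixes \<psi> :: "'a::euclidean_space \<Rightarrow> real"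
  assumes dp: "dyadic_partition \<psi> \<rho>" and u: "u \<in> sobolev s" and h: "has_fourier u (h :: 'a \<Rightarrow> complex)"
  shows "integrable lborel (\<lambda>\<xi>. (1 + (norm \<xi>)\<^sup>2) powr s * (norm (h \<xi>))\<^sup>2)"
proof -
  obtain g where g: "has_fourier u g" "integrable lborel (\<lambda>\<xi>. (1 + (norm \<xi>)\<^sup>2) powr s * (norm (g \<xi>))\<^sup>2)"
    using u unfolding sobolev_def by blast
  show ?thesis
    using sobolev_weight_cong(1)[OF has_fourier_unique[OF dp g(1) h] has_fourier_measurable[OF g(1)] has_fourier_measurable[OF h]] g(2)
    by blast
qed

text \<open>Two transforms of one distribution agree almost everywhere, so the choice made in
  \<open>sobolev_norm\<close> can be replaced by any transform at hand.\<close>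

lemma sobolev_norm_eq:
  fixes \<psi> :: "'a::euclidean_space \<Rightarrow> real"
  assumes dp: "dyadic_partition \<psi> \<rho>" and h: "has_fourier u (h :: 'a \<Rightarrow> complex)"
  shows "(sobolev_norm s u)\<^sup>2 = (LINT \<xi>|lborel. (1 + (norm \<xi>)\<^sup>2) powr s * (norm (h \<xi>))\<^sup>2)"
proof -
  let ?g = "SOME g. has_fourier u g"
  have g: "has_fourier u ?g" using h by (rule someI[where P="has_fourier u" and x=h])
  have "(sobolev_norm s u)\<^sup>2 = (LINT \<xi>|lborel. (1 + (norm \<xi>)\<^sup>2) powr s * (norm (?g \<xi>))\<^sup>2)"
    unfolding sobolev_norm_def by (intro real_sqrt_pow2 integral_nonneg_AE AE_I2) simp
  also have "\<dots> = (LINT \<xi>|lborel. (1 + (norm \<xi>)\<^sup>2) powr s * (norm (h \<xi>))\<^sup>2)"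
    by (rule sobolev_weight_cong(2)[OF has_fourier_unique[OF dp g h] has_fourier_measurable[OF g] has_fourier_measurable[OF h]])
  finally show ?thesis .
qed

lemma sobolev_norm_nonneg: "0 \<le> sobolev_norm s u"
  unfolding sobolev_norm_def by (intro real_sqrt_ge_zero integral_nonneg_AE AE_I2) simp

text \<open>Occupation measure of the whole space: the total mass of \<open>L t\<close> is the
  length of [0, t].\<close>

lemma local_time_integrable:
  assumes "is_local_time T z L" and t: "t \<in> {0..T}"
  shows "integrable lborel (L t)"
proof (rule integrableI_nonneg)
  note D = bspec[OF assms(1)[unfolded is_local_time_def] t]
  show "L t \<in> borel_measurable lborel" using D[THEN conjunct1] by simp
  show "AE x in lborel. 0 \<le> L t x" by (rule AE_I2) (rule D[THEN conjunct2, THEN conjunct1, THEN spec])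
  have "(\<integral>\<^sup>+x\<in>UNIV. ennreal (L t x) \<partial>lborel) = emeasure lebesgue {s\<in>{0..t}. z s \<in> UNIV}"
    by (rule bspec[OF D[THEN conjunct2, THEN conjunct2], of UNIV, symmetric]) simp
  also have "{s\<in>{0..t}. z s \<in> UNIV} = {0..t}" by auto
  also have "emeasure lebesgue {0..t} < \<infinity>" using t by simp
  finally show "(\<integral>\<^sup>+x. ennreal (L t x) \<partial>lborel) < \<infinity>" by simp
qed

lemma fourier_reflect:
  fixes f :: "'a::euclidean_space \<Rightarrow> real"
  assumes "integrable lborel f"
  shows "integrable lborel (\<lambda>x. f (- x))"
    and "fourier (\<lambda>x. of_real (f (- x))) \<xi> = cnj (fourier (\<lambda>x. of_real (f x)) \<xi>)"
proof -
  have m [measurable]: "f \<in> borel_measurable borel" using borel_measurable_integrable[OF assms] by simp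
  have refl: "(LINT x|lborel. h (- x)) = (LINT x|lborel. h x)" if "h \<in> borel_measurable borel" for h :: "'a \<Rightarrow> complex"
    using lborel_affine_integral[OF that, of "-1" 0] by simp
  show "integrable lborel (\<lambda>x. f (- x))"
    using lborel_affine_integrable[OF assms, of "-1" 0] by simp
  have "fourier (\<lambda>x. of_real (f (- x))) \<xi> = (LINT x|lborel. (\<lambda>x. exp (\<i> * of_real (x \<bullet> \<xi>)) * of_real (f x)) (- x))"
    by (simp add: fourier_def)
  also have "\<dots> = (LINT x|lborel. exp (\<i> * of_real (x \<bullet> \<xi>)) * of_real (f x))" by (rule refl) measurable
  also have "\<dots> = (LINT x|lborel. cnj (exp (- \<i> * of_real (x \<bullet> \<xi>)) * of_real (f x)))"
    by (simp add: exp_cnj)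
  also have "\<dots> = cnj (fourier (\<lambda>x. of_real (f x)) \<xi>)" unfolding fourier_def by (rule Bochner_Integration.integral_cnj)
  finally show "fourier (\<lambda>x. of_real (f (- x))) \<xi> = cnj (fourier (\<lambda>x. of_real (f x)) \<xi>)" .
qed

lemma continuous_AE_eq:
  fixes f h :: "'a::euclidean_space \<Rightarrow> real"
  assumes "continuous_on UNIV f" "continuous_on UNIV h" "AE x in lborel. f x = h x"
  shows "f = h"
proof -
  let ?S = "{x. f x \<noteq> h x}"
  have op: "open ?S" by (rule open_Collect_neq[OF assms(1,2)])
  have "AE x in lebesgue. f x = h x" using assms(3) by (rule AE_completion)
  then have "?S \<in> null_sets lebesgue" using op by (subst (asm) AE_iff_null) auto
  then have "negligible ?S" by (simp add: negligible_iff_null_sets)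
  then have "?S = {}" using open_not_negligible[OF op] by blast
  then show ?thesis by blast
qed

text \<open>Makes the field in \<open>pathwise_solution\<close> unique although the definition only
  asserts its existence: test functions give equality almost everywhere, and continuity removes the
  null set.\<close>

lemma represented_by_unique:
  fixes \<psi> :: "'a::euclidean_space \<Rightarrow> real"
  assumes dp: "dyadic_partition \<psi> \<rho>" and f: "represented_by u f" "continuous_on UNIV f"
    and h: "represented_by u h" "continuous_on UNIV (h :: 'a \<Rightarrow> real)"
  shows "f = h"
proof (rule continuous_AE_eq[OF f(2) h(2)])
  have "AE x in lborel. complex_of_real (f x) - complex_of_real (h x) = 0"
  proof (rule schwartz_test_unique[OF dp])
    fix \<phi> :: "'a \<Rightarrow> complex" assume \<phi>: "\<phi> \<in> schwartz"
    have i: "integrable lborel (\<lambda>x. complex_of_real (f x) * \<phi> x)" "integrable lborel (\<lambda>x. complex_of_real (h x) * \<phi> x)"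
      and e: "(LINT x|lborel. complex_of_real (f x) * \<phi> x) = (LINT x|lborel. complex_of_real (h x) * \<phi> x)"
      using f h \<phi> unfolding represented_by_def reg_dist_def by auto
    show "integrable lborel (\<lambda>x. (complex_of_real (f x) - complex_of_real (h x)) * \<phi> x)"
      using i by (simp add: left_diff_distrib)
    show "(LINT x|lborel. (complex_of_real (f x) - complex_of_real (h x)) * \<phi> x) = 0"
      using i e by (simp add: left_diff_distrib)
  qed
  then show "AE x in lborel. f x = h x" by eventually_elim simp
qed

lemma is_partition_bounds:
  assumes "is_partition t N p" "j \<le> N"
  shows "0 \<le> p j" "p j \<le> t"
proof -
  have p: "p 0 = 0" "p N = t" "\<And>j. j < N \<Longrightarrow> p j < p (Suc j)" using assms(1) by (auto simp: is_partition_def)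
  have mono: "p i \<le> p k" if "i \<le> k" "k \<le> N" for i k
    using that
  proof (induction k)
    case (Suc k)
    show ?case
    proof (cases "i = Suc k")
      case False
      with Suc have "p i \<le> p k" by simp
      also have "p k \<le> p (Suc k)" using p(3)[of k] Suc.prems by simp
      finally show ?thesis .
    qed simp
  qed simp
  show "0 \<le> p j" using mono[of 0 j] assms(2) p by simp
  show "p j \<le> t" using mono[of j N] assms(2) p by simp
qed

text \<open>Riemann sums evaluate the field at partition points, and these lie in [0, t]. Two fields
  that agree up to time T can thus be exchanged in the equation.\<close>

lemma has_young_integral_cong:
  assumes "has_young_integral f \<theta> t I" "\<And>s. s \<in> {0..t} \<Longrightarrow> f s = g s"
  shows "has_young_integral g \<theta> t I"
proof -
  have eq: "(\<Sum>j<N. f (p (Suc j)) (\<theta> (p j)) - f (p j) (\<theta> (p j))) = (\<Sum>j<N. g (p (Suc j)) (\<theta> (p j)) - g (p j) (\<theta> (p j)))"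
    if p: "is_partition t N p" for N p
  proof (rule sum.cong[OF refl])
    fix j assume "j \<in> {..<N}"
    then have "p (Suc j) \<in> {0..t}" "p j \<in> {0..t}"
      using is_partition_bounds[OF p, of "Suc j"] is_partition_bounds[OF p, of j] by auto
    then show "f (p (Suc j)) (\<theta> (p j)) - f (p j) (\<theta> (p j)) = g (p (Suc j)) (\<theta> (p j)) - g (p j) (\<theta> (p j))"
      by (simp add: assms(2))
  qed
  show ?thesis using assms(1) unfolding has_young_integral_def by (simp add: eq cong: conj_cong)
qed

lemma young_field_vec:
  fixes f :: "real \<Rightarrow> real^'d \<Rightarrow> real^'d"
  assumes "\<And>i. \<exists>C. young_field \<gamma> \<epsilon> T C (\<lambda>t x. f t x $ i)"
  shows "\<exists>C. young_field \<gamma> \<epsilon> T C f"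
proof -
  obtain C where C: "\<And>i. young_field \<gamma> \<epsilon> T (C i) (\<lambda>t x. f t x $ i)" using assms by metis
  have C0: "0 \<le> C i" for i using C[of i] by (simp add: young_field_def)
  define A where "A = (\<Sum>i\<in>UNIV. C i)"
  have A0: "0 \<le> A" unfolding A_def by (intro sum_nonneg C0)
  have "C i \<le> A" for i unfolding A_def by (rule member_le_sum) (auto intro: C0)
  then have A: "young_field \<gamma> \<epsilon> T A (\<lambda>t x. f t x $ i)" for i by (rule young_field_mono[OF C])
  have comp: "incr (\<lambda>t x. f t x $ i) s t x = incr f s t x $ i" for i s t x by (simp add: incr_def)
  note A' = A[unfolded young_field_def comp real_norm_def]
  show ?thesis
  proof (intro exI[of _ "real CARD('d) * A"], unfold young_field_def, intro conjI ballI allI)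
    show "0 \<le> real CARD('d) * A" using A0 by simp
    fix s t assume st: "s \<in> {0..T}" "t \<in> {0..T}"
    fix x x' y y' :: "real^'d"
    have "norm (incr f s t x) \<le> real CARD('d) * (A * \<bar>t - s\<bar> powr \<gamma>)"
      by (rule norm_vec_le) (use A' st in blast)
    then show "norm (incr f s t x) \<le> real CARD('d) * A * \<bar>t - s\<bar> powr \<gamma>" by (simp only: mult.assoc)
    have "norm (incr f s t x - incr f s t y) \<le> real CARD('d) * (A * \<bar>t - s\<bar> powr \<gamma> * norm (x - y))"
      by (rule norm_vec_le, unfold vector_minus_component) (use A' st in blast)
    then show "norm (incr f s t x - incr f s t y) \<le> real CARD('d) * A * \<bar>t - s\<bar> powr \<gamma> * norm (x - y)" by (simp only: mult.assoc)
    have "norm ((incr f s t x' - incr f s t x) - (incr f s t y' - incr f s t y))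
      \<le> real CARD('d) * (A * \<bar>t - s\<bar> powr \<gamma> * (norm ((x' - x) - (y' - y)) + norm (x - y) powr \<epsilon> * norm (y' - y)))"
      by (rule norm_vec_le, unfold vector_minus_component) (use A' st in blast)
    then show "norm ((incr f s t x' - incr f s t x) - (incr f s t y' - incr f s t y))
      \<le> real CARD('d) * A * \<bar>t - s\<bar> powr \<gamma> * (norm ((x' - x) - (y' - y)) + norm (x - y) powr \<epsilon> * norm (y' - y))"
      by (simp only: mult.assoc)
  qed
qed

section \<open>The averaged field along one path of the noise\<close>

locale rough_drift =
  fixes \<psi> \<rho> :: "real^'d \<Rightarrow> real" and T \<gamma> \<kappa> \<beta> :: real and z :: "real \<Rightarrow> real^'d"
    and L :: "real \<Rightarrow> real^'d \<Rightarrow> real" and b :: "'d \<Rightarrow> (real^'d) distribution"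
  assumes dp: "dyadic_partition \<psi> \<rho>" and T: "T > 0" and \<gamma>: "1 / 2 < \<gamma>" "\<gamma> < 1"
    and local_time: "is_local_time T z L"
    and regular: "holder_on \<gamma> T (sobolev \<kappa>) (sobolev_norm \<kappa>) (\<lambda>t. reg_dist (L t))"
    and \<beta>: "\<beta> > 2 - \<kappa>" and b: "\<And>i. b i \<in> sobolev \<beta>" "\<And>i. real_valued_distribution (b i)"
begin

definition "b_hat i = (SOME g. has_fourier (b i) g)"

definition "L_hat t = fourier (\<lambda>x. complex_of_real (L t x))"

text \<open>Reflecting a real function conjugates its Fourier transform, so this is the symbol of
  the convolution with the reflected local time.\<close>

definition "\<Gamma>_hat i t \<xi> = b_hat i \<xi> * cnj (L_hat t \<xi>)"

definition "\<Gamma> t x = (\<chi> i. Re (inv_fourier (\<Gamma>_hat i t) x))"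

lemma b_hat: "has_fourier (b i) (b_hat i)"
  "integrable lborel (\<lambda>\<xi>. (1 + (norm \<xi>)\<^sup>2) powr \<beta> * (norm (b_hat i \<xi>))\<^sup>2)"
proof -
  have "\<exists>g. has_fourier (b i) g" using b(1)[of i] unfolding sobolev_def by blast
  then show *: "has_fourier (b i) (b_hat i)" unfolding b_hat_def by (rule someI_ex)
  show "integrable lborel (\<lambda>\<xi>. (1 + (norm \<xi>)\<^sup>2) powr \<beta> * (norm (b_hat i \<xi>))\<^sup>2)"
    by (rule sobolev_integrable[OF dp b(1) *])
qed

lemma L_integrable: "t \<in> {0..T} \<Longrightarrow> integrable lborel (L t)"
  by (rule local_time_integrable[OF local_time])

lemma L_hat_measurable: "t \<in> {0..T} \<Longrightarrow> L_hat t \<in> borel_measurable borel"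
  unfolding L_hat_def by (intro fourier_measurable) (simp add: L_integrable)

lemma L_hat_integrable:
  "t \<in> {0..T} \<Longrightarrow> integrable lborel (\<lambda>\<xi>. (1 + (norm \<xi>)\<^sup>2) powr \<kappa> * (norm (L_hat t \<xi>))\<^sup>2)"
  using regular unfolding L_hat_def holder_on_def
  by (intro sobolev_integrable[OF dp _ reg_dist_diff_has_fourier(2)[OF L_integrable L_integrable]]) auto

lemma L_hat_diff_integrable:
  assumes "s \<in> {0..T}" "t \<in> {0..T}"
  shows "integrable lborel (\<lambda>\<xi>. (1 + (norm \<xi>)\<^sup>2) powr \<kappa> * (norm (L_hat t \<xi> - L_hat s \<xi>))\<^sup>2)"
proof (rule Bochner_Integration.integrable_bound)
  note [measurable] = L_hat_measurable[OF assms(1)] L_hat_measurable[OF assms(2)]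
  let ?w = "\<lambda>\<xi>::real^'d. (1 + (norm \<xi>)\<^sup>2) powr \<kappa>"
  show "integrable lborel (\<lambda>\<xi>. 2 * (?w \<xi> * (norm (L_hat t \<xi>))\<^sup>2 + ?w \<xi> * (norm (L_hat s \<xi>))\<^sup>2))"
    by (intro integrable_mult_right Bochner_Integration.integrable_add L_hat_integrable assms)
  show "(\<lambda>\<xi>. ?w \<xi> * (norm (L_hat t \<xi> - L_hat s \<xi>))\<^sup>2) \<in> borel_measurable lborel" by measurable
  show "AE \<xi> in lborel. norm (?w \<xi> * (norm (L_hat t \<xi> - L_hat s \<xi>))\<^sup>2)
     \<le> norm (2 * (?w \<xi> * (norm (L_hat t \<xi>))\<^sup>2 + ?w \<xi> * (norm (L_hat s \<xi>))\<^sup>2))"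
  proof (rule AE_I2)
    fix \<xi>
    let ?a = "norm (L_hat t \<xi>)" and ?b = "norm (L_hat s \<xi>)"
    have "(norm (L_hat t \<xi> - L_hat s \<xi>))\<^sup>2 \<le> (?a + ?b)\<^sup>2" by (intro power_mono norm_triangle_ineq4) simp
    also have "\<dots> \<le> 2 * (?a\<^sup>2 + ?b\<^sup>2)" using sum_squares_bound[of ?a ?b] by (simp add: power2_sum)
    finally have "?w \<xi> * (norm (L_hat t \<xi> - L_hat s \<xi>))\<^sup>2 \<le> ?w \<xi> * (2 * (?a\<^sup>2 + ?b\<^sup>2))" by (intro mult_left_mono) auto
    also have "\<dots> = 2 * (?w \<xi> * ?a\<^sup>2 + ?w \<xi> * ?b\<^sup>2)" by (simp add: algebra_simps)
    finally have "?w \<xi> * (norm (L_hat t \<xi> - L_hat s \<xi>))\<^sup>2 \<le> norm (2 * (?w \<xi> * ?a\<^sup>2 + ?w \<xi> * ?b\<^sup>2))" by simp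
    moreover have "norm (?w \<xi> * (norm (L_hat t \<xi> - L_hat s \<xi>))\<^sup>2) = ?w \<xi> * (norm (L_hat t \<xi> - L_hat s \<xi>))\<^sup>2"
      unfolding real_norm_def by (rule abs_of_nonneg) simp
    ultimately show "norm (?w \<xi> * (norm (L_hat t \<xi> - L_hat s \<xi>))\<^sup>2) \<le> norm (2 * (?w \<xi> * ?a\<^sup>2 + ?w \<xi> * ?b\<^sup>2))" by (simp only:)
  qed
qed

lemma L_hat_holder:
  obtains C where "\<And>s t. s \<in> {0..T} \<Longrightarrow> t \<in> {0..T} \<Longrightarrow>
    (LINT \<xi>|lborel. (1 + (norm \<xi>)\<^sup>2) powr \<kappa> * (norm (L_hat t \<xi> - L_hat s \<xi>))\<^sup>2) \<le> (C * \<bar>t - s\<bar> powr \<gamma>)\<^sup>2"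
proof -
  obtain C where C: "\<And>s t. s \<in> {0..T} \<Longrightarrow> t \<in> {0..T} \<Longrightarrow>
      sobolev_norm \<kappa> (reg_dist (L t) - reg_dist (L s)) \<le> C * \<bar>t - s\<bar> powr \<gamma>"
    using regular unfolding holder_on_def by blast
  show ?thesis
  proof (rule that[of C])
    fix s t assume st: "s \<in> {0..T}" "t \<in> {0..T}"
    show "(LINT \<xi>|lborel. (1 + (norm \<xi>)\<^sup>2) powr \<kappa> * (norm (L_hat t \<xi> - L_hat s \<xi>))\<^sup>2) \<le> (C * \<bar>t - s\<bar> powr \<gamma>)\<^sup>2"
      unfolding L_hat_def sobolev_norm_eq[OF dp reg_dist_diff_has_fourier(1)[OF L_integrable[OF st(2)] L_integrable[OF st(1)]], symmetric]
      by (intro power_mono C st sobolev_norm_nonneg)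
  qed
qed

text \<open>Both versions occur in the concept of solution: regularity is asked of the convolution
  with the local time itself, while the equation is driven by the reflected one. Conjugation does
  not change moduli, so one product estimate covers both.\<close>

lemma symbols:
  assumes "0 \<le> p" "p \<le> \<beta> + \<kappa>"
  shows "symbol_family \<gamma> T p (\<lambda>t \<xi>. b_hat i \<xi> * L_hat t \<xi>)" and "symbol_family \<gamma> T p (\<Gamma>_hat i)"
proof -
  obtain C where C: "\<And>s t. s \<in> {0..T} \<Longrightarrow> t \<in> {0..T} \<Longrightarrow>
    (LINT \<xi>|lborel. (1 + (norm \<xi>)\<^sup>2) powr \<kappa> * (norm (L_hat t \<xi> - L_hat s \<xi>))\<^sup>2) \<le> (C * \<bar>t - s\<bar> powr \<gamma>)\<^sup>2"
    by (rule L_hat_holder) blast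
  show "symbol_family \<gamma> T p (\<lambda>t \<xi>. b_hat i \<xi> * L_hat t \<xi>)"
    by (rule symbol_family_product[OF has_fourier_measurable[OF b_hat(1)] b_hat(2) L_hat_measurable L_hat_integrable L_hat_diff_integrable C assms])
  have n: "norm (cnj a - cnj c) = norm (a - c)" for a c by (simp only: complex_cnj_diff[symmetric] complex_mod_cnj)
  have m: "(\<lambda>\<xi>. cnj (L_hat t \<xi>)) \<in> borel_measurable borel" if "t \<in> {0..T}" for t
    using borel_measurable_continuous_onI[OF continuous_on_cnj[OF continuous_on_id]] L_hat_measurable[OF that]
    by (rule measurable_compose[rotated])
  have "symbol_family \<gamma> T p (\<lambda>t \<xi>. b_hat i \<xi> * cnj (L_hat t \<xi>))"
    by (rule symbol_family_product[OF has_fourier_measurable[OF b_hat(1)] b_hat(2) m _ _ _ assms, unfolded n complex_mod_cnj,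
        OF _ L_hat_integrable L_hat_diff_integrable C])
  then show "symbol_family \<gamma> T p (\<Gamma>_hat i)" unfolding \<Gamma>_hat_def[abs_def] .
qed

lemma conv_L:
  assumes t: "t \<in> {0..T}"
  shows "convolvable (b i) (L t)" "has_symbol (conv (b i) (L t)) (\<lambda>\<xi>. b_hat i \<xi> * L_hat t \<xi>)"
proof -
  have "0 \<le> \<beta> + \<kappa>" using \<beta> by simp
  then have *: "integrable lborel (\<lambda>\<xi>. b_hat i \<xi> * L_hat t \<xi>)"
    using symbol_family_integrable(1)[OF symbols(1)[of 0] t] by simp
  show "convolvable (b i) (L t)" "has_symbol (conv (b i) (L t)) (\<lambda>\<xi>. b_hat i \<xi> * L_hat t \<xi>)"
    using conv_has_symbol[OF b_hat(1) L_integrable[OF t] *[unfolded L_hat_def]] by (simp_all add: L_hat_def)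
qed

lemma conv_L_reflected:
  assumes t: "t \<in> {0..T}"
  shows "convolvable (b i) (\<lambda>x. L t (- x))" "has_symbol (conv (b i) (\<lambda>x. L t (- x))) (\<Gamma>_hat i t)"
proof -
  have "0 \<le> \<beta> + \<kappa>" using \<beta> by simp
  then have *: "integrable lborel (\<Gamma>_hat i t)"
    using symbol_family_integrable(1)[OF symbols(2)[of 0] t] by simp
  have eq: "\<Gamma>_hat i t = (\<lambda>\<xi>. b_hat i \<xi> * fourier (\<lambda>x. of_real (L t (- x))) \<xi>)"
    unfolding \<Gamma>_hat_def[abs_def] L_hat_def fourier_reflect(2)[OF L_integrable[OF t]] ..
  show "convolvable (b i) (\<lambda>x. L t (- x))" "has_symbol (conv (b i) (\<lambda>x. L t (- x))) (\<Gamma>_hat i t)"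
    using conv_has_symbol[OF b_hat(1) fourier_reflect(1)[OF L_integrable[OF t]] *[unfolded eq]] unfolding eq by simp_all
qed

lemma \<Gamma>_represents:
  assumes t: "t \<in> {0..T}"
  shows "represented_by (conv (b i) (\<lambda>x. L t (- x))) (\<lambda>x. \<Gamma> t x $ i)"
  unfolding \<Gamma>_def vec_lambda_beta
  by (rule has_symbol_represented[OF conv_L_reflected(2)[OF t]], rule conv_real[OF b(2)])

lemma \<Gamma>_has_symbol:
  assumes t: "t \<in> {0..T}"
  shows "has_symbol (reg_dist (\<lambda>x. \<Gamma> t x $ i)) (\<Gamma>_hat i t)"
  using \<Gamma>_represents[OF t, of i] conv_L_reflected(2)[OF t, of i] by (simp add: has_symbol_def represented_by_def)

lemma \<Gamma>_continuous:
  assumes t: "t \<in> {0..T}"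
  shows "continuous_on UNIV (\<Gamma> t)"
proof -
  have "symbol_family \<gamma> T 1 (\<Gamma>_hat i)" for i by (rule symbols(2)) (use \<beta> in auto)
  note i = symbol_family_integrable[OF this t]
  have "continuous_on UNIV (\<lambda>x. Re (inv_fourier (\<Gamma>_hat i t) x))" for i
  proof -
    have "has_grad (\<lambda>x. Re (inv_fourier (\<Gamma>_hat i t) x)) (\<lambda>l. Re (inv_fourier (\<lambda>\<xi>. \<i> * of_real (\<xi> $ l) * \<Gamma>_hat i t \<xi>) x)) x" for x
      by (rule field_has_grad) (use i in auto)
    then show ?thesis unfolding has_grad_def
      by (intro continuous_at_imp_continuous_on ballI has_derivative_continuous) blast
  qed
  then show ?thesis unfolding \<Gamma>_def[abs_def] by (intro continuous_on_vec_lambda)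
qed

text \<open>Here \<beta> > 2 - \<kappa> is needed in full: the symbols are integrable against the
  weight of order 1 + 1 = 2, which is what exponent 1 in \<open>young_field\<close> takes.\<close>

lemma \<Gamma>_young: "\<exists>C. young_field \<gamma> 1 T C \<Gamma>"
proof (rule young_field_vec)
  show "\<exists>C. young_field \<gamma> 1 T C (\<lambda>t x. \<Gamma> t x $ i)" for i
    unfolding \<Gamma>_def vec_lambda_beta by (rule young_field_of_symbol) (use symbols(2)[of "1 + 1"] \<beta> in auto)
qed

lemma \<Gamma>_smooth:
  assumes "0 < \<epsilon>" "\<epsilon> \<le> 1" "real n + 1 + \<epsilon> \<le> \<beta> + \<kappa>"
  shows "smooth_field \<gamma> \<epsilon> T n (\<lambda>t x. \<Gamma> t x $ i)"
  unfolding \<Gamma>_def vec_lambda_beta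
  by (rule smooth_field_of_symbol[OF assms(1,2)], rule symbols(2)) (use assms in auto)

lemma \<Gamma>_admissible: "young_admissible \<psi> \<rho> \<gamma> T \<Gamma>"
  unfolding young_admissible_def
proof (intro conjI allI)
  show "holder_on \<gamma> T (besov \<psi> \<rho> 1) (besov_norm \<psi> \<rho> 1) (\<lambda>t. reg_dist (\<lambda>x. \<Gamma> t x $ i))" for i
    by (rule holder_on_besov[OF dp _ \<Gamma>_has_symbol symbols(2)]) (use \<beta> in auto)
  obtain C where C: "young_field \<gamma> 1 T C \<Gamma>" using \<Gamma>_young by blast
  note C' = C[unfolded young_field_def incr_def]
  show "\<exists>C. \<forall>s\<in>{0..T}. \<forall>t\<in>{0..T}. \<forall>x. norm (\<Gamma> t x - \<Gamma> s x) \<le> C * \<bar>t - s\<bar> powr \<gamma>"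
    using C' by blast
  show "\<exists>C. \<forall>s\<in>{0..T}. \<forall>t\<in>{0..T}. \<forall>x y. norm (\<Gamma> t x - \<Gamma> s x - (\<Gamma> t y - \<Gamma> s y)) \<le> C * norm (x - y) * \<bar>t - s\<bar> powr \<gamma>"
  proof (intro exI[of _ C] ballI allI)
    fix s t x y assume "s \<in> {0..T}" "t \<in> {0..T}"
    then have "norm (\<Gamma> t x - \<Gamma> s x - (\<Gamma> t y - \<Gamma> s y)) \<le> C * \<bar>t - s\<bar> powr \<gamma> * norm (x - y)" using C' by blast
    also have "\<dots> = C * norm (x - y) * \<bar>t - s\<bar> powr \<gamma>" by simp
    finally show "norm (\<Gamma> t x - \<Gamma> s x - (\<Gamma> t y - \<Gamma> s y)) \<le> C * norm (x - y) * \<bar>t - s\<bar> powr \<gamma>" .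
  qed
qed

lemma davie_imp_pathwise:
  assumes sol: "davie_solution \<gamma> T \<Gamma> \<xi> \<theta>"
  shows "pathwise_solution \<psi> \<rho> \<gamma> T b L z \<xi> (\<lambda>t. z t + \<theta> t)"
proof -
  have h: "holder_on \<gamma> T (besov \<psi> \<rho> 2) (besov_norm \<psi> \<rho> 2) (\<lambda>t. conv (b i) (L t))" for i
    by (rule holder_on_besov[OF dp _ conv_L(2) symbols(1)]) (use \<beta> in auto)
  have \<theta>: "holder_on \<gamma> T UNIV norm \<theta>"
  proof -
    obtain C where C: "young_field \<gamma> 1 T C \<Gamma>" using \<Gamma>_young by blast
    note fD = young_fieldD[OF C]
    obtain D where D: "D \<ge> 0" "\<And>s t. 0 \<le> s \<Longrightarrow> s \<le> t \<Longrightarrow> t \<le> T \<Longrightarrow> norm (\<theta> t - \<theta> s - incr \<Gamma> s t (\<theta> s)) \<le> D * (t - s) powr (2 * \<gamma>)"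
      by (rule davie_solutionE[OF sol]) blast
    \<comment> \<open>Hoelder bound of \<theta> from its expansion: the increment of the field
      contributes \<open>C\<close>, and one of the two powers of order \<gamma> in the remainder is
      bounded by T powr \<gamma>.\<close>
    define K where "K = C + D * T powr \<gamma>"
    have le: "norm (\<theta> t - \<theta> s) \<le> K * (t - s) powr \<gamma>" if st: "0 \<le> s" "s \<le> t" "t \<le> T" for s t
    proof -
      have "(t - s) powr (2 * \<gamma>) = (t - s) powr \<gamma> * (t - s) powr \<gamma>" by (simp only: mult_2 powr_add)
      also have "\<dots> \<le> T powr \<gamma> * (t - s) powr \<gamma>" using st \<gamma> by (intro mult_right_mono powr_mono2) auto
      finally have "D * (t - s) powr (2 * \<gamma>) \<le> D * (T powr \<gamma> * (t - s) powr \<gamma>)" by (intro mult_left_mono D)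
      moreover have "norm (\<theta> t - \<theta> s) \<le> norm (\<theta> t - \<theta> s - incr \<Gamma> s t (\<theta> s)) + norm (incr \<Gamma> s t (\<theta> s))"
        using norm_triangle_ineq[of "\<theta> t - \<theta> s - incr \<Gamma> s t (\<theta> s)" "incr \<Gamma> s t (\<theta> s)"] by simp
      moreover have "norm (incr \<Gamma> s t (\<theta> s)) \<le> C * (t - s) powr \<gamma>" by (rule fD(2)[OF st])
      moreover note D(2)[OF st]
      ultimately show ?thesis unfolding K_def distrib_right by (simp add: mult.assoc)
    qed
    have "norm (\<theta> t - \<theta> s) \<le> K * \<bar>t - s\<bar> powr \<gamma>" if "s \<in> {0..T}" "t \<in> {0..T}" for s t
    proof (cases "s \<le> t")
      case True with le[of s t] that show ?thesis by simp
    next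
      case False with le[of t s] that show ?thesis by (simp add: norm_minus_commute)
    qed
    then show ?thesis unfolding holder_on_def by blast
  qed
  have y: "has_young_integral \<Gamma> \<theta> t (\<theta> t - \<xi>)" if "t \<in> {0..T}" for t
    using young_integral_of_davie[OF \<gamma>(1) sol] that by simp
  show ?thesis unfolding pathwise_solution_def
  proof (intro conjI allI ballI exI[of _ \<Gamma>])
    fix i t assume "t \<in> {0..T}"
    then show "convolvable (b i) (L t)" by (rule conv_L(1))
  next
    fix i show "holder_on \<gamma> T (besov \<psi> \<rho> 2) (besov_norm \<psi> \<rho> 2) (\<lambda>t. conv (b i) (L t))" by (rule h)
  next
    show "holder_on \<gamma> T UNIV norm (\<lambda>t. z t + \<theta> t - z t)" using \<theta> by simp
    show "young_admissible \<psi> \<rho> \<gamma> T \<Gamma>" by (rule \<Gamma>_admissible)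
    fix t assume t: "t \<in> {0..T}"
    show "continuous_on UNIV (\<Gamma> t)" by (rule \<Gamma>_continuous[OF t])
    show "convolvable (b i) (\<lambda>y. L t (- y))" for i by (rule conv_L_reflected(1)[OF t])
    show "represented_by (conv (b i) (\<lambda>y. L t (- y))) (\<lambda>y. \<Gamma> t y $ i)" for i by (rule \<Gamma>_represents[OF t])
    show "has_young_integral \<Gamma> (\<lambda>r. z r + \<theta> r - z r) t (z t + \<theta> t - z t - \<xi>)" using y[OF t] by simp
  qed
qed

text \<open>The definition allows any field \<Gamma>', but at each time this is a continuous
  representative of the same distribution as \<Gamma>, hence equal to it. The Young equation then
  passes to \<Gamma>, and its Hoelder solution has Davie's expansion.\<close>

lemma pathwise_imp_davie:
  assumes "pathwise_solution \<psi> \<rho> \<gamma> T b L z \<xi> x"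
  shows "davie_solution \<gamma> T \<Gamma> \<xi> (\<lambda>t. x t - z t)"
proof -
  obtain \<Gamma>' where cont: "\<And>t. t \<in> {0..T} \<Longrightarrow> continuous_on UNIV (\<Gamma>' t)"
    and rep: "\<And>t i. t \<in> {0..T} \<Longrightarrow> represented_by (conv (b i) (\<lambda>y. L t (- y))) (\<lambda>y. \<Gamma>' t y $ i)"
    and young: "\<And>t. t \<in> {0..T} \<Longrightarrow> has_young_integral \<Gamma>' (\<lambda>r. x r - z r) t (x t - z t - \<xi>)"
    using assms unfolding pathwise_solution_def by blast
  have eq: "\<Gamma>' t = \<Gamma> t" if t: "t \<in> {0..T}" for t
  proof -
    have "(\<lambda>y. \<Gamma>' t y $ i) = (\<lambda>y. \<Gamma> t y $ i)" for i
      by (rule represented_by_unique[OF dp rep[OF t] _ \<Gamma>_represents[OF t]])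
         (intro continuous_on_component cont \<Gamma>_continuous t)+
    then show ?thesis by (simp add: fun_eq_iff vec_eq_iff)
  qed
  have "holder_on \<gamma> T UNIV norm (\<lambda>t. x t - z t)" using assms by (simp add: pathwise_solution_def)
  then obtain M where M: "\<And>s t. s \<in> {0..T} \<Longrightarrow> t \<in> {0..T} \<Longrightarrow> norm ((x t - z t) - (x s - z s)) \<le> M * \<bar>t - s\<bar> powr \<gamma>"
    unfolding holder_on_def by blast
  obtain C where C: "young_field \<gamma> 1 T C \<Gamma>" using \<Gamma>_young by blast
  show ?thesis
  proof (rule davie_of_young_solution[OF \<gamma>(1) less_imp_le[OF T] C])
    fix s t assume st: "0 \<le> s" "s \<le> t" "t \<le> T"
    show "norm ((x t - z t) - (x s - z s)) \<le> M * (t - s) powr \<gamma>" using M[of s t] st by simp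
  next
    fix t assume t: "0 \<le> t" "t \<le> T"
    then have "t \<in> {0..T}" by simp
    from young[OF this] show "has_young_integral \<Gamma> (\<lambda>t. x t - z t) t (x t - z t - \<xi>)"
      by (rule has_young_integral_cong) (use t eq in auto)
  qed
qed

lemma existence: "\<exists>x. pathwise_solution \<psi> \<rho> \<gamma> T b L z \<xi> x"
proof -
  obtain C where "young_field \<gamma> 1 T C \<Gamma>" using \<Gamma>_young by blast
  then have "\<exists>\<theta>. davie_solution \<gamma> T \<Gamma> \<xi> \<theta>" by (rule davie_solution_exists[OF \<gamma>(1) less_imp_le[OF \<gamma>(2)] T])
  then show ?thesis using davie_imp_pathwise by blast
qed

text \<open>Both solutions, minus the noise, are limits of the same Euler schemes started from
  \<xi>.\<close>

lemma uniqueness: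
  assumes "pathwise_solution \<psi> \<rho> \<gamma> T b L z \<xi> x" "pathwise_solution \<psi> \<rho> \<gamma> T b L z \<xi> y" "t \<in> {0..T}"
  shows "y t = x t"
proof -
  obtain C where C: "young_field \<gamma> 1 T C \<Gamma>" using \<Gamma>_young by blast
  have t: "0 \<le> t" "t \<le> T" using assms(3) by auto
  note lim = davie_euler_limit[OF \<gamma>(1) less_imp_le[OF \<gamma>(2)] C _ t]
  have "y t - z t = x t - z t"
    using lim[OF pathwise_imp_davie[OF assms(2)]] lim[OF pathwise_imp_davie[OF assms(1)]] by (rule LIMSEQ_unique)
  then show ?thesis by simp
qed

lemma flow_regularity:
  assumes n: "n \<ge> 1" "\<beta> > real n + 1 - \<kappa>" and x: "\<And>\<xi>. pathwise_solution \<psi> \<rho> \<gamma> T b L z \<xi> (x \<xi>)" and t: "t \<in> {0..T}"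
  shows "cont_diff n (\<lambda>\<xi>. x \<xi> t)"
proof -
  obtain C where C: "young_field \<gamma> 1 T C \<Gamma>" using \<Gamma>_young by blast
  \<comment> \<open>The regularity left over beyond order n + 1, positive by the strict inequality;
    the minimum with 1 fits the range of exponents in \<open>flow_cont_diff\<close>.\<close>
  define \<epsilon> where "\<epsilon> = min 1 (\<beta> + \<kappa> - real n - 1)"
  have \<epsilon>: "0 < \<epsilon>" "\<epsilon> \<le> 1" and le: "real n + 1 + \<epsilon> \<le> \<beta> + \<kappa>" using n(2) by (auto simp: \<epsilon>_def)
  have "cont_diff n (\<lambda>\<xi>. x \<xi> t - z t)"
    by (rule flow_cont_diff[OF \<gamma>(1) less_imp_le[OF \<gamma>(2)] \<epsilon> C \<Gamma>_smooth[OF \<epsilon> le] n(1) pathwise_imp_davie[OF x]])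
       (use t in auto)
  from cont_diff_add[OF this cont_diff_const[of n "z t"]] show ?thesis by simp
qed

end

theorem theorem4:
  fixes M :: "'w measure" and F :: "real \<Rightarrow> 'w measure"
    and z :: "real \<Rightarrow> 'w \<Rightarrow> real^'d"
    and L :: "'w \<Rightarrow> real \<Rightarrow> real^'d \<Rightarrow> real"
    and \<psi> \<rho> :: "real^'d \<Rightarrow> real"
    and T \<gamma> \<kappa> :: real
  assumes "dyadic_partition \<psi> \<rho>"
    and "T > 0"
    and "volterra_levy_process M T F z"
    and "AE \<omega> in M. (\<lambda>t. z t \<omega>) \<in> borel_measurable (lebesgue_on {0..T})"
    and "\<kappa> > 0" and "1 / 2 < \<gamma>" and "\<gamma> < 1"
    and "AE \<omega> in M. is_local_time T (\<lambda>t. z t \<omega>) (L \<omega>) \<and>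
           holder_on \<gamma> T (sobolev \<kappa>) (sobolev_norm \<kappa>) (\<lambda>t. reg_dist (L \<omega> t))"
  shows "AE \<omega> in M. \<forall>(\<beta>::real) (b :: 'd \<Rightarrow> (real^'d) distribution).
           \<beta> > 2 - \<kappa> \<and> (\<forall>i. b i \<in> sobolev \<beta> \<and> real_valued_distribution (b i)) \<longrightarrow>
           (\<forall>\<xi>. \<exists>x. pathwise_solution \<psi> \<rho> \<gamma> T b (L \<omega>) (\<lambda>t. z t \<omega>) \<xi> x \<and>
                (\<forall>y. pathwise_solution \<psi> \<rho> \<gamma> T b (L \<omega>) (\<lambda>t. z t \<omega>) \<xi> y \<longrightarrow>
                     (\<forall>t\<in>{0..T}. y t = x t))) \<and>
           (\<forall>n::nat. n \<ge> 1 \<and> \<beta> > real n + 1 - \<kappa> \<longrightarrow>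
              (\<forall>x. (\<forall>\<xi>. pathwise_solution \<psi> \<rho> \<gamma> T b (L \<omega>) (\<lambda>t. z t \<omega>) \<xi> (x \<xi>)) \<longrightarrow>
                   (\<forall>t\<in>{0..T}. cont_diff n (\<lambda>\<xi>. x \<xi> t))))"
  using assms(8)
\<comment> \<open>The exceptional null set is that of the local time hypothesis. It is fixed before
  \<beta>, \<open>b\<close>, \<xi> and n are chosen, and off it the argument is
  deterministic.\<close>
proof (rule eventually_mono, intro allI impI, elim conjE)
  fix \<omega> \<beta> and b :: "'d \<Rightarrow> (real^'d) distribution"
  assume "is_local_time T (\<lambda>t. z t \<omega>) (L \<omega>)"
    "holder_on \<gamma> T (sobolev \<kappa>) (sobolev_norm \<kappa>) (\<lambda>t. reg_dist (L \<omega> t))"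
    "2 - \<kappa> < \<beta>" "\<forall>i. b i \<in> sobolev \<beta> \<and> real_valued_distribution (b i)"
  then interpret rough_drift \<psi> \<rho> T \<gamma> \<kappa> \<beta> "\<lambda>t. z t \<omega>" "L \<omega>" b
    using assms(1,2,6,7) by unfold_locales auto
  show "(\<forall>\<xi>. \<exists>x. pathwise_solution \<psi> \<rho> \<gamma> T b (L \<omega>) (\<lambda>t. z t \<omega>) \<xi> x \<and>
                (\<forall>y. pathwise_solution \<psi> \<rho> \<gamma> T b (L \<omega>) (\<lambda>t. z t \<omega>) \<xi> y \<longrightarrow>
                     (\<forall>t\<in>{0..T}. y t = x t))) \<and>
           (\<forall>n::nat. n \<ge> 1 \<and> \<beta> > real n + 1 - \<kappa> \<longrightarrow>
              (\<forall>x. (\<forall>\<xi>. pathwise_solution \<psi> \<rho> \<gamma> T b (L \<omega>) (\<lambda>t. z t \<omega>) \<xi> (x \<xi>)) \<longrightarrow>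
                   (\<forall>t\<in>{0..T}. cont_diff n (\<lambda>\<xi>. x \<xi> t))))"
    using existence uniqueness flow_regularity by (intro conjI allI impI ballI) blast+
qed

end
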